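(* Let $d\in\mathbb{N}$, $s\in(0,1)$, $0<\lambda\le\Lambda$, $T>0$. Let $K:\mathbb{R}\times\mathbb{R}^d\times\mathbb{R}^d\to[0,\infty]$ be measurable with $$\frac{\lambda}{|x-y|^{d+2s}}\le K(t;x,y)=K(t;y,x)\le\frac{\Lambda}{|x-y|^{d+2s}}$$ for all $t\in\mathbb{R}$, $x,y\in\mathbb{R}^d$. Let $u\ge 0$ be a global weak solution to $\partial_t u-\mathcal{L}_t u=0$ in $(0,T]\times\mathbb{R}^d$. Then there exists a constant $c>1$ depending only on $d,s,\lambda,\Lambda$ such that for any $\tau\in(0,T]$ and any $x_o\in\mathbb{R}^d$ we have $$\sup_{B_{\tau^{1/2s}}(x_o)}u(\tau,\cdot)\le c\,\tau\int_{\mathbb{R}^d}\frac{u(\tau,x)}{(\tau^{1/2s}+|x-x_o|)^{d+2s}}\,dx$$ and $$c\inf_{B_{\tau^{1/2s}}(x_o)}u(\tau,\cdot)\ge\tau\int_{\mathbb{R}^d}\frac{u(\tau,x)}{(\tau^{1/2s}+|x-x_o|)^{d+2s}}\,dx.$$ Consequently, $$\sup_{B_{\tau^{1/2s}}(x_o)}u(\tau,\cdot)\le c\inf_{B_{\tau^{1/2s}}(x_o)}u(\tau,\cdot)$$ for some constant $c=c(d,s,\lambda,\Lambda)$.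
   Context: $B_r(x_o)$ is the ball of radius $r$ centered at $x_o$, $B_r=B_r(0)$, and $\tau^{1/2s}=\tau^{1/(2s)}$. The operator is $-\mathcal{L}_t u(t,x)=\mathrm{p.v.}\int_{\mathbb{R}^d}(u(t,x)-u(t,y))K(t;x,y)\,dy$, with bilinear form $$\mathcal{E}^{(t)}(u,v)=\int_{\mathbb{R}^d}\int_{\mathbb{R}^d}(u(x)-u(y))(v(x)-v(y))K(t;x,y)\,dy\,dx.$$ $L^1(\mathbb{R}^d;\mu)$ is the space of $u\in L^1_{\mathrm{loc}}(\mathbb{R}^d)$ with $\|u\|_{L^1(\mathbb{R}^d;\mu)}=\int_{\mathbb{R}^d}\frac{|u(x)|}{(1+|x|)^{d+2s}}dx<\infty$. Local weak (super)solution: for an interval $I\subset\mathbb{R}$ and a bounded domain $\Omega\subset\mathbb{R}^d$, $u\in L^\infty(I;L^2_{\mathrm{loc}}(\Omega))\cap L^2(I;H^s_{\mathrm{loc}}(\Omega))\cap L^1(I;L^1(\mathbb{R}^d;\mu))$ is a weak supersolution to $\partial_tu-\mathcal{L}_tu=0$ in $I\times\Omega$ if $$-\int_I\int_{\mathbb{R}^d}u\,\partial_t\phi\,dx\,dt+\int_I\mathcal{E}^{(t)}(u(t),\phi(t))\,dt\ge0$$ for every $\phi\ge0$, $\phi\in H^1(I;L^2(\Omega))\cap L^2(I;H^s(\mathbb{R}^d))$ whose support is compactly contained in $\mathrm{int}(I)\times\Omega$. It is a weak subsolution if $-u$ is a weak supersolution, and a weak solution if it is both. Global weak solution in $I\times\mathbb{R}^d$: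 $u\in L^\infty(I;L^2_{\mathrm{loc}}(\mathbb{R}^d))\cap L^2(I;H^s_{\mathrm{loc}}(\mathbb{R}^d))\cap L^1(I;L^1(\mathbb{R}^d;\mu))$ which is a weak solution in $I\times B_R$ for every $R>0$. Suprema and infima are essential, and $u(t,\cdot)$ refers to the representative of $u$ that is continuous in time with values in $L^2_{\mathrm{loc}}(\mathbb{R}^d)$. *)

theory Defs
  imports "HOL-Analysis.Analysis" "HOL-Probability.Essential_Supremum"
begin

text \<open>
  All measurability and all integrals refer to Lebesgue (not just Borel) measure. A function
  of time and space is a curried \<open>u :: real \<Rightarrow> real ^ 'n \<Rightarrow> real\<close>, with \<open>d = CARD('n)\<close>. It stands
  for its almost-everywhere class, and nothing below depends on the choice of the
  representative, except \<open>continuous_representative\<close>, which singles one out.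
\<close>

section \<open>Function spaces\<close>

definition compactly_contained :: "'a::topological_space set \<Rightarrow> 'a set \<Rightarrow> bool" where
  "compactly_contained A B \<longleftrightarrow> compact (closure A) \<and> closure A \<subseteq> B"

definition L2_sq :: "(real ^ 'n) set \<Rightarrow> (real ^ 'n \<Rightarrow> real) \<Rightarrow> ennreal" where
  "L2_sq \<Omega> v = (\<integral>\<^sup>+x\<in>\<Omega>. ennreal ((v x)\<^sup>2) \<partial>lebesgue)"

text \<open>The integrand on the diagonal is \<open>0 / 0 = 0\<close>; the diagonal is a null set.\<close>

definition gagliardo_sq :: "real \<Rightarrow> (real ^ 'n) set \<Rightarrow> (real ^ 'n \<Rightarrow> real) \<Rightarrow> ennreal" where
  "gagliardo_sq s \<Omega> v =
     (\<integral>\<^sup>+x\<in>\<Omega>. (\<integral>\<^sup>+y\<in>\<Omega>.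
        ennreal ((v x - v y)\<^sup>2 / norm (x - y) powr (real CARD('n) + 2 * s)) \<partial>lebesgue) \<partial>lebesgue)"

definition Hs_sq :: "real \<Rightarrow> (real ^ 'n) set \<Rightarrow> (real ^ 'n \<Rightarrow> real) \<Rightarrow> ennreal" where
  "Hs_sq s \<Omega> v = L2_sq \<Omega> v + gagliardo_sq s \<Omega> v"

definition L1_mu :: "real \<Rightarrow> (real ^ 'n \<Rightarrow> real) \<Rightarrow> ennreal" where
  "L1_mu s v = (\<integral>\<^sup>+x. ennreal (\<bar>v x\<bar> / (1 + norm x) powr (real CARD('n) + 2 * s)) \<partial>lebesgue)"

definition measurable_on_cylinder ::
  "real set \<Rightarrow> (real ^ 'n) set \<Rightarrow> (real \<Rightarrow> real ^ 'n \<Rightarrow> real) \<Rightarrow> bool" where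
  "measurable_on_cylinder I \<Omega> u \<longleftrightarrow> set_borel_measurable lebesgue (I \<times> \<Omega>) (\<lambda>(t, x). u t x)"

text \<open>
  The space $L^\infty(I; L^2_{loc}(\Omega)) \cap L^2(I; H^s_{loc}(\Omega)) \cap L^1(I; L^1(R^d; \mu))$.
  The spaces in which \<open>u(t)\<close> takes its values are separable, so that the strong measurability of
  $t \mapsto u(t)$ amounts to joint measurability.
\<close>

definition solution_space ::
  "real \<Rightarrow> real set \<Rightarrow> (real ^ 'n) set \<Rightarrow> (real \<Rightarrow> real ^ 'n \<Rightarrow> real) \<Rightarrow> bool" where
  "solution_space s I \<Omega> u \<longleftrightarrow>
     measurable_on_cylinder I UNIV u \<and>
     (\<forall>\<Omega>'. open \<Omega>' \<and> compactly_contained \<Omega>' \<Omega> \<longrightarrow>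
        (\<exists>C::real. AE t in lebesgue. t \<in> I \<longrightarrow> L2_sq \<Omega>' (u t) \<le> ennreal C) \<and>
        (\<integral>\<^sup>+t\<in>I. Hs_sq s \<Omega>' (u t) \<partial>lebesgue) < \<infinity>) \<and>
     (\<integral>\<^sup>+t\<in>I. L1_mu s (u t) \<partial>lebesgue) < \<infinity>"

section \<open>Test functions\<close>

definition smooth_compact_support :: "real set \<Rightarrow> (real \<Rightarrow> real) \<Rightarrow> bool" where
  "smooth_compact_support J \<eta> \<longleftrightarrow>
     (\<forall>k. (deriv ^^ k) \<eta> differentiable_on UNIV) \<and> compactly_contained {t. \<eta> t \<noteq> 0} J"

text \<open>
  \<open>H1_time_derivative I \<Omega> \<phi> \<psi>\<close> says that $\phi \in H^1(I; L^2(\Omega))$ with weak derivative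
  $\partial_t \phi = \psi \in L^2(I; L^2(\Omega))$. The identity
  $\int_I \phi\, \eta' dt = - \int_I \psi\, \eta\, dt$ in $L^2(\Omega)$ is read pointwise a.e. in \<open>\<Omega>\<close>.
  The derivative is extended by zero outside of \<open>\<Omega>\<close>, where the test functions used below vanish.
\<close>

definition H1_time_derivative ::
  "real set \<Rightarrow> (real ^ 'n) set \<Rightarrow> (real \<Rightarrow> real ^ 'n \<Rightarrow> real) \<Rightarrow> (real \<Rightarrow> real ^ 'n \<Rightarrow> real) \<Rightarrow> bool"
where
  "H1_time_derivative I \<Omega> \<phi> \<psi> \<longleftrightarrow>
     measurable_on_cylinder I \<Omega> \<phi> \<and> (\<integral>\<^sup>+t\<in>I. L2_sq \<Omega> (\<phi> t) \<partial>lebesgue) < \<infinity> \<and>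
     measurable_on_cylinder I \<Omega> \<psi> \<and> (\<integral>\<^sup>+t\<in>I. L2_sq \<Omega> (\<psi> t) \<partial>lebesgue) < \<infinity> \<and>
     (\<forall>\<eta>. smooth_compact_support (interior I) \<eta> \<longrightarrow>
        (AE x in lebesgue. x \<in> \<Omega> \<longrightarrow>
           (LINT t:I|lebesgue. \<phi> t x * deriv \<eta> t) = - (LINT t:I|lebesgue. \<psi> t x * \<eta> t))) \<and>
     (\<forall>t x. x \<notin> \<Omega> \<longrightarrow> \<psi> t x = 0)"

definition test_function ::
  "real \<Rightarrow> real set \<Rightarrow> (real ^ 'n) set \<Rightarrow> (real \<Rightarrow> real ^ 'n \<Rightarrow> real) \<Rightarrow> bool" where
  "test_function s I \<Omega> \<phi> \<longleftrightarrow>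
     (\<exists>\<psi>. H1_time_derivative I \<Omega> \<phi> \<psi>) \<and>
     measurable_on_cylinder I UNIV \<phi> \<and> (\<integral>\<^sup>+t\<in>I. Hs_sq s UNIV (\<phi> t) \<partial>lebesgue) < \<infinity> \<and>
     (\<forall>t x. 0 \<le> \<phi> t x) \<and>
     compactly_contained {(t, x). \<phi> t x \<noteq> 0} (interior I \<times> \<Omega>)"

section \<open>Weak solutions\<close>

text \<open>
  \<open>enn2real\<close> sends the value \<open>\<infinity>\<close> to \<open>0\<close>. For the kernels considered here this value occurs only
  on the diagonal, a null set on which the other factors vanish anyway.
\<close>

definition energy_form ::
  "(real ^ 'n \<Rightarrow> real ^ 'n \<Rightarrow> ennreal) \<Rightarrow> (real ^ 'n \<Rightarrow> real) \<Rightarrow> (real ^ 'n \<Rightarrow> real) \<Rightarrow> real" where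
  "energy_form k u v =
     (LINT x|lebesgue. (LINT y|lebesgue. (u x - u y) * (v x - v y) * enn2real (k x y)))"

definition weak_supersolution ::
  "real \<Rightarrow> (real \<Rightarrow> real ^ 'n \<Rightarrow> real ^ 'n \<Rightarrow> ennreal) \<Rightarrow> real set \<Rightarrow> (real ^ 'n) set \<Rightarrow>
     (real \<Rightarrow> real ^ 'n \<Rightarrow> real) \<Rightarrow> bool" where
  "weak_supersolution s K I \<Omega> u \<longleftrightarrow>
     solution_space s I \<Omega> u \<and>
     (\<forall>\<phi> \<psi>. test_function s I \<Omega> \<phi> \<and> H1_time_derivative I \<Omega> \<phi> \<psi> \<longrightarrow>
        - (LINT t:I|lebesgue. (LINT x|lebesgue. u t x * \<psi> t x))
        + (LINT t:I|lebesgue. energy_form (K t) (u t) (\<phi> t)) \<ge> 0)"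

definition weak_subsolution ::
  "real \<Rightarrow> (real \<Rightarrow> real ^ 'n \<Rightarrow> real ^ 'n \<Rightarrow> ennreal) \<Rightarrow> real set \<Rightarrow> (real ^ 'n) set \<Rightarrow>
     (real \<Rightarrow> real ^ 'n \<Rightarrow> real) \<Rightarrow> bool" where
  "weak_subsolution s K I \<Omega> u \<longleftrightarrow> weak_supersolution s K I \<Omega> (\<lambda>t x. - u t x)"

definition weak_solution ::
  "real \<Rightarrow> (real \<Rightarrow> real ^ 'n \<Rightarrow> real ^ 'n \<Rightarrow> ennreal) \<Rightarrow> real set \<Rightarrow> (real ^ 'n) set \<Rightarrow>
     (real \<Rightarrow> real ^ 'n \<Rightarrow> real) \<Rightarrow> bool" where
  "weak_solution s K I \<Omega> u \<longleftrightarrow> weak_supersolution s K I \<Omega> u \<and> weak_subsolution s K I \<Omega> u"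

definition global_weak_solution ::
  "real \<Rightarrow> (real \<Rightarrow> real ^ 'n \<Rightarrow> real ^ 'n \<Rightarrow> ennreal) \<Rightarrow> real set \<Rightarrow>
     (real \<Rightarrow> real ^ 'n \<Rightarrow> real) \<Rightarrow> bool" where
  "global_weak_solution s K I u \<longleftrightarrow>
     solution_space s I UNIV u \<and> (\<forall>R>0. weak_solution s K I (ball 0 R) u)"

text \<open>
  \<open>w\<close> is the representative of \<open>u\<close> that belongs to $C(I; L^2_{loc}(R^d))$. It is unique in the
  sense that every \<open>w t\<close>, \<open>t \<in> I\<close>, is determined almost everywhere on $R^d$ if \<open>I\<close> is a
  nondegenerate interval.
\<close>

definition continuous_representative ::
  "real set \<Rightarrow> (real \<Rightarrow> real ^ 'n \<Rightarrow> real) \<Rightarrow> (real \<Rightarrow> real ^ 'n \<Rightarrow> real) \<Rightarrow> bool" where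
  "continuous_representative I u w \<longleftrightarrow>
     (AE (t, x) in lebesgue. t \<in> I \<longrightarrow> w t x = u t x) \<and>
     (\<forall>t\<in>I. w t \<in> borel_measurable lebesgue) \<and>
     (\<forall>\<Omega>'. open \<Omega>' \<and> bounded \<Omega>' \<longrightarrow>
        (\<forall>t\<in>I. L2_sq \<Omega>' (w t) < \<infinity> \<and>
           ((\<lambda>r. L2_sq \<Omega>' (\<lambda>x. w r x - w t x)) \<longlongrightarrow> 0) (at t within I)))"

section \<open>Essential suprema and infima over a set\<close>

definition ess_sup_on :: "(real ^ 'n) set \<Rightarrow> (real ^ 'n \<Rightarrow> real) \<Rightarrow> ereal" where
  "ess_sup_on A f = esssup (lebesgue_on A) (\<lambda>x. ereal (f x))"

definition ess_inf_on :: "(real ^ 'n) set \<Rightarrow> (real ^ 'n \<Rightarrow> real) \<Rightarrow> ereal" where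
  "ess_inf_on A f = - esssup (lebesgue_on A) (\<lambda>x. - ereal (f x))"

text \<open>
  Only used for \<open>v\<close> that is nonnegative almost everywhere; \<open>ennreal\<close> would truncate negative values.
\<close>

definition weighted_integral :: "real \<Rightarrow> real \<Rightarrow> real ^ 'n \<Rightarrow> (real ^ 'n \<Rightarrow> real) \<Rightarrow> ereal" where
  "weighted_integral s \<rho> x\<^sub>o v =
     enn2ereal (\<integral>\<^sup>+x. ennreal (v x / (\<rho> + norm (x - x\<^sub>o)) powr (real CARD('n) + 2 * s)) \<partial>lebesgue)"

end

theory Submission
  imports Defs
begin

text \<open>
 After translation and dilation the time is \<open>1\<close> and the ball is the unit ball. Let \<open>N t\<close> be the
 integral of \<open>U t\<close> against the weight \<open>(1 + norm x) powr - (d + 2 s)\<close>. Truncating \<open>U\<close> at a level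
 that moves in time gives an energy inequality in which the speed of the level absorbs the far field
 of the nonlocal form. De Giorgi's iteration then bounds \<open>U\<close> locally by its \<open>L\<^sup>2\<close> norm and its tail, and
 an absorption argument turns this into \<open>U 1 \<le> C\<close> times the integral of \<open>N\<close> over \<open>(0, 1)\<close>. Conversely,
 the level can be raised at the rate at which the kernel transports past mass, so \<open>U\<close> lies above a
 multiple of the integral of \<open>N\<close> over \<open>(0, 1/2)\<close>. Both bounds hold at all scales; integrated against the
 weight they give \<open>N t \<le> C\<close> times the integral of \<open>N\<close> over \<open>(0, t)\<close>, and that integral is in turn
 at most \<open>C * N t\<close>. By Gronwall's inequality the integrals of \<open>N\<close> over \<open>(0, 1/2)\<close> and \<open>(0, 1)\<close> are
 comparable, hence both are comparable to \<open>N 1\<close>.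
\<close>

\<comment> \<open>A truncation of a weak solution has no time derivative in L^2, so it is not an
  admissible test function. The weak formulation is therefore used only with fixed functions of
  space times trapezoids in time, which gives a balance between two time slices. The truncation
  enters frozen at the later slice, and the error of freezing vanishes on average because
  translations in time are continuous in L^2. This replaces mollification in time. The far field is
  only integrable in time. A fixed truncation level would need its supremum over time; a level whose
  speed is proportional to the far field needs only its integral. The lower bound uses the same
  mechanism with the sign reversed: there the interaction across the level, usually discarded as a
  good term, pays for pushing the level up. Constants depend on the parameters alone because each
  main estimate fixes its constant before the solution is introduced. It can then be applied to
  translated and dilated solutions and, for the lower bound, to \<open>k - U\<close>, which is a
  solution of indefinite sign; this is why local boundedness is proved without assuming
  nonnegativity.\<close>
syntax
 "_nnint" :: "pttrn => ennreal => ennreal" ("(INT+ _./ _)" [0, 10] 10)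
 "_nnint_set" :: "pttrn => 'a set => ennreal => ennreal" ("(INT+ _:_./ _)" [0, 0, 10] 10)
 "_leint" :: "pttrn => real => real" ("(INT1 _./ _)" [0, 10] 10)
 "_aelb" :: "pttrn => bool => bool" ("(AEL _./ _)" [0, 10] 10)
translations
 "AEL x. P" => "CONST eventually (%x. P) (CONST ae_filter (CONST lborel))"
 "INT1 x. f" => "CONST lebesgue_integral (CONST lborel) (%x. f)"
 "INT+ x. f" => "CONST nn_integral (CONST lborel) (%x. f)"
 "INT+ x:A. f" => "CONST set_nn_integral (CONST lborel) A (%x. f)"
abbreviation (input) "ind == indicator"
abbreviation (input) "inft == \<infinity>"
abbreviation (input) "en == ennreal"
abbreviation (input) "borelm == borel_measurable borel"
abbreviation (input) tends :: "(nat => 'a::topological_space) => 'a => bool" (infix "~~>" 60)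
 where "X ~~> L == X \<longlonglongrightarrow> L"
abbreviation (input) scaleR_ascii (infixr "*R" 75) where "r *R x == r *\<^sub>R x"
abbreviation (input) "lborel2 == lborel \<Otimes>\<^sub>M lborel"
abbreviation (input) "borel2 == borel \<Otimes>\<^sub>M borel"
notation (input) abs ("<|_|>")
abbreviation (input) "sqb R f == INT+ x:ball 0 R. en ((f x)^2)"

section \<open>Continuity of translations in L^1 and L^2\<close>

lemma tendsto_zero_ennreal_le:
 fixes f :: "'b => ennreal"
 assumes "!!e::real. 0 < e ==> \<forall>\<^sub>F x in F. f x <= en e"
 shows "(f \<longlongrightarrow> 0) F"
proof (rule tendsto_zero_ennreal)
 fix r :: real assume "0 < r"
 then have "\<forall>\<^sub>F x in F. f x <= en (r / 2)" by (intro assms) simp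
 then show "\<forall>\<^sub>F x in F. f x < en r"
  by eventually_elim (rule le_less_trans, assumption, use \<open>0 < r\<close> in "simp add: ennreal_lessI")
qed

lemma tendsto_zero_ennrealD:
 fixes f :: "'b => ennreal"
 assumes "(f \<longlongrightarrow> 0) F" "0 < (e::real)"
 shows "\<forall>\<^sub>F x in F. f x <= en e"
 using order_tendstoD(2)[OF assms(1), of "en e"] assms(2)
 by (auto elim: eventually_mono)

lemma nn_integral_real_shift:
 fixes f :: "real => ennreal"
 assumes [measurable]: "f : borelm"
 shows "(INT+ t. f (t + h)) = (INT+ t. f t)"
 using nn_integral_real_affine[of f 1 h] by (simp add: add.commute)

lemma translation_approx:
 fixes f g :: "real => real"
 assumes [measurable]: "f : borelm" "g : borelm"
 shows "(INT+ t. en <|f (t + h) - f t|>)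
  <= 2 * (INT+ t. en <|f t - g t|>) + (INT+ t. en <|g (t + h) - g t|>)"
proof -
 have "(INT+ t. en <|f (t + h) - f t|>)
  <= (INT+ t. en <|f (t + h) - g (t + h)|> + (en <|f t - g t|> + en <|g (t + h) - g t|>))"
  by (intro nn_integral_mono) (auto simp flip: ennreal_plus)
 also have "... = (INT+ t. en <|f (t + h) - g (t + h)|>) + ((INT+ t. en <|f t - g t|>)
  + (INT+ t. en <|g (t + h) - g t|>))"
  by (simp add: nn_integral_add)
 also have "(INT+ t. en <|f (t + h) - g (t + h)|>) = (INT+ t. en <|f t - g t|>)"
  using nn_integral_real_shift[of "%t. en <|f t - g t|>" h] by simp
 finally show ?thesis by (simp add: mult_2 add_ac)
qed

text \<open>Translations preserve the L^1 norm, so passing from \<open>f\<close> to an approximant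
  \<open>g\<close> costs twice their distance, uniformly in the shift. Functions with continuous
  translations thus form a closed class, and both approximation steps of
  \<open>translation_L1\<close> go through this lemma.\<close>

lemma translation_closure:
 fixes f :: "real => real"
 assumes f: "f : borelm"
  and ex: "!!e::real. 0 < e ==> \<exists>g\<in>borel_measurable borel. (INT+ t. en <|f t - g t|>) <= en e \<and>
  (%n. INT+ t. en <|g (t + h n) - g t|>) ~~> 0"
 shows "(%n. INT+ t. en <|f (t + h n) - f t|>) ~~> 0"
proof (rule tendsto_zero_ennreal_le)
 fix e :: real assume "0 < e"
 then obtain g where g: "g : borelm" "(INT+ t. en <|f t - g t|>) <= en (e/3)"
  "(%n. INT+ t. en <|g (t + h n) - g t|>) ~~> 0"
  using ex[of "e/3"] by auto
 from tendsto_zero_ennrealD[OF g(3), of "e/3"] \<open>0 < e\<close>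
 have "\<forall>\<^sub>F n in sequentially. (INT+ t. en <|g (t + h n) - g t|>) <= en (e/3)" by simp
 then show "\<forall>\<^sub>F n in sequentially. (INT+ t. en <|f (t + h n) - f t|>) <= en e"
 proof eventually_elim
  case (elim n)
  have "(INT+ t. en <|f (t + h n) - f t|>) <= 2 * en (e/3) + en (e/3)"
  by (rule order_trans[OF translation_approx[OF f g(1)]]) (intro add_mono mult_left_mono g elim; simp)
  also have "... = en e"
  using \<open>0 < e\<close> ennreal_plus[of "2 * (e/3)" "e/3"] ennreal_mult[of 2 "e/3"] by simp
  finally show ?case .
 qed
qed

text \<open>\<open>A\<close> and its translate have the same finite measure, so the two halves of
  their symmetric difference have equal measure. It is enough to follow the points that leave
  \<open>A\<close>: since \<open>A\<close> is open, each of its points stays in \<open>A\<close> for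
  all small shifts, and dominated convergence applies.\<close>

lemma translation_open:
 fixes A :: "real set"
 assumes A: "open A" "emeasure lborel A < inft" and h: "h ~~> 0"
 shows "(%n. INT+ t. en <|ind A (t + h n) - ind A t|>) ~~> 0"
proof -
 have [measurable]: "A : sets borel" using A by simp
 define D where "D n t = (ind A t * ind (-A) (t + h n) :: ennreal)" for n t
 have Dm[measurable]: "D n : borelm" for n unfolding D_def by measurable
 have int: "(INT+ t. ind A (t + h n)) = emeasure lborel A" for n
  using nn_integral_real_shift[of "ind A" "h n"] by simp
 have eq: "(INT+ t. en <|ind A (t + h n) - ind A t|>) = 2 * (INT+ t. D n t)" for n
 proof -
  define c where "c = (INT+ t. ind A t * ind A (t + h n))"
  have "c <= emeasure lborel A"
  unfolding c_def int[of n, symmetric] by (intro nn_integral_mono) (auto simp: indicator_def)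
  then have c: "c \<noteq> top" using A by (auto simp: top_unique)
  have 1: "emeasure lborel A = c + (INT+ t. D n t)"
  unfolding c_def by (subst nn_integral_add[symmetric], (simp; fail)+, subst nn_integral_indicator[symmetric], simp)
  (intro nn_integral_cong, auto simp: D_def indicator_def)
  have 2: "emeasure lborel A = c + (INT+ t. ind A (t + h n) * ind (-A) t)"
  unfolding c_def int[of n, symmetric] by (subst nn_integral_add[symmetric]) (auto intro!: nn_integral_cong simp: indicator_def)
  from 1 2 have "c + (INT+ t. ind A (t + h n) * ind (-A) t) = c + (INT+ t. D n t)"
  by simp
  with c have "(INT+ t. ind A (t + h n) * ind (-A) t) = (INT+ t. D n t)"
  unfolding ennreal_add_left_cancel by simp
  moreover have "(INT+ t. en <|ind A (t + h n) - ind A t|>) =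
  (INT+ t. D n t + ind A (t + h n) * ind (-A) t)"
  by (intro nn_integral_cong) (auto simp: D_def indicator_def)
  ultimately show ?thesis by (simp add: nn_integral_add mult_2)
 qed
 have "(%n. INT+ t. D n t) ~~> (\<integral>\<^sup>+t. 0 \<partial>(lborel::real measure))"
 proof (rule nn_integral_dominated_convergence[where w="ind A"])
  show "(INT+ t. ind A t) < inft" using A by simp
  show "AEL t. (%n. D n t) ~~> 0"
  proof (rule AE_I2)
  fix t
  show "(%n. D n t) ~~> 0"
  proof (cases "t : A")
  case True
  have "(%n. t + h n) ~~> t" using tendsto_add[OF tendsto_const h] by simp
  from topological_tendstoD[OF this A(1) True]
  have "\<forall>\<^sub>F n in sequentially. D n t = 0" by eventually_elim (auto simp: D_def)
  then show ?thesis by (rule tendsto_eventually)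
  qed (simp add: D_def)
  qed
 qed (auto simp: D_def indicator_def)
 then show ?thesis unfolding eq using ennreal_tendsto_cmult[of 2] by fastforce
qed

lemma translation_L1:
 fixes f :: "real => real"
 assumes "integrable lborel f" and h: "h ~~> 0"
 shows "(%n. INT+ t. en <|f (t + h n) - f t|>) ~~> 0"
 using assms(1)
proof (induction rule: integrable_induct)
 case (base A c)
 then have A[measurable]: "A : sets borel" by simp
 have iA: "(%n. INT+ t. en <|ind A (t + h n) - ind A t :: real|>) ~~> 0"
 proof (rule translation_closure)
  fix e :: real assume e: "0 < e"
  \<comment> \<open>Outer regularity supplies an open set of finite measure that is close to
    \<open>A\<close> in measure, which is the situation of \<open>translation_open\<close>.\<close>
  obtain B where B: "open B" "A \<subseteq> B" "emeasure lborel (B - A) < e"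
  using outer_regular_lborel[OF A e] by blast
  have [measurable]: "B : sets borel" using B by simp
  have "emeasure lborel B <= emeasure lborel A + emeasure lborel (B - A)"
  by (rule order_trans[OF _ emeasure_subadditive]) (auto intro!: emeasure_mono)
  also have "... < inft" using base B by (auto simp: less_top[symmetric] top_unique)
  finally have fin: "emeasure lborel B < inft" .
  have "(INT+ t. en <|ind A t - ind B t|>) = (INT+ t. ind (B - A) t)"
  using B by (intro nn_integral_cong) (auto simp: indicator_def)
  also have "... <= en e" using B by simp
  finally have 1: "(INT+ t. en <|ind A t - ind B t|>) <= en e" .
  show "\<exists>g\<in>borel_measurable borel. (INT+ t. en <|ind A t - g t|>) <= en e \<and>
  (%n. INT+ t. en <|g (t + h n) - g t|>) ~~> 0"
  by (rule bexI[of _ "ind B"]) (use 1 translation_open[OF B(1) fin h] in auto)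
 qed simp
 have "(INT+ t. en <|ind A (t + h n) *R c - ind A t *R c|>)
  = en <|c|> * (INT+ t. en <|ind A (t + h n) - ind A t :: real|>)" for n
  by (subst nn_integral_cmult[symmetric]) (auto intro!: nn_integral_cong simp: abs_mult ennreal_mult[symmetric] simp flip: left_diff_distrib)
 then show ?case using ennreal_tendsto_cmult[OF _ iA, of "en <|c|>"] by simp
next
 case (add f g)
 then have [measurable]: "f : borelm" "g : borelm" by auto
 show ?case
 proof (rule tendsto_sandwich[OF _ _ tendsto_const tendsto_add[OF add(3,4), simplified]])
  show "\<forall>\<^sub>F n in sequentially. (INT+ t. en <|f (t + h n) + g (t + h n) - (f t + g t)|>)
  <= (INT+ t. en <|f (t + h n) - f t|>) + (INT+ t. en <|g (t + h n) - g t|>)"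
  by (intro always_eventually allI, subst nn_integral_add[symmetric])
  (auto intro!: nn_integral_mono simp flip: ennreal_plus)
 qed simp
next
 case (lim f s)
 then have [measurable]: "f : borelm" "!!i. s i : borelm" by auto
 show ?case
 proof (rule translation_closure)
  fix e :: real assume e: "0 < e"
  have "(%i. INT+ t. en (norm (f t - s i t))) ~~> 0"
  proof (rule nn_integral_dominated_convergence_norm[where w="%t. 2 * norm (f t)"])
  show "(INT+ t. en (2 * norm (f t))) < inft"
  using lim(4) unfolding integrable_iff_bounded by (simp add: ennreal_mult nn_integral_cmult ennreal_mult_less_top)
  qed (use lim(2,3) in "auto intro!: AE_I2")
  from tendsto_zero_ennrealD[OF this e] obtain i where "(INT+ t. en <|f t - s i t|>) <= en e"
  by (auto simp: eventually_sequentially)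
  then show "\<exists>g\<in>borel_measurable borel. (INT+ t. en <|f t - g t|>) <= en e \<and>
  (%n. INT+ t. en <|g (t + h n) - g t|>) ~~> 0"
  using lim(5)[of i] by (intro bexI[of _ "s i"]) auto
 qed simp
qed

text \<open>The signed square \<open>a * <|a|>\<close> turns continuity of translations in L^2 into
  continuity in L^1: if \<open>f\<close> is square integrable, its signed square is integrable, and
  the increments of the latter dominate the squared increments of \<open>f\<close>.\<close>

lemma diff_sq_le_signed_sq: "(a - b)^2 <= 2 * <|a * <|a|> - b * <|b|>|>" for a b :: real
proof -
 have same: "(a - b)^2 <= <|a * a - b * b|>" if "<|a - b|> <= <|a + b|>"
 proof -
  have "(a - b)^2 = <|a - b|> * <|a - b|>" by (simp add: power2_eq_square)
  also have "... <= <|a - b|> * <|a + b|>" using that by (intro mult_left_mono) auto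
  also have "... = <|a * a - b * b|>" by (simp add: algebra_simps flip: abs_mult)
  finally show ?thesis .
 qed
 have opp: "(a - b)^2 <= 2 * (a * a + b * b)"
  using zero_le_power2[of "a + b"] by (simp add: power2_eq_square algebra_simps)
 consider "a \<ge> 0 \<and> b \<ge> 0 \<or> a <= 0 \<and> b <= 0" | "a \<ge> 0" "b <= 0" | "a <= 0" "b \<ge> 0" by linarith
 then show ?thesis
 proof cases
  case 1
  then have "<|a * <|a|> - b * <|b|>|> = <|a * a - b * b|>" by auto
  moreover have "(a - b)^2 <= <|a * a - b * b|>" by (rule same) (use 1 in auto)
  ultimately show ?thesis by (smt (verit) zero_le_power2)
 next
  case 2
  then have "<|a * <|a|> - b * <|b|>|> = a * a + b * b" by auto
  with opp show ?thesis by simp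
 next
  case 3
  then have "<|a|> = -a" "<|b|> = b" by auto
  then have "<|a * <|a|> - b * <|b|>|> = <|- (a * a + b * b)|>" by simp
  then have "<|a * <|a|> - b * <|b|>|> = a * a + b * b" by simp
  with opp show ?thesis by simp
 qed
qed

text \<open>Only the time variable is shifted. For almost every \<open>m\<close> the fibre is square
  integrable in time and the one-dimensional result applies; the fibre integrals are dominated by
  four times the squared norm of the fibre. The later application takes for \<open>M\<close> the
  square of space.\<close>

lemma translation_L2_product:
 fixes f :: "real => 'm => real"
 assumes "sigma_finite_measure M"
  and f[measurable]: "(%(t, m). f t m) : borel_measurable (lborel \<Otimes>\<^sub>M M)"
  and fin: "(\<integral>\<^sup>+m. (INT+ t. en ((f t m)^2)) \<partial>M) < inft" and h: "h ~~> 0"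
 shows "(%n. \<integral>\<^sup>+m. (INT+ t. en ((f (t + h n) m - f t m)^2)) \<partial>M) ~~> 0"
proof -
 interpret M: sigma_finite_measure M by fact
 define A where "A m = (INT+ t. en ((f t m)^2))" for m
 let ?d = "%n m. INT+ t. en ((f (t + h n) m - f t m)^2)"
 have Am[measurable]: "A : borel_measurable M" unfolding A_def by measurable
 have "(%n. \<integral>\<^sup>+m. ?d n m \<partial>M) ~~> (\<integral>\<^sup>+m. 0 \<partial>M)"
 proof (rule nn_integral_dominated_convergence[where w="%m. 4 * A m"])
  show "(\<integral>\<^sup>+m. 4 * A m \<partial>M) < inft"
  using fin by (simp add: nn_integral_cmult A_def ennreal_mult_less_top)
  have "?d n m <= 4 * A m" if m: "m : space M" for m n
  proof -
  have [measurable]: "(%t. f t m) : borelm"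
  using f m by measurable
  have "?d n m <= (INT+ t. 2 * en ((f (t + h n) m)^2) + 2 * en ((f t m)^2))"
  proof (intro nn_integral_mono, goal_cases)
  case (1 t)
  have "(f (t + h n) m - f t m)^2 <= 2 * (f (t + h n) m)^2 + 2 * (f t m)^2"
  using zero_le_power2[of "f (t + h n) m + f t m"] by (simp add: power2_eq_square algebra_simps)
  from ennreal_leI[OF this] show ?case
  by (simp add: ennreal_mult)
  qed
  also have "... = 2 * A m + 2 * A m"
  using nn_integral_real_shift[of "%t. en ((f t m)^2)" "h n"]
  by (simp add: nn_integral_add nn_integral_cmult A_def)
  also have "... = 4 * A m" by (simp flip: distrib_right)
  finally show ?thesis .
  qed
  then show "AE m in M. ?d n m <= 4 * A m" for n by auto
  have "AE m in M. A m \<noteq> inft"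
  by (rule nn_integral_noteq_infinite) (use fin in "auto simp: A_def")
  then show "AE m in M. (%n. INT+ t. en ((f (t + h n) m - f t m)^2)) ~~> 0"
  using AE_space
  proof eventually_elim
  fix m assume m: "A m \<noteq> inft" "m : space M"
  have [measurable]: "(%t. f t m) : borelm"
  using f m(2) by measurable
  define F where "F t = f t m * <|f t m|>" for t
  have [measurable]: "F : borelm" unfolding F_def by measurable
  have "en <|F t|> = en ((f t m)^2)" for t
  by (simp add: F_def abs_mult power2_eq_square)
  then have "integrable lborel F"
  using m by (simp add: integrable_iff_bounded A_def less_top)
  from ennreal_tendsto_cmult[OF _ translation_L1[OF this h], of 2]
  have lim: "(%n. 2 * (INT+ t. en <|F (t + h n) - F t|>)) ~~> 0" by simp
  show "(%n. INT+ t. en ((f (t + h n) m - f t m)^2)) ~~> 0"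
  proof (rule tendsto_sandwich[OF _ _ tendsto_const lim])
  show "\<forall>\<^sub>F n in sequentially. ?d n m
  <= 2 * (INT+ t. en <|F (t + h n) - F t|>)"
  proof (intro always_eventually allI)
  fix n
  have "?d n m
  <= (INT+ t. 2 * en <|F (t + h n) - F t|>)"
  using ennreal_leI[OF diff_sq_le_signed_sq]
  by (intro nn_integral_mono) (simp add: F_def ennreal_mult)
  then show "?d n m
  <= 2 * (INT+ t. en <|F (t + h n) - F t|>)"
  by (simp add: nn_integral_cmult)
  qed
  qed simp
  qed
 qed measurable
 then show ?thesis by simp
qed

section \<open>The kernel and the weight\<close>

text \<open>On the diagonal \<open>kern\<close> is \<open>1 / 0 = 0\<close>, which is what \<open>enn2real\<close> makes of the given kernel there.\<close>

definition kern :: "real => 'a::euclidean_space => 'a => real" where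
 "kern s x y = 1 / norm (x - y) powr (real DIM('a) + 2 * s)"

definition rho :: "real => 'a::euclidean_space => real" where
 "rho s x = 1 / (1 + norm x) powr (real DIM('a) + 2 * s)"

lemma kern_nonneg [simp]: "0 <= kern s x y"
 by (simp add: kern_def)

lemma kern_self [simp]: "kern s x x = 0"
 by (simp add: kern_def)

lemma kern_commute: "kern s x y = kern s y x"
 by (simp add: kern_def norm_minus_commute)

lemma measurable_kern [measurable (raw)]:
 assumes [measurable]: "f : borel_measurable M" "g : borel_measurable M"
 shows "(%x. kern s (f x) (g x)) : borel_measurable M"
 unfolding kern_def by measurable

lemma measurable_rho [measurable (raw)]:
 assumes [measurable]: "f : borel_measurable M"
 shows "(%x. rho s (f x)) : borel_measurable M"
 unfolding rho_def by measurable

lemma rho_pos [simp]: "0 < rho s x"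
 by (simp add: rho_def add_pos_nonneg) (metis add_pos_nonneg norm_ge_zero zero_less_one less_irrefl)

lemma rho_nonneg [simp]: "0 <= rho s x"
 using rho_pos[of s x] by linarith

lemma one_le_powr: "1 <= x ==> 0 <= e ==> 1 <= x powr (e::real)"
 using powr_mono[of 0 e x] by simp

lemma rho_le_1: "0 < s ==> rho s (x :: 'a::euclidean_space) <= 1"
 using one_le_powr[of "1 + norm x" "real DIM('a) + 2 * s"]
 by (simp add: rho_def divide_le_eq)

text \<open>Kernel and weight are both inverse powers with the same exponent, so every comparison
  between them reduces to a linear comparison of their bases.\<close>

lemma inverse_powr_mono:
 assumes "0 < u" "u <= c * v" "0 <= e" "0 < c"
 shows "1 / v powr e <= c powr e * (1 / u powr e :: real)"
proof -
 from assms have v: "0 < v" by (metis less_le_trans zero_less_mult_pos)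
 have "u powr e <= (c * v) powr e" using assms by (intro powr_mono2) auto
 also have "... = c powr e * v powr e" using v assms by (simp add: powr_mult)
 finally show ?thesis using v assms(1) by (simp add: field_simps)
qed

lemma rho_le_rho:
 fixes x y :: "'a::euclidean_space"
 assumes "0 < s" "1 + norm x <= c * (1 + norm y)"
 shows "rho s y <= c powr (real DIM('a) + 2 * s) * rho s x"
proof -
 have "0 < c" using assms(2) by (smt (verit) mult_nonpos_nonneg norm_ge_zero)
 then show ?thesis unfolding rho_def using assms
  by (intro inverse_powr_mono) (auto intro: add_pos_nonneg)
qed

text \<open>The factor \<open>q + 2\<close> is what makes
  \<open>1 + norm y <= (q + 2) * (norm y - q)\<close> true from \<open>norm y = q + 1\<close> on.
  Far away from a ball the kernel is thus dominated by the weight, so the far field is controlled by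
  the weighted integral.\<close>

lemma kern_far:
 fixes x y :: "'a::euclidean_space"
 assumes "0 < s" "0 <= q" "norm x <= q" "q + 1 <= norm y"
 shows "kern s x y <= (q + 2) powr (real DIM('a) + 2 * s) * rho s y"
 unfolding kern_def rho_def
proof (rule inverse_powr_mono)
 have "norm y <= norm (x - y) + norm x" using norm_triangle_ineq2[of y x] by (simp add: norm_minus_commute)
 then have "norm y - q <= norm (x - y)" using assms by linarith
 then have "(q + 2) * (norm y - q) <= (q + 2) * norm (x - y)" using assms by (intro mult_left_mono) auto
 moreover have "(q + 1) * (q + 1) <= (q + 1) * norm y" using assms by (intro mult_left_mono) auto
 ultimately show "1 + norm y <= (q + 2) * norm (x - y)" by (simp add: algebra_simps)
qed (use assms in "auto intro: add_pos_nonneg")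

lemma kern_le_rho:
 fixes x y :: "'a::euclidean_space"
 assumes "0 < s" "1 <= norm (x - y)"
 shows "kern s x y <= 2 powr (real DIM('a) + 2 * s) * rho s (x - y)"
 using kern_far[of s 0 0 "x - y"] assms by (simp add: kern_def norm_minus_commute)

text \<open>The converse comparison, the source of the lower bound: mass anywhere in space is seen
  from a bounded point through the kernel. Distinct points are required because \<open>kern\<close>
  is 0 on the diagonal.\<close>

lemma rho_le_kern:
 fixes x y :: "'a::euclidean_space"
 assumes "0 < s" "1 <= R" "norm x <= R" "x \<noteq> y"
 shows "rho s y <= R powr (real DIM('a) + 2 * s) * kern s x y"
 unfolding kern_def rho_def
proof (rule inverse_powr_mono)
 have "norm y <= R * norm y" using assms mult_right_mono[of 1 R "norm y"] by simp
 then show "norm (x - y) <= R * (1 + norm y)"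
  using norm_triangle_ineq4[of x y] assms by (simp add: algebra_simps)
qed (use assms in auto)

lemma sets_ball [measurable]: "ball (c::'a::euclidean_space) r : sets borel"
 by simp

text \<open>Dyadic decomposition instead of polar coordinates: the integrand is dominated by a
  series of multiples of indicators of balls, whose integrals form two geometric series.\<close>

lemma kern_moment_origin:
 assumes "0 < s" "s < 1"
 shows "(INT+ z. en (min 1 ((norm z)^2) * kern s z (0::'a::euclidean_space))) < inft"
proof -
 let ?d = "DIM('a)"
 define p where "p = real ?d + 2 * s"
 define v where "v = unit_ball_vol ?d"
 have v: "0 <= v" by (simp add: v_def)
 have p: "0 < p" using assms by (simp add: p_def add_nonneg_pos)
 define f where "f z = min 1 ((norm z)^2) * kern s z (0::'a)" for z
 \<comment> \<open>\<open>a n\<close> bounds the integrand on the annulus from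
   \<open>(1/2) ^ n\<close> to twice that radius, \<open>b n\<close> on the annulus from
   \<open>2 ^ n / 2\<close> to \<open>2 ^ n\<close>. Whole balls are used instead of annuli, since
   their volumes are explicit.\<close>
 define a b where "a n = 4 * (1/4) ^ n * (2 powr p) ^ n" and "b n = 2 powr p * (1 / 2 powr p) ^ n" for n :: nat
 have ab: "0 <= a n" "0 <= b n" for n by (auto simp: a_def b_def)
 have le: "en (f z) <= (\<Sum>n. en (a n) * ind (ball 0 (2 * (1/2) ^ n)) z + en (b n) * ind (ball 0 (2 ^ n)) z)"
  (is "_ <= (\<Sum>n. ?F n)") for z :: 'a
 proof -
  have "\<exists>n. en (f z) <= ?F n"
  proof (cases "z = 0 \<or> norm z \<ge> 1")
  case True
  then consider "z = 0" | "norm z \<ge> 1" by auto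
  then show ?thesis
  proof cases
  case 1 then show ?thesis by (simp add: f_def)
  next
  case 2
  define n where "n = (LEAST n. norm z < 2 ^ n)"
  have "\<exists>n. norm z < 2 ^ n" by (simp add: real_arch_pow)
  then have n: "norm z < 2 ^ n" unfolding n_def by (rule LeastI_ex)
  have n0: "n \<noteq> 0" using 2 n by (intro notI) simp
  then have "\<not> norm z < 2 ^ (n - 1)" unfolding n_def by (intro not_less_Least) simp
  then have ge: "2 ^ n <= 2 * norm z" using n0 by (cases n) auto
  have "f z = 1 / norm z powr p" using 2 by (simp add: f_def kern_def p_def min_def power_increasing)
  also have "... <= 2 powr p * (1 / (2 ^ n) powr p)" using p ge by (intro inverse_powr_mono) auto
  also have "... = b n" by (simp add: b_def powr_power power_one_over powr_realpow[symmetric] powr_powr mult.commute)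
  finally show ?thesis using n by (intro exI[of _ n]) (auto intro: ennreal_leI add_increasing)
  qed
  next
  case False
  then have z: "z \<noteq> 0" "0 < norm z" "norm z < 1" by auto
  define n where "n = (LEAST n. (1/2) ^ n <= norm z)"
  have "\<exists>n. (1/2) ^ n < norm z" using z by (intro real_arch_pow_inv) auto
  then have "\<exists>n. (1/2) ^ n <= norm z" using less_imp_le by blast
  then have n: "(1/2) ^ n <= norm z" unfolding n_def by (rule LeastI_ex)
  have n0: "n \<noteq> 0" using z n by (intro notI) simp
  then have "\<not> (1/2) ^ (n - 1) <= norm z" unfolding n_def by (intro not_less_Least) simp
  then have ge: "norm z < 2 * (1/2) ^ n" using n0 by (cases n) auto
  have "f z <= (norm z)^2 * (1 / norm z powr p)" by (simp add: f_def kern_def p_def mult_right_mono divide_right_mono)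
  also have "... <= (2 * (1/2) ^ n)^2 * (1 powr p * (1 / ((1/2) ^ n) powr p))"
  using p ge n z by (intro mult_mono power_mono inverse_powr_mono) auto
  also have "... = a n"
  using powr_powr[of "2::real" 2 "real n"] by (simp add: a_def powr_power power_one_over powr_realpow[symmetric] powr_powr powr_divide power2_eq_square mult.commute
  flip: powr_add power_mult_distrib)
  finally show ?thesis using ge by (intro exI[of _ n]) (auto intro: ennreal_leI add_increasing2)
  qed
  then obtain n where "en (f z) <= ?F n" by blast
  also have "?F n <= (\<Sum>n. ?F n)" using sum_le_suminf[of ?F "{n}"] by (simp add: summableI)
  finally show ?thesis .
 qed
 \<comment> \<open>The ratios of the two geometric series. The inner series converges because
   \<open>s < 1\<close>, the outer one because \<open>0 < s\<close>.\<close>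
 define qa qb where "qa = 2 powr (2 * s - 2)" and "qb = 2 powr (- 2 * s)"
 have em: "emeasure lborel (ball (0::'a) r) = en (v * r ^ ?d)" if "0 <= r" for r
  using emeasure_ball[OF that, of "0::'a"] by (simp add: v_def)
 have trm: "(INT+ z. en (a n) * ind (ball (0::'a) (2 * (1/2) ^ n)) z + en (b n) * ind (ball 0 (2 ^ n)) z)
  = en (4 * v * 2 ^ ?d * qa ^ n + 2 powr p * v * qb ^ n)" for n
 proof -
  have pw: "(2 * (1/2) ^ n) ^ ?d = 2 ^ ?d * ((1/2::real) ^ ?d) ^ n"
  unfolding power_mult_distrib power_mult[symmetric] by (simp add: mult.commute)
  have pw3: "((1/2) ^ n) ^ ?d = ((1/2::real) ^ ?d) ^ n"
  unfolding power_mult[symmetric] by (simp add: mult.commute)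
  have pw2: "(2 ^ n) ^ ?d = ((2::real) ^ ?d) ^ n"
  by (simp add: power_mult[symmetric] mult.commute)
  have "a n * (v * (2 * (1/2) ^ n) ^ ?d) = 4 * v * 2 ^ ?d * ((1/4) * (2 powr p) * (1/2) ^ ?d) ^ n"
  unfolding pw a_def power_mult_distrib pw3 by simp
  also have "(1/4) * (2 powr p) * (1/2) ^ ?d = qa"
  by (simp add: qa_def p_def powr_add powr_diff powr_realpow power_one_over powr_minus divide_simps)
  finally have 1: "a n * (v * (2 * (1/2) ^ n) ^ ?d) = 4 * v * 2 ^ ?d * qa ^ n" .
  have "b n * (v * (2 ^ n) ^ ?d) = 2 powr p * v * ((1 / 2 powr p) * 2 ^ ?d) ^ n"
  unfolding pw2 b_def power_mult_distrib by simp
  also have "(1 / 2 powr p) * 2 ^ ?d = qb"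
  by (simp add: qb_def p_def powr_add powr_realpow powr_minus divide_simps)
  finally have 2: "b n * (v * (2 ^ n) ^ ?d) = 2 powr p * v * qb ^ n" .
  have "(INT+ z. en (a n) * ind (ball (0::'a) (2 * (1/2) ^ n)) z + en (b n) * ind (ball 0 (2 ^ n)) z)
  = en (a n) * en (v * (2 * (1/2) ^ n) ^ ?d) + en (b n) * en (v * (2 ^ n) ^ ?d)"
  by (subst nn_integral_add) (measurable, simp add: nn_integral_cmult_indicator em)
  also have "... = en (a n * (v * (2 * (1/2) ^ n) ^ ?d) + b n * (v * (2 ^ n) ^ ?d))"
  using ab v by (simp add: ennreal_mult[symmetric] ennreal_plus[symmetric] del: ennreal_plus)
  finally show ?thesis unfolding 1 2 .
 qed
 have "summable (%n. 4 * v * 2 ^ ?d * qa ^ n + 2 powr p * v * qb ^ n)"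
  using assms by (intro summable_add summable_mult summable_geometric)
  (auto simp: qa_def qb_def powr_less_one)
 then have sum: "(\<Sum>n. en (4 * v * 2 ^ ?d * qa ^ n + 2 powr p * v * qb ^ n)) \<noteq> inft"
  using v by (subst suminf_ennreal2) (auto simp: qa_def qb_def)
 have "(INT+ z. en (f z))
  <= (\<integral>\<^sup>+z. (\<Sum>n. en (a n) * ind (ball 0 (2 * (1/2) ^ n)) z + en (b n) * ind (ball 0 (2 ^ n)) z) \<partial>(lborel :: 'a measure))"
  by (intro nn_integral_mono le)
 also have "... = (\<Sum>n. en (4 * v * 2 ^ ?d * qa ^ n + 2 powr p * v * qb ^ n))"
  by (subst nn_integral_suminf) (auto simp: trm)
 finally show ?thesis using sum unfolding f_def by (auto simp: less_top[symmetric] top_unique)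
qed

lemma nn_integral_shift:
 fixes f :: "'a::euclidean_space => ennreal"
 assumes [measurable]: "f : borelm"
 shows "(INT+ y. f (y - x)) = (INT+ y. f y)"
proof -
 have "(INT+ y. f y) = (\<integral>\<^sup>+y. f y \<partial>distr lborel borel ((+) (- x)))"
  using lborel_distr_plus[of "- x"] by simp
 also have "... = (INT+ y. f (y - x))"
  by (subst nn_integral_distr) auto
 finally show ?thesis by simp
qed

lemma ennreal_finiteE:
 assumes "(x::ennreal) < inft"
 obtains c where "0 <= c" "x = en c"
 using assms by (cases x) auto

lemma kern_moment:
 assumes "0 < s" "s < 1"
 obtains C where "0 < C"
  "!!x::'a::euclidean_space. (INT+ y. en (min 1 ((norm (x - y))^2) * kern s x y)) <= en C"
proof -
 let ?I = "INT+ z. en (min 1 ((norm z)^2) * kern s z (0::'a))"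
 from kern_moment_origin[OF assms] obtain c where c: "0 <= c" "?I = en c"
  by (rule ennreal_finiteE)
 have "(INT+ y. en (min 1 ((norm (x - y))^2) * kern s x y)) <= en (c + 1)" for x :: 'a
 proof -
  have "(INT+ y. en (min 1 ((norm (x - y))^2) * kern s x y))
  = (INT+ y. en (min 1 ((norm (y - x))^2) * kern s (y - x) 0))"
  by (simp add: kern_def norm_minus_commute)
  also have "... = ?I" by (rule nn_integral_shift[where f="%z. en (min 1 ((norm z)^2) * kern s z 0)"]) simp
  also have "... <= en (c + 1)" unfolding c by (intro ennreal_leI) simp
  finally show ?thesis .
 qed
 then show thesis using c by (intro that[of "c + 1"]) auto
qed

lemma rho_finite_integral:
 assumes "0 < s" "s < 1"
 shows "(INT+ y. en (rho s (y::'a::euclidean_space))) < inft"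
proof -
 obtain C where C: "!!x::'a. (INT+ y. en (min 1 ((norm (x - y))^2) * kern s x y)) <= en C"
  using kern_moment[OF assms] by metis
 have "(INT+ y. en (rho s (y::'a)))
  <= (INT+ y. ind (ball (0::'a) 1) y + en (min 1 ((norm (0 - y))^2) * kern s 0 y))"
 proof (rule nn_integral_mono)
  fix y :: 'a
  show "en (rho s y) <= ind (ball 0 1) y + en (min 1 ((norm (0 - y))^2) * kern s 0 y)"
  proof (cases "norm y < 1")
  case True then show ?thesis using rho_le_1[OF assms(1), of y]
  by (auto intro!: add_increasing2)
  next
  case False
  then have "rho s y <= kern s 0 y" using rho_le_kern[of s 1 0 y] assms by fastforce
  moreover have "min 1 ((norm (0 - y))^2) = 1" using False by (simp add: min_def)
  ultimately show ?thesis using False by (simp add: ennreal_leI)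
  qed
 qed
 also have "... <= emeasure lborel (ball (0::'a) 1) + en C"
  using C[of 0] by (subst nn_integral_add) (auto intro!: borel_measurable_indicator)
 also have "... < inft" using emeasure_lborel_ball_finite[of "0::'a" 1] by (simp add: less_top[symmetric])
 finally show ?thesis .
qed

text \<open>By the triangle inequality one of the two arguments \<open>y\<close> and
  \<open>x - y\<close> is about as large as \<open>x\<close>, so that one factor is at most a
  multiple of \<open>rho s x\<close>; the other factor is integrable.\<close>

lemma rho_convolution:
 assumes "0 < s" "s < 1"
 obtains C where "0 < C"
  "!!x::'a::euclidean_space. (INT+ y. en (rho s (x - y) * rho s y)) <= en (C * rho s x)"
proof -
 let ?c = "2 powr (real DIM('a) + 2 * s)"
 from rho_finite_integral[OF assms, where ?'a='a] obtain c where c: "0 <= c" "(INT+ y. en (rho s (y::'a))) = en c"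
  by (rule ennreal_finiteE)
 have "(INT+ y. en (rho s (x - y) * rho s y)) <= en ((2 * ?c * (c + 1)) * rho s x)" for x :: 'a
 proof -
  have pt: "rho s (x - y) * rho s y <= (?c * rho s x) * (rho s (y - x) + rho s y)" for y
  proof -
  have s: "rho s (x - y) = rho s (y - x)" by (simp add: rho_def norm_minus_commute)
  consider "1 + norm x <= 2 * (1 + norm y)" | "1 + norm x <= 2 * (1 + norm (y - x))"
  using norm_triangle_sub[of x y] by (fastforce simp: norm_minus_commute)
  then show ?thesis
  proof cases
  case 1
  have "rho s (x - y) * rho s y <= rho s (y - x) * (?c * rho s x)"
  unfolding s by (intro mult_left_mono rho_le_rho[OF assms(1) 1]) simp
  also have "... <= (?c * rho s x) * (rho s (y - x) + rho s y)" by (simp add: algebra_simps)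
  finally show ?thesis .
  next
  case 2
  have "rho s (x - y) * rho s y <= (?c * rho s x) * rho s y"
  unfolding s by (intro mult_right_mono rho_le_rho[OF assms(1) 2]) simp
  also have "... <= (?c * rho s x) * (rho s (y - x) + rho s y)" by (simp add: algebra_simps)
  finally show ?thesis .
  qed
  qed
  have "(INT+ y. en (rho s (x - y) * rho s y))
  <= (INT+ y. en (?c * rho s x) * (en (rho s (y - x)) + en (rho s y)))"
  by (intro nn_integral_mono) (simp add: pt ennreal_leI flip: ennreal_plus ennreal_mult)
  also have "... = en (?c * rho s x) * (en c + en c)"
  using nn_integral_shift[of "%y. en (rho s y)" x]
  by (simp add: nn_integral_cmult nn_integral_add c)
  also have "... = en (?c * rho s x * (c + c))" using c by (simp add: flip: ennreal_plus ennreal_mult)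
  also have "... <= en ((2 * ?c * (c + 1)) * rho s x)"
  by (intro ennreal_leI) (simp add: algebra_simps)
  finally show ?thesis .
 qed
 then show thesis using c by (intro that[of "2 * ?c * (c + 1)"]) auto
qed

text \<open>A cut-off is Lipschitz and also oscillates by at most 1. Together these bound its
  squared difference by \<open>L^2\<close> times the integrand of the kernel moment.\<close>

lemma lipschitz_moment:
 fixes et :: "'a::euclidean_space => real"
 assumes "!!y. <|et x - et y|> <= L * norm (x - y)" "!!y. <|et x - et y|> <= 1" "1 <= L"
  and C: "(INT+ y. en (min 1 ((norm (x - y))^2) * kern s x y)) <= en C" and "0 <= C"
 shows "(INT+ y. en ((et x - et y)^2 * kern s x y)) <= en (L^2 * C)"
proof -
 have "(INT+ y. en ((et x - et y)^2 * kern s x y))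
  <= (INT+ y. en (L^2) * en (min 1 ((norm (x - y))^2) * kern s x y))"
 proof (intro nn_integral_mono, goal_cases)
  case (1 y)
  have "(et x - et y)^2 <= (L * norm (x - y))^2" using assms(1)[of y] by (rule power2_le_iff_abs_le[THEN iffD2, rotated]) (use assms in auto)
  moreover have "(et x - et y)^2 <= 1" using assms(2)[of y] by (simp add: abs_square_le_1)
  moreover have "1 <= L^2" using assms(3) by simp
  ultimately have "(et x - et y)^2 <= L^2 * min 1 ((norm (x - y))^2)"
  by (simp add: min_def power_mult_distrib)
  from mult_right_mono[OF this, of "kern s x y"]
  show ?case
  by (simp add: ennreal_leI mult.assoc flip: ennreal_mult)
 qed
 also have "... <= en (L^2) * en C" by (simp add: nn_integral_cmult mult_left_mono C)
 finally show ?thesis using assms by (simp add: ennreal_mult)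
qed

lemma exp_diff_le: "<|exp a - exp b|> <= <|a - b|> * max (exp a) (exp (b::real))"
proof -
 have *: "exp a - exp b <= (a - b) * exp a" for a b :: real
 proof -
  have "exp a * (1 + (b - a)) <= exp a * exp (b - a)" by (intro mult_left_mono exp_ge_add_one_self) simp
  also have "... = exp b" by (simp flip: exp_add)
  finally show ?thesis by (simp add: algebra_simps)
 qed
 show ?thesis using *[of a b] *[of b a] by (cases "a \<ge> b") (auto simp: abs_if max_def)
qed

text \<open>The square root of the weight is a cut-off for the whole space: the energy density it
  creates is bounded by a multiple of the weight itself. An energy estimate weighted by
  \<open>rho\<close> can then be closed without shrinking the domain.\<close>

lemma sqrt_rho_moment:
 assumes "0 < s" "s < 1"
 obtains C where "0 < C"
  "!!x::'a::euclidean_space. (INT+ y. en ((sqrt (rho s x) - sqrt (rho s y))^2 * kern s x y)) <= en (C * rho s x)"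
proof -
 define p where "p = real DIM('a) + 2 * s"
 have p: "0 < p" using assms by (simp add: p_def add_nonneg_pos)
 let ?c = "2 powr p"
 obtain C1 where C1: "0 < C1" "!!x::'a. (INT+ y. en (min 1 ((norm (x - y))^2) * kern s x y)) <= en C1"
  using kern_moment[OF assms] by metis
 obtain C2 where C2: "0 < C2" "!!x::'a. (INT+ y. en (rho s (x - y) * rho s y)) <= en (C2 * rho s x)"
  using rho_convolution[OF assms] by metis
 from rho_finite_integral[OF assms, where ?'a='a] obtain c where c: "0 <= c" "(INT+ y. en (rho s (y::'a))) = en c"
  by (rule ennreal_finiteE)
 define L where "L x = (p/2)^2 * ?c * rho s x" for x :: 'a
 have sq: "sqrt (rho s x) = exp (- (p / 2) * ln (1 + norm x))" for x :: 'a
 proof -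
  have "0 < 1 + norm x" by (simp add: add_pos_nonneg)
  then have "rho s x = exp (- p * ln (1 + norm x))" unfolding rho_def p_def[symmetric] by (simp add: powr_def exp_minus divide_inverse)
  also have "... = (exp (- (p / 2) * ln (1 + norm x)))^2" by (simp flip: exp_of_nat_mult exp_double)
  finally show ?thesis by simp
 qed
 have pt: "(sqrt (rho s x) - sqrt (rho s y))^2 * kern s x y \<le>
  L x * (min 1 ((norm (x - y))^2) * kern s x y) + ?c * (rho s x * rho s (y - x) + rho s (x - y) * rho s y)" for x y :: 'a
 proof (cases "norm (x - y) < 1")
  \<comment> \<open>Near part: \<open>sqrt (rho s x)\<close> is the exponential of a Lipschitz
    function, so its increment is at most a multiple of the distance times its own size, and its
    sizes at points of distance below 1 are comparable. This produces the factor
    \<open>rho s x\<close>.\<close>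
  case True
  have ln: "<|ln (1 + norm x) - ln (1 + norm y)|> <= norm (x - y)"
  proof -
  have *: "ln (1 + norm x) - ln (1 + norm y) <= norm (x - y)" for x y :: 'a
  proof -
  have pos: "0 < 1 + norm x" "0 < 1 + norm y" by (auto simp: add_pos_nonneg)
  then have "ln (1 + norm x) - ln (1 + norm y) = ln ((1 + norm x) / (1 + norm y))" by (simp add: ln_div)
  also have "... <= (1 + norm x) / (1 + norm y) - 1" using pos by (intro ln_le_minus_one) simp
  also have "... = (norm x - norm y) / (1 + norm y)" using pos by (simp add: field_simps)
  also have "... <= norm (x - y) / (1 + norm y)" using norm_triangle_ineq2[of x y] pos by (intro divide_right_mono) auto
  also have "... <= norm (x - y)" using pos by (simp add: divide_le_eq mult_le_cancel_left1)
  finally show ?thesis .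
  qed
  show ?thesis using *[of x y] *[of y x] by (simp add: norm_minus_commute abs_le_iff)
  qed
  have r: "max (sqrt (rho s x)) (sqrt (rho s y)) <= sqrt (?c * rho s x)"
  proof -
  have "norm x <= norm y + 1" using True norm_triangle_ineq2[of x y] by linarith
  then have "1 + norm x <= 2 * (1 + norm y)" by (smt (verit) norm_ge_zero)
  then have "rho s y <= ?c * rho s x" unfolding p_def by (intro rho_le_rho[OF assms(1)])
  moreover have "rho s x <= ?c * rho s x" using p one_le_powr[of 2 p] by simp
  ultimately show ?thesis by (simp add: real_sqrt_le_iff)
  qed
  have "<|sqrt (rho s x) - sqrt (rho s y)|> <= (p / 2 * <|ln (1 + norm x) - ln (1 + norm y)|>) * max (sqrt (rho s x)) (sqrt (rho s y))"
  proof -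
  have "<|- (p / 2) * ln (1 + norm x) - - (p / 2) * ln (1 + norm y)|> = <|- (p / 2) * (ln (1 + norm x) - ln (1 + norm y))|>"
  by (simp add: algebra_simps)
  also have "... = p / 2 * <|ln (1 + norm x) - ln (1 + norm y)|>"
  unfolding abs_mult using p by simp
  finally have eq: "<|- (p / 2) * ln (1 + norm x) - - (p / 2) * ln (1 + norm y)|> = p / 2 * <|ln (1 + norm x) - ln (1 + norm y)|>" .
  show ?thesis
  unfolding sq by (rule exp_diff_le[of "- (p / 2) * ln (1 + norm x)" "- (p / 2) * ln (1 + norm y)", unfolded eq])
  qed
  also have "... <= (p / 2 * norm (x - y)) * sqrt (?c * rho s x)"
  using p ln r by (intro mult_mono mult_nonneg_nonneg) (auto simp: le_max_iff_disj)
  finally have "(sqrt (rho s x) - sqrt (rho s y))^2 <= ((p / 2 * norm (x - y)) * sqrt (?c * rho s x))^2"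
  by (metis abs_ge_zero power2_abs power_mono)
  also have "... = L x * (norm (x - y))^2"
  unfolding power_mult_distrib L_def by (simp add: power_divide)
  also have "... = L x * min 1 ((norm (x - y))^2)" using True power_le_one[of "norm (x - y)" 2] by (simp add: min_def)
  finally have "(sqrt (rho s x) - sqrt (rho s y))^2 * kern s x y <= L x * min 1 ((norm (x - y))^2) * kern s x y"
  by (rule mult_right_mono) simp
  then show ?thesis by (simp add: mult.assoc add_increasing2)
 next
  \<comment> \<open>Far part: the squared difference of two nonnegative numbers is at most the sum
    of their squares. The summand with \<open>rho s x\<close> leaves an integrable function of
    \<open>y\<close>, the one with \<open>rho s y\<close> a convolution.\<close>
  case False
  have "(sqrt (rho s x) - sqrt (rho s y))^2 <= rho s x + rho s y"
  by (simp add: power2_diff)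
  then have "(sqrt (rho s x) - sqrt (rho s y))^2 * kern s x y <= (rho s x + rho s y) * (?c * rho s (x - y))"
  using False unfolding p_def by (intro mult_mono kern_le_rho assms) auto
  also have "rho s (x - y) = rho s (y - x)" by (simp add: rho_def norm_minus_commute)
  also have "(rho s x + rho s y) * (?c * rho s (y - x)) = ?c * (rho s x * rho s (y - x) + rho s (y - x) * rho s y)"
  by (simp add: algebra_simps)
  finally show ?thesis unfolding \<open>rho s (x - y) = rho s (y - x)\<close> by (simp add: add_increasing L_def)
 qed
 have "(INT+ y. en ((sqrt (rho s x) - sqrt (rho s y))^2 * kern s x y)) <= en (((p/2)^2 * ?c * C1 + ?c * (c + C2)) * rho s x)" for x :: 'a
 proof -
  have L: "0 <= L x" by (simp add: L_def)
  have "(INT+ y. en ((sqrt (rho s x) - sqrt (rho s y))^2 * kern s x y))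
  <= (INT+ y. en (L x) * en (min 1 ((norm (x - y))^2) * kern s x y) +
  en ?c * (en (rho s x) * en (rho s (y - x)) + en (rho s (x - y) * rho s y)))"
  using L by (intro nn_integral_mono) (simp add: pt ennreal_leI flip: ennreal_plus ennreal_mult)
  also have "... <= en (L x) * en C1 + en ?c * (en (rho s x) * en c + en (C2 * rho s x))"
  using nn_integral_shift[of "%y. en (rho s y)" x]
  by (simp add: nn_integral_cmult nn_integral_add c(2)) (intro add_mono mult_left_mono C1 C2; simp)
  also have "... = en (((p/2)^2 * ?c * C1 + ?c * (c + C2)) * rho s x)"
  using L c C1 C2 by (simp add: L_def algebra_simps flip: ennreal_plus ennreal_mult)
  finally show ?thesis .
 qed
 moreover have "0 < (p/2)^2 * ?c * C1 + ?c * (c + C2)"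
  using p c C1 C2 by (intro add_pos_pos mult_pos_pos add_nonneg_pos) auto
 ultimately show thesis by (rule that[rotated])
qed

section \<open>Iterated integrals and the bilinear form\<close>

lemma iterated_integral:
 fixes w :: "'a::euclidean_space => 'b::euclidean_space => real"
 assumes w[measurable]: "(%(x, y). w x y) : borel_measurable lborel2"
  and fin: "(INT+ x. INT+ y. en <|w x y|>) < inft"
 shows iterated_integrable: "integrable lborel2 (%(x, y). w x y)"
  and iterated_integral_eq: "(INT1 x. INT1 y. w x y) = integral\<^sup>L lborel2 (%(x, y). w x y)"
proof -
 have "(\<integral>\<^sup>+z. en (norm ((%(x, y). w x y) z)) \<partial>lborel2) = (INT+ x. INT+ y. en <|w x y|>)"
  by (subst lborel.nn_integral_fst[symmetric]) (auto simp: split_beta)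
 with fin show int: "integrable lborel2 (%(x, y). w x y)"
  by (intro integrableI_bounded) auto
 from lborel_pair.integral_fst'[OF int]
 show "(INT1 x. INT1 y. w x y) = integral\<^sup>L lborel2 (%(x, y). w x y)" by simp
qed

lemma iterated_integral_diff:
 fixes w w' :: "'a::euclidean_space => 'b::euclidean_space => real"
 assumes [measurable]: "(%(x, y). w x y) : borel_measurable lborel2"
  "(%(x, y). w' x y) : borel_measurable lborel2"
  and fin: "(INT+ x. INT+ y. en <|w x y|>) < inft" "(INT+ x. INT+ y. en <|w' x y|>) < inft"
 shows "en <|(INT1 x. INT1 y. w x y) - (INT1 x. INT1 y. w' x y)|>
  <= (INT+ x. INT+ y. en <|w x y - w' x y|>)"
proof -
 let ?w = "%(x, y). w x y" and ?w' = "%(x, y). w' x y"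
 have "(INT1 x. INT1 y. w x y) - (INT1 x. INT1 y. w' x y)
  = integral\<^sup>L lborel2 (%z. ?w z - ?w' z)"
  unfolding iterated_integral_eq[OF assms(1) fin(1)] iterated_integral_eq[OF assms(2) fin(2)]
  by (rule Bochner_Integration.integral_diff[symmetric])
  (rule iterated_integrable[OF assms(1) fin(1)] iterated_integrable[OF assms(2) fin(2)])+
 also have "en <|...|> <= (\<integral>\<^sup>+z. en <|?w z - ?w' z|> \<partial>lborel2)"
  unfolding real_norm_def[symmetric]
  by (rule integral_norm_bound_ennreal, rule Bochner_Integration.integrable_diff)
  (rule iterated_integrable[OF assms(1) fin(1)] iterated_integrable[OF assms(2) fin(2)])+
 also have "... = (INT+ x. INT+ y. en <|w x y - w' x y|>)"
  by (subst lborel.nn_integral_fst[symmetric]) (auto simp: split_beta)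
 finally show ?thesis .
qed

text \<open>The passage from the signed bilinear form to nonnegative integrals. \<open>w\<close> has
  no sign, but after adding \<open>f\<close> it equals the nonnegative \<open>g\<close>; absolute
  integrability of \<open>w\<close> and \<open>f\<close> allows splitting the double
  integral.\<close>

lemma iterated_integral_sum_nonneg:
 fixes w f g :: "'a::euclidean_space => 'b::euclidean_space => real"
 assumes [measurable]: "(%(x, y). w x y) : borel_measurable lborel2"
  "(%(x, y). f x y) : borel_measurable lborel2" "(%(x, y). g x y) : borel_measurable lborel2"
  and fin: "(INT+ x. INT+ y. en <|w x y|>) < inft" "(INT+ x. INT+ y. en (f x y)) < inft"
  and nn: "!!x y. 0 <= f x y" "!!x y. 0 <= g x y" and eq: "!!x y. w x y + f x y = g x y"
 shows "0 <= (INT1 x. INT1 y. w x y) + enn2real (INT+ x. INT+ y. en (f x y))"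
  "(INT+ x. INT+ y. en (g x y))
  = en ((INT1 x. INT1 y. w x y) + enn2real (INT+ x. INT+ y. en (f x y)))"
proof -
 let ?P = "lborel \<Otimes>\<^sub>M lborel :: ('a \<times> 'b) measure"
 let ?w = "%(x, y). w x y" and ?f = "%(x, y). f x y" and ?g = "%(x, y). g x y"
 have f: "integrable ?P ?f" using fin(2) nn by (intro iterated_integrable) auto
 have w: "integrable ?P ?w" using fin(1) by (intro iterated_integrable) auto
 have geq: "?g = (%z. ?w z + ?f z)" using eq by (auto simp: fun_eq_iff)
 have g: "integrable ?P ?g" unfolding geq using f w by (rule Bochner_Integration.integrable_add[rotated])
 have F: "(INT+ x. INT+ y. en (f x y)) = en (integral\<^sup>L ?P ?f)"
  by (subst nn_integral_eq_integral[OF f, symmetric])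
  (use nn in "auto simp: lborel.nn_integral_fst[symmetric] split_beta")
 have G: "(INT+ x. INT+ y. en (g x y)) = en (integral\<^sup>L ?P ?g)"
  by (subst nn_integral_eq_integral[OF g, symmetric])
  (use nn in "auto simp: lborel.nn_integral_fst[symmetric] split_beta")
 have I: "integral\<^sup>L ?P ?g = integral\<^sup>L ?P ?w + integral\<^sup>L ?P ?f"
  unfolding geq using w f by (rule Bochner_Integration.integral_add)
 have nnf: "0 <= integral\<^sup>L ?P ?f" and nng: "0 <= integral\<^sup>L ?P ?g"
  using nn by (auto intro!: integral_nonneg_AE)
 show "0 <= (INT1 x. INT1 y. w x y) + enn2real (INT+ x. INT+ y. en (f x y))"
  "(INT+ x. INT+ y. en (g x y))
  = en ((INT1 x. INT1 y. w x y) + enn2real (INT+ x. INT+ y. en (f x y)))"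
  unfolding F G iterated_integral_eq[OF assms(1) fin(1)] using I nnf nng by auto
qed

lemma set_integral_split_Icc:
 fixes f :: "real => real"
 assumes "set_integrable lborel {a..b} f" "a <= c" "c <= b"
 shows "(LINT t:{a..b}|lborel. f t) = (LINT t:{a..c}|lborel. f t) + (LINT t:{c..b}|lborel. f t)"
proof -
 have 1: "set_integrable lborel {a..c} f" "set_integrable lborel {c..b} f"
  using assms by (auto intro: set_integrable_subset)
 have "(LINT t:{a..b}|lborel. f t) = (INT1 t. ind {a..c} t *R f t + ind {c..b} t *R f t)"
  unfolding set_lebesgue_integral_def
  using assms 1[unfolded set_integrable_def] AE_lborel_singleton[of c]
  by (intro integral_cong_AE) (auto simp: set_integrable_def indicator_def elim!: eventually_mono)
 also have "... = (LINT t:{a..c}|lborel. f t) + (LINT t:{c..b}|lborel. f t)"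
  using 1 unfolding set_lebesgue_integral_def set_integrable_def by (rule Bochner_Integration.integral_add)
 finally show ?thesis .
qed

lemma ennreal_integral_le_nn_integral: "en (integral\<^sup>L M f) <= (\<integral>\<^sup>+x. en (f x) \<partial>M)"
proof (cases "integrable M f")
 case True
 then have "(\<integral>\<^sup>+x. en (f x) \<partial>M) < inft" by (auto simp: real_integrable_def top.not_eq_extremum)
 moreover have "integral\<^sup>L M f <= enn2real (\<integral>\<^sup>+x. en (f x) \<partial>M)"
  unfolding real_lebesgue_integral_def[OF True] by simp
 ultimately show ?thesis by (metis ennreal_enn2real ennreal_leI infinity_ennreal_def)
qed (simp add: not_integrable_integral_eq)

text \<open>Monotonicity from increments that are small only on average. If \<open>H b\<close>
  exceeded \<open>H a\<close>, the means of \<open>H\<close> over short intervals at the two ends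
  would differ by a fixed amount. That difference is a mean of the increments
  \<open>H t - H (t - h)\<close>, which after exchanging integrals is a mean of the defects at
  delays between 0 and \<open>h\<close>, and these tend to 0.\<close>

lemma averaged_decrease:
 fixes H :: "real => real" and q :: "real => real => ennreal"
 assumes ab: "a < b" "a : G" "b : G" and G: "AEL t. t : {a..b} --> t : G"
  and H[measurable]: "H : borelm" and bd: "!!t. t : G ==> a <= t ==> t <= b ==> <|H t|> <= B"
  and conta: "!!tu. (!!n. tu n : G) ==> (!!n. a <= tu n \<and> tu n <= b) ==> tu ~~> a ==> (%n. H (tu n)) ~~> H a"
  and contb: "!!tu. (!!n. tu n : G) ==> (!!n. a <= tu n \<and> tu n <= b) ==> tu ~~> b ==> (%n. H (tu n)) ~~> H b"
  and q[measurable]: "(%(r, t). q r t) : borel_measurable lborel2"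
  and incr: "!!vt. 0 < vt ==> AEL t. a + vt <= t \<and> t <= b --> en (H t - H (t - vt)) <= (INT+ r:{t - vt..t}. q r t)"
  and small: "!!vt. (!!n. 0 < vt n) ==> vt ~~> 0 ==> (%n. INT+ t:{a + vt n..b}. q (t - vt n) t) ~~> 0"
 shows "H b <= H a"
proof (rule ccontr)
 assume "\<not> H b <= H a"
 define e where "e = (H b - H a) / 4"
 have e: "0 < e" "H b = H a + 4 * e" using \<open>\<not> H b <= H a\<close> by (auto simp: e_def field_simps)
 have near: "\<exists>d>0. \<forall>t\<in>G. a <= t \<and> t <= b \<and> <|t - c|> < d --> <|H t - H c|> < e"
  if c: "!!tu. (!!n. tu n : G) ==> (!!n. a <= tu n \<and> tu n <= b) ==> tu ~~> c ==> (%n. H (tu n)) ~~> H c" for c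
 proof (rule ccontr)
  assume "\<not> ?thesis"
  then have "\<exists>t\<in>G. a <= t \<and> t <= b \<and> <|t - c|> < 1 / real (Suc n) \<and> e <= <|H t - H c|>" for n
  using not_less by (metis of_nat_0_less_iff zero_less_Suc zero_less_divide_1_iff)
  then obtain tu where tu: "!!n. tu n : G" "!!n. a <= tu n \<and> tu n <= b" "!!n. <|tu n - c|> < 1 / real (Suc n)" "!!n. e <= <|H (tu n) - H c|>"
  by metis
  have "(%n. tu n - c) ~~> 0"
  by (rule Lim_null_comparison[OF _ LIMSEQ_inverse_real_of_nat]) (use tu(3) in "auto simp: inverse_eq_divide intro!: always_eventually less_imp_le")
  then have "tu ~~> c" by (simp add: LIM_zero_iff)
  from tendsto_rabs[OF LIM_zero[OF c[OF tu(1,2) this]]]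
  have "(%n. <|H (tu n) - H c|>) ~~> 0" by simp
  from LIMSEQ_le_const[OF this, of e] tu(4) e show False by fastforce
 qed
 from near[OF conta] obtain d1 where d1: "0 < d1" "!!t. t : G ==> a <= t ==> t <= b ==> <|t - a|> < d1 ==> <|H t - H a|> < e" by blast
 from near[OF contb] obtain d2 where d2: "0 < d2" "!!t. t : G ==> a <= t ==> t <= b ==> <|t - b|> < d2 ==> <|H t - H b|> < e" by blast
 define I where "I vt = (INT+ t:{a + vt..b}. q (t - vt) t)" for vt
 have "\<exists>d>0. \<forall>vt. 0 < vt \<and> vt < d --> I vt <= en e"
 proof (rule ccontr)
  assume "\<not> ?thesis"
  then have "\<exists>vt. 0 < vt \<and> vt < 1 / real (Suc n) \<and> en e < I vt" for n
  using not_less by (metis of_nat_0_less_iff zero_less_Suc zero_less_divide_1_iff)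
  then obtain vt where vt: "!!n. 0 < vt n" "!!n. vt n < 1 / real (Suc n)" "!!n. en e < I (vt n)"
  by metis
  have "vt ~~> 0"
  by (rule Lim_null_comparison[OF _ LIMSEQ_inverse_real_of_nat]) (use vt(1,2) in "auto simp: inverse_eq_divide abs_of_pos intro!: always_eventually less_imp_le")
  from tendsto_zero_ennrealD[OF small[OF vt(1) this] e(1)] vt(3)
  show False by (auto simp: I_def eventually_sequentially not_le[symmetric])
 qed
 then obtain d3 where d3: "0 < d3" "!!vt. 0 < vt ==> vt < d3 ==> I vt <= en e" by blast
 define h where "h = min (min d1 d2) (min d3 (b - a)) / 2"
 have h: "0 < h" "h < d1" "h < d2" "h < d3" "h < b - a" using d1 d2 d3 ab by (auto simp: h_def min_def)
 have bH: "AEL t. t : {a..b} --> <|H t|> <= B" using G by eventually_elim (auto intro: bd)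
 have Hint: "set_integrable lborel {c..d} H" if "a <= c" "d <= b" for c d
  unfolding set_integrable_def
  by (rule integrableI_bounded_set[where A="{c..d}" and B=B]) (use bH that in "auto simp: indicator_def emeasure_lborel_Icc_eq elim!: eventually_mono")
 have Hint': "set_integrable lborel {a + h..b} (%t. H (t - h))"
  using lborel_integrable_real_affine[OF Hint[of a "b - h", unfolded set_integrable_def], of 1 "-h"] h
  by (simp add: set_integrable_def indicator_def algebra_simps cong: if_cong)
 have shift: "(LINT t:{a + h..b}|lborel. H (t - h)) = (LINT t:{a..b - h}|lborel. H t)"
  unfolding set_lebesgue_integral_def
  by (subst (2) lborel_integral_real_affine[where c=1 and t="-h"]) (auto simp: indicator_def intro!: Bochner_Integration.integral_cong)
 have split1: "(LINT t:{a..b - h}|lborel. H t) + (LINT t:{b - h..b}|lborel. H t) = (LINT t:{a..b}|lborel. H t)"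
  using h ab by (intro set_integral_split_Icc[symmetric] Hint) auto
 have split2: "(LINT t:{a..a + h}|lborel. H t) + (LINT t:{a + h..b}|lborel. H t) = (LINT t:{a..b}|lborel. H t)"
  using h ab by (intro set_integral_split_Icc[symmetric] Hint) auto
 have const: "set_integrable lborel {c..d} (%_. k)" for c d k :: real
  by (simp add: set_integrable_def emeasure_lborel_Icc_eq)
 have low: "h * (H b - e) <= (LINT t:{b - h..b}|lborel. H t)"
 proof -
  have "(LINT t:{b - h..b}|lborel. (H b - e)) <= (LINT t:{b - h..b}|lborel. H t)"
  using h ab G by (intro set_integral_mono_AE Hint) (auto intro!: const simp: elim!: eventually_mono dest: d2(2))
  then show ?thesis using h by (simp add: set_lebesgue_integral_def)
 qed
 have up: "(LINT t:{a..a + h}|lborel. H t) <= h * (H a + e)"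
 proof -
  have "(LINT t:{a..a + h}|lborel. H t) <= (LINT t:{a..a + h}|lborel. (H a + e))"
  using h ab G by (intro set_integral_mono_AE Hint) (auto intro!: const simp: elim!: eventually_mono dest: d1(2))
  then show ?thesis using h by (simp add: set_lebesgue_integral_def)
 qed
 \<comment> \<open>In terms of the delay \<open>vt = t - r\<close> the inner interval no longer
   depends on \<open>t\<close>. Exchanging the order of integration then isolates the defect at a
   fixed delay, which is what \<open>small\<close> controls.\<close>
 have sub: "(INT+ r:{t - h..t}. q r t) = (INT+ vt:{0..h}. q (t - vt) t)" for t
 proof -
  have "(INT+ r:{t - h..t}. q r t) = (INT+ vt. q (t + (-1) * vt) t * ind {t - h..t} (t + (-1) * vt))"
  by (subst nn_integral_real_affine[where c="-1" and t=t]) auto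
  also have "... = (INT+ vt:{0..h}. q (t - vt) t)"
  by (intro nn_integral_cong) (auto simp: indicator_def)
  finally show ?thesis .
 qed
 \<comment> \<open>The integrals over the common part cancel, leaving one interval of length
   \<open>h\<close> at each end. The gap of \<open>4 * e\<close> loses \<open>e\<close> at each of
   them; the upper bound \<open>e * h\<close> derived below contradicts the remaining
   \<open>2 * e * h\<close>.\<close>
 have "h * (2 * e) <= (LINT t:{a + h..b}|lborel. H t - H (t - h))"
 proof -
  have "(LINT t:{a + h..b}|lborel. H t - H (t - h)) = (LINT t:{a + h..b}|lborel. H t) - (LINT t:{a..b - h}|lborel. H t)"
  using Hint'  h Hint[of "a + h" b] by (simp add: set_integral_diff shift)
  also have "... = (LINT t:{b - h..b}|lborel. H t) - (LINT t:{a..a + h}|lborel. H t)" using split1 split2 by simp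
  also have "... \<ge> h * (H b - e) - h * (H a + e)" using low up by simp
  finally show ?thesis by (simp add: e(2) algebra_simps)
 qed
 then have "en (h * (2 * e)) <= en (LINT t:{a + h..b}|lborel. H t - H (t - h))" by (rule ennreal_leI)
 also have "... <= (INT+ t:{a + h..b}. en (H t - H (t - h)))"
 proof -
  have "en (LINT t:{a + h..b}|lborel. H t - H (t - h)) <= (INT+ t. en (ind {a + h..b} t * (H t - H (t - h))))"
  unfolding set_lebesgue_integral_def real_scaleR_def
  by (rule ennreal_integral_le_nn_integral)
  also have "... = (INT+ t:{a + h..b}. en (H t - H (t - h)))"
  by (intro nn_integral_cong) (auto simp: indicator_def)
  finally show ?thesis .
 qed
 also have "... <= (INT+ t:{a + h..b}. (INT+ r:{t - h..t}. q r t))"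
  using incr[OF h(1)] by (intro nn_integral_mono_AE) (auto simp: indicator_def elim!: eventually_mono)
 also have "... = (INT+ t:{a + h..b}. (INT+ vt:{0..h}. q (t - vt) t))"
  by (simp only: sub)
 also have "... = (INT+ t. INT+ vt. q (t - vt) t * ind {0..h} vt * ind {a + h..b} t)"
  by (intro nn_integral_cong) (simp add: nn_integral_multc)
 also have "... = (INT+ vt. INT+ t. q (t - vt) t * ind {0..h} vt * ind {a + h..b} t)"
  by (rule lborel_pair.Fubini') measurable
 also have "... <= (INT+ vt. en e * ind {0..h} vt)"
 proof (rule nn_integral_mono_AE, use AE_lborel_singleton[of "0::real"] in eventually_elim)
  fix vt :: real assume "vt \<noteq> 0"
  show "(INT+ t. q (t - vt) t * ind {0..h} vt * ind {a + h..b} t) <= en e * ind {0..h} vt"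
  proof (cases "vt : {0..h}")
  case True
  then have "(INT+ t. q (t - vt) t * ind {0..h} vt * ind {a + h..b} t) <= I vt"
  unfolding I_def by (intro nn_integral_mono) (auto simp: indicator_def)
  also have "... <= en e" using True \<open>vt \<noteq> 0\<close> h by (intro d3) auto
  finally show ?thesis using True by simp
  qed simp
 qed
 also have "... = en (e * h)" using h e by (simp add: nn_integral_cmult_indicator ennreal_mult)
 finally have "h * (2 * e) <= e * h" using h e by (simp add: ennreal_le_iff)
 with h e show False by simp
qed

section \<open>Estimates for the bilinear form\<close>

definition gag :: "real => 'a::euclidean_space set => ('a => real) => ennreal" where
 "gag s A v = (INT+ x:A. (INT+ y:A. en ((v x - v y)^2 * kern s x y)))"

lemma gag_eq:
 "gag s A v = (INT+ x. INT+ y. en ((v x - v y)^2 * kern s x y) * ind A y * ind A x)"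
 if [measurable]: "v : borelm" "A : sets borel"
 unfolding gag_def by (simp add: nn_integral_multc)

lemma mult_le_weighted_squares: "a * b <= de * a^2 + (1 / de) * b^2" if "0 < de" for a b de :: real
proof -
 have "0 <= (de * a - b)^2 + de^2 * a^2 + b^2" by simp
 also have "... = 2 * de * (de * a^2 + (1 / de) * b^2 - a * b)"
  using that by (simp add: power2_eq_square field_simps)
 finally show ?thesis using that by (simp add: zero_le_mult_iff)
qed

text \<open>Pairs inside the double ball are treated by Young's inequality. Every other contributing
  pair has one point in the support of \<open>ps\<close> and the other beyond the double ball, where
  the kernel is at most a multiple of the weight. The parameter \<open>de\<close> stays free so that
  the part carrying \<open>ps\<close> can be made small while the part carrying \<open>v\<close> is
  merely bounded.\<close>

lemma form_bound:
 assumes s: "0 < s" "s < 1" and R: "1 <= R"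
 obtains C where "0 < C" "!!(v :: 'a::euclidean_space => real) ps de. v : borelm ==> ps : borelm ==>
  (!!x. R <= norm x ==> ps x = 0) ==> 0 < de ==>
  (INT+ x. INT+ y. en (<|v x - v y|> * <|ps x - ps y|> * kern s x y))
  <= en de * (gag s (ball 0 (2 * R)) v + en C * (sqb R v)
  + en C * (INT+ x. en (<|v x|> * rho s x)))
  + en (1 / de) * (gag s (ball 0 (2 * R)) ps + en C * (1 + (INT+ x. en (<|v x|> * rho s x))) * (INT+ x. en ((ps x)^2)))"
proof -
 define c1 where "c1 = (R + 2) powr (real DIM('a) + 2 * s)"
 have c1: "0 < c1" using R by (simp add: c1_def)
 from rho_finite_integral[OF s, where ?'a='a] obtain C0 where C0: "0 <= C0" "(INT+ y. en (rho s (y::'a))) = en C0"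
  by (rule ennreal_finiteE)
 from emeasure_lborel_ball_finite[of "0::'a" R] obtain vol where vol: "0 <= vol" "emeasure lborel (ball (0::'a) R) = en vol"
  by (rule ennreal_finiteE)
 \<comment> \<open>The factor 2 counts the two orders of a near and a far point. \<open>C0\<close>
   and \<open>vol\<close> come from integrating the far and the near variable when the integrand
   does not depend on it.\<close>
 define C where "C = 2 * c1 * (C0 + vol + 1)"
 have C: "0 < C" using c1 C0 vol by (simp add: C_def add_nonneg_pos)
 show thesis
 proof (rule that[OF C])
  fix v ps :: "'a => real" and de :: real
  assume m[measurable]: "v : borelm" "ps : borelm"
  and supp: "!!x. R <= norm x ==> ps x = 0" and de: "0 < de"
  let ?A = "ball (0::'a) R" and ?A2 = "ball (0::'a) (2 * R)"
  define N where "N = (INT+ x. en (<|v x|> * rho s x))"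
  define S where "S = (INT+ x. en ((ps x)^2))"
  define Q where "Q = (INT+ x:?A. en ((v x)^2))"
  define F where "F x y = en (<|ps x|> * c1) * ind ?A x * (en (<|v x|>) * en (rho s y) + en (<|v y|> * rho s y))" for x y
  have Fm[measurable]: "(%(x, y). F x y) : borel_measurable lborel2" unfolding F_def by measurable
  let ?T = "en de * (Q + N) + en (1 / de) * ((1 + N) * S)" and ?f = "%x y. <|v x - v y|> * <|ps x - ps y|> * kern s x y"
  define H where "H x y = en de * (en ((v x - v y)^2 * kern s x y) * ind ?A2 y * ind ?A2 x)
  + en (1 / de) * (en ((ps x - ps y)^2 * kern s x y) * ind ?A2 y * ind ?A2 x)" for x y
  have Hm[measurable]: "(%(x, y). H x y) : borel_measurable lborel2" unfolding H_def by measurable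
  have far: "en (?f x y) <= F x y" if "x : ?A" "y \<notin> ?A2" for x y
  proof -
  have k: "kern s x y <= c1 * rho s y"
  unfolding c1_def using that R s by (intro kern_far) auto
  have "ps y = 0" using that R by (intro supp) auto
  then have "<|v x - v y|> * <|ps x - ps y|> * kern s x y <= (<|v x|> + <|v y|>) * <|ps x|> * (c1 * rho s y)"
  using k by (intro mult_mono mult_nonneg_nonneg) auto
  also have "... = (<|ps x|> * c1) * (<|v x|> * rho s y + <|v y|> * rho s y)" by (simp add: algebra_simps)
  finally have "en (?f x y) <= en ((<|ps x|> * c1) * (<|v x|> * rho s y + <|v y|> * rho s y))"
  by (rule ennreal_leI)
  also have "... = F x y" using that c1 unfolding F_def by (simp add: ennreal_mult)
  finally show ?thesis .
  qed
  have pt: "en (?f x y) <= H x y + (F x y + F y x)" for x y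
  proof -
  consider "x : ?A2" "y : ?A2" | "x : ?A" "y \<notin> ?A2" | "y : ?A" "x \<notin> ?A2" | "ps x = 0" "ps y = 0"
  using supp[of x] supp[of y] R by fastforce
  then show ?thesis
  proof cases
  case 1
  have "<|v x - v y|> * <|ps x - ps y|> * kern s x y <= (de * (v x - v y)^2 + (1 / de) * (ps x - ps y)^2) * kern s x y"
  using mult_le_weighted_squares[OF de, of "<|v x - v y|>" "<|ps x - ps y|>"] by (intro mult_right_mono) auto
  also have "... = de * ((v x - v y)^2 * kern s x y) + (1 / de) * ((ps x - ps y)^2 * kern s x y)" by (simp add: algebra_simps)
  finally have "en (?f x y)
  <= en (de * ((v x - v y)^2 * kern s x y) + (1 / de) * ((ps x - ps y)^2 * kern s x y))" by (rule ennreal_leI)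
  also have "... = H x y" using 1 de unfolding H_def by (simp flip: ennreal_plus ennreal_mult)
  finally show ?thesis by (rule order_trans) simp
  next
  case 2 then show ?thesis using far[of x y] by (metis add.commute add_increasing2 order_trans zero_le)
  next
  case 3 then show ?thesis using far[of y x]
  by (simp add: kern_commute[of s y x] abs_minus_commute add_increasing)
  next
  case 4 then show ?thesis by simp
  qed
  qed
  have intF: "(INT+ x. INT+ y. F x y)
  <= en c1 * (en (C0 + vol + 1) * ?T)"
  proof -
  have "(INT+ y. F x y) = en (<|ps x|> * c1) * ind ?A x * (en <|v x|> * en C0 + N)" for x
  unfolding F_def N_def by (simp add: nn_integral_cmult nn_integral_add C0)
  moreover have "en (<|ps x|> * c1) * ind ?A x * (en <|v x|> * en C0 + N)
  <= en c1 * ((en C0 * (en de * (en ((v x)^2) * ind ?A x) + en (1 / de) * en ((ps x)^2)))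
  + N * (en de * ind ?A x + en (1 / de) * en ((ps x)^2)))" for x
  proof (cases "x : ?A")
  case True
  have 1: "en <|ps x|> * en <|v x|> <= en de * en ((v x)^2) + en (1 / de) * en ((ps x)^2)"
  using mult_le_weighted_squares[OF de, of "<|v x|>" "<|ps x|>"] de
  by (simp add: mult.commute flip: ennreal_mult ennreal_plus)
  have 2: "en <|ps x|> <= en de + en (1 / de) * en ((ps x)^2)"
  using mult_le_weighted_squares[OF de, of 1 "<|ps x|>"] de
  by (simp flip: ennreal_mult ennreal_plus)
  have "en (<|ps x|> * c1) * ind ?A x * (en <|v x|> * en C0 + N)
  = en c1 * (en C0 * (en <|ps x|> * en <|v x|>) + N * en <|ps x|>)"
  using True c1 by (simp add: ennreal_mult algebra_simps)
  also have "... <= en c1 * (en C0 * (en de * en ((v x)^2) + en (1 / de) * en ((ps x)^2))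
  + N * (en de + en (1 / de) * en ((ps x)^2)))"
  by (intro mult_left_mono add_mono 1 2) auto
  finally show ?thesis using True by simp
  qed simp
  ultimately have "(INT+ x. INT+ y. F x y)
  <= (INT+ x. en c1 * ((en C0 * (en de * (en ((v x)^2) * ind ?A x) + en (1 / de) * en ((ps x)^2)))
  + N * (en de * ind ?A x + en (1 / de) * en ((ps x)^2))))"
  by (intro nn_integral_mono) simp
  also have "... = en c1 * (en C0 * (en de * Q + en (1 / de) * S) + N * (en de * en vol + en (1 / de) * S))"
  by (simp add: nn_integral_cmult nn_integral_add nn_integral_cmult_indicator vol Q_def S_def)
  also have "... <= en c1 * (en (C0 + vol + 1) * ?T)"
  proof (rule mult_left_mono)
  have e: "en (C0 + vol + 1) = en C0 + en vol + 1" using C0 vol by simp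
  show "en C0 * (en de * Q + en (1 / de) * S) + N * (en de * en vol + en (1 / de) * S)
  <= en (C0 + vol + 1) * ?T"
  unfolding e by (simp add: distrib_left distrib_right mult_ac add_ac)
  qed simp
  finally show ?thesis .
  qed
  have F2: "(INT+ x. INT+ y. F y x) = (INT+ x. INT+ y. F x y)"
  by (rule lborel_pair.Fubini') measurable
  have intH: "(INT+ x. INT+ y. H x y) = en de * gag s ?A2 v + en (1 / de) * gag s ?A2 ps"
  unfolding H_def by (simp add: gag_eq nn_integral_cmult nn_integral_add)
  have "(INT+ x. INT+ y. en (?f x y))
  <= (INT+ x. INT+ y. H x y + (F x y + F y x))"
  by (intro nn_integral_mono pt)
  also have "... = (INT+ x. INT+ y. H x y) + ((INT+ x. INT+ y. F x y) + (INT+ x. INT+ y. F y x))"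
  by (simp add: nn_integral_add)
  also have "... <= (en de * gag s ?A2 v + en (1 / de) * gag s ?A2 ps)
  + 2 * (en c1 * (en (C0 + vol + 1) * ?T))"
  unfolding intH F2 mult_2 by (intro add_mono intF order_refl)
  also have "2 * (en c1 * (en (C0 + vol + 1) * ?T))
  = en C * ?T"
  using c1 C0 vol by (simp add: C_def ennreal_mult mult.assoc)
  also have "(en de * gag s ?A2 v + en (1 / de) * gag s ?A2 ps) + en C * ?T
  = en de * (gag s ?A2 v + en C * Q + en C * N) + en (1 / de) * (gag s ?A2 ps + en C * (1 + N) * S)"
  by (simp add: distrib_left distrib_right mult_ac add_ac)
  finally show "(INT+ x. INT+ y. en (?f x y))
  <= en de * (gag s ?A2 v + en C * (INT+ x:?A. en ((v x)^2))
  + en C * (INT+ x. en (<|v x|> * rho s x)))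
  + en (1 / de) * (gag s ?A2 ps + en C * (1 + (INT+ x. en (<|v x|> * rho s x))) * (INT+ x. en ((ps x)^2)))"
  unfolding N_def Q_def S_def .
 qed
qed

section \<open>Abstract solutions\<close>

text \<open>The Young parameter is fixed first so as to make the bounded part small; only then is
  \<open>n\<close> sent to infinity.\<close>

lemma weighted_tendsto_zero:
 fixes X W :: "nat => ennreal"
 assumes le: "!!de n. 0 < de ==> X n <= en de * K + en (1 / de) * W n" and K: "K < inft" and W: "W ~~> 0"
 shows "X ~~> 0"
proof (rule tendsto_zero_ennreal_le)
 fix e :: real assume e: "0 < e"
 from K obtain k where k: "0 <= k" "K = en k" by (rule ennreal_finiteE)
 define de where "de = e / (2 * (k + 1))"
 have de: "0 < de" using e k by (simp add: de_def)
 have dk: "de * k <= e / 2" using e k by (simp add: de_def field_simps)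
 from tendsto_zero_ennrealD[OF W, of "de * (e / 2)"] de e
 have "\<forall>\<^sub>F n in sequentially. W n <= en (de * (e / 2))" by simp
 then show "\<forall>\<^sub>F n in sequentially. X n <= en e"
 proof eventually_elim
  case (elim n)
  have "X n <= en de * K + en (1 / de) * W n" by (rule le[OF de])
  also have "... <= en de * en k + en (1 / de) * en (de * (e / 2))"
  unfolding k by (intro add_left_mono mult_left_mono elim) simp
  also have "... = en (de * k + e / 2)"
  using de e k by (simp flip: ennreal_mult ennreal_plus)
  also have "... <= en e" using dk by (intro ennreal_leI) simp
  finally show ?case .
 qed
qed

text \<open>\<open>G\<close> is a set of times of full measure at which the slices are controlled. Testing against fixed functions of the space variable on slices in \<open>G\<close> replaces the weak formulation in space-time.\<close>

locale nlsol_on =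
 fixes s lam Lam Te :: real and U :: "real => 'a::euclidean_space => real"
  and kap :: "real => 'a => 'a => real" and G :: "real set"
 assumes s: "0 < s" "s < 1" and lam: "0 < lam" "lam <= Lam"
  and U_meas: "(%(t, x). U t x) : borel_measurable borel2"
  and kap_meas: "(%(t, x, y). kap t x y) : borel_measurable (borel \<Otimes>\<^sub>M borel \<Otimes>\<^sub>M borel)"
  and kap_sym: "kap t x y = kap t y x"
  and kap_lower: "lam * kern s x y <= kap t x y" and kap_upper: "kap t x y <= Lam * kern s x y"
  and G_sets [measurable]: "G : sets borel" and G_sub: "G \<subseteq> {0<..Te}" and G_1: "Te : G"
  and G_AE: "AEL t. t : {0<..Te} --> t : G"
  and L2_bound: "\<exists>C. \<forall>t\<in>G. (sqb R (U t)) <= en C"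
  and L2_cont: "t : G ==> (!!n. tu n : G) ==> tu ~~> t ==>
  (%n. INT+ x:ball 0 R. en ((U (tu n) x - U t x)^2)) ~~> 0"
  and Hs_fin: "(INT+ t:{0<..Te}. gag s (ball 0 R) (U t)) < inft"
  and L1_fin: "(INT+ t:{0<..Te}. (INT+ x. en (<|U t x|> * rho s x))) < inft"
  and slice: "a : G ==> b : G ==> a < b ==> ps : borelm ==> (!!x. 0 <= ps x) ==>
  (!!x. R <= norm x ==> ps x = 0) ==> (INT+ x. en ((ps x)^2)) < inft ==> gag s UNIV ps < inft ==>
  (INT1 x. U b x * ps x) - (INT1 x. U a x * ps x)
  = - (LINT t:{a..b}|lborel. INT1 x. INT1 y. (U t x - U t y) * (ps x - ps y) * kap t x y)"
begin

lemma U_measurable [measurable (raw)]: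
 assumes "f : borel_measurable M" "g : borel_measurable M"
 shows "(%x. U (f x) (g x)) : borel_measurable M"
 using measurable_compose[OF measurable_Pair[OF assms] U_meas] by simp

lemma kap_measurable [measurable (raw)]:
 assumes "f : borel_measurable M" "g : borel_measurable M" "h : borel_measurable M"
 shows "(%x. kap (f x) (g x) (h x)) : borel_measurable M"
 using measurable_compose[OF measurable_Pair[OF assms(1) measurable_Pair[OF assms(2,3)]] kap_meas] by simp

lemma kap_nonneg [simp]: "0 <= kap t x y"
 using kap_lower[of x y t] lam by (meson kern_nonneg less_imp_le mult_nonneg_nonneg order_trans)

lemma Lam_pos [simp]: "0 < Lam" using lam by simp

lemma gag_measurable:
 assumes [measurable]: "(%(t, x). u t x) : borel_measurable borel2" "A : sets borel"
 shows "(%t. gag s A (u t)) : borelm"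
 unfolding gag_def by measurable

end

locale nlsol = nlsol_on s lam Lam 1 U kap G
 for s lam Lam :: real and U :: "real => 'a::euclidean_space => real"
  and kap :: "real => 'a => 'a => real" and G :: "real set"
begin

definition N :: "real => ennreal" where
 "N t = (INT+ x. en (<|U t x|> * rho s x))"

lemma N_measurable [measurable]: "N : borelm"
 unfolding N_def by measurable

end

text \<open>The truncation level \<open>l\<close> moves in time with speed \<open>g\<close>; a rising level produces the term that absorbs the far field of the nonlocal form.\<close>

locale nl_energy = nlsol +
 fixes et :: "'a => real" and L R :: real and l g :: "real => real" and a b :: real
 assumes eta_meas [measurable]: "et : borelm"
  and eta_lip: "<|et x - et y|> <= L * norm (x - y)" and eta_nn: "0 <= et x" and eta_1: "et x <= 1"
  and eta_supp: "R <= norm x ==> et x = 0" and R: "1 <= R" and L: "1 <= L"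
  and a: "a : G" and b: "b : G" and ab: "a < b"
  and l_meas [measurable]: "l : borelm" and g_meas [measurable]: "g : borelm"
  and g_int: "set_integrable lborel {a..b} g"
  and l_g: "a <= r ==> r <= t ==> t <= b ==> l t - l r = (LINT u:{r..t}|lborel. g u)"
begin

lemma ab01: "0 < a" "b <= 1" "{a..b} \<subseteq> {0<..1}"
proof -
 have "a : {0<..1}" "b : {0<..1}" using a b G_sub by blast+
 then show "0 < a" "b <= 1" "{a..b} \<subseteq> {0<..1}" by auto
qed

lemma l_cont: "continuous_on {a..b} l"
proof -
 have "continuous_on {a..b} (%t. l a + integral {a..t} g)"
  using set_borel_integral_eq_integral(1)[OF g_int]
  by (intro continuous_intros indefinite_integral_continuous_1)
 moreover have "l t = l a + integral {a..t} g" if "t : {a..b}" for t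
 proof -
  have "set_integrable lborel {a..t} g" using that by (intro set_integrable_subset[OF g_int]) auto
  from set_borel_integral_eq_integral(2)[OF this] l_g[of a t] that show ?thesis by simp
 qed
 ultimately show ?thesis by (metis (no_types, lifting) continuous_on_cong)
qed

lemma l_bounded: obtains B where "0 <= B" "!!t. a <= t ==> t <= b ==> <|l t|> <= B"
proof -
 have "bounded (l ` {a..b})" by (intro compact_imp_bounded compact_continuous_image l_cont) simp
 then obtain B where "\<forall>t\<in>{a..b}. <|l t|> <= B" by (auto simp: bounded_iff)
 then show thesis by (intro that[of "max B 0"]) (auto simp: le_max_iff_disj)
qed

definition V :: "real => 'a => real" where "V t x = max 0 (U t x - l t)"
text \<open>The derivative of the density of \<open>Gt\<close> with respect to \<open>U\<close>:
  testing the equation with it differentiates \<open>Gt\<close> in time. The cut-off is squared so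
  that the form evaluated on it can be completed to the square in \<open>D\<close>.\<close>

definition phi :: "real => 'a => real" where "phi t x = V t x * (et x)^2"
definition m :: "real => real" where "m t = (INT1 x. phi t x)"
definition Gt :: "real => real" where "Gt t = (INT1 x. (V t x)^2 / 2 * (et x)^2)"
definition W :: "real => real => ennreal" where "W t r = (INT+ x:ball 0 R. en ((V r x - V t x)^2))"
definition vol :: real where "vol = measure lborel (ball (0::'a) R)"

lemma V_measurable [measurable (raw)]:
 assumes [measurable]: "f : borel_measurable M" "h : borel_measurable M"
 shows "(%x. V (f x) (h x)) : borel_measurable M"
 unfolding V_def by measurable

lemma phi_measurable [measurable (raw)]:
 assumes [measurable]: "f : borel_measurable M" "h : borel_measurable M"
 shows "(%x. phi (f x) (h x)) : borel_measurable M"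
 unfolding phi_def by measurable

lemma m_measurable [measurable]: "m : borelm"
 unfolding m_def by measurable

lemma Gt_measurable [measurable]: "Gt : borelm"
 unfolding Gt_def by measurable

lemma W_measurable [measurable]: "(%(t, r). W t r) : borel_measurable lborel2"
 unfolding W_def by measurable

lemma vol: "emeasure lborel (ball (0::'a) R) = en vol" "0 <= vol"
 using emeasure_lborel_ball_finite[of "0::'a" R] by (auto simp: vol_def emeasure_eq_ennreal_measure less_top)

lemma V_nn [simp]: "0 <= V t x" by (simp add: V_def)
lemma phi_nn [simp]: "0 <= phi t x" by (simp add: phi_def)
lemma eta_sq: "0 <= (et x)^2" "(et x)^2 <= 1" "(et x)^2 <= ind (ball 0 R) x"
 using eta_nn[of x] eta_1[of x] eta_supp[of x] by (auto simp: power_le_one indicator_def not_less)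
lemma phi_supp: "R <= norm x ==> phi t x = 0" by (simp add: phi_def eta_supp)

lemma phi_diff: "<|phi t x - phi r x|> <= <|V t x - V r x|> * ind (ball 0 R) x"
proof -
 have "<|phi t x - phi r x|> = <|V t x - V r x|> * (et x)^2"
  by (simp add: phi_def abs_mult flip: left_diff_distrib)
 also have "... <= <|V t x - V r x|> * ind (ball 0 R) x" by (intro mult_left_mono eta_sq) simp
 finally show ?thesis .
qed

lemma phi_diff_sq: "(INT+ x. en ((phi t x - phi r x)^2)) <= W r t"
 unfolding W_def
proof (intro nn_integral_mono, goal_cases)
 case (1 x)
 have "(phi t x - phi r x)^2 <= (<|V t x - V r x|> * ind (ball 0 R) x)^2"
  using phi_diff[of t x r] by (metis abs_ge_zero power2_abs power_mono)
 also have "... = (V t x - V r x)^2 * ind (ball 0 R) x" by (auto simp: indicator_def)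
 finally show ?case
  by (metis (no_types, lifting) ennreal_indicator ennreal_leI ennreal_mult'' indicator_pos_le)
qed

lemma phi_diff_abs:
 assumes "0 < de"
 shows "(INT+ x. en <|phi t x - phi r x|>) <= en de * en vol + en (1 / de) * W r t"
proof -
 have "(INT+ x. en <|phi t x - phi r x|>)
  <= (INT+ x. en de * ind (ball 0 R) x + en (1 / de) * (en ((V t x - V r x)^2) * ind (ball 0 R) x))"
 proof (intro nn_integral_mono, goal_cases)
  case (1 x)
  have "<|phi t x - phi r x|> <= (de + (1 / de) * (V t x - V r x)^2) * ind (ball 0 R) x"
  proof (rule order_trans[OF phi_diff mult_right_mono])
  show "<|V t x - V r x|> <= de + (1 / de) * (V t x - V r x)^2"
  using mult_le_weighted_squares[OF assms, of 1 "<|V t x - V r x|>"] by simp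
  qed simp
  then have "en <|phi t x - phi r x|> <= en ((de + (1 / de) * (V t x - V r x)^2) * ind (ball 0 R) x)" by (rule ennreal_leI)
  also have "... = en de * ind (ball 0 R) x + en (1 / de) * (en ((V t x - V r x)^2) * ind (ball 0 R) x)"
  using assms by (cases "x : ball 0 R") (simp_all flip: ennreal_mult ennreal_plus)
  finally show ?case .
 qed
 also have "... = en de * en vol + en (1 / de) * W r t"
  by (simp add: nn_integral_add nn_integral_cmult nn_integral_cmult_indicator vol W_def)
 finally show ?thesis .
qed

lemma W_le:
 "W t r <= 2 * (INT+ x:ball 0 R. en ((U r x - U t x)^2)) + 2 * en ((l r - l t)^2 * vol)"
proof -
 have "W t r <= (INT+ x. 2 * (en ((U r x - U t x)^2) * ind (ball 0 R) x) + 2 * (en ((l r - l t)^2) * ind (ball 0 R) x))"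
  unfolding W_def
 proof (intro nn_integral_mono, goal_cases)
  case (1 x)
  have "(V r x - V t x)^2 <= (<|U r x - U t x|> + <|l r - l t|>)^2"
  by (rule power2_le_iff_abs_le[THEN iffD2]) (auto simp: V_def)
  also have "... <= 2 * (U r x - U t x)^2 + 2 * (l r - l t)^2"
  using zero_le_power2[of "<|U r x - U t x|> - <|l r - l t|>"] by (simp add: power2_eq_square algebra_simps)
  finally have "en ((V r x - V t x)^2) <= en (2 * (U r x - U t x)^2 + 2 * (l r - l t)^2)" by (rule ennreal_leI)
  then show ?case
  by (cases "x : ball 0 R") (simp_all add: ennreal_mult)
 qed
 also have "... = 2 * (INT+ x:ball 0 R. en ((U r x - U t x)^2)) + 2 * en ((l r - l t)^2 * vol)"
  by (simp add: nn_integral_add nn_integral_cmult nn_integral_cmult_indicator vol ennreal_mult)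
 finally show ?thesis .
qed

lemma W_tendsto:
 assumes "t : G" "a <= t" "t <= b" "!!n. tu n : G" "!!n. a <= tu n \<and> tu n <= b" "tu ~~> t"
 shows "(%n. W t (tu n)) ~~> 0"
proof -
 have lt: "(%n. l (tu n)) ~~> l t"
  using l_cont assms unfolding continuous_on_sequentially by (auto simp: o_def)
 have "(%n. 2 * (INT+ x:ball 0 R. en ((U (tu n) x - U t x)^2)) + 2 * en ((l (tu n) - l t)^2 * vol)) ~~> 2 * 0 + 2 * en ((l t - l t)^2 * vol)"
  using assms by (intro tendsto_add ennreal_tendsto_cmult L2_cont tendsto_ennrealI tendsto_intros lt) auto
 then have lim: "(%n. 2 * (INT+ x:ball 0 R. en ((U (tu n) x - U t x)^2)) + 2 * en ((l (tu n) - l t)^2 * vol)) ~~> 0" by simp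
 show ?thesis by (rule tendsto_sandwich[OF _ _ tendsto_const lim]) (auto intro!: W_le always_eventually)
qed

lemma V_L2: obtains K where "0 <= K" "!!t. t : G ==> a <= t ==> t <= b ==> (sqb R (V t)) <= en K"
proof -
 obtain B where B: "0 <= B" "!!t. a <= t ==> t <= b ==> <|l t|> <= B" using l_bounded by blast
 obtain C where C: "!!t. t : G ==> (sqb R (U t)) <= en C" using L2_bound[of R] by blast
 define K where "K = 2 * max C 0 + 2 * (B^2 * vol)"
 have "(sqb R (V t)) <= en K" if t: "t : G" "a <= t" "t <= b" for t
 proof -
  have "(sqb R (V t))
  <= (INT+ x. 2 * (en ((U t x)^2) * ind (ball 0 R) x) + 2 * (en (B^2) * ind (ball 0 R) x))"
  proof (intro nn_integral_mono, goal_cases)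
  case (1 x)
  have "(V t x)^2 <= (<|U t x|> + B)^2"
  using B(2)[of t] t B(1) by (intro power_mono) (auto simp: V_def)
  also have "... <= 2 * (U t x)^2 + 2 * B^2"
  using zero_le_power2[of "<|U t x|> - B"] by (simp add: power2_eq_square algebra_simps)
  finally have "en ((V t x)^2) <= en (2 * (U t x)^2 + 2 * B^2)" by (rule ennreal_leI)
  then show ?case
  by (cases "x : ball 0 R") (simp_all add: ennreal_mult)
  qed
  also have "... = 2 * (sqb R (U t)) + 2 * en (B^2 * vol)"
  by (simp add: nn_integral_add nn_integral_cmult nn_integral_cmult_indicator vol ennreal_mult)
  also have "... <= 2 * en (max C 0) + 2 * en (B^2 * vol)"
  by (intro add_right_mono mult_left_mono order_trans[OF C[OF t(1)] ennreal_leI]) auto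
  also have "... = en K" using vol(2) by (simp add: K_def ennreal_mult ennreal_plus)
  finally show ?thesis .
 qed
 then show thesis using vol(2) by (intro that[of K]) (auto simp: K_def)
qed

lemma V_L2_fin: "t : G ==> a <= t ==> t <= b ==> (sqb R (V t)) < inft"
 using V_L2 by (metis ennreal_less_top infinity_ennreal_def le_less_trans)

lemma phi_le: "phi t x <= V t x * ind (ball 0 R) x"
 unfolding phi_def by (intro mult_left_mono eta_sq) simp

lemma phi_sq_fin: "(INT+ x. en ((phi t x)^2)) <= (sqb R (V t))"
proof (intro nn_integral_mono, goal_cases)
 case (1 x)
 have "(phi t x)^2 <= (V t x * ind (ball 0 R) x)^2" by (intro power_mono phi_le) simp
 then show ?case
  by (cases "x : ball 0 R") (auto intro: ennreal_leI simp: phi_supp)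
qed

lemma phi_integrable:
 assumes "t : G" "a <= t" "t <= b"
 shows "integrable lborel (phi t)"
proof (rule integrableI_bounded)
 have "(INT+ x. en (norm (phi t x))) <= (INT+ x. ind (ball 0 R) x + en ((V t x)^2) * ind (ball 0 R) x)"
 proof (intro nn_integral_mono, goal_cases)
  case (1 x)
  have "V t x <= 1 + (V t x)^2" using mult_le_weighted_squares[of 1 1 "V t x"] by simp
  then have "phi t x <= (1 + (V t x)^2) * ind (ball 0 R) x" using phi_le[of t x] by (auto simp: phi_supp indicator_def split: if_splits)
  then have "en (norm (phi t x)) <= en ((1 + (V t x)^2) * ind (ball 0 R) x)" by (simp add: ennreal_leI)
  also have "... = ind (ball 0 R) x + en ((V t x)^2) * ind (ball 0 R) x"
  by (cases "x : ball 0 R") simp_all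
  finally show ?case .
 qed
 also have "... < inft" using V_L2_fin[OF assms] by (simp add: nn_integral_add vol)
 finally show "(INT+ x. en (norm (phi t x))) < inft" .
qed simp

lemma Gt_integrable:
 assumes "t : G" "a <= t" "t <= b"
 shows "integrable lborel (%x. (V t x)^2 / 2 * (et x)^2)"
proof (rule integrableI_bounded)
 have "(INT+ x. en (norm ((V t x)^2 / 2 * (et x)^2))) <= (sqb R (V t))"
 proof (intro nn_integral_mono, goal_cases)
  case (1 x)
  have "(V t x)^2 / 2 * (et x)^2 <= (V t x)^2 * ind (ball 0 R) x" by (intro mult_mono eta_sq) auto
  then show ?case
  by (cases "x : ball 0 R") (auto intro: ennreal_leI simp: eta_supp)
 qed
 also have "... < inft" by (rule V_L2_fin[OF assms])
 finally show "(INT+ x. en (norm ((V t x)^2 / 2 * (et x)^2))) < inft" .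
qed simp

lemma m_nn: "0 <= m t" unfolding m_def by (intro integral_nonneg_AE) simp
lemma Gt_nn: "0 <= Gt t" unfolding Gt_def by (intro integral_nonneg_AE) simp

lemma m_eq: "t : G ==> a <= t ==> t <= b ==> (INT+ x. en (phi t x)) = en (m t)"
 unfolding m_def by (rule nn_integral_eq_integral[OF phi_integrable]) auto

lemma Gt_eq: "t : G ==> a <= t ==> t <= b ==> (INT+ x. en ((V t x)^2 / 2 * (et x)^2)) = en (Gt t)"
 unfolding Gt_def by (rule nn_integral_eq_integral[OF Gt_integrable]) auto

lemma m_diff:
 assumes "t : G" "a <= t" "t <= b" "r : G" "a <= r" "r <= b"
 shows "en <|m t - m r|> <= (INT+ x. en <|phi t x - phi r x|>)"
 using integral_norm_bound_ennreal[OF Bochner_Integration.integrable_diff[OF phi_integrable[OF assms(1-3)] phi_integrable[OF assms(4-6)]]]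
  phi_integrable[OF assms(1-3)] phi_integrable[OF assms(4-6)]
 by (simp add: m_def)

lemma Gt_tendsto:
 assumes t: "t : G" "a <= t" "t <= b" and tu: "!!n. tu n : G" "!!n. a <= tu n \<and> tu n <= b" "tu ~~> t"
 shows "(%n. Gt (tu n)) ~~> Gt t"
proof -
 obtain K where K: "0 <= K" "!!t. t : G ==> a <= t ==> t <= b ==> (sqb R (V t)) <= en K"
  using V_L2 by blast
 have "(%n. en <|Gt (tu n) - Gt t|>) ~~> 0"
 proof (rule weighted_tendsto_zero[where K="2 * en K + 2 * en K" and W="%n. W t (tu n)"])
  fix de :: real and n assume de: "0 < de"
  have tn: "tu n : G" "a <= tu n" "tu n <= b" using tu by auto
  have "en <|Gt (tu n) - Gt t|> <= (INT+ x. en <|(V (tu n) x)^2 / 2 * (et x)^2 - (V t x)^2 / 2 * (et x)^2|>)"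
  using integral_norm_bound_ennreal[OF Bochner_Integration.integrable_diff[OF Gt_integrable[OF tn] Gt_integrable[OF t]]]
  Gt_integrable[OF tn] Gt_integrable[OF t]
  by (simp add: Gt_def)
  also have "... <= (INT+ x. en de * (2 * (en ((V (tu n) x)^2) * ind (ball 0 R) x) + 2 * (en ((V t x)^2) * ind (ball 0 R) x))
  + en (1 / de) * (en ((V (tu n) x - V t x)^2) * ind (ball 0 R) x))"
  proof (intro nn_integral_mono, goal_cases)
  case (1 x)
  let ?p = "V (tu n) x" and ?q = "V t x"
  have "<|?p^2 / 2 * (et x)^2 - ?q^2 / 2 * (et x)^2|> = <|?p^2 / 2 - ?q^2 / 2|> * (et x)^2"
  unfolding left_diff_distrib[symmetric] abs_mult by simp
  also have "... <= <|?p^2 / 2 - ?q^2 / 2|> * ind (ball 0 R) x" by (intro mult_left_mono eta_sq) simp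
  also have "<|?p^2 / 2 - ?q^2 / 2|> = (?p + ?q) * <|?p - ?q|> / 2"
  proof -
  have "?p^2 / 2 - ?q^2 / 2 = ((?p + ?q) * (?p - ?q)) / 2" by (simp add: power2_eq_square algebra_simps)
  then have "<|?p^2 / 2 - ?q^2 / 2|> = <|((?p + ?q) * (?p - ?q)) / 2|>" by (rule arg_cong)
  then show ?thesis unfolding abs_divide abs_mult by simp
  qed
  also have "(?p + ?q) * <|?p - ?q|> / 2 * ind (ball 0 R) x <= (de * (2 * ?p^2 + 2 * ?q^2) + (1 / de) * (?p - ?q)^2) * ind (ball 0 R) x"
  proof (rule mult_right_mono)
  have "0 <= (?p + ?q) * <|?p - ?q|>" by simp
  moreover have "(?p + ?q) * <|?p - ?q|> <= de * (?p + ?q)^2 + (1 / de) * (?p - ?q)^2"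
  using mult_le_weighted_squares[OF de, of "?p + ?q" "<|?p - ?q|>"] by simp
  moreover have "(?p + ?q)^2 <= 2 * ?p^2 + 2 * ?q^2" using zero_le_power2[of "?p - ?q"] by (simp add: power2_eq_square algebra_simps)
  then have "de * (?p + ?q)^2 <= de * (2 * ?p^2 + 2 * ?q^2)" using de by (intro mult_left_mono) auto
  ultimately show "(?p + ?q) * <|?p - ?q|> / 2 <= de * (2 * ?p^2 + 2 * ?q^2) + (1 / de) * (?p - ?q)^2" by linarith
  qed simp
  finally have *: "<|?p^2 / 2 * (et x)^2 - ?q^2 / 2 * (et x)^2|> <= (de * (2 * ?p^2 + 2 * ?q^2) + (1 / de) * (?p - ?q)^2) * ind (ball 0 R) x" .
  have "en <|?p^2 / 2 * (et x)^2 - ?q^2 / 2 * (et x)^2|> <= en ((de * (2 * ?p^2 + 2 * ?q^2) + (1 / de) * (?p - ?q)^2) * ind (ball 0 R) x)"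
  by (rule ennreal_leI[OF *])
  also have "... = en de * (2 * (en (?p^2) * ind (ball 0 R) x) + 2 * (en (?q^2) * ind (ball 0 R) x))
  + en (1 / de) * (en ((?p - ?q)^2) * ind (ball 0 R) x)"
  proof -
  have "en ((?p - ?q)^2 / de) = en (1 / de) * en ((?p - ?q)^2)"
  using de by (simp flip: ennreal_mult)
  then show ?thesis using de by (cases "x : ball 0 R") (simp_all add: ennreal_mult ennreal_plus)
  qed
  finally show ?case .
  qed
  also have "... = en de * (2 * (INT+ x:ball 0 R. en ((V (tu n) x)^2)) + 2 * (sqb R (V t)))
  + en (1 / de) * W t (tu n)"
  by (simp add: nn_integral_add nn_integral_cmult W_def)
  also have "... <= en de * (2 * en K + 2 * en K) + en (1 / de) * W t (tu n)"
  by (intro add_mono mult_left_mono K t tn) auto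
  finally show "en <|Gt (tu n) - Gt t|> <= en de * (2 * en K + 2 * en K) + en (1 / de) * W t (tu n)" .
 qed (use W_tendsto[OF t tu] in "auto simp: ennreal_mult_less_top")
 then have "(%n. <|Gt (tu n) - Gt t|>) ~~> 0" by (subst (asm) ennreal_tendsto_0_iff) auto
 then show ?thesis by (simp add: tendsto_rabs_zero_iff LIM_zero_iff)
qed

end

lemma AE_translate:
 fixes P :: "real => bool"
 assumes "AEL t. P t"
 shows "AEL t. P (t + c)"
proof -
 from assms obtain S where S: "{t : space lborel. \<not> P t} \<subseteq> S" "emeasure lborel S = 0" "S : sets lborel"
  by (rule AE_E)
 then have "AEL t. t \<notin> S" by (intro AE_not_in) auto
 then have "AEL t. c + 1 * t \<notin> S" using S by (intro AE_borel_affine) auto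
 then show ?thesis by eventually_elim (use S in "auto simp: add.commute")
qed

section \<open>Admissibility of the truncation as a test function\<close>

context nl_energy
begin

abbreviation A2 :: "'a set" where "A2 \<equiv> ball 0 (2 * R)"

lemma eta_sq_diff: "((et x)^2 - (et y)^2)^2 <= 4 * (et x - et y)^2"
proof -
 have "((et x)^2 - (et y)^2)^2 = (et x + et y)^2 * (et x - et y)^2"
  by (simp add: power2_eq_square algebra_simps)
 also have "... <= 2^2 * (et x - et y)^2"
  using eta_nn[of x] eta_nn[of y] eta_1[of x] eta_1[of y] by (intro mult_right_mono power_mono) auto
 finally show ?thesis by simp
qed

text \<open>Discrete product rule. The increment of the cut-off is paired with the value of
  \<open>V\<close> at a point inside the ball, whichever of the two that is, because
  \<open>V\<close> is square integrable only there. The increment of \<open>V\<close> is at most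
  that of \<open>U\<close>, since the level does not depend on the point.\<close>

lemma phi_pair_diff:
 "(phi t x - phi t y)^2 <= 2 * (U t x - U t y)^2 + 8 * ((et x - et y)^2 * ((V t x)^2 * ind (ball 0 R) x + (V t y)^2 * ind (ball 0 R) y))"
proof -
 have sum: "(A + B)^2 <= 2 * A^2 + 2 * B^2" for A B :: real
  using zero_le_power2[of "A - B"] by (simp add: power2_eq_square algebra_simps)
 have V: "(V t x - V t y)^2 <= (U t x - U t y)^2"
  by (rule power2_le_iff_abs_le[THEN iffD2, of "<|U t x - U t y|>", simplified]) (auto simp: V_def)
 have A: "((V t x - V t y) * h)^2 <= (U t x - U t y)^2" if "0 <= h" "h <= 1" for h
 proof -
  have "((V t x - V t y) * h)^2 <= (U t x - U t y)^2 * 1"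
  unfolding power_mult_distrib using that V by (intro mult_mono) (auto simp: power_le_one)
  then show ?thesis by simp
 qed
 have B: "(V t z * ((et x)^2 - (et y)^2))^2 <= 4 * ((et x - et y)^2 * (V t z)^2)" for z
  unfolding power_mult_distrib using mult_left_mono[OF eta_sq_diff[of x y], of "(V t z)^2"] by (simp add: mult_ac)
 show ?thesis
 proof (cases "y : ball 0 R")
  case True
  have "phi t x - phi t y = (V t x - V t y) * (et x)^2 + V t y * ((et x)^2 - (et y)^2)"
  by (simp add: phi_def algebra_simps)
  then have "(phi t x - phi t y)^2 <= 2 * (U t x - U t y)^2 + 8 * ((et x - et y)^2 * (V t y)^2)"
  using sum[of "(V t x - V t y) * (et x)^2" "V t y * ((et x)^2 - (et y)^2)"] A[OF eta_sq(1,2)[of x]] B[of y] by simp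
  also have "... <= 2 * (U t x - U t y)^2 + 8 * ((et x - et y)^2 * ((V t x)^2 * ind (ball 0 R) x + (V t y)^2 * ind (ball 0 R) y))"
  using True by (intro add_left_mono mult_left_mono) auto
  finally show ?thesis .
 next
  case False
  show ?thesis
  proof (cases "x : ball 0 R")
  case True
  have "phi t x - phi t y = (V t x - V t y) * (et y)^2 + V t x * ((et x)^2 - (et y)^2)"
  by (simp add: phi_def algebra_simps)
  then have "(phi t x - phi t y)^2 <= 2 * (U t x - U t y)^2 + 8 * ((et x - et y)^2 * (V t x)^2)"
  using sum[of "(V t x - V t y) * (et y)^2" "V t x * ((et x)^2 - (et y)^2)"] A[OF eta_sq(1,2)[of y]] B[of x] by simp
  also have "... <= 2 * (U t x - U t y)^2 + 8 * ((et x - et y)^2 * ((V t x)^2 * ind (ball 0 R) x + (V t y)^2 * ind (ball 0 R) y))"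
  using True by (intro add_left_mono mult_left_mono) auto
  finally show ?thesis .
  next
  case False
  then have "phi t x = 0" "phi t y = 0" using \<open>y \<notin> ball 0 R\<close> by (auto intro!: phi_supp)
  then show ?thesis by simp
  qed
 qed
qed

text \<open>The truncated and localized slice inherits the local seminorm of \<open>U\<close>; the
  cut-off costs only an L^2 norm, through the kernel moment.\<close>

lemma gag_phi:
 obtains c where "0 <= c" "!!t. gag s A2 (phi t) <= 2 * gag s A2 (U t) + en c * (sqb R (V t))"
proof -
 obtain C where C: "0 < C" "!!x::'a. (INT+ y. en (min 1 ((norm (x - y))^2) * kern s x y)) <= en C"
  using kern_moment[OF s] by metis
 have mom: "(INT+ y. en ((et x - et y)^2 * kern s x y)) <= en (L^2 * C)" for x
 proof (rule lipschitz_moment)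
  show "<|et x - et y|> <= 1" for y using eta_nn[of x] eta_nn[of y] eta_1[of x] eta_1[of y] by (auto simp: abs_le_iff)
 qed (use eta_lip L C in auto)
 define J where "J t x y = en ((et x - et y)^2 * kern s x y) * (en ((V t x)^2) * ind (ball 0 R) x)" for t x y
 have Jm[measurable]: "(%(x, y). J t x y) : borel_measurable lborel2" for t unfolding J_def by measurable
 have intJ: "(INT+ x. INT+ y. J t x y) <= en (L^2 * C) * (sqb R (V t))" for t
 proof -
  have "(INT+ x. INT+ y. J t x y) <= (INT+ x. en (L^2 * C) * (en ((V t x)^2) * ind (ball 0 R) x))"
  unfolding J_def by (intro nn_integral_mono) (simp add: nn_integral_multc mult_right_mono mom)
  then show ?thesis by (simp add: nn_integral_cmult)
 qed
 have J2: "(INT+ x. INT+ y. J t y x) = (INT+ x. INT+ y. J t x y)" for t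
  by (rule lborel_pair.Fubini') measurable
 have "gag s A2 (phi t) <= 2 * gag s A2 (U t) + en (16 * (L^2 * C)) * (sqb R (V t))" for t
 proof -
  have pt: "en ((phi t x - phi t y)^2 * kern s x y) * ind A2 y * ind A2 x
  <= 2 * (en ((U t x - U t y)^2 * kern s x y) * ind A2 y * ind A2 x) + 8 * (J t x y + J t y x)" for x y
  proof -
  have "(phi t x - phi t y)^2 * kern s x y <= (2 * (U t x - U t y)^2 + 8 * ((et x - et y)^2 * ((V t x)^2 * ind (ball 0 R) x + (V t y)^2 * ind (ball 0 R) y))) * kern s x y"
  by (intro mult_right_mono phi_pair_diff) simp
  also have "... = 2 * ((U t x - U t y)^2 * kern s x y)
  + 8 * (((et x - et y)^2 * kern s x y) * ((V t x)^2 * ind (ball 0 R) x) + ((et y - et x)^2 * kern s y x) * ((V t y)^2 * ind (ball 0 R) y))"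
  by (simp add: algebra_simps kern_commute[of s y x] power2_commute[of "et y"])
  finally have "en ((phi t x - phi t y)^2 * kern s x y) <= en ..." by (rule ennreal_leI)
  also have "... = 2 * en ((U t x - U t y)^2 * kern s x y) + 8 * (J t x y + J t y x)"
  unfolding J_def by (simp add: ennreal_mult ennreal_plus ennreal_indicator)
  finally show ?thesis by (cases "x : A2 \<and> y : A2") auto
  qed
  have "gag s A2 (phi t) <= (INT+ x. INT+ y. 2 * (en ((U t x - U t y)^2 * kern s x y) * ind A2 y * ind A2 x) + 8 * (J t x y + J t y x))"
  by (subst gag_eq, measurable) (intro nn_integral_mono pt)
  also have "... = 2 * gag s A2 (U t) + 8 * ((INT+ x. INT+ y. J t x y) + (INT+ x. INT+ y. J t y x))"
  by (simp add: gag_eq nn_integral_add nn_integral_cmult)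
  also have "... <= 2 * gag s A2 (U t) + 8 * (en (L^2 * C) * (sqb R (V t)) + en (L^2 * C) * (sqb R (V t)))"
  unfolding J2 by (intro add_left_mono mult_left_mono add_mono intJ) auto
  also have "8 * (en (L^2 * C) * (sqb R (V t)) + en (L^2 * C) * (sqb R (V t)))
  = en (16 * (L^2 * C)) * (sqb R (V t))"
  proof -
  have "8 * (z + z) = 16 * z" for z :: ennreal by (simp add: distrib_left flip: distrib_right)
  then show ?thesis using C by (simp add: ennreal_mult mult.assoc)
  qed
  finally show ?thesis .
 qed
 with C show thesis by (intro that[of "16 * (L^2 * C)"]) auto
qed

text \<open>The times at which \<open>phi t\<close> may be inserted into \<open>slice\<close> and
  all forms are absolutely convergent; almost every time in the interval is of this kind.\<close>

definition good :: "real => bool" where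
 "good t \<longleftrightarrow> t : G \<and> a <= t \<and> t <= b \<and> gag s A2 (U t) < inft \<and> N t < inft"

lemma goodD: "good t ==> t : G" "good t ==> a <= t" "good t ==> t <= b"
 by (auto simp: good_def)

lemma AE_good: "AEL t. t : {a..b} --> good t"
proof -
 have gm[measurable]: "(%t. gag s A2 (U t)) : borelm"
  by (rule gag_measurable) (use U_meas in auto)
 have "AEL t. gag s A2 (U t) * ind {0<..1} t \<noteq> inft"
  by (rule nn_integral_noteq_infinite) (use Hs_fin[of "2 * R"] in auto)
 moreover have "AEL t. N t * ind {0<..1} t \<noteq> inft"
  by (rule nn_integral_noteq_infinite) (use L1_fin in "auto simp: N_def[symmetric]")
 ultimately show ?thesis using G_AE
  by eventually_elim (use ab01 in "auto simp: good_def less_top indicator_def split: if_splits")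
qed

lemma gag_phi_fin: "good t ==> gag s A2 (phi t) < inft"
proof -
 assume t: "good t"
 obtain c where c: "0 <= c" "!!t. gag s A2 (phi t) <= 2 * gag s A2 (U t) + en c * (sqb R (V t))"
  using gag_phi by blast
 have "2 * gag s A2 (U t) + en c * (sqb R (V t)) < inft"
  using t V_L2_fin[OF goodD[OF t]] by (auto simp: good_def ennreal_mult_less_top)
 then show ?thesis using c(2)[of t] by (rule le_less_trans[rotated])
qed

lemma phi_sq_fin': "t : G ==> a <= t ==> t <= b ==> (INT+ x. en ((phi t x)^2)) < inft"
 by (rule le_less_trans[OF phi_sq_fin V_L2_fin])

lemma U_L2_fin: "t : G ==> (INT+ x:ball 0 R'. en ((U t x)^2)) < inft"
proof -
 assume "t : G"
 then obtain C where "(INT+ x:ball 0 R'. en ((U t x)^2)) <= en C" using L2_bound[of R'] by blast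
 then show ?thesis by (rule le_less_trans) simp
qed

lemma form_fin:
 assumes "good r" "good t"
 shows "(INT+ x. INT+ y. en (<|U r x - U r y|> * <|phi t x - phi t y|> * kern s x y)) < inft"
proof (rule form_bound[OF s R, where ?'a='a], goal_cases)
 case (1 C)
 show ?thesis
  by (rule le_less_trans[OF 1(2)[where de=1]])
  (use assms U_L2_fin[OF goodD(1)[OF assms(1)]] gag_phi_fin[OF assms(2)] phi_sq_fin'[OF goodD[OF assms(2)]] in
  "auto simp: good_def N_def[symmetric] ennreal_mult_less_top phi_supp")
qed

text \<open>\<open>slice\<close> asks for a finite seminorm over the whole space. It is the form of
  \<open>phi t\<close> with itself, so \<open>form_bound\<close> reduces it to the seminorm over the
  double ball plus lower order terms.\<close>

lemma gag_phi_UNIV_fin: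
 assumes "good t"
 shows "gag s UNIV (phi t) < inft"
proof (rule form_bound[OF s R, where ?'a='a], goal_cases)
 case (1 C)
 have N: "(INT+ x. en (<|phi t x|> * rho s x)) < inft"
 proof -
  have "(INT+ x. en (<|phi t x|> * rho s x)) <= (INT+ x. en (phi t x))"
  by (intro nn_integral_mono ennreal_leI) (auto simp: mult_left_le rho_le_1 s)
  also have "... < inft" using m_eq[OF goodD[OF assms]] by simp
  finally show ?thesis .
 qed
 have Q: "(sqb R (phi t)) < inft"
  by (rule le_less_trans[OF _ phi_sq_fin'[OF goodD[OF assms]]]) (auto intro!: nn_integral_mono simp: indicator_def)
 have "gag s UNIV (phi t) = (INT+ x. INT+ y. en (<|phi t x - phi t y|> * <|phi t x - phi t y|> * kern s x y))"
  by (simp add: gag_def power2_eq_square flip: abs_mult)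
 also have "... < inft"
  by (rule le_less_trans[OF 1(2)[where de=1]])
  (use gag_phi_fin[OF assms] phi_sq_fin'[OF goodD[OF assms]] N Q in
  "auto simp: ennreal_mult_less_top phi_supp")
 finally show ?thesis .
qed

text \<open>Two times on purpose: solution and kernel are taken at \<open>r\<close>, the test
  function at \<open>t\<close>. The equation provides \<open>e r t\<close> with \<open>t\<close>
  frozen, whereas the energy inequality needs the diagonal \<open>e r r\<close>.\<close>

definition e :: "real => real => real" where
 "e r t = (INT1 x. INT1 y. (U r x - U r y) * (phi t x - phi t y) * kap r x y)"

lemma e_measurable [measurable]:
 assumes [measurable]: "f : borel_measurable M" "h : borel_measurable M"
 shows "(%x. e (f x) (h x)) : borel_measurable M"
 unfolding e_def by measurable

text \<open>Convexity of the squared positive part replaces a chain rule in time: the increment of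
  \<open>Gt\<close> is bounded by the increment of \<open>U\<close> minus that of the level, both
  paired with the truncation at the later time. That pairing is a fixed function of space and so is
  covered by \<open>slice\<close>.\<close>

lemma convex_incr:
 assumes r: "r : G" "a <= r" and t: "good t" and rt: "r < t"
 shows "Gt t - Gt r <= - (LINT u:{r..t}|lborel. e u t) - (l t - l r) * m t"
proof -
 note tG = goodD[OF t]
 have rG: "r : G" "a <= r" "r <= b" using r rt tG by auto
 have Uint: "integrable lborel (%x. U u x * phi t x)" if u: "u : G" for u
 proof (rule integrableI_bounded)
  have "(INT+ x. en (norm (U u x * phi t x))) <= (INT+ x. en ((U u x)^2) * ind (ball 0 R) x + en ((phi t x)^2))"
  proof (intro nn_integral_mono, goal_cases)
  case (1 x)
  have "<|U u x|> * phi t x <= (U u x)^2 * ind (ball 0 R) x + (phi t x)^2"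
  using mult_le_weighted_squares[of 1 "<|U u x|>" "phi t x"] phi_supp[of x t] by (cases "x : ball 0 R") auto
  then have "en (norm (U u x * phi t x)) <= en ((U u x)^2 * ind (ball 0 R) x + (phi t x)^2)"
  by (simp add: abs_mult ennreal_leI del: ennreal_plus)
  also have "... = en ((U u x)^2) * ind (ball 0 R) x + en ((phi t x)^2)"
  by (simp add: ennreal_mult ennreal_indicator)
  finally show ?case .
  qed
  also have "... < inft" using U_L2_fin[OF u] phi_sq_fin'[OF tG] by (simp add: nn_integral_add)
  finally show "(INT+ x. en (norm (U u x * phi t x))) < inft" .
 qed simp
 have "Gt t - Gt r = (INT1 x. (V t x)^2 / 2 * (et x)^2 - (V r x)^2 / 2 * (et x)^2)"
  unfolding Gt_def using Gt_integrable[OF tG] Gt_integrable[OF rG] by simp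
 also have "... <= (INT1 x. (U t x * phi t x - U r x * phi t x) - (l t - l r) * phi t x)"
 proof (rule integral_mono)
  fix x
  \<comment> \<open>The tangent inequality for half the squared positive part, taken at the later
    time: \<open>V t x\<close> times the untruncated earlier value is at most
    \<open>V t x * V r x\<close>.\<close>
  have "(V t x)^2 / 2 - (V r x)^2 / 2 <= V t x * ((U t x - U r x) - (l t - l r))"
  proof -
  let ?p = "U t x - l t" and ?q = "U r x - l r"
  have V: "V t x * ?p = (V t x)^2" by (simp add: V_def power2_eq_square max_def)
  have "V t x * ?q <= V t x * V r x" by (intro mult_left_mono) (auto simp: V_def)
  moreover have "0 <= (V t x - V r x)^2" by simp
  ultimately have "(V t x)^2 / 2 - (V r x)^2 / 2 <= V t x * ?p - V t x * ?q" unfolding V by (simp add: power2_eq_square algebra_simps)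
  then show ?thesis by (simp add: algebra_simps)
  qed
  then have "((V t x)^2 / 2 - (V r x)^2 / 2) * (et x)^2 <= (V t x * ((U t x - U r x) - (l t - l r))) * (et x)^2"
  by (rule mult_right_mono) simp
  then show "(V t x)^2 / 2 * (et x)^2 - (V r x)^2 / 2 * (et x)^2 <= (U t x * phi t x - U r x * phi t x) - (l t - l r) * phi t x"
  by (simp add: phi_def algebra_simps)
 qed (use Gt_integrable[OF tG] Gt_integrable[OF rG] phi_integrable[OF tG] Uint[OF tG(1)] Uint[OF rG(1)] in auto)
 also have "... = ((INT1 x. U t x * phi t x) - (INT1 x. U r x * phi t x)) - (l t - l r) * m t"
  unfolding m_def using phi_integrable[OF tG] Uint[OF tG(1)] Uint[OF rG(1)] by simp
 \<comment> \<open>The equation enters here, with the truncation at time \<open>t\<close> as a fixed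
   test function between the times \<open>r\<close> and \<open>t\<close>.\<close>
 also have "(INT1 x. U t x * phi t x) - (INT1 x. U r x * phi t x) = - (LINT u:{r..t}|lborel. e u t)"
  unfolding e_def
  by (rule slice[where R=R]) (use rG tG rt phi_supp phi_sq_fin'[OF tG] gag_phi_UNIV_fin[OF t] in auto)
 finally show ?thesis .
qed

lemma e_bound:
 "en <|e r t|> <= en Lam * (INT+ x. INT+ y. en (<|U r x - U r y|> * <|phi t x - phi t y|> * kern s x y))"
 if rt: "good r" "good t"
proof -
 have pt: "en <|(U r x - U r y) * (phi t x - phi t y) * kap r x y|> <= en Lam * en (<|U r x - U r y|> * <|phi t x - phi t y|> * kern s x y)" for x y
 proof -
  have "<|(U r x - U r y) * (phi t x - phi t y) * kap r x y|> <= Lam * (<|U r x - U r y|> * <|phi t x - phi t y|> * kern s x y)"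
  using mult_left_mono[OF kap_upper[of r x y], of "<|U r x - U r y|> * <|phi t x - phi t y|>"]
  by (simp add: abs_mult mult_ac)
  from ennreal_leI[OF this] show ?thesis by (subst ennreal_mult[symmetric]) (use less_imp_le[OF Lam_pos] in auto)
 qed
 have le: "(INT+ x. INT+ y. en <|(U r x - U r y) * (phi t x - phi t y) * kap r x y|>)
  <= en Lam * (INT+ x. INT+ y. en (<|U r x - U r y|> * <|phi t x - phi t y|> * kern s x y))"
  by (subst nn_integral_cmult[symmetric], measurable, subst nn_integral_cmult[symmetric], measurable) (intro nn_integral_mono pt)
 have fin: "(INT+ x. INT+ y. en <|(U r x - U r y) * (phi t x - phi t y) * kap r x y|>) < inft"
  by (rule le_less_trans[OF le]) (use form_fin[OF rt] in "auto simp: ennreal_mult_less_top")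
 show ?thesis unfolding e_def
  using iterated_integral_diff[OF _ _ fin, where w'="%x y. 0"] le by (force intro: order_trans)
qed

end

lemma set_integrableI_nn:
 fixes f :: "real => real"
 assumes [measurable]: "f : borelm" "A : sets borel" and "(INT+ t:A. en <|f t|>) < inft"
 shows "set_integrable lborel A f"
 unfolding set_integrable_def
proof (rule integrableI_bounded)
 have "(INT+ t. en (norm (ind A t *R f t))) = (INT+ t:A. en <|f t|>)"
  by (intro nn_integral_cong) (auto simp: indicator_def)
 with assms show "(INT+ t. en (norm (ind A t *R f t))) < inft" by simp
qed measurable

lemma set_integrable_nnD:
 fixes f :: "real => real"
 assumes "set_integrable lborel A f"
 shows "(INT+ t:A. en <|f t|>) < inft"
proof -
 have "(INT+ t:A. en <|f t|>) = (INT+ t. en (norm (ind A t *R f t)))"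
  by (intro nn_integral_cong) (auto simp: indicator_def)
 with assms show ?thesis by (simp add: set_integrable_def integrable_iff_bounded)
qed

context nl_energy
begin

text \<open>Error density at the time \<open>r\<close> caused by freezing the test function at
  \<open>t\<close>: one term for the form and one for the motion of the level.\<close>

definition q :: "real => real => ennreal" where
 "q r t = en Lam * (INT+ x. INT+ y. en (<|U r x - U r y|> * <|(phi t x - phi r x) - (phi t y - phi r y)|> * kern s x y))
  + en <|g r|> * (INT+ x. en <|phi t x - phi r x|>)"

lemma q_measurable [measurable]: "(%(r, t). q r t) : borel_measurable lborel2"
 unfolding q_def by measurable

lemma gagU_measurable [measurable]: "(%t. gag s A2 (U t)) : borelm"
 by (rule gag_measurable) (use U_meas in auto)

lemma gagphi_measurable [measurable]: "(%t. gag s A2 (phi t)) : borelm"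
 by (rule gag_measurable) measurable

lemma sub_int: "(INT+ t:{a..b}. f t) <= (INT+ t:{0<..1}. f t)"
 using ab01 by (intro nn_integral_mono) (auto simp: indicator_def)

lemma gagU_int: "(INT+ t:{a..b}. gag s A2 (U t)) < inft"
 using sub_int Hs_fin by (rule le_less_trans)

lemma N_int: "(INT+ t:{a..b}. N t) < inft"
 using sub_int L1_fin unfolding N_def[symmetric] by (rule le_less_trans)

lemma const_int: "c < inft ==> (INT+ t:{a..b}. c) < inft"
 using ab by (simp add: nn_integral_cmult_indicator ennreal_mult_less_top)

lemma gag_phi_int: "(INT+ t:{a..b}. gag s A2 (phi t)) < inft"
proof -
 obtain c where c: "0 <= c" "!!t. gag s A2 (phi t) <= 2 * gag s A2 (U t) + en c * (sqb R (V t))"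
  using gag_phi by blast
 obtain K where K: "0 <= K" "!!t. t : G ==> a <= t ==> t <= b ==> (sqb R (V t)) <= en K"
  using V_L2 by blast
 have "(INT+ t:{a..b}. gag s A2 (phi t)) <= (INT+ t. 2 * (gag s A2 (U t) * ind {a..b} t) + (en c * en K) * ind {a..b} t)"
 proof (rule nn_integral_mono_AE, use AE_good in eventually_elim)
  fix t assume *: "t : {a..b} --> good t"
  show "gag s A2 (phi t) * ind {a..b} t <= 2 * (gag s A2 (U t) * ind {a..b} t) + (en c * en K) * ind {a..b} t"
  proof (cases "t : {a..b}")
  case True
  with * have t: "good t" by simp
  have "gag s A2 (phi t) <= 2 * gag s A2 (U t) + en c * en K"
  by (rule order_trans[OF c(2)]) (intro add_left_mono mult_left_mono K goodD[OF t]; simp)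
  then show ?thesis using True by simp
  qed simp
 qed
 also have "... < inft"
  using gagU_int ab by (simp add: nn_integral_add nn_integral_cmult nn_integral_cmult_indicator ennreal_mult_less_top)
 finally show ?thesis .
qed

text \<open>The bound is a sum of a function of \<open>r\<close> and a function of \<open>t\<close>.
  Hence it is integrable in \<open>r\<close> both for frozen \<open>t\<close> and along the
  diagonal.\<close>

lemma e_bound2:
 obtains C where "0 <= C" "!!r t. good r ==> good t ==>
  en <|e r t|> <= en Lam * (gag s A2 (U r) + en C * (1 + N r) + gag s A2 (phi t))"
proof (rule form_bound[OF s R, where ?'a='a], goal_cases)
 case (1 C)
 obtain K where K: "0 <= K" "!!t. t : G ==> a <= t ==> t <= b ==> (sqb R (V t)) <= en K"
  using V_L2 by blast
 obtain K' where K': "!!t. t : G ==> (sqb R (U t)) <= en K'" using L2_bound[of R] by blast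
 define D where "D = C * max K' 0 + C + C * K"
 have "en <|e r t|> <= en Lam * (gag s A2 (U r) + en D * (1 + N r) + gag s A2 (phi t))" if rt: "good r" "good t" for r t
 proof (rule order_trans[OF e_bound[OF rt] mult_left_mono])
  have S: "(INT+ x. en ((phi t x)^2)) <= en K" by (rule order_trans[OF phi_sq_fin K(2)[OF goodD[OF rt(2)]]])
  have Q: "(sqb R (U r)) <= en (max K' 0)"
  by (rule order_trans[OF K'[OF goodD(1)[OF rt(1)]]]) (simp add: ennreal_leI)
  have "(INT+ x. INT+ y. en (<|U r x - U r y|> * <|phi t x - phi t y|> * kern s x y))
  <= en 1 * (gag s A2 (U r) + en C * (sqb R (U r)) + en C * N r)
  + en (1 / 1) * (gag s A2 (phi t) + en C * (1 + N r) * (INT+ x. en ((phi t x)^2)))"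
  unfolding N_def by (rule 1(3)[where de=1]) (auto simp: phi_supp)
  also have "... <= en 1 * (gag s A2 (U r) + en C * en (max K' 0) + en C * N r)
  + en (1 / 1) * (gag s A2 (phi t) + en C * (1 + N r) * en K)"
  by (intro add_mono mult_left_mono order_refl S Q) auto
  also have "... <= gag s A2 (U r) + en D * (1 + N r) + gag s A2 (phi t)"
  proof -
  have D: "en D = en C * en (max K' 0) + en C + en C * en K"
  using 1(2) K(1) by (simp add: D_def ennreal_plus ennreal_mult)
  show ?thesis unfolding D by (simp add: distrib_left distrib_right mult_ac add_ac)
  qed
  finally show "(INT+ x. INT+ y. en (<|U r x - U r y|> * <|phi t x - phi t y|> * kern s x y))
  <= gag s A2 (U r) + en D * (1 + N r) + gag s A2 (phi t)" .
 qed simp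
 moreover have "0 <= D" using 1(2) K(1) by (simp add: D_def)
 ultimately show thesis by (rule that[rotated])
qed

lemma e_integrable: "good t ==> set_integrable lborel {a..b} (%r. e r t)"
 and e_integrable_diag: "set_integrable lborel {a..b} (%r. e r r)"
proof -
 obtain C where C: "0 <= C" "!!r t. good r ==> good t ==>
  en <|e r t|> <= en Lam * (gag s A2 (U r) + en C * (1 + N r) + gag s A2 (phi t))" using e_bound2 by blast
 have fin: "(INT+ r:{a..b}. (en Lam * (gag s A2 (U r) + en C * (1 + N r) + f r))) < inft"
  if [measurable]: "f : borelm" and f: "(INT+ r:{a..b}. f r) < inft" for f
 proof -
  have "(INT+ r:{a..b}. (en Lam * (gag s A2 (U r) + en C * (1 + N r) + f r)))
  = (INT+ r. en Lam * (gag s A2 (U r) * ind {a..b} r + en C * (ind {a..b} r + N r * ind {a..b} r) + f r * ind {a..b} r))"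
  by (intro nn_integral_cong) (auto simp: indicator_def)
  also have "... < inft"
  using f gagU_int N_int ab by (simp add: nn_integral_add nn_integral_cmult ennreal_mult_less_top)
  finally show ?thesis .
 qed
 show "set_integrable lborel {a..b} (%r. e r t)" if t: "good t"
 proof (rule set_integrableI_nn)
  have "(INT+ r:{a..b}. en <|e r t|>) <= (INT+ r:{a..b}. (en Lam * (gag s A2 (U r) + en C * (1 + N r) + gag s A2 (phi t))))"
  using AE_good by (intro nn_integral_mono_AE, eventually_elim) (auto simp: indicator_def intro!: C t)
  also have "... < inft" using const_int[OF gag_phi_fin[OF t]] by (intro fin) auto
  finally show "(INT+ r:{a..b}. en <|e r t|>) < inft" .
 qed measurable
 show "set_integrable lborel {a..b} (%r. e r r)"
 proof (rule set_integrableI_nn)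
  have "(INT+ r:{a..b}. en <|e r r|>) <= (INT+ r:{a..b}. (en Lam * (gag s A2 (U r) + en C * (1 + N r) + gag s A2 (phi r))))"
  using AE_good by (intro nn_integral_mono_AE, eventually_elim) (auto simp: indicator_def intro!: C)
  also have "... < inft" using gag_phi_int by (intro fin) auto
  finally show "(INT+ r:{a..b}. en <|e r r|>) < inft" .
 qed measurable
qed

lemma mG_bound: obtains M where "0 <= M" "!!t. t : G ==> a <= t ==> t <= b ==> m t <= M \<and> Gt t <= M \<and> (\<forall>r\<in>G. a <= r \<and> r <= b --> W r t <= en M)"
proof -
 obtain K where K: "0 <= K" "!!t. t : G ==> a <= t ==> t <= b ==> (sqb R (V t)) <= en K"
  using V_L2 by blast
 define M where "M = 4 * K + vol"
 have M: "0 <= M" "K <= M" "vol + K <= M" using K vol(2) by (auto simp: M_def)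
 have "m t <= M \<and> Gt t <= M \<and> (\<forall>r\<in>G. a <= r \<and> r <= b --> W r t <= en M)" if t: "t : G" "a <= t" "t <= b" for t
 proof (intro conjI ballI impI)
  have "en (m t) <= (INT+ x. ind (ball 0 R) x + en ((V t x)^2) * ind (ball 0 R) x)"
  unfolding m_eq[OF t, symmetric]
  proof (intro nn_integral_mono, goal_cases)
  case (1 x)
  have "V t x <= 1 + (V t x)^2" using mult_le_weighted_squares[of 1 1 "V t x"] by simp
  then have "phi t x <= (1 + (V t x)^2) * ind (ball 0 R) x" using phi_le[of t x] by (auto simp: phi_supp indicator_def split: if_splits)
  then have "en (phi t x) <= en ((1 + (V t x)^2) * ind (ball 0 R) x)" by (simp add: ennreal_leI)
  also have "... = ind (ball 0 R) x + en ((V t x)^2) * ind (ball 0 R) x"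
  by (cases "x : ball 0 R") simp_all
  finally show ?case .
  qed
  also have "... <= en vol + en K" using K(2)[OF t] by (simp add: nn_integral_add vol)
  finally have "en (m t) <= en (vol + K)" using vol(2) K(1) by simp
  then have "m t <= vol + K" by (rule ennreal_le_iff[THEN iffD1, rotated]) (use vol(2) K(1) in simp)
  then show "m t <= M" using M by linarith
  have "en (Gt t) <= (sqb R (V t))"
  unfolding Gt_eq[OF t, symmetric]
  proof (intro nn_integral_mono, goal_cases)
  case (1 x)
  have "(V t x)^2 / 2 * (et x)^2 <= (V t x)^2 * ind (ball 0 R) x" by (intro mult_mono eta_sq) auto
  then show ?case
  by (cases "x : ball 0 R") (auto intro: ennreal_leI simp: eta_supp)
  qed
  also note K(2)[OF t]
  finally show "Gt t <= M" using K(1) M by (simp add: ennreal_le_iff)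
  fix r assume r: "r : G" "a <= r \<and> r <= b"
  have "W r t <= (INT+ x. 2 * (en ((V t x)^2) * ind (ball 0 R) x) + 2 * (en ((V r x)^2) * ind (ball 0 R) x))"
  unfolding W_def
  proof (intro nn_integral_mono, goal_cases)
  case (1 x)
  have "(V t x - V r x)^2 <= 2 * (V t x)^2 + 2 * (V r x)^2"
  using zero_le_power2[of "V t x + V r x"] by (simp add: power2_eq_square algebra_simps)
  then have "en ((V t x - V r x)^2) <= en (2 * (V t x)^2 + 2 * (V r x)^2)" by (rule ennreal_leI)
  then show ?case
  by (cases "x : ball 0 R") (simp_all add: ennreal_mult)
  qed
  also have "... <= 2 * en K + 2 * en K"
  using K(2)[OF t] K(2)[of r] r by (simp add: nn_integral_add nn_integral_cmult) (intro add_mono mult_left_mono; simp)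
  also have "... = en (4 * K)"
  proof -
  have "2 * z + 2 * z = 4 * z" for z :: ennreal by (simp flip: distrib_right)
  then show ?thesis using K(1) by (simp add: ennreal_mult)
  qed
  also have "... <= en M" using vol(2) by (intro ennreal_leI) (simp add: M_def)
  finally show "W r t <= en M" .
 qed
 with M show thesis by (intro that[of M]) auto
qed

lemma m_bound: obtains M where "0 <= M" "!!t. t : G ==> a <= t ==> t <= b ==> m t <= M"
proof -
 obtain M where "0 <= M" and *: "!!t. t : G ==> a <= t ==> t <= b ==> m t <= M \<and> Gt t <= M \<and> (\<forall>r\<in>G. a <= r \<and> r <= b --> W r t <= en M)"
  by (fact mG_bound)
 then show thesis by (intro that[of M]) (auto dest: *)
qed

lemma gm_integrable: "set_integrable lborel {a..b} (%r. g r * m r)" "set_integrable lborel {a..b} (%r. g r * c)"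
proof -
 obtain M where M: "0 <= M" "!!t. t : G ==> a <= t ==> t <= b ==> m t <= M" by (fact m_bound)
 show "set_integrable lborel {a..b} (%r. g r * m r)"
 proof (rule set_integrableI_nn)
  have "(INT+ r:{a..b}. en <|g r * m r|>) <= (INT+ r. en M * (en <|g r|> * ind {a..b} r))"
  proof (rule nn_integral_mono_AE, use AE_good in eventually_elim)
  fix r assume *: "r : {a..b} --> good r"
  show "en <|g r * m r|> * ind {a..b} r <= en M * (en <|g r|> * ind {a..b} r)"
  proof (cases "r : {a..b}")
  case True
  then have "m r <= M" using * M(2)[of r] by (auto simp: good_def)
  then have "<|g r * m r|> <= M * <|g r|>" using m_nn[of r] mult_right_mono[of "m r" M "<|g r|>"] by (simp add: abs_mult mult.commute)
  then show ?thesis using True M by (simp add: ennreal_leI flip: ennreal_mult)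
  qed simp
  qed
  also have "... < inft" using set_integrable_nnD[OF g_int] by (simp add: nn_integral_cmult ennreal_mult_less_top)
  finally show "(INT+ r:{a..b}. en <|g r * m r|>) < inft" .
 qed measurable
 show "set_integrable lborel {a..b} (%r. g r * c)" using g_int by simp
qed

lemma q_bound:
 assumes rt: "good r" "good t"
 shows "en ((e r r - e r t) + g r * (m r - m t)) <= q r t"
proof -
 let ?q = "%x y. <|U r x - U r y|> * <|(phi t x - phi r x) - (phi t y - phi r y)|> * kern s x y"
 have form: "(INT+ x. INT+ y. en <|(U r x - U r y) * (phi t' x - phi t' y) * kap r x y|>) < inft" if t': "good t'" for t'
 proof -
  have pt: "en <|(U r x - U r y) * (phi t' x - phi t' y) * kap r x y|> <= en Lam * en (<|U r x - U r y|> * <|phi t' x - phi t' y|> * kern s x y)" for x y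
  proof -
  have "<|(U r x - U r y) * (phi t' x - phi t' y) * kap r x y|> <= Lam * (<|U r x - U r y|> * <|phi t' x - phi t' y|> * kern s x y)"
  using mult_left_mono[OF kap_upper[of r x y], of "<|U r x - U r y|> * <|phi t' x - phi t' y|>"]
  by (simp add: abs_mult mult_ac)
  from ennreal_leI[OF this] show ?thesis by (subst ennreal_mult[symmetric]) (use less_imp_le[OF Lam_pos] in auto)
  qed
  have "(INT+ x. INT+ y. en <|(U r x - U r y) * (phi t' x - phi t' y) * kap r x y|>)
  <= en Lam * (INT+ x. INT+ y. en (<|U r x - U r y|> * <|phi t' x - phi t' y|> * kern s x y))"
  by (subst nn_integral_cmult[symmetric], measurable, subst nn_integral_cmult[symmetric], measurable) (intro nn_integral_mono pt)
  also have "... < inft" using form_fin[OF rt(1) t'] by (auto simp: ennreal_mult_less_top)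
  finally show ?thesis .
 qed
 have "en <|e r r - e r t|> <= (INT+ x. INT+ y. en <|(U r x - U r y) * (phi r x - phi r y) * kap r x y - (U r x - U r y) * (phi t x - phi t y) * kap r x y|>)"
  unfolding e_def by (rule iterated_integral_diff[OF _ _ form[OF rt(1)] form[OF rt(2)]]) measurable
 also have "... <= (INT+ x. INT+ y. en Lam * en (?q x y))"
 proof (intro nn_integral_mono, goal_cases)
  case gc: (1 x y)
  have "(U r x - U r y) * (phi r x - phi r y) * kap r x y - (U r x - U r y) * (phi t x - phi t y) * kap r x y
  = - ((U r x - U r y) * ((phi t x - phi r x) - (phi t y - phi r y)) * kap r x y)" by (simp add: algebra_simps)
  then have "<|(U r x - U r y) * (phi r x - phi r y) * kap r x y - (U r x - U r y) * (phi t x - phi t y) * kap r x y|>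
  = <|U r x - U r y|> * <|(phi t x - phi r x) - (phi t y - phi r y)|> * kap r x y" by (simp only: abs_minus_cancel abs_mult) simp
  also have "... <= Lam * (?q x y)"
  using mult_left_mono[OF kap_upper[of r x y], of "<|U r x - U r y|> * <|(phi t x - phi r x) - (phi t y - phi r y)|>"]
  by (simp add: mult_ac)
  finally have *: "<|(U r x - U r y) * (phi r x - phi r y) * kap r x y - (U r x - U r y) * (phi t x - phi t y) * kap r x y|>
  <= Lam * (?q x y)" .
  from ennreal_leI[OF *]
  show ?case
  by (subst ennreal_mult[symmetric]) (use less_imp_le[OF Lam_pos] in auto)
 qed
 also have "... = en Lam * (INT+ x. INT+ y. en (?q x y))"
  by (simp add: nn_integral_cmult)
 finally have 1: "en <|e r r - e r t|> <= ..." .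
 have "en <|m t - m r|> <= (INT+ x. en <|phi t x - phi r x|>)"
  by (rule m_diff) (use rt in "auto simp: good_def")
 then have 2: "en (<|g r|> * <|m t - m r|>) <= en <|g r|> * (INT+ x. en <|phi t x - phi r x|>)"
  by (simp add: ennreal_mult mult_left_mono)
 have "(e r r - e r t) + g r * (m r - m t) <= <|e r r - e r t|> + <|g r * (m r - m t)|>" by linarith
 also have "... = <|e r r - e r t|> + <|g r|> * <|m t - m r|>" by (simp add: abs_mult abs_minus_commute)
 finally have "en ((e r r - e r t) + g r * (m r - m t)) <= en (<|e r r - e r t|> + <|g r|> * <|m t - m r|>)" by (rule ennreal_leI)
 also have "... = en <|e r r - e r t|> + en (<|g r|> * <|m t - m r|>)" by (rule ennreal_plus) auto
 also have "... <= q r t" unfolding q_def by (rule add_mono[OF 1 2])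
 finally show ?thesis .
qed

end

section \<open>The freezing error vanishes as the delay tends to zero\<close>

context nl_energy
begin

text \<open>\<open>k1\<close> and \<open>k2\<close> collect the coefficients that
  \<open>form_bound\<close> produces for the increment of \<open>phi\<close>. \<open>k1\<close>
  multiplies the small parameter and needs only to be integrable; \<open>k2\<close> multiplies the
  squared L^2 distance \<open>W\<close>, which tends to 0.\<close>

definition k1 :: "real => real => ennreal" where
 "k1 C r = en Lam * (gag s A2 (U r) + en C * (sqb R (U r)) + en C * N r) + en <|g r|> * en vol"

definition k2 :: "real => real => ennreal" where
 "k2 C r = en Lam * (en C * (1 + N r)) + en <|g r|>"

lemma k1_measurable [measurable]: "k1 C : borelm" unfolding k1_def by measurable
lemma k2_measurable [measurable]: "k2 C : borelm" unfolding k2_def by measurable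

definition dgag :: "real => real => ennreal" where
 "dgag r t = gag s A2 (%x. phi t x - phi r x)"

lemma dgag_measurable [measurable]: "(%(r, t). dgag r t) : borel_measurable lborel2"
 unfolding dgag_def gag_def by measurable

lemma k_int: "0 <= C ==> (INT+ r:{a..b}. k1 C r) < inft" "0 <= C ==> (INT+ r:{a..b}. k2 C r) < inft"
proof -
 assume C: "0 <= C"
 note gi = set_integrable_nnD[OF g_int]
 obtain K' where K': "!!t. t : G ==> (sqb R (U t)) <= en K'" using L2_bound[of R] by blast
 have "(INT+ r:{a..b}. k1 C r) <= (INT+ r. en Lam * (gag s A2 (U r) * ind {a..b} r + (en C * en K') * ind {a..b} r + en C * (N r * ind {a..b} r)) + (en <|g r|> * ind {a..b} r) * en vol)"
 proof (rule nn_integral_mono_AE, use AE_good in eventually_elim)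
  fix r assume *: "r : {a..b} --> good r"
  show "k1 C r * ind {a..b} r <= en Lam * (gag s A2 (U r) * ind {a..b} r + (en C * en K') * ind {a..b} r + en C * (N r * ind {a..b} r)) + (en <|g r|> * ind {a..b} r) * en vol"
  proof (cases "r : {a..b}")
  case True
  with * have r: "good r" by simp
  have "k1 C r <= en Lam * (gag s A2 (U r) + en C * en K' + en C * N r) + en <|g r|> * en vol"
  unfolding k1_def by (intro add_mono mult_left_mono order_refl K' goodD[OF r]) auto
  then show ?thesis using True by simp
  qed simp
 qed
 also have "... < inft"
  using gagU_int N_int gi ab
  by (simp add: nn_integral_add nn_integral_cmult nn_integral_multc nn_integral_cmult_indicator ennreal_mult_less_top)
 finally show "(INT+ r:{a..b}. k1 C r) < inft" .
 have "(INT+ r:{a..b}. k2 C r) = (INT+ r. en Lam * (en C * (ind {a..b} r + N r * ind {a..b} r)) + en <|g r|> * ind {a..b} r)"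
  unfolding k2_def by (intro nn_integral_cong) (auto simp: indicator_def)
 also have "... < inft"
  using N_int gi ab by (simp add: nn_integral_add nn_integral_cmult ennreal_mult_less_top)
 finally show "(INT+ r:{a..b}. k2 C r) < inft" .
qed

lemma q_split:
 obtains C where "0 < C" "!!r t de. 0 < de ==>
  q r t <= en de * k1 C r + en (1 / de) * (en Lam * dgag r t + k2 C r * W r t)"
proof (rule form_bound[OF s R, where ?'a='a], goal_cases)
 case (1 C)
 have "q r t <= en de * k1 C r + en (1 / de) * (en Lam * dgag r t + k2 C r * W r t)" if de: "0 < de" for r t de
 proof -
  let ?Q = "INT+ x:ball 0 R. en ((U r x)^2)" and ?S = "INT+ x. en ((phi t x - phi r x)^2)"
  have "(INT+ x. INT+ y. en (<|U r x - U r y|> * <|(phi t x - phi r x) - (phi t y - phi r y)|> * kern s x y))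
  <= en de * (gag s A2 (U r) + en C * ?Q + en C * N r)
  + en (1 / de) * (dgag r t + en C * (1 + N r) * ?S)"
  unfolding N_def dgag_def by (rule 1(3)) (use de in "auto simp: phi_supp")
  also have "... <= en de * (gag s A2 (U r) + en C * ?Q + en C * N r)
  + en (1 / de) * (dgag r t + en C * (1 + N r) * W r t)"
  by (intro add_left_mono mult_left_mono phi_diff_sq) auto
  finally have B: "(INT+ x. INT+ y. en (<|U r x - U r y|> * <|(phi t x - phi r x) - (phi t y - phi r y)|> * kern s x y)) <= ..." .
  have "q r t <= en Lam * (en de * (gag s A2 (U r) + en C * ?Q + en C * N r)
  + en (1 / de) * (dgag r t + en C * (1 + N r) * W r t))
  + en <|g r|> * (en de * en vol + en (1 / de) * W r t)"
  unfolding q_def by (intro add_mono mult_left_mono B phi_diff_abs de) auto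
  also have "... = en de * k1 C r + en (1 / de) * (en Lam * dgag r t + k2 C r * W r t)"
  unfolding k1_def k2_def by (simp add: distrib_left distrib_right mult_ac add_ac)
  finally show ?thesis .
 qed
 with 1(2) show ?case by (rule 1(1))
qed

lemma shift_window:
 fixes f :: "real => ennreal"
 assumes [measurable]: "f : borelm" and "0 < vt"
 shows "(INT+ t:{a + vt..b}. f (t - vt)) <= (INT+ r:{a..b}. f r)"
proof -
 have "(INT+ t:{a + vt..b}. f (t - vt)) <= (INT+ t. f (t + (- vt)) * ind {a..b} (t + (- vt)))"
  using assms by (intro nn_integral_mono) (auto simp: indicator_def)
 also have "... = (INT+ r:{a..b}. f r)" by (rule nn_integral_real_shift[where f="%r. f r * ind {a..b} r"]) measurable
 finally show ?thesis .
qed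

text \<open>Continuity of \<open>phi\<close> as a function of time with values in the fractional
  Sobolev space is available only in mean square over time, as continuity of translations in L^2.
  This suffices because \<open>averaged_decrease\<close> integrates over time.\<close>

lemma dgag_small:
 assumes vt: "!!n. 0 < vt n" "vt ~~> 0"
 shows "(%n. INT+ t:{a + vt n..b}. dgag (t - vt n) t) ~~> 0"
proof -
 \<comment> \<open>The square root of the kernel is absorbed into the function, which makes the
   seminorm a plain L^2 norm over pairs of points. The indicator in time extends the function by
   zero, so that translating it makes sense.\<close>
 define f where "f t z = (case z of (x, y) => ind {a..b} t * ind A2 x * ind A2 y * ((phi t x - phi t y) * sqrt (kern s x y)))" for t z
 let ?M = "lborel \<Otimes>\<^sub>M lborel :: ('a \<times> 'a) measure"
 have sf: "sigma_finite_measure ?M" by (simp add: lborel_prod sigma_finite_lborel)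
 interpret M: sigma_finite_measure ?M by (rule sf)
 interpret P: pair_sigma_finite lborel ?M by (rule pair_sigma_finite.intro) (rule sigma_finite_lborel, rule sf)
 have fm[measurable]: "(%(t, z). f t z) : borel_measurable (lborel \<Otimes>\<^sub>M ?M)" unfolding f_def by measurable
 have fm'[measurable]: "(%z. f t z) : borel_measurable ?M" for t unfolding f_def by measurable
 have sq: "en ((f t (x, y))^2) = en ((phi t x - phi t y)^2 * kern s x y) * ind A2 y * ind A2 x * ind {a..b} t" for t x y
  by (auto simp: f_def power_mult_distrib indicator_def)
 have pairI: "(\<integral>\<^sup>+z. F z \<partial>?M) = (INT+ x. INT+ y. F (x, y))" if "F : borel_measurable ?M" for F
  using lborel.nn_integral_fst[OF that] by simp
 have fin: "(\<integral>\<^sup>+z. (INT+ t. en ((f t z)^2)) \<partial>?M) < inft"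
 proof -
  have "(\<integral>\<^sup>+z. (INT+ t. en ((f t z)^2)) \<partial>?M) = (INT+ t. \<integral>\<^sup>+z. en ((f t z)^2) \<partial>?M)"
  by (rule P.Fubini') measurable
  also have "... = (INT+ t:{a..b}. gag s A2 (phi t))"
  proof (rule nn_integral_cong, goal_cases)
  case (1 t)
  have "(\<integral>\<^sup>+z. en ((f t z)^2) \<partial>?M) = (INT+ x. INT+ y. en ((f t (x, y))^2))" by (rule pairI) measurable
  also have "... = gag s A2 (phi t) * ind {a..b} t"
  unfolding sq by (subst gag_eq, measurable) (simp add: nn_integral_multc)
  finally show ?case .
  qed
  also have "... < inft" by (rule gag_phi_int)
  finally show ?thesis .
 qed
 have "(%n. - vt n) ~~> 0" using tendsto_minus[OF vt(2)] by simp
 from translation_L2_product[OF sf fm fin this]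
 have lim: "(%n. \<integral>\<^sup>+z. (INT+ t. en ((f (t - vt n) z - f t z)^2)) \<partial>?M) ~~> 0" by simp
 show ?thesis
 proof (rule tendsto_sandwich[OF _ _ tendsto_const lim])
  show "\<forall>\<^sub>F n in sequentially. (INT+ t:{a + vt n..b}. dgag (t - vt n) t)
  <= (\<integral>\<^sup>+z. (INT+ t. en ((f (t - vt n) z - f t z)^2)) \<partial>?M)"
  proof (intro always_eventually allI)
  fix n
  have "(INT+ t:{a + vt n..b}. dgag (t - vt n) t) <= (INT+ t. \<integral>\<^sup>+z. en ((f (t - vt n) z - f t z)^2) \<partial>?M)"
  proof (rule nn_integral_mono, goal_cases)
  case (1 t)
  show ?case
  proof (cases "t : {a + vt n..b}")
  case True
  then have t: "t : {a..b}" "t - vt n : {a..b}" using vt(1)[of n] by auto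
  have "(\<integral>\<^sup>+z. en ((f (t - vt n) z - f t z)^2) \<partial>?M) = (INT+ x. INT+ y. en ((f (t - vt n) (x, y) - f t (x, y))^2))"
  by (rule pairI) measurable
  also have "... = dgag (t - vt n) t"
  unfolding dgag_def
  proof (subst gag_eq, measurable, intro nn_integral_cong)
  fix x y
  have "f (t - vt n) (x, y) - f t (x, y) = ind A2 x * ind A2 y * (- ((phi t x - phi (t - vt n) x) - (phi t y - phi (t - vt n) y)) * sqrt (kern s x y))"
  using t by (simp add: f_def algebra_simps)
  then show "en ((f (t - vt n) (x, y) - f t (x, y))^2) =
  en ((phi t x - phi (t - vt n) x - (phi t y - phi (t - vt n) y))^2 * kern s x y) * ind A2 y * ind A2 x"
  by (auto simp: power_mult_distrib indicator_def power2_commute)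
  qed
  finally show ?thesis using True by simp
  qed simp
  qed
  also have "... = (\<integral>\<^sup>+z. (INT+ t. en ((f (t - vt n) z - f t z)^2)) \<partial>?M)"
  by (rule P.Fubini'[symmetric]) measurable
  finally show "(INT+ t:{a + vt n..b}. dgag (t - vt n) t)
  <= (\<integral>\<^sup>+z. (INT+ t. en ((f (t - vt n) z - f t z)^2)) \<partial>?M)" .
  qed
 qed simp
qed

lemma G_translate: "AEL r. r + c : {a..b} --> r + c : G"
proof -
 have "AEL t. t : {a..b} --> t : G" using G_AE by eventually_elim (use ab01 in auto)
 from AE_translate[OF this, of c] show ?thesis by simp
qed

text \<open>\<open>k2\<close> is merely integrable, so an L^2 average of \<open>W\<close> would not
  be enough. But \<open>W\<close> is bounded and tends to 0 at every good time by the continuity of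
  slices. Shifting the variable to the earlier time keeps the dominating function fixed.\<close>

lemma W_small:
 assumes vt: "!!n. 0 < vt n" "vt ~~> 0" and C: "0 <= C"
 shows "(%n. INT+ t:{a + vt n..b}. k2 C (t - vt n) * W (t - vt n) t) ~~> 0"
proof -
 obtain M where M: "0 <= M" "!!t. t : G ==> a <= t ==> t <= b ==> m t <= M \<and> Gt t <= M \<and> (\<forall>r\<in>G. a <= r \<and> r <= b --> W r t <= en M)"
  by (fact mG_bound)
 define F where "F n r = k2 C r * W r (r + vt n) * ind {a..b} r * ind {a..b} (r + vt n)" for n r
 have Fm[measurable]: "F n : borelm" for n unfolding F_def by measurable
 have eq: "(INT+ t:{a + vt n..b}. k2 C (t - vt n) * W (t - vt n) t) = (INT+ r. F n r)" for n
 proof -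
  have "(INT+ r. F n r) = (INT+ t. F n (t + (- vt n)))" by (rule nn_integral_real_shift[symmetric]) measurable
  also have "... = (INT+ t:{a + vt n..b}. k2 C (t - vt n) * W (t - vt n) t)"
  using vt(1)[of n] by (intro nn_integral_cong) (auto simp: F_def indicator_def)
  finally show ?thesis by simp
 qed
 have AEs: "AEL r. \<forall>n. r + vt n : {a..b} --> r + vt n : G"
  unfolding AE_all_countable by (intro allI G_translate)
 have "(%n. INT+ r. F n r) ~~> (\<integral>\<^sup>+r. 0 \<partial>(lborel::real measure))"
 proof (rule nn_integral_dominated_convergence[where w="%r. en M * (k2 C r * ind {a..b} r)"])
  show "(INT+ r. en M * (k2 C r * ind {a..b} r)) < inft"
  using k_int(2)[OF C] by (simp add: nn_integral_cmult ennreal_mult_less_top)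
  show "AEL r. F n r <= en M * (k2 C r * ind {a..b} r)" for n
  using AEs AE_good
  proof eventually_elim
  case (elim r)
  show ?case
  proof (cases "r : {a..b} \<and> r + vt n : {a..b}")
  case True
  then have "W r (r + vt n) <= en M" using M(2)[of "r + vt n"] elim by (auto simp: good_def)
  then have "k2 C r * W r (r + vt n) <= k2 C r * en M" by (rule mult_left_mono) simp
  then show ?thesis using True by (simp add: F_def mult.commute)
  qed (auto simp: F_def)
  qed
  show "AEL r. (%n. F n r) ~~> 0"
  using AEs AE_good AE_lborel_singleton[of b]
  proof eventually_elim
  case (elim r)
  show ?case
  proof (cases "r : {a..b}")
  case True
  with elim have r: "good r" "r < b" by auto
  \<comment> \<open>Times beyond \<open>b\<close> are replaced by \<open>r\<close> itself, so that
    the whole sequence stays where \<open>W_tendsto\<close> applies; this affects only finitely many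
    terms since \<open>r < b\<close>.\<close>
  define tu where "tu n = (if r + vt n <= b then r + vt n else r)" for n
  have tuG: "tu n : G" "a <= tu n \<and> tu n <= b" for n
  using elim r vt(1)[of n] True by (auto simp: tu_def good_def)
  have "tu ~~> r"
  proof (rule Lim_transform_eventually)
  show "(%n. r + vt n) ~~> r" using tendsto_add[OF tendsto_const vt(2)] by simp
  from order_tendstoD(2)[OF this r(2)] show "\<forall>\<^sub>F n in sequentially. r + vt n = tu n"
  by eventually_elim (simp add: tu_def)
  qed
  with W_tendsto[OF goodD[OF r(1)] tuG] have W0: "(%n. W r (tu n)) ~~> 0" by simp
  have k2f: "k2 C r < top" using r(1) by (auto simp: k2_def good_def ennreal_mult_less_top)
  from ennreal_tendsto_cmult[OF k2f W0]
  have lim: "(%n. k2 C r * W r (tu n)) ~~> 0" by simp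
  show ?thesis
  by (rule tendsto_sandwich[OF _ _ tendsto_const lim]) (auto simp: F_def tu_def indicator_def)
  qed (simp add: F_def)
  qed
 qed measurable
 then show ?thesis unfolding eq by simp
qed

lemma q_small:
 assumes vt: "!!n. 0 < vt n" "vt ~~> 0"
 shows "(%n. INT+ t:{a + vt n..b}. q (t - vt n) t) ~~> 0"
proof -
 obtain C where C: "0 < C" "!!r t de. 0 < de ==>
  q r t <= en de * k1 C r + en (1 / de) * (en Lam * dgag r t + k2 C r * W r t)"
  by (fact q_split)
 let ?T = "%n. INT+ t:{a + vt n..b}. dgag (t - vt n) t"
 let ?Z = "%n. INT+ t:{a + vt n..b}. k2 C (t - vt n) * W (t - vt n) t"
 show ?thesis
 proof (rule weighted_tendsto_zero[where W="%n. en Lam * ?T n + ?Z n" and K="INT+ r:{a..b}. k1 C r"])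
  show "(INT+ r:{a..b}. k1 C r) < inft" using C by (intro k_int) simp
  have "(%n. en Lam * ?T n + ?Z n) ~~> en Lam * 0 + 0"
  using C by (intro tendsto_add ennreal_tendsto_cmult dgag_small W_small vt) auto
  then show "(%n. en Lam * ?T n + ?Z n) ~~> 0" by simp
  fix de :: real and n assume de: "0 < de"
  have "(INT+ t:{a + vt n..b}. q (t - vt n) t)
  <= (INT+ t. en de * (k1 C (t - vt n) * ind {a + vt n..b} t) + en (1 / de) * (en Lam * (dgag (t - vt n) t * ind {a + vt n..b} t)
  + k2 C (t - vt n) * W (t - vt n) t * ind {a + vt n..b} t))"
  by (intro nn_integral_mono) (auto simp: indicator_def intro: C(2)[OF de])
  also have "... = en de * (INT+ t:{a + vt n..b}. k1 C (t - vt n)) + en (1 / de) * (en Lam * ?T n + ?Z n)"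
  by (simp add: nn_integral_add nn_integral_cmult)
  also have "... <= en de * (INT+ r:{a..b}. k1 C r) + en (1 / de) * (en Lam * ?T n + ?Z n)"
  using vt(1) by (intro add_right_mono mult_left_mono shift_window) auto
  finally show "(INT+ t:{a + vt n..b}. q (t - vt n) t) <= ..." .
 qed
qed

end

section \<open>The energy inequality\<close>

lemma nn_integral_iterated_add:
 fixes f g :: "'a::euclidean_space => 'b::euclidean_space => ennreal"
 assumes [measurable]: "(%(x, y). f x y) : borel_measurable lborel2" "(%(x, y). g x y) : borel_measurable lborel2"
 shows "(INT+ x. INT+ y. f x y + g x y) = (INT+ x. INT+ y. f x y) + (INT+ x. INT+ y. g x y)"
 by (simp add: nn_integral_add)

context nl_energy
begin

definition D :: "real => ennreal" where
 "D t = (INT+ x. INT+ y. en ((V t x * et x - V t y * et y)^2 * kap t x y))"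
text \<open>Interaction between points above the level and points below it. It is discarded in the
  proof of local boundedness and is the decisive term for the lower bound.\<close>

definition P :: "real => ennreal" where
 "P t = (INT+ x. INT+ y. en (V t x * (et x)^2 * max 0 (l t - U t y) * kap t x y))"
text \<open>The price of localization: this term disappears where the cut-off is constant.\<close>

definition X :: "real => ennreal" where
 "X t = (INT+ x. INT+ y. en (V t x * V t y * (et x - et y)^2 * kap t x y))"

lemma DPX_measurable [measurable]: "D : borelm" "P : borelm" "X : borelm"
 unfolding D_def P_def X_def by measurable

text \<open>An algebraic identity, not an estimate: the form of \<open>U\<close> against
  \<open>V * et^2\<close> is the form of \<open>V * et\<close>, plus the interaction across the
  level in both orders, minus the localization term. By symmetry of the kernel the two orders have
  the same integral, hence the factor 2.\<close>

lemma diag_identity: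
 assumes "good t" "X t < inft"
 shows "D t + 2 * P t = en (e t t + enn2real (X t))" "0 <= e t t + enn2real (X t)"
proof -
 let ?w = "%x y. (U t x - U t y) * (phi t x - phi t y) * kap t x y"
 let ?f = "%x y. V t x * V t y * (et x - et y)^2 * kap t x y"
 let ?p = "%x y. V t x * (et x)^2 * max 0 (l t - U t y) * kap t x y"
 let ?d = "%x y. (V t x * et x - V t y * et y)^2 * kap t x y"
 let ?g = "%x y. ?d x y + (?p x y + ?p y x)"
 have id: "?w x y + ?f x y = ?g x y" for x y
 proof -
  \<comment> \<open>\<open>U\<close> is written as level plus positive part minus negative part. The
    product of the two parts at the same point vanishes, which removes the diagonal terms of the
    expansion.\<close>
  have U: "U t z = l t + V t z - max 0 (l t - U t z)" for z by (simp add: V_def max_def)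
  have 0: "V t z * max 0 (l t - U t z) = 0" for z by (simp add: V_def max_def)
  have "(U t x - U t y) * (phi t x - phi t y) + V t x * V t y * (et x - et y)^2
  = (V t x * et x - V t y * et y)^2 + V t x * (et x)^2 * max 0 (l t - U t y) + V t y * (et y)^2 * max 0 (l t - U t x)
  - V t x * max 0 (l t - U t x) * (et x)^2 - V t y * max 0 (l t - U t y) * (et y)^2"
  unfolding phi_def by (subst (1) U[of x], subst (1) U[of y]) (simp add: power2_eq_square algebra_simps)
  then have *: "(U t x - U t y) * (phi t x - phi t y) + V t x * V t y * (et x - et y)^2
  = (V t x * et x - V t y * et y)^2 + V t x * (et x)^2 * max 0 (l t - U t y) + V t y * (et y)^2 * max 0 (l t - U t x)"
  unfolding 0 by simp
  have "?w x y + ?f x y = ((U t x - U t y) * (phi t x - phi t y) + V t x * V t y * (et x - et y)^2) * kap t x y"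
  by (simp add: algebra_simps)
  also have "... = ?g x y" unfolding * kap_sym[of t y x] by (simp add: algebra_simps)
  finally show ?thesis .
 qed
 have pn: "0 <= ?p x y" "0 <= ?d x y" for x y by simp_all
 have finw: "(INT+ x. INT+ y. en <|?w x y|>) < inft"
 proof -
  have pt: "en <|?w x y|> <= en Lam * en (<|U t x - U t y|> * <|phi t x - phi t y|> * kern s x y)" for x y
  proof -
  have "<|?w x y|> <= Lam * (<|U t x - U t y|> * <|phi t x - phi t y|> * kern s x y)"
  using mult_left_mono[OF kap_upper[of t x y], of "<|U t x - U t y|> * <|phi t x - phi t y|>"]
  by (simp add: abs_mult mult_ac)
  from ennreal_leI[OF this] show ?thesis by (subst ennreal_mult[symmetric]) (use less_imp_le[OF Lam_pos] in auto)
  qed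
  have "(INT+ x. INT+ y. en <|?w x y|>)
  <= en Lam * (INT+ x. INT+ y. en (<|U t x - U t y|> * <|phi t x - phi t y|> * kern s x y))"
  by (subst nn_integral_cmult[symmetric], measurable, subst nn_integral_cmult[symmetric], measurable) (intro nn_integral_mono pt)
  also have "... < inft" using form_fin[OF assms(1) assms(1)] by (auto simp: ennreal_mult_less_top)
  finally show ?thesis .
 qed
 have g: "(INT+ x. INT+ y. en (?g x y)) = en (e t t + enn2real (X t))" "0 <= e t t + enn2real (X t)"
  unfolding e_def X_def
  by (rule iterated_integral_sum_nonneg[where w="?w" and f="?f" and g="?g"], measurable, rule finw,
  use assms(2) in "simp add: X_def", simp, simp, rule id)+
 have "(INT+ x. INT+ y. en (?g x y)) = (INT+ x. INT+ y. en (?d x y) + (en (?p x y) + en (?p y x)))"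
  by (intro nn_integral_cong) (simp add: ennreal_plus pn)
 also have "... = D t + (P t + (INT+ x. INT+ y. en (?p y x)))"
 proof -
  have m1: "(%(x, y). en (?d x y)) : borel_measurable lborel2" by measurable
  have m2: "(%(x, y). en (?p x y)) : borel_measurable lborel2" by measurable
  have m3: "(%(x, y). en (?p y x)) : borel_measurable lborel2" by measurable
  have m4: "(%(x, y). en (?p x y) + en (?p y x)) : borel_measurable lborel2" by measurable
  show ?thesis unfolding D_def P_def nn_integral_iterated_add[OF m1 m4] nn_integral_iterated_add[OF m2 m3] ..
 qed
 also have "(INT+ x. INT+ y. en (?p y x)) = P t"
  unfolding P_def by (rule lborel_pair.Fubini') measurable
 finally show "D t + 2 * P t = en (e t t + enn2real (X t))" unfolding g(1) by (simp add: mult_2)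
 show "0 <= e t t + enn2real (X t)" by (rule g(2))
qed

text \<open>The energy together with the dissipation and level work accumulated since
  \<open>a\<close>. The energy inequality, before signs are separated, says that this quantity does
  not increase.\<close>

definition H :: "real => real" where
 "H t = Gt t + (LINT r:{a..t}|lborel. e r r + g r * m r)"

lemma H_measurable [measurable]: "H : borelm"
 unfolding H_def set_lebesgue_integral_def indicator_def atLeastAtMost_iff by measurable

lemma em_integrable: "set_integrable lborel {a..b} (%r. e r r + g r * m r)"
 using e_integrable_diag gm_integrable(1) by (rule set_integral_add)

lemma H_tendsto:
 assumes t: "t : G" "a <= t" "t <= b" and tu: "!!n. tu n : G" "!!n. a <= tu n \<and> tu n <= b" "tu ~~> t"
 shows "(%n. H (tu n)) ~~> H t"
proof -
 have eq: "(LINT r:{a..c}|lborel. e r r + g r * m r) = integral {a..c} (%r. e r r + g r * m r)" if "c <= b" for c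
  using that by (intro set_borel_integral_eq_integral(2) set_integrable_subset[OF em_integrable]) auto
 have "continuous_on {a..b} (%c. integral {a..c} (%r. e r r + g r * m r))"
  using set_borel_integral_eq_integral(1)[OF em_integrable] by (rule indefinite_integral_continuous_1)
 then have "(%n. integral {a..tu n} (%r. e r r + g r * m r)) ~~> integral {a..t} (%r. e r r + g r * m r)"
  using t tu unfolding continuous_on_sequentially by (auto simp: o_def)
 then have "(%n. LINT r:{a..tu n}|lborel. e r r + g r * m r) ~~> (LINT r:{a..t}|lborel. e r r + g r * m r)"
  using t tu by (simp add: eq)
 then show ?thesis unfolding H_def by (intro tendsto_add Gt_tendsto t tu)
qed

text \<open>\<open>convex_incr\<close> bounds the increment of \<open>Gt\<close> by frozen terms,
  while \<open>H\<close> contains the diagonal ones. Their difference is the freezing error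
  \<open>q\<close>, which \<open>averaged_decrease\<close> tolerates.\<close>

lemma H_decrease: "H b <= H a"
proof -
 obtain M where M: "0 <= M" "!!t. t : G ==> a <= t ==> t <= b ==> m t <= M \<and> Gt t <= M \<and> (\<forall>r\<in>G. a <= r \<and> r <= b --> W r t <= en M)"
  by (fact mG_bound)
 show ?thesis
proof (rule averaged_decrease[where G=G and q=q and a=a and b=b])
 show "AEL t. t : {a..b} --> t : G" using AE_good by eventually_elim (auto dest: goodD)
 let ?B = "M + (LINT r:{a..b}|lborel. <|e r r + g r * m r|>)"
 show "<|H t|> <= ?B" if t: "t : G" "a <= t" "t <= b" for t
 proof -
  have "<|LINT r:{a..t}|lborel. e r r + g r * m r|> <= (LINT r:{a..t}|lborel. <|e r r + g r * m r|>)"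
  using set_integral_norm_bound[OF set_integrable_subset[OF em_integrable, of "{a..t}"]] t by simp
  also have "... <= (LINT r:{a..b}|lborel. <|e r r + g r * m r|>)"
  unfolding set_lebesgue_integral_def
  using set_integrable_abs[OF em_integrable] set_integrable_subset[OF set_integrable_abs[OF em_integrable], of "{a..t}"] t
  by (intro integral_mono) (auto simp: set_integrable_def indicator_def)
  finally have "<|LINT r:{a..t}|lborel. e r r + g r * m r|> <= ..." .
  moreover have "<|Gt t|> <= M" using M(2)[OF t] Gt_nn[of t] by simp
  ultimately show ?thesis unfolding H_def by linarith
 qed
 show "AEL t. a + vt <= t \<and> t <= b --> en (H t - H (t - vt)) <= (INT+ r:{t - vt..t}. q r t)" if vt: "0 < vt" for vt
  using AE_good G_translate[of "- vt"]
 proof eventually_elim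
  case (elim t)
  show ?case
  proof
  assume t: "a + vt <= t \<and> t <= b"
  then have gt: "good t" and rG: "t - vt : G" using elim vt by auto
  let ?r = "t - vt"
  have sub: "{?r..t} \<subseteq> {a..b}" using t vt by auto
  have i1: "set_integrable lborel {?r..t} (%r. e r r + g r * m r)" by (rule set_integrable_subset[OF em_integrable _ sub]) simp
  have i2: "set_integrable lborel {?r..t} (%r. e r t)" by (rule set_integrable_subset[OF e_integrable[OF gt] _ sub]) simp
  have i3: "set_integrable lborel {?r..t} (%r. g r * m t)" by (rule set_integrable_subset[OF gm_integrable(2) _ sub]) simp
  have i4: "set_integrable lborel {a..t} (%r. e r r + g r * m r)" by (rule set_integrable_subset[OF em_integrable]) (use t in auto)
  have "H t - H ?r = (Gt t - Gt ?r) + (LINT r:{?r..t}|lborel. e r r + g r * m r)"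
  unfolding H_def using set_integral_split_Icc[OF i4, of ?r] t vt by simp
  also have "... <= (- (LINT u:{?r..t}|lborel. e u t) - (l t - l ?r) * m t) + (LINT r:{?r..t}|lborel. e r r + g r * m r)"
  using convex_incr[OF rG _ gt] t vt by simp
  also have "l t - l ?r = (LINT u:{?r..t}|lborel. g u)" using t vt by (intro l_g) auto
  also have "(LINT u:{?r..t}|lborel. g u) * m t = (LINT u:{?r..t}|lborel. g u * m t)" by simp
  also have "(- (LINT u:{?r..t}|lborel. e u t) - (LINT u:{?r..t}|lborel. g u * m t)) + (LINT r:{?r..t}|lborel. e r r + g r * m r)
  = (LINT r:{?r..t}|lborel. (e r r + g r * m r) - (e r t + g r * m t))"
  using i1 i2 i3 by (simp add: set_integral_diff set_integral_add)
  finally have "en (H t - H ?r) <= en (LINT r:{?r..t}|lborel. (e r r + g r * m r) - (e r t + g r * m t))" by (rule ennreal_leI)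
  also have "... <= (INT+ r. en (ind {?r..t} r *R ((e r r + g r * m r) - (e r t + g r * m t))))"
  unfolding set_lebesgue_integral_def by (rule ennreal_integral_le_nn_integral)
  also have "... <= (INT+ r:{?r..t}. q r t)"
  proof (rule nn_integral_mono_AE, use AE_good in eventually_elim)
  fix r assume *: "r : {a..b} --> good r"
  show "en (ind {?r..t} r *R ((e r r + g r * m r) - (e r t + g r * m t))) <= q r t * ind {?r..t} r"
  proof (cases "r : {?r..t}")
  case True
  with * sub have "good r" by auto
  from q_bound[OF this gt] have "en ((e r r + g r * m r) - (e r t + g r * m t)) <= q r t" by (simp add: algebra_simps)
  then show ?thesis using True by simp
  qed simp
  qed
  finally show "en (H t - H (t - vt)) <= (INT+ r:{t - vt..t}. q r t)" .
  qed
 qed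
 show "(%n. H (tu n)) ~~> H a" if "!!n. tu n : G" "!!n. a <= tu n \<and> tu n <= b" "tu ~~> a" for tu
  using that ab by (intro H_tendsto a) auto
 show "(%n. H (tu n)) ~~> H b" if "!!n. tu n : G" "!!n. a <= tu n \<and> tu n <= b" "tu ~~> b" for tu
  using that ab by (intro H_tendsto b) auto
qed (use a b ab q_small in auto)
qed

text \<open>The speed of the level is split by sign, so that both sides consist of nonnegative
  terms: a rising level contributes on the left, a falling one is paid for on the right. If the
  localization term has infinite integral the claim is trivial; otherwise everything is finite and
  may be rearranged.\<close>

theorem energy_inequality:
 "en (Gt b) + (INT+ t:{a..b}. (D t + 2 * P t)) + (INT+ t:{a..b}. en (max 0 (g t) * m t))
  <= en (Gt a) + (INT+ t:{a..b}. X t) + (INT+ t:{a..b}. en (max 0 (- g t) * m t))"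
proof (cases "(INT+ t:{a..b}. X t) = inft")
 case False
 then have Xfin: "(INT+ t:{a..b}. X t) < inft" by (simp add: less_top)
 let ?M = "LINT t:{a..b}|lborel. max 0 (- g t) * m t" and ?L = "LINT t:{a..b}|lborel. max 0 (g t) * m t"
 define x where "x t = enn2real (X t)" for t
 have [measurable]: "x : borelm" unfolding x_def by measurable
 have AX: "AEL t. t : {a..b} --> X t < inft"
 proof -
  have "AEL t. X t * ind {a..b} t \<noteq> inft" by (rule nn_integral_noteq_infinite) (use False in auto)
  then show ?thesis by eventually_elim (auto simp: less_top)
 qed
 have X_eq: "(INT+ t:{a..b}. X t) = (INT+ t:{a..b}. en (x t))"
  using AX by (intro nn_integral_cong_AE, eventually_elim) (auto simp: x_def indicator_def)
 have nx: "0 <= x t" for t by (simp add: x_def)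
 have setnn: "(INT+ t:{a..b}. en (f t)) = en (LINT t:{a..b}|lborel. f t)" "0 <= (LINT t:{a..b}|lborel. f t)"
  if f: "set_integrable lborel {a..b} f" "AEL t. t : {a..b} --> 0 <= f t" for f
 proof -
  have "(INT+ t:{a..b}. en (f t)) = (INT+ t. en (ind {a..b} t *R f t))"
  by (intro nn_integral_cong) (auto simp: indicator_def)
  also have "... = en (LINT t:{a..b}|lborel. f t)"
  unfolding set_lebesgue_integral_def
  using f by (intro nn_integral_eq_integral) (auto simp: set_integrable_def indicator_def elim: eventually_mono)
  finally show "(INT+ t:{a..b}. en (f t)) = en (LINT t:{a..b}|lborel. f t)" .
  show "0 <= (LINT t:{a..b}|lborel. f t)"
  unfolding set_lebesgue_integral_def using f(2)
  by (intro integral_nonneg_AE) (auto simp: indicator_def elim: eventually_mono)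
 qed
 have xi: "set_integrable lborel {a..b} x"
  by (rule set_integrableI_nn) (use Xfin nx in "auto simp: X_eq")
 have exi: "set_integrable lborel {a..b} (%t. e t t + x t)" using e_integrable_diag xi by (rule set_integral_add)
 have DP: "(INT+ t:{a..b}. (D t + 2 * P t)) = (INT+ t:{a..b}. en (e t t + x t))"
  using AX AE_good by (intro nn_integral_cong_AE, eventually_elim) (auto simp: indicator_def x_def diag_identity(1))
 have ex0: "AEL t. t : {a..b} --> 0 <= e t t + x t"
  using AX AE_good by eventually_elim (auto simp: x_def intro: diag_identity(2))
 have gp: "set_integrable lborel {a..b} (%t. max 0 (g t) * m t)" "set_integrable lborel {a..b} (%t. max 0 (- g t) * m t)"
 proof -
  have *: "set_integrable lborel {a..b} (%t. max 0 (h t) * m t)" if [measurable]: "h : borelm" and h: "!!t. <|h t|> = <|g t|>" for h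
  proof (rule set_integrableI_nn)
  have "(INT+ t:{a..b}. en <|max 0 (h t) * m t|>) <= (INT+ t:{a..b}. en <|g t * m t|>)"
  by (intro nn_integral_mono mult_right_mono ennreal_leI) (auto simp: abs_mult h[symmetric] intro!: mult_right_mono)
  also have "... < inft" by (rule set_integrable_nnD[OF gm_integrable(1)])
  finally show "(INT+ t:{a..b}. en <|max 0 (h t) * m t|>) < inft" .
  qed measurable
  show "set_integrable lborel {a..b} (%t. max 0 (g t) * m t)" "set_integrable lborel {a..b} (%t. max 0 (- g t) * m t)"
  by (rule *; simp)+
 qed
 have gsplit: "(LINT t:{a..b}|lborel. g t * m t) = ?L - ?M"
 proof -
  have "?L - ?M
  = (LINT t:{a..b}|lborel. max 0 (g t) * m t - max 0 (- g t) * m t)" using gp by (simp add: set_integral_diff)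
  also have "(%t. max 0 (g t) * m t - max 0 (- g t) * m t) = (%t. g t * m t)"
  by (auto simp: max_def fun_eq_iff)
  finally show ?thesis by simp
 qed
 have Ha: "H a = Gt a"
 proof -
  have "(LINT r:{a..a}|lborel. e r r + g r * m r) = 0"
  unfolding set_lebesgue_integral_def using AE_lborel_singleton[of a]
  by (intro integral_eq_zero_AE) (auto elim: eventually_mono)
  then show ?thesis by (simp add: H_def)
 qed
 have Hb: "H b = Gt b + (LINT r:{a..b}|lborel. e r r) + (LINT r:{a..b}|lborel. g r * m r)"
  unfolding H_def using e_integrable_diag gm_integrable(1) by (simp add: set_integral_add)
 let ?I = "LINT t:{a..b}|lborel. e t t + x t"
 have ex: "?I = (LINT r:{a..b}|lborel. e r r) + (LINT r:{a..b}|lborel. x r)"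
  using e_integrable_diag xi by (simp add: set_integral_add)
 have final: "Gt b + ?I + ?L <= Gt a + (LINT r:{a..b}|lborel. x r) + ?M"
  using H_decrease unfolding Ha Hb ex gsplit by linarith
 have nnm: "AEL t. t : {a..b} --> 0 <= max 0 (g t) * m t" "AEL t. t : {a..b} --> 0 <= max 0 (- g t) * m t"
  using m_nn by (auto intro!: AE_I2)
 have "en (Gt b) + en ?I + en ?L
  = en (Gt b + ?I + ?L)"
  using Gt_nn setnn(2)[OF exi ex0] setnn(2)[OF gp(1) nnm(1)] by (simp add: ennreal_plus)
 also have "... <= en (Gt a + (LINT r:{a..b}|lborel. x r) + ?M)"
  by (rule ennreal_leI[OF final])
 also have "... = en (Gt a) + en (LINT r:{a..b}|lborel. x r) + en ?M"
  using Gt_nn setnn(2)[OF xi] nx setnn(2)[OF gp(2) nnm(2)] by (simp add: ennreal_plus)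
 finally show ?thesis
  unfolding DP X_eq setnn(1)[OF exi ex0] setnn(1)[OF gp(1) nnm(1)] setnn(1)[OF gp(2) nnm(2)] setnn(1)[OF xi, OF AE_I2, OF impI, OF nx] .
qed simp

end

section \<open>Local boundedness\<close>

context nlsol
begin

definition Np :: "real => ennreal" where
 "Np t = (INT+ x. en (max 0 (U t x) * rho s x))"
text \<open>The 2 counts the two orders of a near and a far point; 6 is the factor
  \<open>q + 2\<close> of \<open>kern_far\<close> for the largest radius \<open>q = 4\<close> in
  use.\<close>

definition C1 :: real where "C1 = 2 * Lam * 6 powr (real DIM('a) + 2 * s)"
text \<open>Speed of the level, proportional to the weighted positive part. Where that is infinite
  \<open>enn2real\<close> gives speed 0, which happens only on a null set of times in the unit
  interval.\<close>

definition gN :: "real => real" where "gN t = C1 * enn2real (Np t)"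
definition hN :: "real => real" where "hN t = (LINT u:{0..t}|lborel. gN u)"
definition VV :: "real => real => 'a => real" where "VV k t x = max 0 (U t x - (hN t + k))"

lemma Lam_nn [simp]: "0 <= Lam" using Lam_pos by linarith

lemma Np_measurable [measurable]: "Np : borelm" unfolding Np_def by measurable
lemma gN_measurable [measurable]: "gN : borelm" unfolding gN_def by measurable
lemma hN_measurable [measurable]: "hN : borelm"
 unfolding hN_def set_lebesgue_integral_def indicator_def atLeastAtMost_iff by measurable
lemma VV_measurable [measurable (raw)]:
 assumes [measurable]: "f : borel_measurable M" "h : borel_measurable M"
 shows "(%x. VV k (f x) (h x)) : borel_measurable M"
 unfolding VV_def by measurable

lemma C1_pos: "0 < C1" by (simp add: C1_def)
lemma gN_nn [simp]: "0 <= gN t" using C1_pos by (simp add: gN_def)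
lemma VV_nn [simp]: "0 <= VV k t x" by (simp add: VV_def)

lemma Np_le_N: "Np t <= N t"
 unfolding Np_def N_def by (intro nn_integral_mono ennreal_leI mult_right_mono) auto

lemma Np_int: "(INT+ t:{0<..1}. Np t) < inft"
proof -
 have "(INT+ t:{0<..1}. Np t) <= (INT+ t:{0<..1}. N t)"
  by (intro nn_integral_mono mult_right_mono Np_le_N) simp
 also have "... < inft" using L1_fin by (simp add: N_def)
 finally show ?thesis .
qed

lemma AE_Np_fin: "AEL t. t : {0<..1} --> Np t < inft"
proof -
 have "AEL t. Np t * ind {0<..1} t \<noteq> inft" by (rule nn_integral_noteq_infinite) (use Np_int in auto)
 then show ?thesis by eventually_elim (auto simp: less_top)
qed

lemma gN_nn_integral: "(INT+ t:{0..1}. en (gN t)) = en C1 * (INT+ t:{0<..1}. Np t)"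
proof -
 have "(INT+ t:{0..1}. en (gN t)) = (INT+ t. en C1 * (Np t * ind {0<..1} t))"
  using AE_Np_fin AE_lborel_singleton[of "0::real"]
  by (intro nn_integral_cong_AE, eventually_elim) (use C1_pos in "auto simp: gN_def indicator_def ennreal_mult")
 then show ?thesis by (simp add: nn_integral_cmult)
qed

lemma gN_integrable: "set_integrable lborel {0..1} gN"
proof (rule set_integrableI_nn)
 have "(INT+ t:{0..1}. en <|gN t|>) = en C1 * (INT+ t:{0<..1}. Np t)"
  using gN_nn_integral by simp
 also have "... < inft" using Np_int by (simp add: ennreal_mult_less_top)
 finally show "(INT+ t:{0..1}. en <|gN t|>) < inft" .
qed measurable

lemma hN_diff: "0 <= r ==> r <= t ==> t <= 1 ==> hN t - hN r = (LINT u:{r..t}|lborel. gN u)"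
 unfolding hN_def by (subst set_integral_split_Icc[of 0 t gN r]) (auto intro!: set_integrable_subset[OF gN_integrable])

lemma hN_nn [simp]: "0 <= hN t"
 unfolding hN_def set_lebesgue_integral_def by (intro integral_nonneg_AE) (auto intro!: AE_I2)

lemma hN_1: "en (hN 1) = en C1 * (INT+ t:{0<..1}. Np t)"
proof -
 have "en (hN 1) = (INT+ t. en (ind {0..1} t *R gN t))"
  unfolding hN_def set_lebesgue_integral_def using gN_integrable
  by (intro nn_integral_eq_integral[symmetric]) (auto simp: set_integrable_def)
 also have "... = (INT+ t:{0..1}. en (gN t))" by (intro nn_integral_cong) (auto simp: indicator_def)
 finally show ?thesis by (simp add: gN_nn_integral)
qed

lemma VV_le: "0 <= k ==> VV k t x <= max 0 (U t x)"
proof -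
 assume "0 <= k"
 moreover have "0 <= hN t" by (rule hN_nn)
 ultimately have "0 <= hN t + k" by (rule add_nonneg_nonneg[rotated])
 then show ?thesis unfolding VV_def by (intro max.mono) linarith+
qed

text \<open>The part of the localization term that is left to estimate: pairs with a point outside
  the ball of radius \<open>q + 1\<close> are absorbed by the motion of the level.\<close>

definition Xn :: "real => real => ('a => real) => real => ennreal" where
 "Xn q k et t = (INT+ x. INT+ y. en (VV k t x * VV k t y * (et x - et y)^2 * kap t x y) * ind (ball 0 (q + 1)) y * ind (ball 0 (q + 1)) x)"

text \<open>The far part of the localization term is at most \<open>C1 * Np t\<close> times the mass
  \<open>m t\<close> of the test function. With the level rising at exactly that speed it equals the
  extra term on the left of the energy inequality, and the two cancel.\<close>

lemma level_energy:
 assumes q: "1 <= q" "q <= 4" and k: "0 <= k" and [measurable]: "et : borelm"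
  and et: "!!x y. <|et x - et y|> <= L * norm (x - y)" "!!x. 0 <= et x" "!!x. et x <= 1" "!!x. q <= norm x ==> et x = 0" "1 <= L"
  and ab: "a : G" "b : G" "a < b"
 shows "(INT+ x. en ((VV k b x)^2 * (et x)^2))
  + 2 * (INT+ t:{a..b}. (INT+ x. INT+ y. en ((VV k t x * et x - VV k t y * et y)^2 * kap t x y)))
  <= (INT+ x. en ((VV k a x)^2 * (et x)^2)) + 2 * (INT+ t:{a..b}. Xn q k et t)"
proof -
 have "a : {0<..1}" "b : {0<..1}" using ab G_sub by blast+
 then have aG: "0 < a" "b <= 1" by auto
 interpret E: nl_energy s lam Lam U kap G et L q "%t. hN t + k" gN a b
 proof unfold_locales
  show "set_integrable lborel {a..b} gN" by (rule set_integrable_subset[OF gN_integrable]) (use aG in auto)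
  show "hN t + k - (hN r + k) = (LINT u:{r..t}|lborel. gN u)" if "a <= r" "r <= t" "t <= b" for r t
  using hN_diff[of r t] that aG by simp
 qed (use q et ab in auto)
 have VE: "E.V = VV k" by (simp add: E.V_def VV_def fun_eq_iff)
 let ?B = "ball (0::'a) (q + 1)"
 have Xnm[measurable]: "(%t. Xn q k et t) : borelm" unfolding Xn_def by measurable
 have Xbound: "E.X t <= Xn q k et t + en C1 * Np t * en (E.m t)" if t: "E.good t" for t
 proof -
  define F where "F x y = en (Lam * 6 powr (real DIM('a) + 2 * s)) * (en (E.phi t x) * en (max 0 (U t y) * rho s y))" for x y
  have Fm[measurable]: "(%(x, y). F x y) : borel_measurable lborel2" unfolding F_def by measurable
  define X0 where "X0 x y = en (VV k t x * VV k t y * (et x - et y)^2 * kap t x y)" for x y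
  have X0m[measurable]: "(%(x, y). X0 x y) : borel_measurable lborel2" unfolding X0_def by measurable
  have far: "X0 x y <= F x y" if xy: "norm x < q" "y \<notin> ?B" for x y
  proof -
  have "kap t x y <= Lam * ((q + 2) powr (real DIM('a) + 2 * s) * rho s y)"
  by (rule order_trans[OF kap_upper mult_left_mono]) (use xy q s in "auto intro!: kern_far")
  also have "... <= Lam * (6 powr (real DIM('a) + 2 * s) * rho s y)"
  using q s by (intro mult_left_mono mult_right_mono powr_mono2) auto
  finally have kb: "kap t x y <= Lam * 6 powr (real DIM('a) + 2 * s) * rho s y" by simp
  have "et y = 0" using xy q by (intro et(4)) auto
  then have "VV k t x * VV k t y * (et x - et y)^2 * kap t x y = E.phi t x * (VV k t y * kap t x y)"
  by (simp add: E.phi_def VE)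
  also have "... <= E.phi t x * (max 0 (U t y) * (Lam * 6 powr (real DIM('a) + 2 * s) * rho s y))"
  by (intro mult_left_mono mult_mono VV_le k kb) auto
  also have "... = (Lam * 6 powr (real DIM('a) + 2 * s)) * (E.phi t x * (max 0 (U t y) * rho s y))" by simp
  finally show ?thesis unfolding X0_def F_def
  by (subst ennreal_mult[symmetric], simp, simp, subst ennreal_mult[symmetric], use less_imp_le[OF Lam_pos] in "auto intro: ennreal_leI")
  qed
  have pt: "X0 x y <= X0 x y * ind ?B y * ind ?B x + (F x y + F y x)" for x y
  proof -
  consider "x : ?B" "y : ?B" | "norm x < q" "y \<notin> ?B" | "norm y < q" "x \<notin> ?B" | "q <= norm x" "q <= norm y"
  using q by fastforce
  then show ?thesis
  proof cases
  case 1 then show ?thesis by simp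
  next
  case 2 then show ?thesis using far[of x y] by (simp add: add_increasing2)
  next
  case 3
  have "X0 x y = X0 y x" unfolding X0_def by (simp add: kap_sym[of t x y] power2_commute mult_ac)
  then show ?thesis using far[of y x] 3 by (simp add: add_increasing)
  next
  case 4 then show ?thesis by (simp add: X0_def et(4))
  qed
  qed
  have intF: "(INT+ x. INT+ y. F x y) = en (Lam * 6 powr (real DIM('a) + 2 * s)) * (en (E.m t) * Np t)"
  unfolding F_def by (simp add: nn_integral_cmult nn_integral_multc Np_def[symmetric] E.m_eq[OF E.goodD[OF t]])
  have F2: "(INT+ x. INT+ y. F y x) = (INT+ x. INT+ y. F x y)"
  by (rule lborel_pair.Fubini') measurable
  have "E.X t = (INT+ x. INT+ y. X0 x y)" unfolding E.X_def X0_def VE ..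
  also have "... <= (INT+ x. INT+ y. X0 x y * ind ?B y * ind ?B x + (F x y + F y x))"
  by (intro nn_integral_mono pt)
  also have "... = Xn q k et t + ((INT+ x. INT+ y. F x y) + (INT+ x. INT+ y. F y x))"
  unfolding Xn_def X0_def[symmetric] by (simp add: nn_integral_add)
  also have "(INT+ x. INT+ y. F x y) + (INT+ x. INT+ y. F y x) = en C1 * Np t * en (E.m t)"
  unfolding F2 intF C1_def using less_imp_le[OF Lam_pos] by (simp add: mult_2[symmetric] ennreal_mult mult_ac)
  finally show ?thesis .
 qed
 \<comment> \<open>Finiteness is what permits cancelling this term from both sides in
   \<open>ennreal\<close>.\<close>
 have gm: "(INT+ t:{a..b}. en (max 0 (gN t) * E.m t)) < inft"
 proof -
  have "(INT+ t:{a..b}. en (max 0 (gN t) * E.m t)) = (INT+ t:{a..b}. en <|gN t * E.m t|>)"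
  using E.m_nn by (intro nn_integral_cong) (auto simp: max_def abs_mult)
  also have "... < inft" by (rule set_integrable_nnD[OF E.gm_integrable(1)])
  finally show ?thesis .
 qed
 have Xint: "(INT+ t:{a..b}. E.X t) <= (INT+ t:{a..b}. Xn q k et t) + (INT+ t:{a..b}. en (max 0 (gN t) * E.m t))"
 proof -
  have "(INT+ t:{a..b}. E.X t) <= (INT+ t. Xn q k et t * ind {a..b} t + en (max 0 (gN t) * E.m t) * ind {a..b} t)"
  proof (rule nn_integral_mono_AE, use E.AE_good AE_Np_fin in eventually_elim)
  fix t assume *: "t : {a..b} --> E.good t" "t : {0<..1} --> Np t < inft"
  show "E.X t * ind {a..b} t <= Xn q k et t * ind {a..b} t + en (max 0 (gN t) * E.m t) * ind {a..b} t"
  proof (cases "t : {a..b}")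
  case True
  then have t: "E.good t" "Np t < inft" using * aG by auto
  have "en C1 * Np t * en (E.m t) = en (max 0 (gN t) * E.m t)"
  using t(2) C1_pos E.m_nn[of t] by (simp add: gN_def ennreal_mult max_def)
  with Xbound[OF t(1)] True show ?thesis by simp
  qed simp
  qed
  also have "... = (INT+ t:{a..b}. Xn q k et t) + (INT+ t:{a..b}. en (max 0 (gN t) * E.m t))"
  by (rule nn_integral_add) measurable
  finally show ?thesis .
 qed
 have Gt2: "(INT+ x. en ((VV k t x)^2 * (et x)^2)) = 2 * en (E.Gt t)" if "t : G" "a <= t" "t <= b" for t
 proof -
  have "(INT+ x. en ((VV k t x)^2 * (et x)^2)) = (INT+ x. 2 * en ((E.V t x)^2 / 2 * (et x)^2))"
  unfolding VE
  proof (intro nn_integral_cong, goal_cases)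
  case (1 x)
  have "(VV k t x)^2 * (et x)^2 = 2 * ((VV k t x)^2 / 2 * (et x)^2)" by simp
  then show ?case
  by (metis ennreal_mult' ennreal_numeral zero_le_numeral)
  qed
  also have "... = 2 * (INT+ x. en ((E.V t x)^2 / 2 * (et x)^2))" by (rule nn_integral_cmult) measurable
  also have "... = 2 * en (E.Gt t)" unfolding E.Gt_eq[OF that] ..
  finally show ?thesis .
 qed
 have neg0: "max 0 (- gN t) = 0" for t using gN_nn[of t] by simp
 let ?g = "INT+ t:{a..b}. en (max 0 (gN t) * E.m t)"
 have "en (E.Gt b) + (INT+ t:{a..b}. E.D t) + ?g <= en (E.Gt b) + (INT+ t:{a..b}. (E.D t + 2 * E.P t)) + ?g"
  by (intro add_mono nn_integral_mono) (auto simp: indicator_def)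
 also have "... <= en (E.Gt a) + (INT+ t:{a..b}. E.X t)"
  using E.energy_inequality unfolding neg0 by simp
 also have "... <= (en (E.Gt a) + (INT+ t:{a..b}. Xn q k et t)) + ?g"
  using Xint by (simp add: add.assoc add_left_mono)
 finally have "en (E.Gt b) + (INT+ t:{a..b}. E.D t) <= en (E.Gt a) + (INT+ t:{a..b}. Xn q k et t)"
  using gm by (auto simp: add.commute[of _ ?g] ennreal_add_left_cancel_le)
 then have "2 * (en (E.Gt b) + (INT+ t:{a..b}. E.D t)) <= 2 * (en (E.Gt a) + (INT+ t:{a..b}. Xn q k et t))"
  by (rule mult_left_mono) simp
 then show ?thesis using ab by (simp add: Gt2 distrib_left E.D_def VE)
qed

end

text \<open>Nash's inequality before optimization. The pointwise bound of \<open>(f x)^2\<close> by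
  \<open>(f x - f y)^2 + 2 * f x * f y\<close> is averaged over \<open>y\<close> in a ball of radius
  \<open>r\<close>, where the kernel is at least \<open>r\<close> to the power
  \<open>- (d + 2 s)\<close>. The radius stays free and is chosen anew at each stage of the
  iteration.\<close>

lemma nash_average:
 fixes f :: "'a::euclidean_space => real"
 assumes [measurable]: "f : borelm" and nn: "!!x. 0 <= f x" and r: "0 < r" and s: "0 < s"
 shows "en (unit_ball_vol DIM('a) * r ^ DIM('a)) * (INT+ x. en ((f x)^2))
  <= en (r powr (real DIM('a) + 2 * s)) * gag s UNIV f + 2 * (INT+ x. en (f x))^2"
proof -
 let ?p = "real DIM('a) + 2 * s"
 define S where "S = (INT+ x. en (f x))"
 have em: "emeasure lborel (ball x r) = en (unit_ball_vol DIM('a) * r ^ DIM('a))" for x :: 'a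
  using r by (intro emeasure_ball) simp
 have pt: "en ((f x)^2) * ind (ball x r) y <= en (r powr ?p) * en ((f x - f y)^2 * kern s x y) + 2 * (en (f x) * en (f y))" for x y
 proof (cases "y : ball x r")
  case True
  have "(f x - f y)^2 <= r powr ?p * ((f x - f y)^2 * kern s x y)"
  proof (cases "x = y")
  case False
  have "1 / r powr ?p <= 1 powr ?p * (1 / norm (x - y) powr ?p)"
  using True False s by (intro inverse_powr_mono) (auto simp: dist_norm)
  then have "1 <= r powr ?p * kern s x y" using r by (simp add: kern_def field_simps)
  from mult_left_mono[OF this, of "(f x - f y)^2"] show ?thesis by (simp add: mult_ac)
  qed simp
  moreover have "(f x)^2 <= (f x - f y)^2 + 2 * (f x * f y)" by (simp add: power2_diff)
  ultimately have "(f x)^2 <= r powr ?p * ((f x - f y)^2 * kern s x y) + 2 * (f x * f y)" by linarith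
  then have "en ((f x)^2) <= en (r powr ?p * ((f x - f y)^2 * kern s x y) + 2 * (f x * f y))" by (rule ennreal_leI)
  also have "... = en (r powr ?p) * en ((f x - f y)^2 * kern s x y) + 2 * (en (f x) * en (f y))"
  using nn by (simp add: ennreal_plus ennreal_mult)
  finally show ?thesis using True by simp
 qed simp
 have "en (unit_ball_vol DIM('a) * r ^ DIM('a)) * (INT+ x. en ((f x)^2))
  = (INT+ x. INT+ y. en ((f x)^2) * ind (ball x r) y)"
 proof -
  have "(INT+ y. en ((f x)^2) * ind (ball x r) y) = en ((f x)^2) * en (unit_ball_vol DIM('a) * r ^ DIM('a))" for x
  by (simp add: nn_integral_cmult_indicator em)
  then show ?thesis by (simp add: nn_integral_multc mult.commute)
 qed
 also have "... <= (INT+ x. INT+ y. en (r powr ?p) * en ((f x - f y)^2 * kern s x y) + 2 * (en (f x) * en (f y)))"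
  by (intro nn_integral_mono pt)
 also have "... = (INT+ x. INT+ y. en (r powr ?p) * en ((f x - f y)^2 * kern s x y))
  + (INT+ x. INT+ y. 2 * (en (f x) * en (f y)))"
  by (rule nn_integral_iterated_add) measurable
 also have "(INT+ x. INT+ y. en (r powr ?p) * en ((f x - f y)^2 * kern s x y)) = en (r powr ?p) * gag s UNIV f"
  by (subst nn_integral_cmult, measurable, subst nn_integral_cmult, measurable) (simp add: gag_def)
 also have "(INT+ x. INT+ y. 2 * (en (f x) * en (f y))) = 2 * S^2"
  by (simp add: nn_integral_cmult nn_integral_multc S_def power2_eq_square)
 finally show ?thesis unfolding S_def .
qed

context nlsol
begin

text \<open>Nothing is known at a particular initial time. The energy inequality is averaged over
  initial times between \<open>c\<close> and \<open>d\<close>, which trades the initial energy for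
  its time integral at the price \<open>1 / (d - c)\<close>.\<close>

lemma average_energy:
 assumes q: "1 <= q" "q <= 4" and k: "0 <= k" and m[measurable]: "et : borelm"
  and et: "!!x y. <|et x - et y|> <= L * norm (x - y)" "!!x. 0 <= et x" "!!x. et x <= 1" "!!x. q <= norm x ==> et x = 0" "1 <= L"
  and cd: "0 <= c" "c < d" "d <= b" "b : G"
 shows "(INT+ x. en ((VV k b x)^2 * (et x)^2)) + 2 * (en lam * (INT+ t:{d..b}. gag s UNIV (%x. VV k t x * et x)))
  <= en (1 / (d - c)) * (INT+ t:{c..1}. (INT+ x. en ((VV k t x)^2 * (et x)^2))) + 2 * (INT+ t:{c..1}. Xn q k et t)"
proof -
 define S where "S t = (INT+ x. en ((VV k t x)^2 * (et x)^2))" for t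
 define DD where "DD t = (INT+ x. INT+ y. en ((VV k t x * et x - VV k t y * et y)^2 * kap t x y))" for t
 define gg where "gg t = gag s UNIV (%x. VV k t x * et x)" for t
 have Sm[measurable]: "S : borelm" unfolding S_def by measurable
 have DDm[measurable]: "DD : borelm" unfolding DD_def by measurable
 have ggm[measurable]: "gg : borelm" unfolding gg_def gag_def by measurable
 have Xm[measurable]: "Xn q k et : borelm" unfolding Xn_def by measurable
 have b1: "b <= 1" using cd(4) G_sub by auto
 have gD: "en lam * gg t <= DD t" for t
 proof -
  have "en lam * gg t = (INT+ x. INT+ y. en lam * en ((VV k t x * et x - VV k t y * et y)^2 * kern s x y))"
  unfolding gg_def gag_def by (subst nn_integral_cmult, measurable, subst nn_integral_cmult, measurable)
  also have "... <= DD t" unfolding DD_def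
  proof (intro nn_integral_mono, goal_cases)
  case (1 x y)
  have "lam * ((VV k t x * et x - VV k t y * et y)^2 * kern s x y) <= (VV k t x * et x - VV k t y * et y)^2 * kap t x y"
  using mult_left_mono[OF kap_lower[of x y t], of "(VV k t x * et x - VV k t y * et y)^2"] by (simp add: mult_ac)
  from ennreal_leI[OF this] lam(1)
  show ?case
  by (subst ennreal_mult[symmetric]) auto
  qed
  finally show ?thesis .
 qed
 define Z where "Z = S b + 2 * (en lam * (INT+ t:{d..b}. gg t))"
 define Y where "Y = (INT+ t:{c..1}. Xn q k et t)"
 have step: "Z <= S a + 2 * Y" if a: "a : G" "c < a" "a < d" for a
 proof -
  have "Z = S b + 2 * (INT+ t. en lam * (gg t * ind {d..b} t))" unfolding Z_def by (simp add: nn_integral_cmult)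
  also have "... <= S b + 2 * (INT+ t:{a..b}. DD t)"
  using a gD by (intro add_left_mono mult_left_mono nn_integral_mono) (auto simp: indicator_def)
  also have "... <= S a + 2 * (INT+ t:{a..b}. Xn q k et t)"
  unfolding S_def DD_def by (rule level_energy[OF q k m et]) (use a cd in auto)
  also have "... <= S a + 2 * Y"
  unfolding Y_def using a b1 by (intro add_left_mono mult_left_mono nn_integral_mono) (auto simp: indicator_def)
  finally show ?thesis .
 qed
 have "Z * en (d - c) = (INT+ a. Z * ind {c..d} a)" using cd by (simp add: nn_integral_cmult_indicator)
 also have "... <= (INT+ a. S a * ind {c..1} a + 2 * Y * ind {c..d} a)"
 proof (rule nn_integral_mono_AE, use G_AE AE_lborel_singleton[of c] AE_lborel_singleton[of d] in eventually_elim)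
  fix a assume *: "a : {0<..1} --> a : G" "a \<noteq> c" "a \<noteq> d"
  show "Z * ind {c..d} a <= S a * ind {c..1} a + 2 * Y * ind {c..d} a"
  proof (cases "a : {c..d}")
  case True
  then have "c < a" "a < d" "a : G" "a <= 1" using * cd b1 by auto
  with step[of a] True show ?thesis by simp
  qed simp
 qed
 also have "... = (INT+ t:{c..1}. S t) + 2 * Y * en (d - c)"
  using cd by (simp add: nn_integral_add nn_integral_cmult_indicator)
 finally have "en (1 / (d - c)) * (Z * en (d - c)) <= en (1 / (d - c)) * ((INT+ t:{c..1}. S t) + 2 * Y * en (d - c))"
  by (rule mult_left_mono) simp
 moreover have c1: "en (1 / (d - c)) * (z * en (d - c)) = z" for z
 proof -
  have "en (1 / (d - c)) * en (d - c) = 1" using cd by (simp flip: ennreal_mult)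
  then show ?thesis by (metis mult.assoc mult.commute mult.right_neutral)
 qed
 ultimately have "Z <= en (1 / (d - c)) * (INT+ t:{c..1}. S t) + 2 * Y" by (simp add: distrib_left)
 then show ?thesis unfolding Z_def Y_def S_def gg_def .
qed

lemma moment_pair:
 fixes B :: "'a set"
 assumes M0: "0 <= M0" "!!x::'a. (INT+ y. en (min 1 ((norm (x - y))^2) * kern s x y)) <= en M0"
  and [measurable]: "et : borelm" "B : sets borel"
  and et: "!!x y. <|et x - et y|> <= L * norm (x - y)" "!!x. 0 <= et x" "!!x. et x <= 1" "1 <= L"
 shows "(INT+ x. INT+ y. en (VV k t x * VV k t y * (et x - et y)^2 * kap t x y) * ind B y * ind B x)
  <= en (Lam * (L^2 * M0)) * (INT+ x:B. en ((VV k t x)^2))"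
proof -
 have mom: "(INT+ y. en ((et x - et y)^2 * kern s x y)) <= en (L^2 * M0)" for x
 proof (rule lipschitz_moment[OF et(1) _ et(4) M0(2) M0(1)])
  show "<|et x - et y|> <= 1" for y using et(2)[of x] et(2)[of y] et(3)[of x] et(3)[of y] by (auto simp: abs_le_iff)
 qed
 define F where "F x y = en (Lam / 2) * (en ((et x - et y)^2 * kern s x y) * (en ((VV k t x)^2) * ind B x))" for x y
 have Fm[measurable]: "(%(x, y). F x y) : borel_measurable lborel2" unfolding F_def by measurable
 have pt: "en (VV k t x * VV k t y * (et x - et y)^2 * kap t x y) * ind B y * ind B x <= F x y + F y x" for x y
 proof (cases "x : B \<and> y : B")
  case True
  have "VV k t x * VV k t y <= (VV k t x)^2 / 2 + (VV k t y)^2 / 2"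
  using zero_le_power2[of "VV k t x - VV k t y"] by (simp add: power2_diff)
  then have "(VV k t x * VV k t y) * ((et x - et y)^2 * kap t x y) <= ((VV k t x)^2 / 2 + (VV k t y)^2 / 2) * ((et x - et y)^2 * (Lam * kern s x y))"
  by (intro mult_mono kap_upper) auto
  then have *: "VV k t x * VV k t y * (et x - et y)^2 * kap t x y
  <= Lam / 2 * (((et x - et y)^2 * kern s x y) * (VV k t x)^2) + Lam / 2 * (((et y - et x)^2 * kern s y x) * (VV k t y)^2)"
  by (simp add: algebra_simps power2_commute[of "et y"] kern_commute[of s y x])
  from ennreal_leI[OF *] True show ?thesis
  unfolding F_def by (simp add: ennreal_plus ennreal_mult del: times_divide_eq_left)
 qed auto
 have F2: "(INT+ x. INT+ y. F y x) = (INT+ x. INT+ y. F x y)"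
  by (rule lborel_pair.Fubini') measurable
 have intF: "(INT+ x. INT+ y. F x y) <= en (Lam / 2) * (en (L^2 * M0) * (INT+ x:B. en ((VV k t x)^2)))"
 proof -
  have "(INT+ x. INT+ y. F x y) <= (INT+ x. en (Lam / 2) * (en (L^2 * M0) * (en ((VV k t x)^2) * ind B x)))"
  unfolding F_def by (intro nn_integral_mono) (simp add: nn_integral_cmult nn_integral_multc mult_left_mono mult_right_mono mom)
  then show ?thesis by (simp add: nn_integral_cmult)
 qed
 have "(INT+ x. INT+ y. en (VV k t x * VV k t y * (et x - et y)^2 * kap t x y) * ind B y * ind B x)
  <= (INT+ x. INT+ y. F x y + F y x)" by (intro nn_integral_mono pt)
 also have "... = (INT+ x. INT+ y. F x y) + (INT+ x. INT+ y. F y x)"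
  by (rule nn_integral_iterated_add) measurable
 also have "... <= en (Lam / 2) * (en (L^2 * M0) * (INT+ x:B. en ((VV k t x)^2)))
  + en (Lam / 2) * (en (L^2 * M0) * (INT+ x:B. en ((VV k t x)^2)))"
  unfolding F2 by (intro add_mono intF)
 also have "... = en (Lam * (L^2 * M0)) * (INT+ x:B. en ((VV k t x)^2))"
 proof -
  have "en (Lam / 2) + en (Lam / 2) = en Lam" by (subst ennreal_plus[symmetric]) auto
  then show ?thesis using M0(1) by (simp add: ennreal_mult mult.assoc flip: distrib_right)
 qed
 finally show ?thesis .
qed

text \<open>Pairs inside the smaller ball see the Lipschitz cut-off and cost an L^2 norm. The
  remaining pairs are at least \<open>ga\<close> apart, so the kernel is bounded and a product of
  L^1 norms appears; one of these is later squeezed into an L^2 norm one level below, the other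
  bounded uniformly.\<close>

lemma Xn_split:
 assumes M0: "0 <= M0" "!!x::'a. (INT+ y. en (min 1 ((norm (x - y))^2) * kern s x y)) <= en M0"
  and m[measurable]: "et : borelm"
  and et: "!!x y. <|et x - et y|> <= L * norm (x - y)" "!!x. 0 <= et x" "!!x. et x <= 1" "!!x. r0 <= norm x ==> et x = 0" "1 <= L"
  and r: "0 < ga" "r0 + ga <= r" "r <= 3"
 shows "Xn 2 k et t <= en (Lam * (L^2 * M0)) * (sqb r (VV k t))
  + en (2 * Lam / ga powr (real DIM('a) + 2 * s)) * ((INT+ x:ball 0 r. en (VV k t x)) * (INT+ x:ball 0 3. en (VV k t x)))"
proof -
 let ?p = "real DIM('a) + 2 * s" and ?B = "ball (0::'a) r"
 define X0 where "X0 x y = en (VV k t x * VV k t y * (et x - et y)^2 * kap t x y)" for x y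
 have X0m[measurable]: "(%(x, y). X0 x y) : borel_measurable lborel2" unfolding X0_def by measurable
 define F where "F x y = en (Lam / ga powr ?p) * (en (VV k t x) * ind ?B x) * (en (VV k t y) * ind (ball 0 3) y)" for x y
 have Fm[measurable]: "(%(x, y). F x y) : borel_measurable lborel2" unfolding F_def by measurable
 have far: "X0 x y <= F x y" if "norm x < r0" "r <= norm y" "norm y < 3" for x y
 proof -
  have "ga <= norm (x - y)" using that r norm_triangle_ineq2[of y x] by (simp add: norm_minus_commute)
  then have "kern s x y <= 1 powr ?p * (1 / ga powr ?p)" unfolding kern_def using r s by (intro inverse_powr_mono) auto
  then have "kap t x y <= Lam * (1 / ga powr ?p)" by (intro order_trans[OF kap_upper mult_left_mono]) auto
  moreover have "(et x - et y)^2 <= 1"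
  proof -
  have "<|et x - et y|> <= 1" using et(2)[of x] et(2)[of y] et(3)[of x] et(3)[of y] by (auto simp: abs_le_iff)
  then show ?thesis by (simp add: abs_square_le_1)
  qed
  ultimately have "VV k t x * VV k t y * (et x - et y)^2 * kap t x y <= VV k t x * VV k t y * 1 * (Lam * (1 / ga powr ?p))"
  by (intro mult_mono) auto
  also have "... = (Lam / ga powr ?p) * VV k t x * VV k t y" by simp
  finally have "X0 x y <= en ((Lam / ga powr ?p) * VV k t x * VV k t y)" unfolding X0_def by (rule ennreal_leI)
  also have "... = F x y" using that r unfolding F_def by (simp add: ennreal_mult del: times_divide_eq_left)
  finally show ?thesis .
 qed
 have pt: "X0 x y * ind (ball 0 3) y * ind (ball 0 3) x <= X0 x y * ind ?B y * ind ?B x + (F x y + F y x)" for x y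
 proof -
  consider "x \<notin> ball 0 3 \<or> y \<notin> ball 0 3" | "x : ?B" "y : ?B" | "norm x < r0" "r <= norm y" "norm y < 3" "norm x < 3"
  | "norm y < r0" "r <= norm x" "norm x < 3" "norm y < 3" | "r0 <= norm x" "r0 <= norm y"
  using r by fastforce
  then show ?thesis
  proof cases
  case 1 then show ?thesis by auto
  next
  case 2 then show ?thesis using r by (simp add: add_increasing2)
  next
  case 3 then show ?thesis using far[of x y] by (simp add: add_increasing2)
  next
  case 4
  have "X0 x y = X0 y x" unfolding X0_def by (simp add: kap_sym[of t x y] power2_commute mult_ac)
  then show ?thesis using far[of y x] 4 by (simp add: add_increasing)
  next
  case 5 then show ?thesis by (simp add: X0_def et(4))
  qed
 qed
 have intF: "(INT+ x. INT+ y. F x y) = en (Lam / ga powr ?p) * ((INT+ x:?B. en (VV k t x)) * (INT+ x:ball 0 3. en (VV k t x)))"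
  unfolding F_def by (simp add: nn_integral_cmult nn_integral_multc, simp only: mult.assoc)
 have F2: "(INT+ x. INT+ y. F y x) = (INT+ x. INT+ y. F x y)"
  by (rule lborel_pair.Fubini') measurable
 have "Xn 2 k et t = (INT+ x. INT+ y. X0 x y * ind (ball 0 3) y * ind (ball 0 3) x)"
  unfolding Xn_def X0_def by simp
 also have "... <= (INT+ x. INT+ y. X0 x y * ind ?B y * ind ?B x + (F x y + F y x))"
  by (intro nn_integral_mono pt)
 also have "... = (INT+ x. INT+ y. X0 x y * ind ?B y * ind ?B x) + (INT+ x. INT+ y. F x y + F y x)"
  by (rule nn_integral_iterated_add) measurable
 also have "(INT+ x. INT+ y. F x y + F y x) = (INT+ x. INT+ y. F x y) + (INT+ x. INT+ y. F y x)"
  by (rule nn_integral_iterated_add) measurable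
 also have "... = en (2 * Lam / ga powr ?p) * ((INT+ x:?B. en (VV k t x)) * (INT+ x:ball 0 3. en (VV k t x)))"
 proof -
  have "en (Lam / ga powr ?p) + en (Lam / ga powr ?p) = en (2 * Lam / ga powr ?p)"
  by (subst ennreal_plus[symmetric]) auto
  then show ?thesis unfolding F2 intF by (simp flip: distrib_right)
 qed
 also have "(INT+ x. INT+ y. X0 x y * ind ?B y * ind ?B x) <= en (Lam * (L^2 * M0)) * (INT+ x:?B. en ((VV k t x)^2))"
  unfolding X0_def by (rule moment_pair[OF M0 m]) (use et in auto)
 finally show ?thesis by (simp add: add_right_mono)
qed

end

section \<open>Cut-offs and the dyadic cylinders of the iteration\<close>

definition cut :: "real => real => 'a::euclidean_space => real" where
 "cut r ga x = max 0 (min 1 ((r - norm x) / ga))"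

lemma cut_measurable [measurable]: "cut r ga : borelm"
 unfolding cut_def by measurable

lemma cut_props:
 assumes "0 < ga"
 shows "<|cut r ga x - cut r ga y|> <= (1 / ga) * norm (x - y)" "0 <= cut r ga x" "cut r ga x <= 1"
  "r <= norm x ==> cut r ga x = 0" "norm x <= r - ga ==> cut r ga x = 1"
proof -
 have "<|(r - norm x) / ga - (r - norm y) / ga|> = <|norm x - norm y|> / ga"
  using assms by (simp add: abs_minus_commute flip: diff_divide_distrib)
 also have "... <= (1 / ga) * norm (x - y)"
  using assms norm_triangle_ineq3[of x y] by (simp add: divide_right_mono)
 finally have "<|(r - norm x) / ga - (r - norm y) / ga|> <= (1 / ga) * norm (x - y)" .
 then show "<|cut r ga x - cut r ga y|> <= (1 / ga) * norm (x - y)" unfolding cut_def by linarith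
qed (use assms in "auto simp: cut_def divide_le_0_iff max_def min_def field_simps")

definition rr :: "nat => real" where "rr j = 1 + (1/2) ^ j"
definition tt :: "nat => real" where "tt j = 1/2 - (1/2) ^ j / 4"
text \<open>Equal to 1 up to the radius \<open>rr (Suc j)\<close> and zero from three quarters of
  the way to \<open>1 + (1/2) ^ j\<close> on. The gap of \<open>(1/2) ^ j / 4\<close> left to
  \<open>rr j\<close> is the distance \<open>ga\<close> that \<open>Xn_split\<close> needs.\<close>

definition cutj :: "nat => 'a::euclidean_space => real" where
 "cutj j = cut (1 + 3/4 * (1/2) ^ j) ((1/2) ^ j / 4)"

lemma half_pow: "0 < (1/2::real) ^ j" "(1/2::real) ^ j <= 1" by (auto simp: power_le_one)

lemma rr_bounds: "1 < rr j" "rr j <= 2" "rr (Suc j) <= rr j"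
 using half_pow[of j] by (auto simp: rr_def)

lemma tt_bounds: "1/4 <= tt j" "tt j < 1/2" "tt j < tt (Suc j)" "tt (Suc j) - tt j = (1/2) ^ j / 8"
 using half_pow[of j] by (auto simp: tt_def)

lemma cutj_props:
 "cutj j : borelm"
 "<|cutj j x - cutj j y|> <= (4 * 2 ^ j) * norm (x - y)" "0 <= cutj j x" "cutj j x <= 1"
 "1 + 3/4 * (1/2) ^ j <= norm x ==> cutj j x = 0" "norm x <= rr (Suc j) ==> cutj j x = 1"
proof -
 have g: "0 < (1/2::real) ^ j / 4" by simp
 have "1 / ((1/2::real) ^ j / 4) = 4 * 2 ^ j" by (simp add: field_simps)
 with cut_props(1)[OF g, of "1 + 3/4 * (1/2) ^ j" x y] show "<|cutj j x - cutj j y|> <= (4 * 2 ^ j) * norm (x - y)"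
  by (simp only: cutj_def)
 show "norm x <= rr (Suc j) ==> cutj j x = 1"
  unfolding cutj_def by (rule cut_props(5)[OF g]) (simp add: rr_def)
qed (use cut_props(2-4)[of "(1/2) ^ j / 4" "1 + 3/4 * (1/2) ^ j" x] in "auto simp: cutj_def")

lemma nn_integral_squeeze_level:
 fixes f g :: "'b => real"
 assumes [measurable]: "g : borel_measurable M" and "0 < c" "!!x. f x <= (1 / c) * (g x)^2"
  and A: "A : sets M"
 shows "(\<integral>\<^sup>+x\<in>A. en (f x) \<partial>M) <= en (1 / c) * (\<integral>\<^sup>+x\<in>A. en ((g x)^2) \<partial>M)"
proof -
 have "(\<integral>\<^sup>+x\<in>A. en (f x) \<partial>M) <= (\<integral>\<^sup>+x. en (1 / c) * (en ((g x)^2) * ind A x) \<partial>M)"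
 proof (intro nn_integral_mono, goal_cases)
  case (1 x)
  have "en (f x) <= en (1 / c) * en ((g x)^2)"
  using ennreal_leI[OF assms(3)[of x]] assms(2) by (subst ennreal_mult[symmetric]) auto
  then show ?case
  by (cases "x : A") auto
 qed
 also have "... = en (1 / c) * (\<integral>\<^sup>+x\<in>A. en ((g x)^2) \<partial>M)"
  using A by (subst nn_integral_cmult) auto
 finally show ?thesis .
qed

section \<open>De Giorgi iteration\<close>

context nlsol
begin

definition kk :: "real => nat => real" where "kk k j = k * (1 - (1/2) ^ j)"
definition AA :: "real => nat => ennreal" where
 "AA k j = (INT+ t:{tt j..1}. (INT+ x:ball 0 (rr j). en ((VV (kk k j) t x)^2)))"
text \<open>The three summands stem from averaging over the initial time, from the Lipschitz
  constant of the cut-off, and from pairs separated by the gap. Their growth in \<open>j\<close> is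
  collected in \<open>b0\<close>: a factor 4 for the Lipschitz constants and level gaps, the power
  of 2 for the gap of the cut-offs.\<close>

definition EE :: "real => real" where "EE M0 = 8 + 32 * Lam * M0 + 8 * Lam * 4 powr (real DIM('a) + 2 * s)"
definition b0 :: real where "b0 = 4 * 2 powr (real DIM('a) + 2 * s)"

lemma VV_mono: "k <= k' ==> VV k' t x <= VV k t x" by (auto simp: VV_def)

text \<open>Where the higher truncation is positive, the lower one exceeds the gap between the two
  levels, so a first power may be replaced by a square divided by the gap.\<close>

lemma VV_step:
 assumes "0 < k"
 shows "VV (kk k (Suc j)) t x <= (1 / (k * (1/2) ^ Suc j)) * (VV (kk k j) t x)^2" "VV (kk k (Suc j)) t x <= VV (kk k j) t x"
proof -
 let ?c = "k * (1/2) ^ Suc j" and ?V = "VV (kk k (Suc j)) t x" and ?W = "VV (kk k j) t x"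
 have c: "0 < ?c" using assms by simp
 have kk: "kk k (Suc j) = kk k j + ?c" by (simp add: kk_def algebra_simps)
 show le: "?V <= ?W" by (rule VV_mono) (use c in "simp add: kk")
 show "?V <= (1 / ?c) * ?W^2"
 proof (cases "?V = 0")
  case False
  then have "?c <= ?W" unfolding VV_def kk by (auto simp: max_def split: if_splits)
  then have "?V * ?c <= ?W * ?W" using le by (intro mult_mono) (use c in auto)
  then show ?thesis using c by (simp add: field_simps power2_eq_square)
 qed (use c in simp)
qed

lemma EE_b0_bound:
 assumes "0 <= M0" "0 <= a0" "a0 <= k" "0 < k"
 shows "8 * 2 ^ j + 2 * (Lam * ((4 * 2 ^ j)^2 * M0)) + 2 * (2 * Lam / ((1/2) ^ j / 4) powr (real DIM('a) + 2 * s) * a0 * (1 / (k * (1/2) ^ Suc j)))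
  <= EE M0 * b0 ^ j"
proof -
 let ?p = "real DIM('a) + 2 * s"
 define P where "P = 2 powr ?p"
 have P1: "1 <= P" unfolding P_def using s by (intro one_le_powr) auto
 have Pj: "1 <= P ^ j" using P1 by (rule one_le_power)
 have g: "1 / ((1/2) ^ j / 4) powr ?p = 4 powr ?p * P ^ j"
 proof -
  have "((1/2::real) ^ j / 4) = 1 / (4 * 2 ^ j)" by (simp add: field_simps)
  then have "1 / ((1/2) ^ j / 4) powr ?p = (4 * 2 ^ j) powr ?p" by (simp add: powr_divide powr_mult)
  also have "... = 4 powr ?p * P ^ j"
  unfolding P_def by (simp add: powr_mult powr_power powr_powr mult.commute flip: powr_realpow)
  finally show ?thesis .
 qed
 have b: "b0 ^ j = 4 ^ j * P ^ j" by (simp add: b0_def P_def power_mult_distrib)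
 have 24: "(2::real) ^ j <= 4 ^ j" by (intro power_mono) auto
 have "8 * 2 ^ j <= 8 * (4 ^ j * P ^ j)"
  using mult_mono[OF 24 Pj] by simp
 moreover have "2 * (Lam * ((4 * 2 ^ j)^2 * M0)) <= 32 * Lam * M0 * (4 ^ j * P ^ j)"
 proof -
  have "(4 * 2 ^ j)^2 = 16 * (4::real) ^ j" by (simp add: power_mult_distrib power2_eq_square flip: power_mult_distrib)
  then have "2 * (Lam * ((4 * 2 ^ j)^2 * M0)) = 32 * Lam * M0 * (4 ^ j * 1)" by simp
  also have "... <= 32 * Lam * M0 * (4 ^ j * P ^ j)" using Pj assms by (intro mult_left_mono) auto
  finally show ?thesis .
 qed
 moreover have "2 * (2 * Lam / ((1/2) ^ j / 4) powr ?p * a0 * (1 / (k * (1/2) ^ Suc j))) <= 8 * Lam * 4 powr ?p * (4 ^ j * P ^ j)"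
 proof -
  have "2 * (2 * Lam / ((1/2) ^ j / 4) powr ?p * a0 * (1 / (k * (1/2) ^ Suc j)))
  = 4 * Lam * (1 / ((1/2) ^ j / 4) powr ?p) * (a0 / k) * (1 / (1/2) ^ Suc j)" by simp
  also have "... = 4 * Lam * (4 powr ?p * P ^ j) * (a0 / k) * (2 * 2 ^ j)" unfolding g by (simp add: power_one_over)
  also have "... <= 4 * Lam * (4 powr ?p * P ^ j) * 1 * (2 * 4 ^ j)"
  using assms 24 P1 by (intro mult_mono) auto
  finally show ?thesis by (simp add: mult_ac)
 qed
 ultimately show ?thesis unfolding EE_def b distrib_right by linarith
qed

text \<open>Energy at one level from the space-time L^2 norm at the level below. In the product of
  L^1 norms from \<open>Xn_split\<close> one factor is squeezed by \<open>VV_step\<close> and the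
  other is at most \<open>a0\<close>; since \<open>a0 <= k\<close>, the factor \<open>1 / k\<close>
  from the squeezing is compensated.\<close>

lemma dg_step:
 assumes M0: "0 <= M0" "!!x::'a. (INT+ y. en (min 1 ((norm (x - y))^2) * kern s x y)) <= en M0"
  and k: "0 < k" "0 <= a0" "a0 <= k"
  and a0: "!!t. t : G ==> 1/4 <= t ==> (INT+ x:ball 0 3. en (VV 0 t x)) <= en a0"
  and b: "b : G" "tt (Suc j) <= b"
 shows "(INT+ x. en ((VV (kk k (Suc j)) b x)^2 * (cutj j x)^2))
  + 2 * (en lam * (INT+ t:{tt (Suc j)..b}. gag s UNIV (%x. VV (kk k (Suc j)) t x * cutj j x)))
  <= en (EE M0 * b0 ^ j) * AA k j"
proof -
 let ?k = "kk k (Suc j)" and ?B = "ball (0::'a) (rr j)"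
 define ga where "ga = (1/2::real) ^ j / 4"
 define c where "c = k * (1/2) ^ Suc j"
 have ga: "0 < ga" by (simp add: ga_def)
 have c: "0 < c" using k by (simp add: c_def)
 have k0: "0 <= ?k" using k half_pow[of "Suc j"] by (simp add: kk_def)
 define Q where "Q = 2 * Lam / ga powr (real DIM('a) + 2 * s)"
 let ?E = "Lam * ((4 * 2 ^ j)^2 * M0) + Q * a0 * (1 / c)"
 have Q: "0 <= Q" by (simp add: Q_def)
 define S where "S t = (INT+ x:?B. en ((VV (kk k j) t x)^2))" for t
 have Sm[measurable]: "S : borelm" unfolding S_def by measurable
 have Xm[measurable]: "Xn 2 ?k (cutj j) : borelm"
  unfolding Xn_def using cutj_props(1)[where ?'a='a, measurable] by measurable
 have AAS: "AA k j = (INT+ t:{tt j..1}. S t)" by (simp add: AA_def S_def)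
 have supp2: "cutj j x = 0" if "2 <= norm x" for x :: 'a
  using that half_pow[of j] by (intro cutj_props(5)) auto
 have S2: "(INT+ x:?B. en ((VV ?k t x)^2)) <= S t" for t
  unfolding S_def by (intro nn_integral_mono mult_right_mono ennreal_leI power_mono VV_step(2) k) auto
 have first: "(INT+ x. en ((VV ?k t x)^2 * (cutj j x)^2)) <= S t" for t
 proof (rule order_trans[OF _ S2], intro nn_integral_mono)
  fix x :: 'a
  show "en ((VV ?k t x)^2 * (cutj j x)^2) <= en ((VV ?k t x)^2) * ind ?B x"
  proof (cases "x : ?B")
  case True
  have "(VV ?k t x)^2 * (cutj j x)^2 <= (VV ?k t x)^2 * 1"
  using cutj_props(3,4)[of j x] by (intro mult_left_mono) (auto simp: power_le_one)
  then show ?thesis using True by (auto intro: ennreal_leI)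
  next
  case False
  then have "1 + (1/2) ^ j <= norm x" by (simp add: rr_def)
  then have "cutj j x = 0" by (intro cutj_props(5)) (use half_pow(1)[of j] in linarith)
  then show ?thesis by simp
  qed
 qed
 have second: "Xn 2 ?k (cutj j) t <= en (?E) * S t"
  if t: "t : G" "1/4 <= t" for t
 proof -
  have "Xn 2 ?k (cutj j) t <= en (Lam * ((4 * 2 ^ j)^2 * M0)) * (INT+ x:?B. en ((VV ?k t x)^2))
  + en Q * ((INT+ x:?B. en (VV ?k t x)) * (INT+ x:ball 0 3. en (VV ?k t x)))"
  unfolding Q_def
  proof (rule Xn_split[OF M0 cutj_props(1,2,3,4,5)])
  show "1 + 3/4 * (1/2) ^ j + ga <= rr j" by (simp add: rr_def ga_def)
  show "1 <= 4 * (2::real) ^ j" by (simp add: order_trans[OF one_le_power[of 2 j]])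
  qed (use ga rr_bounds(2)[of j] in auto)
  also have "... <= en (Lam * ((4 * 2 ^ j)^2 * M0)) * S t + en Q * ((en (1 / c) * S t) * en a0)"
  proof (intro add_mono mult_left_mono mult_mono S2)
  show "(INT+ x:?B. en (VV ?k t x)) <= en (1 / c) * S t"
  unfolding S_def by (rule nn_integral_squeeze_level) (use c VV_step(1)[OF k(1), of j t] in "auto simp: c_def")
  have "(INT+ x:ball 0 3. en (VV ?k t x)) <= (INT+ x:ball 0 3. en (VV 0 t x))"
  by (intro nn_integral_mono mult_right_mono ennreal_leI VV_mono k0) auto
  also have "... <= en a0" by (rule a0[OF t])
  finally show "(INT+ x:ball 0 3. en (VV ?k t x)) <= en a0" .
  qed auto
  also have "... = en (?E) * S t"
  proof -
  define u where "u = Lam * ((4 * 2 ^ j)^2 * M0)"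
  have u: "0 <= u" using M0 by (simp add: u_def)
  have "en (Q * a0 * (1 / c)) = en Q * en a0 * en (1 / c)"
  using Q c k by (simp only: ennreal_mult mult_nonneg_nonneg divide_nonneg_pos zero_le_one)
  then have e: "en (u + Q * a0 * (1 / c)) = en u + en Q * en a0 * en (1 / c)"
  using u Q c k by (subst ennreal_plus) auto
  show ?thesis unfolding u_def[symmetric] e by (simp only: distrib_right) (simp only: mult_ac)
  qed
  finally show ?thesis .
 qed
 have Xint: "(INT+ t:{tt j..1}. Xn 2 ?k (cutj j) t) <= en (?E) * AA k j"
 proof -
  have "(INT+ t:{tt j..1}. Xn 2 ?k (cutj j) t) <= (INT+ t. en (?E) * (S t * ind {tt j..1} t))"
  proof (rule nn_integral_mono_AE, use G_AE in eventually_elim)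
  fix t assume *: "t : {0<..1} --> t : G"
  show "Xn 2 ?k (cutj j) t * ind {tt j..1} t <= en (?E) * (S t * ind {tt j..1} t)"
  proof (cases "t : {tt j..1}")
  case True
  then have "t : G" "1/4 <= t" using * tt_bounds(1)[of j] by auto
  from second[OF this] True show ?thesis by simp
  qed simp
  qed
  then show ?thesis by (simp add: nn_integral_cmult AAS)
 qed
 have "(INT+ x. en ((VV ?k b x)^2 * (cutj j x)^2))
  + 2 * (en lam * (INT+ t:{tt (Suc j)..b}. gag s UNIV (%x. VV ?k t x * cutj j x)))
  <= en (1 / (tt (Suc j) - tt j)) * (INT+ t:{tt j..1}. (INT+ x. en ((VV ?k t x)^2 * (cutj j x)^2)))
  + 2 * (INT+ t:{tt j..1}. Xn 2 ?k (cutj j) t)"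
  by (rule average_energy[OF _ _ k0 cutj_props(1,2,3,4) supp2])
  (use b tt_bounds[of j] in "auto simp: order_trans[OF one_le_power[of 2 j]]")
 also have "... <= en (8 * 2 ^ j) * AA k j + 2 * (en (?E) * AA k j)"
 proof (intro add_mono mult_left_mono Xint)
  have "1 / (tt (Suc j) - tt j) = 8 * 2 ^ j" unfolding tt_bounds(4) by (simp add: field_simps)
  moreover have "(INT+ t:{tt j..1}. (INT+ x. en ((VV ?k t x)^2 * (cutj j x)^2))) <= AA k j"
  unfolding AAS by (intro nn_integral_mono mult_right_mono first) simp
  ultimately show "en (1 / (tt (Suc j) - tt j)) * (INT+ t:{tt j..1}. (INT+ x. en ((VV ?k t x)^2 * (cutj j x)^2))) <= en (8 * 2 ^ j) * AA k j"
  by (simp add: mult_left_mono)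
 qed simp
 also have "... = en (8 * 2 ^ j + 2 * (Lam * ((4 * 2 ^ j)^2 * M0)) + 2 * (Q * a0 * (1 / c))) * AA k j"
 proof -
  define u v where "u = Lam * ((4 * 2 ^ j)^2 * M0)" and "v = Q * a0 * (1 / c)"
  have uv: "0 <= u" "0 <= v" using M0 Q c k by (auto simp: u_def v_def)
  have e: "en (8 * 2 ^ j + 2 * u + 2 * v) = en (8 * 2 ^ j) + 2 * en (u + v)"
  using uv by (simp add: ennreal_plus ennreal_mult distrib_left add_ac)
  show ?thesis unfolding u_def[symmetric] v_def[symmetric] e by (simp add: distrib_right mult.assoc)
 qed
 also have "... <= en (EE M0 * b0 ^ j) * AA k j"
  using EE_b0_bound[OF M0(1) k(2,3,1), of j] unfolding Q_def ga_def c_def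
  by (intro mult_right_mono ennreal_leI) auto
 finally show ?thesis .
qed

end

context nlsol
begin

lemma EE_pos: "0 <= M0 ==> 0 < EE M0"
 unfolding EE_def by (intro add_pos_nonneg) auto

lemma b0_gt_1: "1 < b0"
 using one_le_powr[of 2 "real DIM('a) + 2 * s"] s by (simp add: b0_def)

text \<open>Nash's inequality for the truncation two levels up. Its seminorm is controlled by the
  energy step from \<open>AA k (Suc j)\<close>. Its L^1 norm is squeezed into an L^2 norm at level
  \<open>Suc j\<close>, uniformly in time, which the energy step bounds by \<open>AA k j\<close>.
  The latter enters squared, and this superlinearity drives the decay.\<close>

lemma dg_gain:
 assumes M0: "0 <= M0" "!!x::'a. (INT+ y. en (min 1 ((norm (x - y))^2) * kern s x y)) <= en M0"
  and k: "0 < k" "0 <= a0" "a0 <= k"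
  and a0: "!!t. t : G ==> 1/4 <= t ==> (INT+ x:ball 0 3. en (VV 0 t x)) <= en a0"
  and r: "0 < r"
  and A: "AA k j <= en Aj" "AA k (Suc j) <= en Aj'" "0 <= Aj" "0 <= Aj'"
 shows "AA k (Suc (Suc j)) <= en (r powr (2 * s) / unit_ball_vol DIM('a) * (EE M0 * b0 ^ Suc j * Aj' / (2 * lam))
  + 2 / (unit_ball_vol DIM('a) * r ^ DIM('a)) * (1 / (k * (1/2) ^ Suc (Suc j)) * (EE M0 * b0 ^ j * Aj))^2)"
proof -
 let ?d = "DIM('a)"
 define v where "v = unit_ball_vol ?d"
 have v: "0 < v" by (simp add: v_def)
 define k2 where "k2 = kk k (Suc (Suc j))"
 define f where "f t x = VV k2 t x * cutj (Suc j) x" for t :: real and x :: 'a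
 note cm[measurable] = cutj_props(1)[where ?'a='a]
 have fm[measurable]: "(%x. f (h x) (w x)) : borel_measurable M" if [measurable]: "h : borel_measurable M" "w : borel_measurable M" for h w and M :: "'c measure"
  unfolding f_def by measurable
 have gm[measurable]: "(%t. gag s UNIV (f t)) : borelm" unfolding gag_def by measurable
 define c where "c = k * (1/2) ^ Suc (Suc j)"
 have c: "0 < c" using k by (simp add: c_def)
 have Epos: "0 <= EE M0 * b0 ^ i" for i using EE_pos[OF M0(1)] b0_gt_1 by simp
 have fnn: "0 <= f t x" for t x unfolding f_def using cutj_props(3) by (intro mult_nonneg_nonneg) auto
 define m where "m = 1 / c * (EE M0 * b0 ^ j * Aj)"
 have m0: "0 <= m" unfolding m_def by (rule mult_nonneg_nonneg[OF _ mult_nonneg_nonneg[OF Epos A(3)]]) (use c in simp)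
 have f1: "(INT+ x. en (f t x)) <= en m" if t: "t : G" "tt (Suc j) <= t" for t
 proof -
  have "(INT+ x. en (f t x)) <= (INT+ x:ball 0 (rr (Suc j)). en (VV k2 t x))"
  proof (intro nn_integral_mono)
  fix x :: 'a
  show "en (f t x) <= en (VV k2 t x) * ind (ball 0 (rr (Suc j))) x"
  proof (cases "x : ball 0 (rr (Suc j))")
  case True
  have "f t x <= VV k2 t x * 1" unfolding f_def using cutj_props(4) by (intro mult_left_mono) auto
  then show ?thesis using True by (simp add: ennreal_leI)
  next
  case False
  then have "1 + (1/2) ^ Suc j <= norm x" by (simp add: rr_def)
  then have "cutj (Suc j) x = 0" by (intro cutj_props(5)) (use half_pow(1)[of "Suc j"] in linarith)
  then show ?thesis by (simp add: f_def)
  qed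
  qed
  also have "... <= en (1 / c) * (INT+ x:ball 0 (rr (Suc j)). en ((VV (kk k (Suc j)) t x)^2))"
  unfolding k2_def by (rule nn_integral_squeeze_level) (use c VV_step(1)[OF k(1), of "Suc j" t] in "auto simp: c_def")
  also have "... <= en (1 / c) * (INT+ x. en ((VV (kk k (Suc j)) t x)^2 * (cutj j x)^2))"
  proof (intro mult_left_mono nn_integral_mono)
  fix x :: 'a
  show "en ((VV (kk k (Suc j)) t x)^2) * ind (ball 0 (rr (Suc j))) x <= en ((VV (kk k (Suc j)) t x)^2 * (cutj j x)^2)"
  using cutj_props(6)[of x j] by (cases "x : ball 0 (rr (Suc j))") auto
  qed simp
  also have "... <= en (1 / c) * (en (EE M0 * b0 ^ j) * AA k j)"
  proof (intro mult_left_mono)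
  have "(INT+ x. en ((VV (kk k (Suc j)) t x)^2 * (cutj j x)^2)) \<le>
  (INT+ x. en ((VV (kk k (Suc j)) t x)^2 * (cutj j x)^2))
  + 2 * (en lam * (INT+ u:{tt (Suc j)..t}. gag s UNIV (%x. VV (kk k (Suc j)) u x * cutj j x)))" by simp
  also have "... <= en (EE M0 * b0 ^ j) * AA k j" by (rule dg_step[OF M0 k a0 t])
  finally show "(INT+ x. en ((VV (kk k (Suc j)) t x)^2 * (cutj j x)^2)) <= en (EE M0 * b0 ^ j) * AA k j" .
  qed simp
  also have "... <= en (1 / c) * (en (EE M0 * b0 ^ j) * en Aj)" by (intro mult_left_mono A) auto
  also have "... = en m" using c Epos[of j] A by (simp only: m_def ennreal_mult mult_nonneg_nonneg divide_nonneg_pos zero_le_one)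
  finally show ?thesis .
 qed
 define E where "E = EE M0 * b0 ^ Suc j * Aj' / (2 * lam)"
 have E0: "0 <= E" unfolding E_def by (rule divide_nonneg_pos[OF mult_nonneg_nonneg[OF Epos A(4)]]) (use lam in simp)
 have gagint: "(INT+ t:{tt (Suc (Suc j))..1}. gag s UNIV (f t)) <= en E"
 proof -
  let ?I = "INT+ t:{tt (Suc (Suc j))..1}. gag s UNIV (f t)"
  have "en (2 * lam) * ?I = 2 * (en lam * ?I)" using lam by (simp add: ennreal_mult mult.assoc)
  also have "... <= en (EE M0 * b0 ^ Suc j) * AA k (Suc j)"
  proof -
  have "2 * (en lam * ?I) <= (INT+ x. en ((VV k2 1 x)^2 * (cutj (Suc j) x)^2)) + 2 * (en lam * ?I)" by simp
  also have "... <= en (EE M0 * b0 ^ Suc j) * AA k (Suc j)"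
  unfolding k2_def f_def by (rule dg_step[OF M0 k a0 G_1]) (use tt_bounds(2)[of "Suc (Suc j)"] in auto)
  finally show ?thesis .
  qed
  also have "... <= en (EE M0 * b0 ^ Suc j) * en Aj'" by (intro mult_left_mono A) auto
  finally have "en (1 / (2 * lam)) * (en (2 * lam) * ?I) <= en (1 / (2 * lam)) * (en (EE M0 * b0 ^ Suc j) * en Aj')"
  by (rule mult_left_mono) simp
  moreover have "en (1 / (2 * lam)) * (en (2 * lam) * z) = z" for z
  proof -
  have "en (1 / (2 * lam)) * en (2 * lam) = 1" using lam by (simp flip: ennreal_mult)
  then show ?thesis by (metis mult.assoc mult.left_neutral)
  qed
  moreover have "en (1 / (2 * lam)) * (en (EE M0 * b0 ^ Suc j) * en Aj') = en E"
  proof -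
  have "E = 1 / (2 * lam) * (EE M0 * b0 ^ Suc j * Aj')" by (simp add: E_def)
  then show ?thesis using Epos[of "Suc j"] A lam by (simp only: ennreal_mult mult_nonneg_nonneg divide_nonneg_pos zero_le_one mult_pos_pos zero_less_numeral)
  qed
  ultimately show ?thesis by simp
 qed
 define w where "w = 1 / (v * r ^ ?d)"
 have w: "0 < w" using v r by (simp add: w_def)
 have nash: "(INT+ x. en ((f t x)^2)) <= en (w * r powr (real ?d + 2 * s)) * gag s UNIV (f t) + en (2 * w * m^2)"
  if t: "t : G" "tt (Suc j) <= t" for t
 proof -
  let ?S = "INT+ x. en ((f t x)^2)"
  have "en (v * r ^ ?d) * ?S <= en (r powr (real ?d + 2 * s)) * gag s UNIV (f t) + 2 * (INT+ x. en (f t x))^2"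
  unfolding v_def by (rule nash_average[OF _ fnn r s(1)]) measurable
  also have "... <= en (r powr (real ?d + 2 * s)) * gag s UNIV (f t) + 2 * (en m)^2"
  by (intro add_left_mono mult_left_mono power_mono f1 t) auto
  also have "(en m)^2 = en (m^2)" using m0 by (simp add: ennreal_power)
  finally have "en w * (en (v * r ^ ?d) * ?S) <= en w * (en (r powr (real ?d + 2 * s)) * gag s UNIV (f t) + 2 * en (m^2))"
  by (rule mult_left_mono) simp
  moreover have "en w * (en (v * r ^ ?d) * z) = z" for z
  proof -
  have "en w * en (v * r ^ ?d) = 1" using v r by (simp add: w_def flip: ennreal_mult)
  then show ?thesis by (metis mult.assoc mult.left_neutral)
  qed
  moreover have "en w * (en (r powr (real ?d + 2 * s)) * gag s UNIV (f t) + 2 * en (m^2))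
  = en (w * r powr (real ?d + 2 * s)) * gag s UNIV (f t) + en (2 * w * m^2)"
  using w by (simp add: distrib_left ennreal_mult mult_ac)
  ultimately show ?thesis by simp
 qed
 have "AA k (Suc (Suc j)) <= (INT+ t. en (w * r powr (real ?d + 2 * s)) * (gag s UNIV (f t) * ind {tt (Suc (Suc j))..1} t) + en (2 * w * m^2) * ind {tt (Suc (Suc j))..1} t)"
  unfolding AA_def
 proof (rule nn_integral_mono_AE, use G_AE in eventually_elim)
  fix t assume *: "t : {0<..1} --> t : G"
  show "(INT+ x:ball 0 (rr (Suc (Suc j))). en ((VV (kk k (Suc (Suc j))) t x)^2)) * ind {tt (Suc (Suc j))..1} t
  <= en (w * r powr (real ?d + 2 * s)) * (gag s UNIV (f t) * ind {tt (Suc (Suc j))..1} t) + en (2 * w * m^2) * ind {tt (Suc (Suc j))..1} t"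
  proof (cases "t : {tt (Suc (Suc j))..1}")
  case True
  then have t: "t : G" "tt (Suc j) <= t" using * tt_bounds(1)[of "Suc (Suc j)"] tt_bounds(3)[of "Suc j"] by auto
  have "(INT+ x:ball 0 (rr (Suc (Suc j))). en ((VV (kk k (Suc (Suc j))) t x)^2)) <= (INT+ x. en ((f t x)^2))"
  proof (intro nn_integral_mono, goal_cases)
  case (1 x)
  show ?case
  using cutj_props(6)[of x "Suc j"] by (cases "x : ball 0 (rr (Suc (Suc j)))") (auto simp: f_def k2_def)
  qed
  with nash[OF t] True show ?thesis by (auto intro: order_trans)
  qed simp
 qed
 also have "... = en (w * r powr (real ?d + 2 * s)) * (INT+ t:{tt (Suc (Suc j))..1}. gag s UNIV (f t)) + en (2 * w * m^2) * en (1 - tt (Suc (Suc j)))"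
  using tt_bounds(2)[of "Suc (Suc j)"] by (simp add: nn_integral_add nn_integral_cmult nn_integral_cmult_indicator)
 also have "... <= en (w * r powr (real ?d + 2 * s)) * en E + en (2 * w * m^2) * en 1"
  using tt_bounds(1)[of "Suc (Suc j)"] by (intro add_mono mult_left_mono gagint ennreal_leI) auto
 also have "... = en (w * r powr (real ?d + 2 * s) * E + 2 * w * m^2)"
  using w E0 by (simp add: ennreal_plus ennreal_mult)
 also have "w * r powr (real ?d + 2 * s) = r powr (2 * s) / v"
  using r v by (simp add: w_def powr_add powr_realpow)
 finally show ?thesis unfolding w_def v_def E_def m_def c_def by simp
qed

text \<open>The exponent that expresses \<open>r ^ d\<close> as a power of
  \<open>r powr (2 * s)\<close>; the radius is chosen through the latter.\<close>

definition theta :: real where "theta = real DIM('a) / (2 * s)"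
text \<open>The decay rate of the iteration. It solves
  \<open>4 * b0^2 * beta * b0 powr theta = 1\<close>, which removes all growth in \<open>j\<close>
  from the quadratic term, and it satisfies \<open>b0 * beta < 1\<close>, so that the decay survives
  the loss in a final energy step.\<close>

definition beta :: real where "beta = 1 / (4 * b0^2 * b0 powr theta)"
text \<open>Chosen so that the seminorm term of \<open>dg_gain\<close> is exactly half of the next
  target value.\<close>

definition kappa :: "real => real" where "kappa M0 = lam * unit_ball_vol DIM('a) * beta / EE M0"
text \<open>Chosen so that the quadratic term of \<open>dg_gain\<close> is the other half; this is
  the smallness that the initial norm must have.\<close>

definition eps :: "real => real" where
 "eps M0 = beta^2 * unit_ball_vol DIM('a) * kappa M0 powr theta / (64 * (EE M0)^2 * b0 powr theta)"

lemma beta_props: "0 < beta" "b0 * beta < 1" "beta < 1"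
proof -
 have b: "1 < b0" by (rule b0_gt_1)
 have t: "0 <= theta" using s by (simp add: theta_def)
 have p: "1 <= b0 powr theta" by (rule one_le_powr) (use b t in auto)
 show 0: "0 < beta" using b by (simp add: beta_def)
 have "b0 * 1 < b0 * (4 * (b0 * b0 powr theta))"
 proof (intro mult_strict_left_mono)
  have "1 * 1 <= b0 * b0 powr theta" using b p by (intro mult_mono) auto
  then show "1 < 4 * (b0 * b0 powr theta)" by simp
 qed (use b in simp)
 then show 1: "b0 * beta < 1" using b by (simp add: beta_def power2_eq_square field_simps)
 have "beta * 1 < beta * b0" using 0 b by (intro mult_strict_left_mono) auto
 then show "beta < 1" using 1 by (simp add: mult.commute)
qed

text \<open>Because \<open>dg_gain\<close> looks two levels back, the induction carries two
  consecutive bounds. With the radius determined below, both terms of \<open>dg_gain\<close> equal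
  one half of the claimed bound.\<close>

lemma dg_decay:
 assumes M0: "0 <= M0" "!!x::'a. (INT+ y. en (min 1 ((norm (x - y))^2) * kern s x y)) <= en M0"
  and k: "0 < k" "0 <= a0" "a0 <= k"
  and a0: "!!t. t : G ==> 1/4 <= t ==> (INT+ x:ball 0 3. en (VV 0 t x)) <= en a0"
  and N2: "(INT+ t:{1/4..1}. (sqb 2 (VV 0 t))) <= en (eps M0 * beta * k^2)"
 shows "AA k j <= en (eps M0 * k^2 * beta ^ j) \<and> AA k (Suc j) <= en (eps M0 * k^2 * beta ^ Suc j)"
proof (induction j)
 let ?v = "unit_ball_vol DIM('a)"
 note E = EE_pos[OF M0(1)]
 have v: "0 < ?v" by simp
 have kap0: "0 < kappa M0" using lam v beta_props E by (simp add: kappa_def)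
 have eps0: "0 < eps M0" using v beta_props E kap0 b0_gt_1 by (simp add: eps_def)
 \<comment> \<open>The hypothesis contains one factor \<open>beta\<close> more than stage 0
   requires, so this single bound starts both stages 0 and 1.\<close>
 have AN: "AA k j <= en (eps M0 * beta * k^2)" for j
 proof (rule order_trans[OF _ N2])
  have kk0: "0 <= kk k j" using k half_pow[of j] by (simp add: kk_def)
  have S: "(INT+ x:ball 0 (rr j). en ((VV (kk k j) t x)^2)) <= (sqb 2 (VV 0 t))" for t
  using rr_bounds(2)[of j] VV_mono[OF kk0, of t] by (intro nn_integral_mono mult_mono ennreal_leI power_mono) (auto simp: indicator_def)
  show "AA k j <= (INT+ t:{1/4..1}. (sqb 2 (VV 0 t)))"
  unfolding AA_def
  proof (rule nn_integral_mono, goal_cases)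
  case (1 t)
  show ?case
  by (rule mult_mono[OF S]) (use tt_bounds(1)[of j] in "auto simp: indicator_def")
  qed
 qed
 case 0
 have "eps M0 * beta * k^2 <= eps M0 * 1 * k^2" using beta_props eps0 by (intro mult_right_mono mult_left_mono) auto
 then show ?case using AN[of 0] AN[of "Suc 0"] by (auto intro: order_trans ennreal_leI simp: mult_ac)
next
 case (Suc j)
 let ?v = "unit_ball_vol DIM('a)"
 note E = EE_pos[OF M0(1)]
 have v: "0 < ?v" by simp
 then have v': "?v \<noteq> 0" by linarith
 have b: "1 < b0" by (rule b0_gt_1)
 have kap0: "0 < kappa M0" using lam v beta_props E by (simp add: kappa_def)
 have eps0: "0 < eps M0" using v beta_props E kap0 b by (simp add: eps_def)
 \<comment> \<open>\<open>x\<close> is the value wanted for \<open>r powr (2 * s)\<close>: its decay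
   in \<open>j\<close> compensates the factor \<open>b0 ^ Suc j\<close> of the energy step.\<close>
 define x where "x = kappa M0 / b0 ^ Suc j"
 have x: "0 < x" using kap0 b by (simp add: x_def)
 define r where "r = x powr (1 / (2 * s))"
 have r: "0 < r" using x by (simp add: r_def)
 have r1: "r powr (2 * s) = x" using s x by (simp add: r_def powr_powr)
 have rd: "r ^ DIM('a) = x powr theta"
 proof -
  have "r ^ DIM('a) = r powr real DIM('a)" using r by (simp add: powr_realpow)
  also have "... = x powr theta" by (simp add: r_def powr_powr theta_def)
  finally show ?thesis .
 qed
 have xt: "x powr theta = kappa M0 powr theta / (b0 powr theta) ^ Suc j"
 proof -
  have "(b0 ^ Suc j) powr theta = (b0 powr real (Suc j)) powr theta" using b by (subst powr_realpow) auto
  also have "... = (b0 powr theta) powr real (Suc j)" by (simp only: powr_powr mult.commute)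
  also have "... = (b0 powr theta) ^ Suc j" using b by (subst powr_realpow) auto
  finally show ?thesis using kap0 b by (simp only: x_def powr_divide less_imp_le)
 qed
 let ?e = "eps M0 * k^2"
 let ?G = "1 / (k * (1/2) ^ Suc (Suc j)) * (EE M0 * b0 ^ j * (?e * beta ^ j))"
 have IH: "AA k j <= en (?e * beta ^ j)" "AA k (Suc j) <= en (?e * beta ^ Suc j)" using Suc by auto
 have nn: "0 <= ?e * beta ^ i" for i using eps0 beta_props by simp
 have first: "r powr (2 * s) / ?v * (EE M0 * b0 ^ Suc j * (?e * beta ^ Suc j) / (2 * lam)) = ?e * beta ^ Suc (Suc j) / 2"
  unfolding r1 x_def kappa_def using b E v' lam by (simp add: field_simps)
 have second: "2 / (?v * r ^ DIM('a)) * (?G)^2 = ?e * beta ^ Suc (Suc j) / 2"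
 proof -
  have sq: "(?G)^2
  = 16 * (EE M0)^2 * eps M0 * (4 * b0^2 * beta) ^ j * (?e * beta ^ j)"
  proof -
  have "1 / (k * (1/2) ^ Suc (Suc j)) * (EE M0 * b0 ^ j * (?e * beta ^ j)) = 4 * EE M0 * eps M0 * k * ((2 * b0 * beta) ^ j)"
  using k by (simp add: power_mult_distrib power2_eq_square power_one_over field_simps)
  then have "(?G)^2 = (4 * EE M0 * eps M0 * k * ((2 * b0 * beta) ^ j))^2" by simp
  also have "... = 16 * (EE M0)^2 * eps M0 * (?e * ((2 * b0 * beta)^2) ^ j)"
  proof -
  have "((2 * b0 * beta)^2) ^ j = ((2 * b0 * beta) ^ j)^2" by (simp only: power_mult[symmetric] mult.commute)
  then show ?thesis by (simp add: power2_eq_square)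
  qed
  also have "(2 * b0 * beta)^2 = (4 * b0^2 * beta) * beta" by (simp add: power2_eq_square)
  finally show ?thesis by (simp add: power_mult_distrib)
  qed
  have one: "(4 * b0^2 * beta) ^ j * (b0 powr theta) ^ j = 1"
  proof -
  have "4 * b0^2 * beta * b0 powr theta = 1" unfolding beta_def using b by simp
  then show ?thesis by (metis power_mult_distrib power_one)
  qed
  have kp: "0 < kappa M0 powr theta" "0 < b0 powr theta" using kap0 b by auto
  have "2 / (?v * r ^ DIM('a)) * (?G)^2
  = 2 / ?v * ((b0 powr theta) ^ Suc j / kappa M0 powr theta) * (16 * (EE M0)^2 * eps M0 * (4 * b0^2 * beta) ^ j * (?e * beta ^ j))"
  unfolding sq rd xt by simp
  also have "... = (32 / ?v * (EE M0)^2 * b0 powr theta / kappa M0 powr theta * eps M0) * ((4 * b0^2 * beta) ^ j * (b0 powr theta) ^ j) * (?e * beta ^ j)"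
  by simp
  also have "32 / ?v * (EE M0)^2 * b0 powr theta / kappa M0 powr theta * eps M0 = beta^2 / 2"
  unfolding eps_def using v' E kp by (simp add: field_simps)
  finally show ?thesis unfolding one by (simp add: power2_eq_square)
 qed
 have "AA k (Suc (Suc j)) <= en (r powr (2 * s) / ?v * (EE M0 * b0 ^ Suc j * (?e * beta ^ Suc j) / (2 * lam))
  + 2 / (?v * r ^ DIM('a)) * (?G)^2)"
  by (rule dg_gain[OF M0 k a0 r IH nn nn])
 also have "... = en (?e * beta ^ Suc (Suc j))" by (simp only: first second field_sum_of_halves)
 finally show ?case using IH by simp
qed

text \<open>One last energy step evaluates the iteration at the single time 1: it costs
  \<open>b0 ^ j\<close>, which the rate \<open>beta ^ j\<close> still beats. All levels lie below
  \<open>k\<close>, so the truncation at \<open>k\<close> vanishes almost everywhere in the unit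
  ball.\<close>

lemma dg_bound:
 assumes M0: "0 <= M0" "!!x::'a. (INT+ y. en (min 1 ((norm (x - y))^2) * kern s x y)) <= en M0"
  and k: "0 < k" "0 <= a0" "a0 <= k"
  and a0: "!!t. t : G ==> 1/4 <= t ==> (INT+ x:ball 0 3. en (VV 0 t x)) <= en a0"
  and N2: "(INT+ t:{1/4..1}. (sqb 2 (VV 0 t))) <= en (eps M0 * beta * k^2)"
 shows "AEL x. x : ball 0 1 --> U 1 x <= hN 1 + k"
proof -
 note E = EE_pos[OF M0(1)]
 let ?I = "INT+ x:ball 0 1. en ((VV k 1 x)^2)"
 have le: "?I <= en (EE M0 * (eps M0 * k^2) * (b0 * beta) ^ j)" for j
 proof -
  have kk1: "kk k (Suc j) <= k" using k half_pow[of "Suc j"] by (simp add: kk_def mult_left_le)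
  have "?I <= (INT+ x. en ((VV (kk k (Suc j)) 1 x)^2 * (cutj j x)^2))"
  proof (intro nn_integral_mono, goal_cases)
  case (1 x)
  show ?case
  using cutj_props(6)[of x j] rr_bounds(1)[of "Suc j"] VV_mono[OF kk1, of 1 x]
  by (cases "x : ball 0 1") (auto intro!: ennreal_leI power_mono)
  qed
  also have "... <= ... + 2 * (en lam * (INT+ t:{tt (Suc j)..1}. gag s UNIV (%x. VV (kk k (Suc j)) t x * cutj j x)))" by simp
  also have "... <= en (EE M0 * b0 ^ j) * AA k j"
  by (rule dg_step[OF M0 k a0 G_1]) (use tt_bounds(2)[of "Suc j"] in auto)
  also have "... <= en (EE M0 * b0 ^ j) * en (eps M0 * k^2 * beta ^ j)"
  using dg_decay[OF M0 k a0 N2, of j] by (intro mult_left_mono) auto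
  also have "... = en (EE M0 * (eps M0 * k^2) * (b0 * beta) ^ j)"
  using E b0_gt_1 by (subst ennreal_mult'[symmetric]) (auto simp: power_mult_distrib mult_ac)
  finally show ?thesis .
 qed
 have "(%j. (b0 * beta) ^ j) ~~> 0"
  using beta_props b0_gt_1 by (intro LIMSEQ_realpow_zero) auto
 then have "(%j. en (EE M0 * (eps M0 * k^2) * (b0 * beta) ^ j)) ~~> en (EE M0 * (eps M0 * k^2) * 0)"
  by (intro tendsto_ennrealI tendsto_mult tendsto_const)
 then have "(%j. en (EE M0 * (eps M0 * k^2) * (b0 * beta) ^ j)) ~~> 0" by simp
 from LIMSEQ_le_const[OF this, of ?I] le have "?I <= 0" by blast
 then have "?I = 0" by simp
 then have "AEL x. en ((VV k 1 x)^2) * ind (ball 0 1) x = 0"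
  by (subst (asm) nn_integral_0_iff_AE) auto
 then show ?thesis
  by eventually_elim (auto simp: VV_def indicator_def max_def split: if_splits)
qed

end

context nlsol
begin

text \<open>\<open>C1\<close> accounts for the total rise of the level. In the bracket, the first
  two terms make \<open>k\<close> dominate the uniform L^1 bound, and the last makes the initial
  norm small relative to \<open>k\<close>.\<close>

definition Cb :: "real => real" where
 "Cb M0 = C1 + (unit_ball_vol DIM('a) * 3 ^ DIM('a) + (4 + 2 * Lam * M0) + 1 / sqrt (eps M0 * beta))"

lemma eps_pos: "0 <= M0 ==> 0 < eps M0"
proof -
 assume "0 <= M0"
 then have "0 < EE M0" by (rule EE_pos)
 moreover from this have "0 < kappa M0" using lam beta_props by (simp add: kappa_def)
 ultimately show ?thesis using beta_props b0_gt_1 by (simp add: eps_def)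
qed

text \<open>The iteration asks for an L^1 bound that is uniform in time, whereas only space-time
  norms are given. One preliminary energy estimate on a larger ball provides an L^2 bound for every
  time in \<open>G\<close> from 1/4 on, and Young's inequality with parameter \<open>n\<close> turns
  it into an L^1 bound linear in \<open>n\<close>.\<close>

lemma local_bound:
 assumes M0: "0 <= M0" "!!x::'a. (INT+ y. en (min 1 ((norm (x - y))^2) * kern s x y)) <= en M0"
  and n: "0 < n" and N2: "(INT+ t:{0<..1}. (INT+ x:ball 0 5. en ((max 0 (U t x))^2))) <= en (n^2)"
  and n': "0 <= n'" "(INT+ t:{0<..1}. (INT+ x. en (max 0 (U t x) * rho s x))) <= en n'"
 shows "AEL x. x : ball 0 1 --> U 1 x <= Cb M0 * (n + n')"
proof -
 define v where "v = unit_ball_vol DIM('a) * 3 ^ DIM('a)"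
 have v0: "0 <= v" by (simp add: v_def)
 have vol3: "emeasure lborel (ball (0::'a) 3) = en v" unfolding v_def by (rule emeasure_ball) simp
 define C2 where "C2 = 4 + 2 * Lam * M0"
 have C2: "0 <= C2" using M0 by (simp add: C2_def)
 \<comment> \<open>Equal to 1 on the ball of radius 3 and zero from radius 4 on; its near field is
   the ball of radius 5, which is why the hypothesis uses that ball.\<close>
 let ?et = "cut 4 1 :: 'a => real"
 note cp = cut_props[where ga=1 and r=4, simplified]
 have V0: "VV 0 t x <= max 0 (U t x)" for t x by (rule VV_le) simp
 define S where "S t = (sqb 5 (VV 0 t))" for t
 have Sm[measurable]: "S : borelm" unfolding S_def by measurable
 have SN: "(INT+ t:{0..1}. S t) <= en (n^2)"
 proof (rule order_trans[OF _ N2], rule nn_integral_mono_AE, use AE_lborel_singleton[of "0::real"] in eventually_elim)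
  fix t :: real assume "t \<noteq> 0"
  have "S t <= (INT+ x:ball 0 5. en ((max 0 (U t x))^2))"
  unfolding S_def by (intro nn_integral_mono mult_right_mono ennreal_leI power_mono V0) auto
  then show "S t * ind {0..1} t <= (INT+ x:ball 0 5. en ((max 0 (U t x))^2)) * ind {0<..1} t"
  using \<open>t \<noteq> 0\<close> by (auto simp: indicator_def)
 qed
 have L2: "(sqb 3 (VV 0 b)) <= en (C2 * n^2)" if b: "b : G" "1/4 <= b" for b
 proof -
  have "(sqb 3 (VV 0 b)) <= (INT+ x. en ((VV 0 b x)^2 * (?et x)^2))"
  proof (intro nn_integral_mono, goal_cases)
  case (1 x)
  show ?case
  using cp(5)[of x] by (cases "x : ball 0 3") auto
  qed
  also have "... <= ... + 2 * (en lam * (INT+ t:{1/4..b}. gag s UNIV (%x. VV 0 t x * ?et x)))" by simp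
  also have "... <= en (1 / (1/4 - 0)) * (INT+ t:{0..1}. (INT+ x. en ((VV 0 t x)^2 * (?et x)^2))) + 2 * (INT+ t:{0..1}. Xn 4 0 ?et t)"
  by (rule average_energy[where L=1]) (use cp b in auto)
  also have "... <= en (1 / (1/4 - 0)) * (INT+ t:{0..1}. S t) + 2 * (INT+ t. en (Lam * M0) * (S t * ind {0..1} t))"
  proof (intro add_mono mult_left_mono nn_integral_mono)
  fix t
  show "(INT+ x. en ((VV 0 t x)^2 * (?et x)^2)) * ind {0..1} t <= S t * ind {0..1} t"
  unfolding S_def
  proof (intro mult_right_mono nn_integral_mono)
  fix x :: 'a
  have "(VV 0 t x)^2 * (?et x)^2 <= (VV 0 t x)^2 * 1"
  using cp(2,3)[of x] by (intro mult_left_mono) (auto simp: power_le_one)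
  then show "en ((VV 0 t x)^2 * (?et x)^2) <= en ((VV 0 t x)^2) * ind (ball 0 5) x"
  using cp(4)[of x] by (cases "x : ball 0 5") (auto intro: ennreal_leI)
  qed simp
  have "Xn 4 0 ?et t <= en (Lam * (1^2 * M0)) * (INT+ x:ball 0 (4 + 1). en ((VV 0 t x)^2))"
  unfolding Xn_def by (rule moment_pair[OF M0]) (use cp(1-3) in auto)
  then have "Xn 4 0 ?et t <= en (Lam * M0) * S t" by (simp add: S_def)
  then show "Xn 4 0 ?et t * ind {0..1} t <= en (Lam * M0) * (S t * ind {0..1} t)"
  by (simp add: mult_right_mono mult.assoc[symmetric])
  qed auto
  also have "... = en C2 * (INT+ t:{0..1}. S t)"
  proof -
  have e: "en C2 = en 4 + 2 * en (Lam * M0)" using M0 by (simp add: C2_def ennreal_plus ennreal_mult mult.assoc)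
  show ?thesis unfolding e by (simp add: nn_integral_cmult distrib_right mult.assoc)
  qed
  also have "... <= en C2 * en (n^2)" by (intro mult_left_mono SN) simp
  also have "... = en (C2 * n^2)" using C2 by (simp add: ennreal_mult)
  finally show ?thesis .
 qed
 define a0 where "a0 = (v + C2) * n"
 have a0: "0 <= a0" using v0 C2 n by (simp add: a0_def)
 have L1: "(INT+ x:ball 0 3. en (VV 0 b x)) <= en a0" if b: "b : G" "1/4 <= b" for b
 proof -
  have "(INT+ x:ball 0 3. en (VV 0 b x)) <= (INT+ x. en n * ind (ball 0 3) x + en (1 / n) * (en ((VV 0 b x)^2) * ind (ball 0 3) x))"
  proof (intro nn_integral_mono, goal_cases)
  case (1 x)
  have "VV 0 b x <= n + (1 / n) * (VV 0 b x)^2" using mult_le_weighted_squares[OF n, of 1 "VV 0 b x"] by simp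
  then have "en (VV 0 b x) <= en (n + (1 / n) * (VV 0 b x)^2)" by (rule ennreal_leI)
  also have "... = en n + en (1 / n) * en ((VV 0 b x)^2)" using n by (simp flip: ennreal_plus ennreal_mult)
  finally show ?case
  by (cases "x : ball 0 3") auto
  qed
  also have "... = en n * en v + en (1 / n) * (sqb 3 (VV 0 b))"
  by (simp add: nn_integral_add nn_integral_cmult nn_integral_cmult_indicator vol3)
  also have "... <= en n * en v + en (1 / n) * en (C2 * n^2)"
  by (intro add_left_mono mult_left_mono L2 b) auto
  also have "... = en (n * v + (1 / n) * (C2 * n^2))" using n v0 C2 by (simp flip: ennreal_plus ennreal_mult)
  also have "n * v + (1 / n) * (C2 * n^2) = a0" using n by (simp add: a0_def power2_eq_square algebra_simps)
  finally show ?thesis .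
 qed
 \<comment> \<open>Solves \<open>eps M0 * beta * (d * n)^2 = n^2\<close>, the smallness condition of
   the iteration for a level at least \<open>d * n\<close>.\<close>
 define d where "d = 1 / sqrt (eps M0 * beta)"
 have eb: "0 < eps M0 * beta" using eps_pos[OF M0(1)] beta_props(1) by simp
 have d: "0 < d" using eb by (simp add: d_def)
 define k where "k = (v + C2 + d) * n"
 have k: "0 < k" "a0 <= k" using v0 C2 d n by (auto simp: k_def a0_def)
 have bd: "AEL x. x : ball 0 1 --> U 1 x <= hN 1 + k"
 proof (rule dg_bound[OF M0 k(1) a0 k(2) L1])
  have "(INT+ t:{1/4..1}. (sqb 2 (VV 0 t))) <= (INT+ t:{0..1}. S t)"
  proof (rule nn_integral_mono, goal_cases)
  case (1 t)
  have "(sqb 2 (VV 0 t)) <= S t"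
  unfolding S_def by (intro nn_integral_mono mult_left_mono) (auto simp: indicator_def)
  then show ?case
  by (auto simp: indicator_def)
  qed
  also have "... <= en (n^2)" by (rule SN)
  also have "n^2 <= eps M0 * beta * k^2"
  proof -
  have "d * n <= k" using v0 C2 n by (simp add: k_def)
  then have "(d * n)^2 <= k^2" using d n by (intro power_mono) auto
  then have "eps M0 * beta * (d * n)^2 <= eps M0 * beta * k^2" using eb by (intro mult_left_mono) auto
  moreover have "eps M0 * beta * (d * n)^2 = n^2" using eb eps_pos[OF M0(1)] beta_props(1)
  by (simp add: d_def power_mult_distrib power_divide less_imp_neq[symmetric])
  ultimately show ?thesis by simp
  qed
  finally show "(INT+ t:{1/4..1}. (sqb 2 (VV 0 t))) <= en (eps M0 * beta * k^2)"
  by (simp add: ennreal_leI)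
 qed
 have kb: "hN 1 + k <= Cb M0 * (n + n')"
 proof -
  have "en (hN 1) <= en (C1 * n')"
  unfolding hN_1 using n' C1_pos by (simp add: ennreal_mult mult_left_mono Np_def)
  then have "hN 1 <= C1 * n'" using n' C1_pos by (simp add: ennreal_le_iff)
  moreover have "C1 * n' + k <= Cb M0 * (n + n')"
  proof -
  have "Cb M0 = C1 + (v + C2 + d)" by (simp add: Cb_def v_def C2_def d_def)
  moreover have "0 <= C1 * n" "0 <= (v + C2 + d) * n'" using C1_pos n n' v0 C2 d by auto
  ultimately show ?thesis by (simp add: k_def algebra_simps)
  qed
  ultimately show ?thesis by linarith
 qed
 from bd show ?thesis by eventually_elim (use kb in auto)
qed

end

theorem local_boundedness:
 assumes s: "0 < s" "s < 1" and lam: "0 < lam" "lam <= Lam"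
 obtains C where "0 < C" "!!(U :: real => 'a::euclidean_space => real) kap G n n'. nlsol s lam Lam U kap G ==> 0 < n ==> 0 <= n' ==>
  (INT+ t:{0<..1}. (INT+ x:ball 0 5. en ((max 0 (U t x))^2))) <= en (n^2) ==>
  (INT+ t:{0<..1}. (INT+ x. en (max 0 (U t x) * rho s x))) <= en n' ==>
  AEL x. x : ball 0 1 --> U 1 x <= C * (n + n')"
proof -
 obtain M0 where M0: "0 < M0" "!!x::'a. (INT+ y. en (min 1 ((norm (x - y))^2) * kern s x y)) <= en M0"
  using kern_moment[OF s] by metis
 \<comment> \<open>\<open>Cb\<close> is built from the parameters and the kernel moment alone, so it
   can be fixed before any solution is introduced.\<close>
 define C where "C = max 1 (nlsol.Cb TYPE('a) s lam Lam M0)"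
 show thesis
 proof (rule that)
  show "0 < C" by (simp add: C_def)
  fix U :: "real => 'a => real" and kap G n n'
  assume sol: "nlsol s lam Lam U kap G" and n: "0 < n" "0 <= n'"
  and N: "(INT+ t:{0<..1}. (INT+ x:ball 0 5. en ((max 0 (U t x))^2))) <= en (n^2)"
  "(INT+ t:{0<..1}. (INT+ x. en (max 0 (U t x) * rho s x))) <= en n'"
  interpret nlsol s lam Lam U kap G by fact
  have "Cb M0 * (n + n') <= C * (n + n')" using n unfolding C_def by (intro mult_right_mono) auto
  with local_bound[OF less_imp_le[OF M0(1)] M0(2) n(1) N(1) n(2) N(2)]
  show "AEL x. x : ball 0 1 --> U 1 x <= C * (n + n')" by (auto elim!: eventually_mono)
 qed
qed

section \<open>Translations and dilations\<close>

lemma ennreal_cmult_finiteD: "en c * z < inft ==> 0 < c ==> z < inft"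
 by (auto simp: ennreal_mult_less_top)

text \<open>The form sees only differences, so constants drop out of it, and reversing the sign is
  harmless because \<open>slice\<close> is an equality. Upper bounds for \<open>c - U\<close> are
  lower bounds for \<open>U\<close>.\<close>

lemma nlsol_const_minus:
 assumes "nlsol s lam Lam (U :: real => 'a::euclidean_space => real) kap G"
 shows "nlsol s lam Lam (%t x. c - U t x) kap G"
proof -
 interpret nlsol s lam Lam U kap G by fact
 have vol: "\<exists>v\<ge>0. emeasure lborel (ball (0::'a) R) = en v" for R
  using emeasure_lborel_ball_finite[of "0::'a" R] by (metis ennreal_finiteE infinity_ennreal_def)
 show ?thesis
 proof
  show "\<exists>C. \<forall>t\<in>G. (INT+ x:ball 0 R. en ((c - U t x)^2)) <= en C" for R
  proof -
  obtain C where C: "!!t. t : G ==> (sqb R (U t)) <= en C" using L2_bound[of R] by blast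
  obtain v where v: "0 <= v" "emeasure lborel (ball (0::'a) R) = en v" using vol by blast
  have "(INT+ x:ball 0 R. en ((c - U t x)^2)) <= en (2 * c^2 * v + 2 * max C 0)" if t: "t : G" for t
  proof -
  have "(INT+ x:ball 0 R. en ((c - U t x)^2))
  <= (INT+ x. en (2 * c^2) * ind (ball 0 R) x + 2 * (en ((U t x)^2) * ind (ball 0 R) x))"
  proof (intro nn_integral_mono, goal_cases)
  case (1 x)
  have "(c - U t x)^2 <= 2 * c^2 + 2 * (U t x)^2"
  using zero_le_power2[of "c + U t x"] by (simp add: power2_eq_square algebra_simps)
  then have "en ((c - U t x)^2) <= en (2 * c^2 + 2 * (U t x)^2)" by (rule ennreal_leI)
  also have "... = en (2 * c^2) + 2 * en ((U t x)^2)" by (simp add: ennreal_mult)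
  finally show ?case
  by (cases "x : ball 0 R") auto
  qed
  also have "... = en (2 * c^2) * en v + 2 * (sqb R (U t))"
  by (simp add: nn_integral_add nn_integral_cmult nn_integral_cmult_indicator v)
  also have "... <= en (2 * c^2) * en v + 2 * en (max C 0)"
  by (intro add_left_mono mult_left_mono order_trans[OF C[OF t] ennreal_leI]) auto
  also have "... = en (2 * c^2 * v + 2 * max C 0)" using v by (simp add: ennreal_plus ennreal_mult)
  finally show ?thesis .
  qed
  then show ?thesis by blast
  qed
  show "(%n. INT+ x:ball 0 R. en ((c - U (tu n) x - (c - U t x))^2)) ~~> 0"
  if "t : G" "!!n. tu n : G" "tu ~~> t" for t tu R
  using L2_cont[OF that, of R] by (simp add: power2_commute)
  show "(INT+ t:{0<..1}. gag s (ball 0 R) (%x. c - U t x)) < inft" for R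
  using Hs_fin[of R] by (simp add: gag_def power2_commute)
  show "(INT+ t:{0<..1}. (INT+ x. en (<|c - U t x|> * rho s x))) < inft"
  proof -
  obtain r where r: "0 <= r" "(INT+ y. en (rho s (y::'a))) = en r" using rho_finite_integral[OF s, where ?'a='a] by (rule ennreal_finiteE)
  have "(INT+ x. en (<|c - U t x|> * rho s x)) <= en <|c|> * en r + N t" for t
  proof -
  have "(INT+ x. en (<|c - U t x|> * rho s x)) <= (INT+ x. en <|c|> * en (rho s x) + en (<|U t x|> * rho s x))"
  proof (intro nn_integral_mono, goal_cases)
  case (1 x)
  have "<|c - U t x|> * rho s x <= (<|c|> + <|U t x|>) * rho s x" by (intro mult_right_mono) auto
  then have "<|c - U t x|> * rho s x <= <|c|> * rho s x + <|U t x|> * rho s x" by (simp add: algebra_simps)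
  then have "en (<|c - U t x|> * rho s x) <= en (<|c|> * rho s x + <|U t x|> * rho s x)" by (rule ennreal_leI)
  then show ?case
  by (simp add: ennreal_mult)
  qed
  also have "... = en <|c|> * en r + N t" by (simp add: nn_integral_add nn_integral_cmult r N_def)
  finally show ?thesis .
  qed
  then have "(INT+ t:{0<..1}. (INT+ x. en (<|c - U t x|> * rho s x)))
  <= (INT+ t. (en <|c|> * en r) * ind {0<..1} t + N t * ind {0<..1} t)"
  by (intro nn_integral_mono) (simp add: mult_right_mono flip: distrib_right)
  also have "... < inft" using L1_fin by (simp add: nn_integral_add nn_integral_cmult_indicator N_def[symmetric] ennreal_mult_less_top)
  finally show ?thesis .
  qed
  fix a b R :: real and ps :: "'a => real"
  assume ab: "a : G" "b : G" "a < b" and [measurable]: "ps : borelm" and ps: "!!x. 0 <= ps x"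
  "!!x. R <= norm x ==> ps x = 0" "(INT+ x. en ((ps x)^2)) < inft" "gag s UNIV ps < inft"
  obtain v where v: "0 <= v" "emeasure lborel (ball (0::'a) R) = en v" using vol by blast
  have int: "integrable lborel (%x. f x * ps x)" if [measurable]: "f : borelm"
  and f: "(sqb R f) < inft" for f
  proof (rule integrableI_bounded)
  have "(INT+ x. en (norm (f x * ps x))) <= (INT+ x. en ((f x)^2) * ind (ball 0 R) x + en ((ps x)^2))"
  proof (intro nn_integral_mono, goal_cases)
  case (1 x)
  have "<|f x|> * ps x <= (f x)^2 * ind (ball 0 R) x + (ps x)^2"
  using mult_le_weighted_squares[of 1 "<|f x|>" "ps x"] ps(2)[of x] by (cases "x : ball 0 R") auto
  then have "en (norm (f x * ps x)) <= en ((f x)^2 * ind (ball 0 R) x + (ps x)^2)"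
  using ps(1)[of x] by (simp add: abs_mult ennreal_leI del: ennreal_plus)
  then show ?case
  by (simp add: ennreal_mult ennreal_indicator)
  qed
  also have "... < inft" using f ps(3) by (simp add: nn_integral_add)
  finally show "(INT+ x. en (norm (f x * ps x))) < inft" .
  qed simp
  have U: "integrable lborel (%x. U t x * ps x)" if "t : G" for t
  proof (rule int)
  obtain C where "(sqb R (U t)) <= en C" using L2_bound[of R] \<open>t : G\<close> by blast
  then show "(sqb R (U t)) < inft" by (rule le_less_trans) simp
  qed measurable
  have C: "integrable lborel (%x. c * ps x)"
  by (rule int) (auto simp: nn_integral_cmult_indicator v ennreal_mult_less_top)
  have "(INT1 x. (c - U b x) * ps x) - (INT1 x. (c - U a x) * ps x) = - ((INT1 x. U b x * ps x) - (INT1 x. U a x * ps x))"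
  using U[OF ab(1)] U[OF ab(2)] C by (simp add: left_diff_distrib)
  also have "... = (LINT t:{a..b}|lborel. INT1 x. INT1 y. (U t x - U t y) * (ps x - ps y) * kap t x y)"
  using slice[OF ab _ ps] by simp
  also have "... = - (LINT t:{a..b}|lborel. - (INT1 x. INT1 y. (U t x - U t y) * (ps x - ps y) * kap t x y))"
  by (simp add: set_lebesgue_integral_def)
  also have "(%t. - (INT1 x. INT1 y. (U t x - U t y) * (ps x - ps y) * kap t x y))
  = (%t. INT1 x. INT1 y. ((c - U t x) - (c - U t y)) * (ps x - ps y) * kap t x y)"
  proof
  fix t
  have "(INT1 x. INT1 y. ((c - U t x) - (c - U t y)) * (ps x - ps y) * kap t x y)
  = (INT1 x. INT1 y. - ((U t x - U t y) * (ps x - ps y) * kap t x y))"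
  by (intro Bochner_Integration.integral_cong refl) (simp add: algebra_simps)
  then show "- (INT1 x. INT1 y. (U t x - U t y) * (ps x - ps y) * kap t x y)
  = (INT1 x. INT1 y. ((c - U t x) - (c - U t y)) * (ps x - ps y) * kap t x y)" by simp
  qed
  finally show "(INT1 x. (c - U b x) * ps x) - (INT1 x. (c - U a x) * ps x)
  = - (LINT t:{a..b}|lborel. INT1 x. INT1 y. ((c - U t x) - (c - U t y)) * (ps x - ps y) * kap t x y)" .
 qed (use s lam kap_meas kap_sym kap_lower kap_upper G_sub G_1 G_AE in auto)
qed

lemma nn_integral_affine:
 fixes f :: "'a::euclidean_space => ennreal"
 assumes [measurable]: "f : borelm" and r: "0 < r"
 shows "(INT+ y. f y) = en (r ^ DIM('a)) * (INT+ x. f (x0 + r *R x))"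
 using r by (subst lborel_affine[of r x0]) (simp_all add: nn_integral_density nn_integral_distr nn_integral_cmult)

lemma integral_affine:
 fixes f :: "'a::euclidean_space => real"
 assumes [measurable]: "f : borelm" and r: "0 < r"
 shows "(INT1 y. f y) = r ^ DIM('a) * (INT1 x. f (x0 + r *R x))"
 using r by (subst lborel_affine[of r x0]) (simp_all add: integral_density integral_distr)

lemma kern_affine:
 fixes x y x0 :: "'a::euclidean_space"
 assumes "0 < r"
 shows "r powr (2 * s) * r ^ DIM('a) * kern s (x0 + r *R x) (x0 + r *R y) = kern s x y"
proof -
 have "norm ((x0 + r *R x) - (x0 + r *R y)) = r * norm (x - y)"
  using assms by (simp flip: scaleR_diff_right)
 then have "kern s (x0 + r *R x) (x0 + r *R y) = 1 / (r powr (real DIM('a) + 2 * s) * norm (x - y) powr (real DIM('a) + 2 * s))"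
  unfolding kern_def using assms by (simp add: powr_mult)
 moreover have "r powr (real DIM('a) + 2 * s) = r powr (2 * s) * r ^ DIM('a)"
  using assms by (simp add: powr_add powr_realpow)
 ultimately show ?thesis using assms by (simp add: kern_def)
qed

text \<open>Parabolic scaling with time unit \<open>r powr (2 * s)\<close>. The kernel is
  homogeneous of degree \<open>- (d + 2 s)\<close>, so multiplying it by the time unit and by
  \<open>r ^ d\<close> preserves both ellipticity bounds. Any time \<open>t0\<close> of
  \<open>G\<close> can be moved to the final time 1, provided that its past is long enough.\<close>

lemma nlsol_on_scale:
 fixes U :: "real => 'a::euclidean_space => real"
 assumes sol: "nlsol_on s lam Lam Te U kap G" and r: "0 < r" and t0: "t0 : G" "r powr (2 * s) <= t0"
 defines "h \<equiv> r powr (2 * s)"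
 shows "nlsol s lam Lam (%t x. U (t0 - h + h * t) (x0 + r *R x))
  (%t x y. h * r ^ DIM('a) * kap (t0 - h + h * t) (x0 + r *R x) (x0 + r *R y)) {t\<in>{0<..1}. t0 - h + h * t : G}"
proof -
 interpret nlsol_on s lam Lam Te U kap G by fact
 define N where "N t = (INT+ x. en (<|U t x|> * rho s x))" for t
 have Nm[measurable]: "N : borelm" unfolding N_def by measurable
 let ?d = "DIM('a)"
 have h: "0 < h" "h <= t0" "t0 <= Te" using r t0 G_sub by (auto simp: h_def)
 define T where "T t = t0 - h + h * t" for t
 define X where "X x = x0 + r *R x" for x :: 'a
 have Xm[measurable]: "X : borelm" unfolding X_def by measurable
 have Tm[measurable]: "T : borelm" unfolding T_def by measurable
 let ?U = "%t x. U (T t) (X x)" and ?k = "%t x y. h * r ^ ?d * kap (T t) (X x) (X y)" and ?G = "{t\<in>{0<..1}. T t : G}"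
 have T01: "T t : {0<..Te}" if "t : {0<..1}" for t
 proof -
  have *: "0 < h * t" "h * t <= h * 1" using that h by (auto intro!: mult_left_mono)
  have "0 < T t" "T t <= Te" unfolding T_def using * h by linarith+
  then show ?thesis by simp
 qed
 have rd: "0 < r ^ ?d" using r by simp
 have aff: "(INT+ x. f (X x)) = en (1 / r ^ ?d) * (INT+ y. f y)" if [measurable]: "f : borelm" for f :: "'a => ennreal"
 proof -
  have "en (1 / r ^ ?d) * (INT+ y. f y) = (en (1 / r ^ ?d) * en (r ^ ?d)) * (INT+ x. f (X x))"
  unfolding X_def using nn_integral_affine[OF that r, of x0] by (simp add: mult.assoc)
  also have "en (1 / r ^ ?d) * en (r ^ ?d) = 1" using r by (simp flip: ennreal_mult)
  finally show ?thesis by simp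
 qed
 have affb: "(INT1 x. f (X x)) = (1 / r ^ ?d) * (INT1 y. f y)" if [measurable]: "f : borelm" for f :: "'a => real"
  unfolding X_def using integral_affine[OF that r, of x0] r by (simp add: field_simps)
 have timeT: "(INT+ t:{0<..1}. f (T t)) <= en (1 / h) * (INT+ u:{0<..Te}. f u)" if [measurable]: "f : borelm" for f :: "real => ennreal"
 proof -
  have "(INT+ t:{0<..1}. f (T t)) <= (INT+ t. f (T t) * ind {0<..Te} (T t))"
  using T01 by (intro nn_integral_mono) (auto simp: indicator_def)
  also have "... = (en (1 / h) * en h) * (INT+ t. f (T t) * ind {0<..Te} (T t))"
  using h by (simp flip: ennreal_mult)
  also have "... = en (1 / h) * (INT+ u:{0<..Te}. f u)"
  unfolding T_def using nn_integral_real_affine[of "%u. f u * ind {0<..Te} u" h "t0 - h"] h by (simp add: mult.assoc)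
  finally show ?thesis .
 qed
 define R' where "R' R = norm x0 + r * R" for R
 have ballX: "ind (ball 0 R) x <= (ind (ball 0 (R' R)) (X x) :: ennreal)" for x :: 'a and R
 proof -
  have "norm (X x) <= norm x0 + r * norm x" unfolding X_def using r norm_triangle_ineq[of x0 "r *R x"] by simp
  moreover have "r * norm x < r * R" if "norm x < R" using that r by simp
  ultimately show ?thesis unfolding R'_def by (auto simp: indicator_def)
 qed
 have L2le: "(INT+ x:ball 0 R. f (X x)) <= en (1 / r ^ ?d) * (INT+ y:ball 0 (R' R). f y)" if [measurable]: "f : borelm" for f R
 proof -
  have "(INT+ x:ball 0 R. f (X x)) <= (INT+ x. f (X x) * ind (ball 0 (R' R)) (X x))"
  by (intro nn_integral_mono mult_left_mono ballX) simp
  also have "... = en (1 / r ^ ?d) * (INT+ y:ball 0 (R' R). f y)" by (rule aff) measurable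
  finally show ?thesis .
 qed
 have kern: "h * r ^ ?d * kern s (X x) (X y) = kern s x y" for x y unfolding X_def h_def by (rule kern_affine[OF r])
 have hr: "0 < h * r ^ ?d" using h rd by simp
 have "nlsol s lam Lam ?U ?k ?G"
 proof
  show "(%(t, x). ?U t x) : borel_measurable borel2" by measurable
  show "(%(t, x, y). ?k t x y) : borel_measurable (borel \<Otimes>\<^sub>M borel \<Otimes>\<^sub>M borel)" by measurable
  show "lam * kern s x y <= ?k t x y" for t x y
  proof -
  have "(h * r ^ ?d) * (lam * kern s (X x) (X y)) <= (h * r ^ ?d) * kap (T t) (X x) (X y)"
  using hr by (intro mult_left_mono kap_lower) simp
  then show ?thesis unfolding kern[of x y, symmetric] by (simp add: mult_ac)
  qed
  show "?k t x y <= Lam * kern s x y" for t x y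
  proof -
  have "(h * r ^ ?d) * kap (T t) (X x) (X y) <= (h * r ^ ?d) * (Lam * kern s (X x) (X y))"
  using hr by (intro mult_left_mono kap_upper) simp
  then show ?thesis unfolding kern[of x y, symmetric] by (simp add: mult_ac)
  qed
  show "?G : sets borel" by measurable
  show "1 : ?G" using t0 by (simp add: T_def)
  show "AEL t. t : {0<..1} --> t : ?G"
  proof -
  have "AEL t. (t0 - h) + h * t : {0<..Te} --> (t0 - h) + h * t : G"
  by (rule AE_borel_affine[OF _ _ G_AE]) (use h in auto)
  then show ?thesis by eventually_elim (use T01 in "auto simp: T_def")
  qed
  show "\<exists>C. \<forall>t\<in>?G. (INT+ x:ball 0 R. en ((?U t x)^2)) <= en C" for R
  proof -
  obtain C where C: "!!t. t : G ==> (sqb (R' R) (U t)) <= en C" using L2_bound[of "R' R"] by blast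
  have "(INT+ x:ball 0 R. en ((?U t x)^2)) <= en (1 / r ^ ?d * C)" if "t : ?G" for t
  proof -
  have "(INT+ x:ball 0 R. en ((?U t x)^2)) <= en (1 / r ^ ?d) * (INT+ y:ball 0 (R' R). en ((U (T t) y)^2))"
  by (rule L2le) measurable
  also have "... <= en (1 / r ^ ?d) * en C" using that by (intro mult_left_mono C) auto
  also have "... = en (1 / r ^ ?d * C)" using rd by (subst ennreal_mult'[symmetric]) auto
  finally show ?thesis .
  qed
  then show ?thesis by blast
  qed
  show "(%n. INT+ x:ball 0 R. en ((?U (tu n) x - ?U t x)^2)) ~~> 0"
  if t: "t : ?G" "!!n. tu n : ?G" "tu ~~> t" for t tu R
  proof -
  have "(%n. T (tu n)) ~~> T t" unfolding T_def by (intro tendsto_intros t)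
  then have "(%n. INT+ x:ball 0 (R' R). en ((U (T (tu n)) x - U (T t) x)^2)) ~~> 0"
  using t by (intro L2_cont) auto
  from ennreal_tendsto_cmult[OF _ this, of "en (1 / r ^ ?d)"]
  have lim: "(%n. en (1 / r ^ ?d) * (INT+ x:ball 0 (R' R). en ((U (T (tu n)) x - U (T t) x)^2))) ~~> 0" by simp
  show ?thesis
  proof (rule tendsto_sandwich[OF _ _ tendsto_const lim])
  show "\<forall>\<^sub>F n in sequentially. (INT+ x:ball 0 R. en ((?U (tu n) x - ?U t x)^2))
  <= en (1 / r ^ ?d) * (INT+ x:ball 0 (R' R). en ((U (T (tu n)) x - U (T t) x)^2))"
  by (intro always_eventually allI L2le) measurable
  qed simp
  qed
  show "(INT+ t:{0<..1}. gag s (ball 0 R) (?U t)) < inft" for R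
  proof -
  have gagT: "gag s (ball 0 R) (?U t) <= (en (h * r ^ ?d) * en (1 / r ^ ?d) * en (1 / r ^ ?d)) * gag s (ball 0 (R' R)) (U (T t))" for t
  proof -
  let ?B = "ball (0::'a) (R' R)"
  define F where "F x y = en ((U (T t) x - U (T t) y)^2 * kern s x y) * ind ?B y * ind ?B x" for x y
  have Fm[measurable]: "(%(x, y). F x y) : borel_measurable lborel2" unfolding F_def by measurable
  have "gag s (ball 0 R) (?U t) = (INT+ x. INT+ y. en ((?U t x - ?U t y)^2 * kern s x y) * ind (ball 0 R) y * ind (ball 0 R) x)"
  by (rule gag_eq) measurable
  also have "... <= (INT+ x. INT+ y. en (h * r ^ ?d) * F (X x) (X y))"
  proof (intro nn_integral_mono, goal_cases)
  case (1 x y)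
  have "en ((?U t x - ?U t y)^2 * kern s x y) * ind (ball 0 R) y * ind (ball 0 R) x
  <= en ((?U t x - ?U t y)^2 * kern s x y) * ind ?B (X y) * ind ?B (X x)"
  by (intro mult_mono ballX) auto
  also have "... = en (h * r ^ ?d) * F (X x) (X y)"
  proof -
  have "en ((?U t x - ?U t y)^2 * kern s x y) = en (h * r ^ ?d) * en ((?U t x - ?U t y)^2 * kern s (X x) (X y))"
  unfolding kern[of x y, symmetric] using hr by (subst ennreal_mult[symmetric]) (auto simp: mult_ac)
  then show ?thesis by (simp add: F_def mult.assoc)
  qed
  finally show ?case .
  qed
  also have "... = en (h * r ^ ?d) * (INT+ x. INT+ y. F (X x) (X y))"
  by (simp add: nn_integral_cmult)
  also have "(INT+ x. INT+ y. F (X x) (X y)) = (INT+ x. en (1 / r ^ ?d) * (INT+ y. F (X x) y))"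
  by (intro nn_integral_cong aff) measurable
  also have "... = en (1 / r ^ ?d) * (INT+ x. (INT+ y. F (X x) y))" by (simp add: nn_integral_cmult)
  also have "(INT+ x. (INT+ y. F (X x) y)) = en (1 / r ^ ?d) * (INT+ x. INT+ y. F x y)"
  by (rule aff) measurable
  also have "(INT+ x. INT+ y. F x y) = gag s ?B (U (T t))" unfolding F_def by (rule gag_eq[symmetric]) measurable
  finally show ?thesis by (simp only: mult.assoc)
  qed
  have gm[measurable]: "(%t. gag s (ball 0 (R' R)) (U t)) : borelm" by (rule gag_measurable) (use U_meas in auto)
  define K where "K = en (h * r ^ ?d) * en (1 / r ^ ?d) * en (1 / r ^ ?d)"
  have "(INT+ t:{0<..1}. gag s (ball 0 R) (?U t)) <= (INT+ t. K * (gag s (ball 0 (R' R)) (U (T t)) * ind {0<..1} t))"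
  unfolding mult.assoc[symmetric] K_def by (intro nn_integral_mono mult_right_mono gagT) simp
  also have "... = K * (INT+ t:{0<..1}. gag s (ball 0 (R' R)) (U (T t)))" by (rule nn_integral_cmult) measurable
  also have "... <= K * (en (1 / h) * (INT+ t:{0<..Te}. gag s (ball 0 (R' R)) (U t)))" by (intro mult_left_mono timeT) auto
  also have "... < inft" using Hs_fin[of "R' R"] by (simp add: K_def ennreal_mult_less_top)
  finally show ?thesis .
  qed
  show "(INT+ t:{0<..1}. (INT+ x. en (<|?U t x|> * rho s x))) < inft"
  proof -
  define c where "c = (1 + norm x0 + r) powr (real ?d + 2 * s)"
  have rho: "rho s x <= c * rho s (X x)" for x
  unfolding c_def
  proof (rule rho_le_rho[OF s(1)])
  have "norm (X x) <= norm x0 + r * norm x" unfolding X_def using r norm_triangle_ineq[of x0 "r *R x"] by simp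
  moreover have "0 <= norm x0 * norm x" "0 <= r" "0 <= norm x" using r by auto
  moreover have "(1 + norm x0 + r) * (1 + norm x) = 1 + norm x + norm x0 + norm x0 * norm x + r + r * norm x" by (simp add: algebra_simps)
  ultimately show "1 + norm (X x) <= (1 + norm x0 + r) * (1 + norm x)" by linarith
  qed
  have Nle: "(INT+ x. en (<|?U t x|> * rho s x)) <= en c * (en (1 / r ^ ?d) * N (T t))" for t
  proof -
  have "(INT+ x. en (<|?U t x|> * rho s x)) <= (INT+ x. en c * en (<|U (T t) (X x)|> * rho s (X x)))"
  proof (intro nn_integral_mono, goal_cases)
  case (1 x)
  have "<|?U t x|> * rho s x <= c * (<|U (T t) (X x)|> * rho s (X x))"
  using mult_left_mono[OF rho[of x], of "<|?U t x|>"] by (simp add: mult_ac)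
  from ennreal_leI[OF this] show ?case
  by (subst ennreal_mult[symmetric]) (auto simp: c_def)
  qed
  also have "... = en c * (INT+ x. en (<|U (T t) (X x)|> * rho s (X x)))" by (rule nn_integral_cmult) measurable
  also have "(INT+ x. en (<|U (T t) (X x)|> * rho s (X x))) = en (1 / r ^ ?d) * N (T t)"
  unfolding N_def by (rule aff) measurable
  finally show ?thesis .
  qed
  have "(INT+ t:{0<..1}. (INT+ x. en (<|?U t x|> * rho s x))) <= (INT+ t. (en c * en (1 / r ^ ?d)) * (N (T t) * ind {0<..1} t))"
  unfolding mult.assoc[symmetric] by (intro nn_integral_mono mult_right_mono Nle[unfolded mult.assoc[symmetric]]) simp
  also have "... = (en c * en (1 / r ^ ?d)) * (INT+ t:{0<..1}. N (T t))" by (rule nn_integral_cmult) measurable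
  also have "... <= (en c * en (1 / r ^ ?d)) * (en (1 / h) * (INT+ t:{0<..Te}. N t))" by (intro mult_left_mono timeT) auto
  also have "... < inft" using L1_fin by (simp add: N_def[symmetric] ennreal_mult_less_top)
  finally show ?thesis .
  qed
  fix a b R :: real and ps :: "'a => real"
  assume ab: "a : ?G" "b : ?G" "a < b" and [measurable]: "ps : borelm" and ps: "!!x. 0 <= ps x"
  "!!x. R <= norm x ==> ps x = 0" "(INT+ x. en ((ps x)^2)) < inft" "gag s UNIV ps < inft"
  \<comment> \<open>The test function is carried back to the original variables, where
    \<open>slice\<close> is known; the resulting identity is then rescaled term by term.\<close>
  define ps0 where "ps0 y = ps ((1 / r) *R (y - x0))" for y
  let ?e = "%t x y. (U (T t) x - U (T t) y) * (ps0 x - ps0 y) * kap (T t) x y" and ?g = "%x y. (ps0 x - ps0 y)^2 * kern s x y"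
  have ps0m[measurable]: "ps0 : borelm" unfolding ps0_def by measurable
  have psX: "ps x = ps0 (X x)" for x using r by (simp add: ps0_def X_def)
  define e where "e t = (INT1 x. INT1 y. (U t x - U t y) * (ps0 x - ps0 y) * kap t x y)" for t
  have slice0: "(INT1 x. U (T b) x * ps0 x) - (INT1 x. U (T a) x * ps0 x) = - (LINT t:{T a..T b}|lborel. e t)"
  unfolding e_def
  proof (rule slice[where R="norm x0 + r * max R 0"])
  show "T a : G" "T b : G" "T a < T b" using ab h by (auto simp: T_def)
  show "0 <= ps0 x" for x by (simp add: ps0_def ps)
  show "ps0 x = 0" if "norm x0 + r * max R 0 <= norm x" for x
  unfolding ps0_def
  proof (rule ps(2))
  have "norm x - norm x0 <= norm (x - x0)" by (rule norm_triangle_ineq2)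
  then have "r * max R 0 <= norm (x - x0)" using that by linarith
  moreover have "r * R <= r * max R 0" using r by (intro mult_left_mono) auto
  ultimately have "r * R <= norm (x - x0)" by linarith
  then have "R <= <|1 / r|> * norm (x - x0)" using r by (simp add: field_simps)
  then show "R <= norm ((1 / r) *R (x - x0))" by (simp only: norm_scaleR)
  qed
  have "en (1 / r ^ ?d) * (INT+ x. en ((ps0 x)^2)) = (INT+ x. en ((ps x)^2))"
  unfolding psX by (rule aff[symmetric]) measurable
  then have "en (1 / r ^ ?d) * (INT+ x. en ((ps0 x)^2)) < inft" using ps(3) by simp
  then show "(INT+ x. en ((ps0 x)^2)) < inft" by (rule ennreal_cmult_finiteD) (use rd in simp)
  have "(INT+ x. INT+ y. en ((ps x - ps y)^2 * kern s x y))
  = (INT+ x. INT+ y. en (h * r ^ ?d) * en (?g (X x) (X y)))"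
  proof (intro nn_integral_cong, goal_cases)
  case (1 x y)
  have "(ps x - ps y)^2 * kern s x y = (h * r ^ ?d) * (?g (X x) (X y))"
  unfolding psX kern[of x y, symmetric] by simp
  then show ?case
  using hr by (subst ennreal_mult[symmetric]) auto
  qed
  also have "... = en (h * r ^ ?d) * (INT+ x. INT+ y. en (?g (X x) (X y)))"
  by (subst nn_integral_cmult, measurable, subst nn_integral_cmult, measurable)
  also have "(INT+ x. INT+ y. en (?g (X x) (X y)))
  = (INT+ x. en (1 / r ^ ?d) * (INT+ y. en (?g (X x) y)))"
  by (intro nn_integral_cong aff) measurable
  also have "... = en (1 / r ^ ?d) * (INT+ x. (INT+ y. en (?g (X x) y)))"
  by (rule nn_integral_cmult) measurable
  also have "(INT+ x. (INT+ y. en (?g (X x) y))) = en (1 / r ^ ?d) * gag s UNIV ps0"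
  proof -
  have "(INT+ x. (INT+ y. en (?g (X x) y)))
  = en (1 / r ^ ?d) * (INT+ x. (INT+ y. en ((ps0 x - ps0 y)^2 * kern s x y)))"
  by (rule aff) measurable
  then show ?thesis by (simp add: gag_def)
  qed
  finally have "en (h * r ^ ?d) * (en (1 / r ^ ?d) * (en (1 / r ^ ?d) * gag s UNIV ps0)) < inft"
  using ps(4) by (simp add: gag_def)
  note f1 = ennreal_cmult_finiteD[OF this hr]
  have rd': "0 < 1 / r ^ ?d" using rd by simp
  note f2 = ennreal_cmult_finiteD[OF f1 rd']
  show "gag s UNIV ps0 < inft" by (rule ennreal_cmult_finiteD[OF f2 rd'])
  qed measurable
  have lhs: "(INT1 x. ?U t x * ps x) = (1 / r ^ ?d) * (INT1 x. U (T t) x * ps0 x)" for t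
  unfolding psX by (rule affb) measurable
  have E: "(INT1 x. INT1 y. (?U t x - ?U t y) * (ps x - ps y) * ?k t x y) = h * (1 / r ^ ?d) * e (T t)" for t
  proof -
  have "(INT1 x. INT1 y. (?U t x - ?U t y) * (ps x - ps y) * ?k t x y)
  = (INT1 x. INT1 y. (h * r ^ ?d) * (?e t (X x) (X y)))"
  unfolding psX by (intro Bochner_Integration.integral_cong refl) simp
  also have "... = (h * r ^ ?d) * (INT1 x. INT1 y. (?e t (X x) (X y)))"
  by simp
  also have "(INT1 x. INT1 y. (?e t (X x) (X y)))
  = (INT1 x. (1 / r ^ ?d) * (INT1 y. (?e t (X x) y)))"
  by (intro Bochner_Integration.integral_cong refl affb) measurable
  also have "... = (1 / r ^ ?d) * (INT1 x. (INT1 y. (?e t (X x) y)))"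
  by simp
  also have "(INT1 x. (INT1 y. (?e t (X x) y))) = (1 / r ^ ?d) * e (T t)"
  unfolding e_def by (rule affb) measurable
  finally show ?thesis using rd by simp
  qed
  have time: "(LINT t:{a..b}|lborel. h * (1 / r ^ ?d) * e (T t)) = (1 / r ^ ?d) * (LINT t:{T a..T b}|lborel. e t)"
  proof -
  have "(LINT t:{T a..T b}|lborel. e t) = h * (INT1 t. ind {T a..T b} ((t0 - h) + h * t) *R e ((t0 - h) + h * t))"
  unfolding set_lebesgue_integral_def using h by (subst lborel_integral_real_affine[of h _ "t0 - h"]) auto
  also have "(INT1 t. ind {T a..T b} ((t0 - h) + h * t) *R e ((t0 - h) + h * t)) = (LINT t:{a..b}|lborel. e (T t))"
  unfolding set_lebesgue_integral_def T_def using h by (intro Bochner_Integration.integral_cong refl) (auto simp: indicator_def)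
  finally show ?thesis by (simp add: set_lebesgue_integral_def)
  qed
  show "(INT1 x. ?U b x * ps x) - (INT1 x. ?U a x * ps x)
  = - (LINT t:{a..b}|lborel. INT1 x. INT1 y. (?U t x - ?U t y) * (ps x - ps y) * ?k t x y)"
  unfolding E lhs time right_diff_distrib[symmetric] slice0 by simp
 qed (use s lam kap_sym in auto)
 then show ?thesis by (simp add: T_def X_def)
qed

lemma nlsol_scale:
 fixes U :: "real => 'a::euclidean_space => real"
 assumes sol: "nlsol s lam Lam U kap G" and r: "0 < r" and t0: "t0 : G" "r powr (2 * s) <= t0"
 shows "nlsol s lam Lam (%t x. U (t0 - r powr (2 * s) + r powr (2 * s) * t) (x0 + r *R x))
  (%t x y. r powr (2 * s) * r ^ DIM('a) * kap (t0 - r powr (2 * s) + r powr (2 * s) * t) (x0 + r *R x) (x0 + r *R y))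
  {t\<in>{0<..1}. t0 - r powr (2 * s) + r powr (2 * s) * t : G}"
proof -
 interpret nlsol s lam Lam U kap G by fact
 show ?thesis by (rule nlsol_on_scale[OF nlsol_on_axioms r t0])
qed

section \<open>Lower bound by the past mass\<close>

lemma ennreal_affine: "0 <= a ==> 0 <= u ==> 0 <= b ==> en a * en u + en b = en (a * u + b)"
 by (simp add: ennreal_mult)

lemma ennreal_mult_double: "0 <= a ==> 0 <= u ==> en a * en u + en a * en u = en (2 * (a * u))"
 using ennreal_affine[of a u "a * u"] by (simp add: ennreal_mult)

text \<open>An implicit Euler scheme with \<open>N\<close> equal steps of length at most
  \<open>1 / (2 C)\<close>: half of \<open>Y\<close> at the later time is absorbed on the left, so
  each step at most doubles \<open>Y + 2 * ka\<close>. No differentiability of \<open>Y\<close>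
  enters.\<close>

lemma discrete_gronwall:
 fixes Y :: "real => real"
 assumes ab: "a <= b" "b - a <= 1" and C: "0 <= C" and ka: "0 <= ka" and nn: "!!t. a <= t ==> t <= b ==> 0 <= Y t"
  and step: "!!r t. a <= r ==> r <= t ==> t <= b ==> Y t - Y r <= (t - r) * (ka + C * Y t)"
  and N: "2 * C <= real N" "0 < N"
 shows "Y b <= 2 ^ N * (Y a + 2 * ka)"
proof -
 define de where "de = (b - a) / real N"
 have de: "0 <= de" "de * real N = b - a" using ab N by (auto simp: de_def)
 have d1: "de <= 1" using ab N by (simp add: de_def divide_le_eq)
 have dC: "de * C <= 1/2"
 proof -
  have "de * (2 * C) <= de * real N" using de N by (intro mult_left_mono) auto
  then show ?thesis using de(2) ab by simp
 qed
 have "Y (a + real i * de) + 2 * ka <= 2 ^ i * (Y a + 2 * ka)" if "i <= N" for i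
  using that
 proof (induction i)
  case (Suc i)
  let ?r = "a + real i * de" and ?t = "a + real (Suc i) * de"
  have tb: "?t <= b"
  proof -
  have "real (Suc i) * de <= real N * de" using Suc.prems de by (intro mult_right_mono) auto
  then show ?thesis using de(2) by (simp add: mult.commute)
  qed
  have rt: "a <= ?r" "?r <= ?t" using de by (auto simp: algebra_simps)
  have "Y ?t - Y ?r <= (?t - ?r) * (ka + C * Y ?t)" by (rule step[OF rt tb])
  also have "(?t - ?r) = de" by (simp add: algebra_simps)
  also have "de * (ka + C * Y ?t) <= ka + (1/2) * Y ?t"
  proof -
  have "de * ka <= 1 * ka" using d1 ka by (intro mult_right_mono) auto
  moreover have "(de * C) * Y ?t <= (1/2) * Y ?t" using dC nn[of ?t] tb rt by (intro mult_right_mono) auto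
  ultimately show ?thesis by (simp add: algebra_simps)
  qed
  finally have "Y ?t + 2 * ka <= 2 * (Y ?r + 2 * ka)" using ka by simp
  also have "... <= 2 * (2 ^ i * (Y a + 2 * ka))" using Suc by simp
  finally show ?case by simp
 qed simp
 from this[of N] de(2) ka show ?thesis by (simp add: mult.commute)
qed

lemma sqrt_rho_lipschitz:
 fixes x y :: "'a::euclidean_space"
 assumes "0 < s"
 shows "<|sqrt (rho s x) - sqrt (rho s y)|> <= max 1 (real DIM('a) + 2 * s) * norm (x - y)"
proof -
 define p where "p = real DIM('a) + 2 * s"
 have p: "0 < p" using assms by (simp add: p_def add_nonneg_pos)
 have sq: "sqrt (rho s x) = exp (- (p / 2) * ln (1 + norm x))" for x :: 'a
 proof -
  have "0 < 1 + norm x" by (simp add: add_pos_nonneg)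
  then have "rho s x = exp (- p * ln (1 + norm x))" unfolding rho_def p_def[symmetric] by (simp add: powr_def exp_minus divide_inverse)
  also have "... = (exp (- (p / 2) * ln (1 + norm x)))^2" by (simp flip: exp_of_nat_mult exp_double)
  finally show ?thesis by simp
 qed
 have ln: "<|ln (1 + norm x) - ln (1 + norm y)|> <= norm (x - y)"
 proof -
  have *: "ln (1 + norm x) - ln (1 + norm y) <= norm (x - y)" for x y :: 'a
  proof -
  have pos: "0 < 1 + norm x" "0 < 1 + norm y" by (auto simp: add_pos_nonneg)
  then have "ln (1 + norm x) - ln (1 + norm y) = ln ((1 + norm x) / (1 + norm y))" by (simp add: ln_div)
  also have "... <= (1 + norm x) / (1 + norm y) - 1" using pos by (intro ln_le_minus_one) simp
  also have "... = (norm x - norm y) / (1 + norm y)" using pos by (simp add: field_simps)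
  also have "... <= norm (x - y) / (1 + norm y)" using norm_triangle_ineq2[of x y] pos by (intro divide_right_mono) auto
  also have "... <= norm (x - y)" using pos by (simp add: divide_le_eq mult_le_cancel_left1)
  finally show ?thesis .
  qed
  show ?thesis using *[of x y] *[of y x] by (simp add: norm_minus_commute abs_le_iff)
 qed
 have m1: "max (sqrt (rho s x)) (sqrt (rho s y)) <= 1" using rho_le_1[OF assms, of x] rho_le_1[OF assms, of y] by simp
 have "<|- (p / 2) * ln (1 + norm x) - - (p / 2) * ln (1 + norm y)|> = <|- (p / 2) * (ln (1 + norm x) - ln (1 + norm y))|>"
  by (simp add: algebra_simps)
 also have "... = p / 2 * <|ln (1 + norm x) - ln (1 + norm y)|>"
  unfolding abs_mult using p by simp
 finally have eq: "<|- (p / 2) * ln (1 + norm x) - - (p / 2) * ln (1 + norm y)|> = p / 2 * <|ln (1 + norm x) - ln (1 + norm y)|>" .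
 have "<|sqrt (rho s x) - sqrt (rho s y)|> <= (p / 2 * <|ln (1 + norm x) - ln (1 + norm y)|>) * max (sqrt (rho s x)) (sqrt (rho s y))"
  unfolding sq by (rule exp_diff_le[of "- (p / 2) * ln (1 + norm x)" "- (p / 2) * ln (1 + norm y)", unfolded eq])
 also have "... <= (p / 2 * norm (x - y)) * 1"
  using p ln m1 by (intro mult_mono mult_nonneg_nonneg) (auto simp: le_max_iff_disj)
 also have "... = (p / 2) * norm (x - y)" by simp
 also have "... <= max 1 p * norm (x - y)" using p by (intro mult_right_mono) auto
 finally show ?thesis by (simp add: p_def)
qed

locale nlpos = nlsol +
 assumes U_nn: "0 <= U t x"
begin

text \<open>A compactly supported version of the square root of the weight. Subtracting a constant
  and taking the positive part does not increase differences, so \<open>sqrt_rho_moment\<close>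
  carries over uniformly in \<open>R\<close>. What is lost of the weight is measured by
  \<open>kapR\<close>.\<close>

definition etaR :: "real => 'a => real" where
 "etaR R x = max 0 (sqrt (rho s x) - sqrt (1 / (1 + R) powr (real DIM('a) + 2 * s)))"
definition kapR :: "real => ennreal" where
 "kapR R = (INT+ x. en (min (rho s (x::'a)) (1 / (1 + R) powr (real DIM('a) + 2 * s))))"

lemma etaR_props:
 assumes R: "1 <= R"
 shows "etaR R : borelm" "<|etaR R x - etaR R y|> <= max 1 (real DIM('a) + 2 * s) * norm (x - y)"
  "0 <= etaR R x" "etaR R x <= 1" "R <= norm x ==> etaR R x = 0"
  "<|etaR R x - etaR R y|> <= <|sqrt (rho s x) - sqrt (rho s y)|>"
  "rho s x <= 2 * (etaR R x)^2 + 2 * min (rho s x) (1 / (1 + R) powr (real DIM('a) + 2 * s))"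
proof -
 let ?q = "1 / (1 + R) powr (real DIM('a) + 2 * s)"
 show "etaR R : borelm" unfolding etaR_def by measurable
 show *: "<|etaR R x - etaR R y|> <= <|sqrt (rho s x) - sqrt (rho s y)|>" unfolding etaR_def by linarith
 then show "<|etaR R x - etaR R y|> <= max 1 (real DIM('a) + 2 * s) * norm (x - y)" using sqrt_rho_lipschitz[OF s(1), of x y] by linarith
 show "0 <= etaR R x" by (simp add: etaR_def)
 have "sqrt (rho s x) <= 1" using rho_le_1[OF s(1), of x] by simp
 moreover have "0 <= sqrt ?q" using R by simp
 ultimately show "etaR R x <= 1" unfolding etaR_def by linarith
 show "etaR R x = 0" if "R <= norm x"
 proof -
  have "rho s x <= 1 powr (real DIM('a) + 2 * s) * ?q"
  unfolding rho_def using that R s by (intro inverse_powr_mono) auto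
  then have "sqrt (rho s x) <= sqrt ?q" by simp
  then show ?thesis by (simp add: etaR_def)
 qed
 show "rho s x <= 2 * (etaR R x)^2 + 2 * min (rho s x) ?q"
 proof (cases "rho s x <= ?q")
  case True
  then have "rho s x <= 2 * min (rho s x) ?q" by (simp add: min_def)
  then show ?thesis by (smt (verit) zero_le_power2)
 next
  case False
  have q0: "0 <= ?q" using R by simp
  have "sqrt ?q <= sqrt (rho s x)" using False by simp
  then have e: "etaR R x = sqrt (rho s x) - sqrt ?q" unfolding etaR_def by linarith
  have "rho s x = (sqrt (rho s x))^2" by simp
  also have "... <= 2 * (sqrt (rho s x) - sqrt ?q)^2 + 2 * (sqrt ?q)^2"
  using zero_le_power2[of "sqrt (rho s x) - 2 * sqrt ?q"] by (simp add: power2_eq_square algebra_simps del: real_sqrt_mult_self)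
  also have "(sqrt ?q)^2 = min (rho s x) ?q" using False q0 by (simp add: min_def)
  finally show ?thesis unfolding e .
 qed
qed

lemma N_half_fin: "0 < a ==> (INT+ t:{a..1/2}. N t) < inft"
proof -
 assume a: "0 < a"
 have "(INT+ t:{a..1/2}. N t) <= (INT+ t:{0<..1}. N t)"
  using a by (intro nn_integral_mono mult_left_mono) (auto simp: indicator_def)
 then show ?thesis using L1_fin by (simp add: N_def)
qed

text \<open>The level rises as fast as the past mass enters: a point below the level receives at least \<open>lam R powr - (d + 2 s)\<close> times that mass through the kernel, and this term of the energy inequality pays for the motion of the level.\<close>

lemma low_level_energy:
 assumes a: "a : G" "a < 1/2" and R: "1 <= R" and c: "0 < c" "c * R powr (real DIM('a) + 2 * s) <= lam" "c * C0 <= 1/4"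
  and C0: "0 <= C0" "(INT+ y. en (rho s (y::'a))) = en C0"
  and A: "0 <= A" "(INT+ t:{a..1/2}. N t) = en A"
  and C3: "0 <= C3" "!!x::'a. (INT+ y. en ((sqrt (rho s x) - sqrt (rho s y))^2 * kern s x y)) <= en (C3 * rho s x)"
  and kR: "0 <= kR" "kapR R <= en kR" and NN: "8 * Lam * C3 <= real NN" "0 < NN"
 shows "(INT+ t:{1/2..1}. (INT+ x. en ((max 0 (c * A - U t x))^2 * rho s x)))
  <= en (8 * (2 ^ NN * (8 * Lam * C3) + 1) * kR * (c * A)^2)"
proof -
 let ?p = "real DIM('a) + 2 * s" and ?et = "etaR R"
 have a0: "0 < a" using a G_sub by auto
 define f where "f t = enn2real (N t) * ind {a..1/2} t" for t
 have fm[measurable]: "f : borelm" unfolding f_def by measurable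
 have fnn: "0 <= f t" for t by (simp add: f_def)
 have AEN: "AEL t. t : {0<..1} --> N t < inft"
 proof -
  have "AEL t. N t * ind {0<..1} t \<noteq> inft"
  by (rule nn_integral_noteq_infinite) (use L1_fin in "auto simp: N_def[symmetric]")
  then show ?thesis by eventually_elim (auto simp: less_top)
 qed
 have fint: "(INT+ t. en (f t)) = en A"
 proof -
  have "(INT+ t. en (f t)) = (INT+ t:{a..1/2}. N t)"
  using AEN by (intro nn_integral_cong_AE, eventually_elim) (use a0 in "auto simp: f_def indicator_def")
  then show ?thesis using A by simp
 qed
 have fI: "integrable lborel f" by (rule integrableI_nonneg) (use fnn fint in auto)
 have fA: "(INT1 t. f t) = A" using fint nn_integral_eq_integral[OF fI] fnn A by (auto simp: integral_nonneg_AE)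
 have fS: "set_integrable lborel {r..t} f" for r t
  unfolding set_integrable_def using fI by (intro integrable_mult_indicator) auto
 define F where "F t = (LINT u:{a..t}|lborel. f u)" for t
 have F_le: "F t <= A" for t
  unfolding F_def set_lebesgue_integral_def fA[symmetric]
  using fS[of a t] fI fnn by (intro integral_mono) (auto simp: set_integrable_def indicator_def)
 have F_half: "F t = A" if "1/2 <= t" for t
  unfolding F_def set_lebesgue_integral_def fA[symmetric]
  using that by (intro Bochner_Integration.integral_cong) (auto simp: f_def indicator_def)
 have F_diff: "F t - F r = (LINT u:{r..t}|lborel. f u)" if "a <= r" "r <= t" for r t
  unfolding F_def using that by (subst set_integral_split_Icc[OF fS, of a r t]) auto
 \<comment> \<open>A correction for the mass below the level: it is at most \<open>C0\<close> times
   the level, and the level never exceeds \<open>2 * c * A\<close>. Times \<open>2 * c\<close> this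
   is \<open>d\<close>.\<close>
 define d where "d = 4 * c^2 * C0 * A"
 have d: "0 <= d" using C0 A by (simp add: d_def)
 \<comment> \<open>The level starts at 0 and gains twice the target while the past mass is
   collected. The correction takes back at most \<open>c * A\<close>, because
   \<open>c * C0 <= 1/4\<close>, so at least \<open>c * A\<close> is left from time 1/2 on.\<close>
 define h where "h t = 2 * c * F t - d * (t - a)" for t
 define g where "g t = d - 2 * c * f t" for t
 have gm[measurable]: "g : borelm" unfolding g_def by measurable
 have Fm[measurable]: "F : borelm" unfolding F_def set_lebesgue_integral_def indicator_def atLeastAtMost_iff by measurable
 have hm[measurable]: "h : borelm" unfolding h_def by measurable
 have h_le: "h t <= 2 * c * A" if "a <= t" for t
 proof -
  have "2 * c * F t <= 2 * c * A" using c by (intro mult_left_mono F_le) auto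
  moreover have "0 <= d * (t - a)" using d that by simp
  ultimately show ?thesis unfolding h_def by linarith
 qed
 have kh: "c * A <= h t" if "1/2 <= t" "t <= 1" for t
 proof -
  have "d * (t - a) <= d * 1" using that a0 d by (intro mult_left_mono) auto
  also have "d * 1 = 4 * (c * C0) * (c * A)" by (simp add: d_def power2_eq_square)
  also have "... <= 1 * (c * A)" using c A by (intro mult_right_mono) auto
  finally show ?thesis unfolding h_def F_half[OF that(1)] by (simp add: mult_ac)
 qed
 have cI: "set_integrable lborel {r..t} (%_. d)" for r t :: real
  by (simp add: set_integrable_def emeasure_lborel_Icc_eq)
 have gI: "set_integrable lborel {r..t} g" for r t
  unfolding g_def using cI fS by (intro set_integral_diff) auto
 have lg: "- h t - - h r = (LINT u:{r..t}|lborel. g u)" if "a <= r" "r <= t" "t <= b" for r t b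
 proof -
  have "(LINT u:{r..t}|lborel. g u) = (LINT u:{r..t}|lborel. d) - (LINT u:{r..t}|lborel. 2 * c * f u)"
  unfolding g_def using cI fS by (intro set_integral_diff) auto
  also have "(LINT u:{r..t}|lborel. d) = d * (t - r)" using that by (simp add: set_lebesgue_integral_def)
  also have "(LINT u:{r..t}|lborel. 2 * c * f u) = 2 * c * (F t - F r)" using F_diff that by simp
  finally show ?thesis by (simp add: h_def algebra_simps)
 qed
 define V where "V t x = max 0 (h t - U t x)" for t x
 have Vm[measurable (raw)]: "(%x. V (w x) (z x)) : borel_measurable M" if [measurable]: "w : borel_measurable M" "z : borel_measurable M" for w z and M :: "'c measure"
  unfolding V_def by measurable
 define hb where "hb = 2 * c * A"
 have hb: "0 <= hb" using c A by (simp add: hb_def)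
 have V_le: "V t x <= hb" "0 <= V t x" if "a <= t" for t x
  using h_le[OF that] U_nn[of t x] hb by (auto simp: V_def hb_def)
 define y where "y t = (INT1 x. (V t x)^2 * (?et x)^2)" for t
 let ?Y = "%t. 2 * y t + 2 * hb^2 * kR"
 have etm[measurable]: "?et : borelm" by (rule etaR_props[OF R])
 have ym[measurable]: "y : borelm" unfolding y_def by measurable
 \<comment> \<open>The energy inequality is applied to \<open>- U\<close> with the level
   \<open>- h\<close>, so that the truncation is the deficit of \<open>U\<close> below
   \<open>h\<close>. A rise of \<open>h\<close> is a fall of that level and stands on the expensive
   side.\<close>
 have sol': "nlsol s lam Lam (%t x. - U t x) kap G" using nlsol_const_minus[OF nlsol_axioms, of 0] by simp
 define C4 where "C4 = 4 * Lam * C3"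
 have C4: "0 <= C4" using C3 by (simp add: C4_def)
 have y_nn: "0 <= y t" for t unfolding y_def by (intro integral_nonneg_AE) auto
 have S_eq: "(INT+ x. en ((V t x)^2 * (?et x)^2)) = en (y t) \<and> y t <= hb^2 * C0" if t: "a <= t" for t
 proof -
  have le: "(INT+ x. en ((V t x)^2 * (?et x)^2)) <= en (hb^2 * C0)"
  proof -
  have "(INT+ x. en ((V t x)^2 * (?et x)^2)) <= (INT+ x. en (hb^2) * en (rho s (x::'a)))"
  proof (intro nn_integral_mono, goal_cases)
  case (1 x)
  have "?et x <= sqrt (rho s x)" unfolding etaR_def using R by simp
  then have "(?et x)^2 <= (sqrt (rho s x))^2" using etaR_props(3)[OF R] by (intro power_mono) auto
  then have "(V t x)^2 * (?et x)^2 <= hb^2 * rho s x"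
  using V_le[OF t, of x] by (intro mult_mono power_mono) auto
  then show ?case
  by (subst ennreal_mult[symmetric]) (auto intro: ennreal_leI)
  qed
  also have "... = en (hb^2 * C0)" using C0 by (simp add: nn_integral_cmult ennreal_mult)
  finally show ?thesis .
  qed
  have "integrable lborel (%x. (V t x)^2 * (?et x)^2)"
  by (rule integrableI_nonneg) (use le in "auto intro: le_less_trans")
  then have eq: "(INT+ x. en ((V t x)^2 * (?et x)^2)) = en (y t)"
  unfolding y_def by (intro nn_integral_eq_integral) auto
  with le have "y t <= hb^2 * C0" using C0 by (simp add: ennreal_le_iff)
  with eq show ?thesis by simp
 qed
 have rhoV: "(INT+ x. en ((V t x)^2 * rho s x)) <= en (?Y t)" if t: "a <= t" for t
 proof -
  let ?q = "1 / (1 + R) powr ?p"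
  have "(INT+ x. en ((V t x)^2 * rho s x)) <= (INT+ x. 2 * en ((V t x)^2 * (?et x)^2) + en (2 * hb^2) * en (min (rho s x) ?q))"
  proof (intro nn_integral_mono, goal_cases)
  case (1 x)
  have m0: "0 <= min (rho s x) ?q" using R by (simp add: min_def)
  have "(V t x)^2 * rho s x <= (V t x)^2 * (2 * (?et x)^2 + 2 * min (rho s x) ?q)"
  by (intro mult_left_mono etaR_props(7)[OF R]) simp
  also have "... = 2 * ((V t x)^2 * (?et x)^2) + 2 * (V t x)^2 * min (rho s x) ?q" by (simp add: algebra_simps)
  also have "... <= 2 * ((V t x)^2 * (?et x)^2) + 2 * hb^2 * min (rho s x) ?q"
  using V_le[OF t, of x] m0 by (intro add_left_mono mult_right_mono mult_left_mono power_mono) auto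
  finally have "en ((V t x)^2 * rho s x) <= en (2 * ((V t x)^2 * (?et x)^2) + (2 * hb^2) * min (rho s x) ?q)" by (intro ennreal_leI) simp
  also have "... = 2 * en ((V t x)^2 * (?et x)^2) + en (2 * hb^2) * en (min (rho s x) ?q)"
  using m0 by (subst ennreal_plus) (auto simp: ennreal_mult)
  finally show ?case .
  qed
  also have "... = 2 * en (y t) + en (2 * hb^2) * kapR R"
  using S_eq[OF t] unfolding kapR_def by (simp add: nn_integral_add nn_integral_cmult del: ennreal_mult)
  also have "... <= 2 * en (y t) + en (2 * hb^2) * en kR" by (intro add_left_mono mult_left_mono kR) simp
  also have "... = en (?Y t)" using y_nn kR by (simp add: ennreal_plus ennreal_mult)
  finally show ?thesis .
 qed
 have yI: "set_integrable lborel {r..t} y" if "a <= r" for r t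
  unfolding set_integrable_def
  by (rule integrableI_bounded_set[where A="{r..t}" and B="hb^2 * C0"])
  (use S_eq y_nn that in "auto simp: indicator_def emeasure_lborel_Icc_eq")
 define Y where "Y t = (LINT u:{a..t}|lborel. y u)" for t
 have Y_nn: "0 <= Y t" for t unfolding Y_def set_lebesgue_integral_def by (intro integral_nonneg_AE) (auto simp: y_nn)
 have Y_diff: "Y t - Y r = (LINT u:{r..t}|lborel. y u)" if "a <= r" "r <= t" for r t
  unfolding Y_def using that by (subst set_integral_split_Icc[OF yI, of a r t]) auto
 have Yennreal: "(INT+ u:{r..t}. en (y u)) = en (LINT u:{r..t}|lborel. y u)" if "a <= r" for r t
 proof -
  have "(INT+ u:{r..t}. en (y u)) = (INT+ u. en (ind {r..t} u *R y u))"
  by (intro nn_integral_cong) (auto simp: indicator_def)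
  also have "... = en (LINT u:{r..t}|lborel. y u)"
  unfolding set_lebesgue_integral_def using yI[OF that] y_nn
  by (intro nn_integral_eq_integral) (auto simp: set_integrable_def)
  finally show ?thesis .
 qed
 have main: "y b <= C4 * (Y b + hb^2 * kR)" if b: "b : G" "a < b" for b
 proof -
  have b1: "b <= 1" using b G_sub by auto
  interpret E: nl_energy s lam Lam "%t x. - U t x" kap G ?et "max 1 ?p" R "%t. - h t" g a b
  proof (intro nl_energy.intro nl_energy_axioms.intro sol')
  show "- h t - - h r = (LINT u:{r..t}|lborel. g u)" if "a <= r" "r <= t" "t <= b" for r t by (rule lg[OF that])
  qed (use R a b etaR_props[OF R] gI in auto)
  have VE: "E.V t x = V t x" for t x by (simp add: E.V_def V_def)
  have Gt2: "2 * E.Gt t = y t" for t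
  unfolding E.Gt_def y_def VE by (subst Bochner_Integration.integral_mult_right_zero[symmetric]) (simp add: algebra_simps)
  \<comment> \<open>At the initial time the level is 0 and \<open>U\<close> is nonnegative: the
    deficit vanishes and there is no initial energy.\<close>
  have Ga: "E.Gt a = 0"
  proof -
  have "F a = 0" unfolding F_def set_lebesgue_integral_def
  using AE_lborel_singleton[of a] by (intro integral_eq_zero_AE) (auto elim: eventually_mono)
  then have "V a x = 0" for x using U_nn[of a x] by (simp add: V_def h_def)
  then show ?thesis by (simp add: E.Gt_def VE)
  qed
  \<comment> \<open>The heart of the lower bound: wherever \<open>U\<close> is below the level, the
    mass above the level is felt through the kernel at a rate that pays for the rise.\<close>
  have Pb: "en (max 0 (- g t) * E.m t) <= 2 * E.P t" if t: "E.good t" for t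
  proof (cases "h t <= 0 \<or> - g t <= 0")
  case True
  then show ?thesis
  proof
  assume "h t <= 0"
  then have "V t x = 0" for x using U_nn[of t x] by (simp add: V_def)
  then have "E.m t = 0" by (simp add: E.m_def E.phi_def VE)
  then show ?thesis by simp
  qed (simp add: max_def)
  next
  case False
  then have ht: "0 < h t" and gt: "0 < - g t" by auto
  have tG: "t : G" "a <= t" "t <= b" using E.goodD[OF t] by auto
  have "E.N t = N t" by (simp add: E.N_def N_def)
  then have Nfin: "N t < inft" using t by (simp add: E.good_def)
  then obtain Nr where Nr: "0 <= Nr" "N t = en Nr" by (rule ennreal_finiteE)
  have fN: "f t <= Nr" using Nr by (simp add: f_def indicator_def)
  have gle: "- g t <= 2 * (c * (Nr - C0 * h t))"
  proof -
  have "2 * c * f t <= 2 * c * Nr" using fN c by (intro mult_left_mono) auto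
  moreover have "2 * c * C0 * h t <= 2 * c * C0 * (2 * c * A)" using h_le[OF tG(2)] c C0 by (intro mult_left_mono) auto
  ultimately show ?thesis by (simp add: g_def d_def power2_eq_square algebra_simps)
  qed
  define I where "I = (INT+ y. en (c * (max 0 (U t y - h t) * rho s y)))"
  have Il: "en (c * (Nr - C0 * h t)) <= I"
  proof -
  have "en (c * Nr) = en c * N t" using c Nr by (simp add: ennreal_mult)
  also have "... = (INT+ y. en c * en (<|U t y|> * rho s y))" unfolding N_def by (simp add: nn_integral_cmult)
  also have "... <= (INT+ y. en (c * (max 0 (U t y - h t) * rho s y)) + en (c * h t) * en (rho s y))"
  proof (intro nn_integral_mono, goal_cases)
  case (1 y)
  have "<|U t y|> <= max 0 (U t y - h t) + h t" using U_nn[of t y] ht by (simp add: max_def)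
  then have "c * (<|U t y|> * rho s y) <= c * ((max 0 (U t y - h t) + h t) * rho s y)" using c by (intro mult_left_mono mult_right_mono) auto
  also have "... = c * (max 0 (U t y - h t) * rho s y) + (c * h t) * rho s y" by (simp add: algebra_simps)
  finally have "en (c * (<|U t y|> * rho s y)) <= en (c * (max 0 (U t y - h t) * rho s y) + (c * h t) * rho s y)" by (rule ennreal_leI)
  also have "... = en (c * (max 0 (U t y - h t) * rho s y)) + en (c * h t) * en (rho s y)"
  using c ht by (subst ennreal_plus) (auto simp: ennreal_mult)
  finally show ?case using c by (subst ennreal_mult[symmetric]) auto
  qed
  also have "... = I + en (c * h t) * en C0" unfolding I_def by (simp add: nn_integral_add nn_integral_cmult C0)
  also have "... = I + en (c * h t * C0)" using c ht C0 by (simp add: ennreal_mult)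
  finally have *: "en (c * Nr) <= I + en (c * h t * C0)" .
  show ?thesis
  proof (cases I)
  case (real i)
  then have "en (c * Nr) <= en (i + c * h t * C0)" using * c ht C0 by simp
  then have "c * Nr <= i + c * h t * C0"
  using real c ht C0 by (subst (asm) ennreal_le_iff) (auto intro!: add_nonneg_nonneg)
  then have "c * (Nr - C0 * h t) <= i" by (simp add: algebra_simps)
  then show ?thesis using real by (simp add: ennreal_leI)
  qed simp
  qed
  have "en (c * (Nr - C0 * h t)) * en (E.m t) <= I * en (E.m t)" by (rule mult_right_mono[OF Il]) simp
  also have "... = (INT+ x. en (E.phi t x) * I)"
  by (subst nn_integral_multc) (simp_all add: E.m_eq[OF tG] mult.commute)
  also have "... = (INT+ x. INT+ y. en (E.phi t x) * en (c * (max 0 (U t y - h t) * rho s y)))"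
  unfolding I_def by (simp add: nn_integral_cmult)
  \<comment> \<open>The lower bound of the kernel by the weight fails on the diagonal, where
    \<open>kern\<close> is 0; hence the comparison holds for almost every \<open>y\<close>
    only.\<close>
  also have "... <= E.P t" unfolding E.P_def
  proof (rule nn_integral_mono, rule nn_integral_mono_AE)
  fix x :: 'a
  show "AEL y. en (E.phi t x) * en (c * (max 0 (U t y - h t) * rho s y))
  <= en (E.V t x * (?et x)^2 * max 0 (- h t - (- U t y)) * kap t x y)"
  using AE_lborel_singleton[of x]
  proof eventually_elim
  case (elim y)
  show ?case
  proof (cases "R <= norm x")
  case True
  then have "?et x = 0" by (rule etaR_props(5)[OF R])
  then show ?thesis by (simp add: E.phi_def)
  next
  case False
  have "rho s y <= R powr ?p * kern s x y" using False R elim by (intro rho_le_kern s) auto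
  then have "c * rho s y <= c * (R powr ?p * kern s x y)" using c by (intro mult_left_mono) auto
  also have "... = (c * R powr ?p) * kern s x y" by simp
  also have "... <= lam * kern s x y" by (rule mult_right_mono[OF c(2)]) simp
  also have "... <= kap t x y" by (rule kap_lower)
  finally have "c * rho s y <= kap t x y" .
  then have "(E.phi t x * max 0 (U t y - h t)) * (c * rho s y) <= (E.phi t x * max 0 (U t y - h t)) * kap t x y"
  by (intro mult_left_mono) auto
  then have "E.phi t x * (c * (max 0 (U t y - h t) * rho s y)) <= E.V t x * (?et x)^2 * max 0 (- h t - (- U t y)) * kap t x y"
  by (simp add: E.phi_def mult_ac)
  then show ?thesis using c by (subst ennreal_mult[symmetric]) (auto intro: ennreal_leI)
  qed
  qed
  qed
  finally have Pl: "en (c * (Nr - C0 * h t)) * en (E.m t) <= E.P t" .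
  have "en (max 0 (- g t) * E.m t) <= en (2 * ((c * (Nr - C0 * h t)) * E.m t))"
  using mult_right_mono[OF gle E.m_nn[of t]] gt by (intro ennreal_leI) (simp add: max_def mult.assoc)
  also have "... = 2 * (en (c * (Nr - C0 * h t)) * en (E.m t))"
  using gle gt E.m_nn[of t] by (simp add: ennreal_mult)
  also have "... <= 2 * E.P t" by (intro mult_left_mono Pl) simp
  finally show ?thesis .
  qed
  have gmfin: "(INT+ t:{a..b}. en (max 0 (- g t) * E.m t)) < inft"
  proof -
  have "(INT+ t:{a..b}. en (max 0 (- g t) * E.m t)) <= (INT+ t:{a..b}. en <|g t * E.m t|>)"
  using E.m_nn by (intro nn_integral_mono mult_right_mono ennreal_leI) (auto simp: abs_mult intro!: mult_right_mono)
  also have "... < inft" by (rule set_integrable_nnD[OF E.gm_integrable(1)])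
  finally show ?thesis .
  qed
  let ?gm = "INT+ t:{a..b}. en (max 0 (- g t) * E.m t)"
  have "?gm <= (INT+ t:{a..b}. (E.D t + 2 * E.P t))"
  using E.AE_good
  proof (intro nn_integral_mono_AE, eventually_elim)
  case (elim t)
  then show ?case using Pb[of t] by (auto simp: indicator_def intro: add_increasing)
  qed
  then have "en (E.Gt b) + ?gm <= en (E.Gt b) + (INT+ t:{a..b}. (E.D t + 2 * E.P t))
  + (INT+ t:{a..b}. en (max 0 (g t) * E.m t))" by (intro add_increasing2 add_left_mono) auto
  also have "... <= (INT+ t:{a..b}. E.X t) + ?gm" using E.energy_inequality by (simp add: Ga)
  finally have GX: "en (E.Gt b) <= (INT+ t:{a..b}. E.X t)"
  using gmfin by (auto simp: add.commute[of _ ?gm] ennreal_add_left_cancel_le)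
  \<comment> \<open>With the cut-off \<open>etaR R\<close> the localization term is at most a
    multiple of the weighted energy itself plus the tail of the weight. It is this self-bound that
    lets Gronwall's inequality close the estimate.\<close>
  have Xb: "E.X t <= en (Lam * C3 * (?Y t))" if t: "a <= t" for t
  proof -
  define Fx where "Fx x y = en (Lam / 2) * (en ((V t x)^2) * en ((sqrt (rho s x) - sqrt (rho s y))^2 * kern s x y))" for x y
  have Fxm[measurable]: "(%(x, y). Fx x y) : borel_measurable lborel2" unfolding Fx_def by measurable
  have pt: "en (E.V t x * E.V t y * (?et x - ?et y)^2 * kap t x y) <= Fx x y + Fx y x" for x y
  proof -
  have sq: "(?et x - ?et y)^2 <= (sqrt (rho s x) - sqrt (rho s y))^2"
  using etaR_props(6)[OF R, of x y] by (simp add: abs_le_square_iff)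
  have "V t x * V t y <= (V t x)^2 / 2 + (V t y)^2 / 2"
  using zero_le_power2[of "V t x - V t y"] by (simp add: power2_diff)
  then have "(V t x * V t y) * ((?et x - ?et y)^2 * kap t x y) <= ((V t x)^2 / 2 + (V t y)^2 / 2) * ((sqrt (rho s x) - sqrt (rho s y))^2 * (Lam * kern s x y))"
  by (intro mult_mono kap_upper sq mult_nonneg_nonneg) (auto simp: V_def)
  then have *: "E.V t x * E.V t y * (?et x - ?et y)^2 * kap t x y
  <= Lam / 2 * ((V t x)^2 * ((sqrt (rho s x) - sqrt (rho s y))^2 * kern s x y)) + Lam / 2 * ((V t y)^2 * ((sqrt (rho s y) - sqrt (rho s x))^2 * kern s y x))"
  unfolding VE by (simp add: algebra_simps power2_commute[of "sqrt (rho s y)"] kern_commute[of s y x])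
  from ennreal_leI[OF *] show ?thesis
  unfolding Fx_def by (simp add: ennreal_plus ennreal_mult del: times_divide_eq_left)
  qed
  have F2: "(INT+ x. INT+ y. Fx y x) = (INT+ x. INT+ y. Fx x y)"
  by (rule lborel_pair.Fubini') measurable
  have intF: "(INT+ x. INT+ y. Fx x y) <= en (Lam / 2 * C3) * (INT+ x. en ((V t x)^2 * rho s x))"
  proof -
  have "(INT+ x. INT+ y. Fx x y) <= (INT+ x. en (Lam / 2 * C3) * en ((V t x)^2 * rho s x))"
  proof (intro nn_integral_mono, goal_cases)
  case (1 x)
  have "(INT+ y. Fx x y) = en (Lam / 2) * (en ((V t x)^2) * (INT+ y. en ((sqrt (rho s x) - sqrt (rho s y))^2 * kern s x y)))"
  unfolding Fx_def by (subst nn_integral_cmult, measurable, subst nn_integral_cmult, measurable)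
  also have "... <= en (Lam / 2) * (en ((V t x)^2) * en (C3 * rho s x))" by (intro mult_left_mono C3) auto
  also have "... = en (Lam / 2 * C3) * en ((V t x)^2 * rho s x)" 
  using C3(1) by (subst ennreal_mult''[symmetric], simp)+ (simp add: mult_ac)
  finally show ?case .
  qed
  also have "... = en (Lam / 2 * C3) * (INT+ x. en ((V t x)^2 * rho s x))" by (rule nn_integral_cmult) measurable
  finally show ?thesis .
  qed
  have "E.X t <= (INT+ x. INT+ y. Fx x y + Fx y x)" unfolding E.X_def by (intro nn_integral_mono pt)
  also have "... = (INT+ x. INT+ y. Fx x y) + (INT+ x. INT+ y. Fx y x)"
  by (rule nn_integral_iterated_add) measurable
  also have "... <= en (Lam / 2 * C3) * en (?Y t) + en (Lam / 2 * C3) * en (?Y t)"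
  unfolding F2 by (intro add_mono order_trans[OF intF mult_left_mono[OF rhoV[OF t]]]) auto
  also have "... = en (Lam * C3 * (?Y t))"
  using C3(1) y_nn[of t] kR(1) by (subst ennreal_mult_double) simp_all
  finally show ?thesis .
  qed
  have "en (E.Gt b) <= (INT+ t. en (2 * Lam * C3) * (en (y t) * ind {a..b} t) + en (2 * Lam * C3 * (hb^2 * kR)) * ind {a..b} t)"
  proof (rule order_trans[OF GX], intro nn_integral_mono)
  fix t
  have "Lam * C3 * (?Y t) = (2 * Lam * C3) * y t + 2 * Lam * C3 * (hb^2 * kR)" by (simp add: algebra_simps)
  then have "en (Lam * C3 * (?Y t)) = en (2 * Lam * C3) * en (y t) + en (2 * Lam * C3 * (hb^2 * kR))"
  using C3 y_nn[of t] kR by (simp flip: ennreal_plus ennreal_mult)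
  then show "E.X t * ind {a..b} t <= en (2 * Lam * C3) * (en (y t) * ind {a..b} t) + en (2 * Lam * C3 * (hb^2 * kR)) * ind {a..b} t"
  using Xb[of t] by (cases "t : {a..b}") auto
  qed
  also have "... = en (2 * Lam * C3) * en (Y b) + en (2 * Lam * C3 * (hb^2 * kR)) * en (b - a)"
  using b Yennreal[of a b] by (simp add: nn_integral_add nn_integral_cmult nn_integral_cmult_indicator Y_def)
  also have "... <= en (2 * Lam * C3) * en (Y b) + en (2 * Lam * C3 * (hb^2 * kR)) * en 1"
  using b1 a0 by (intro add_left_mono mult_left_mono ennreal_leI) auto
  also have "... = en (2 * Lam * C3 * (Y b + hb^2 * kR))"
  using C3(1) Y_nn[of b] kR(1) ennreal_affine[of "2 * Lam * C3" "Y b" "2 * Lam * C3 * (hb^2 * kR)"] by (simp add: algebra_simps)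
  finally have "E.Gt b <= 2 * Lam * C3 * (Y b + hb^2 * kR)"
  using C3 Y_nn[of b] kR by (simp add: ennreal_le_iff)
  then show ?thesis unfolding Gt2[symmetric] C4_def by (simp add: algebra_simps)
 qed
 \<comment> \<open>Gronwall's inequality is applied to the time integral \<open>Y\<close> of the
   energy, as the energy is bounded only at times of \<open>G\<close>.\<close>
 have "Y 1 <= 2 ^ NN * (Y a + 2 * (C4 * (hb^2 * kR)))"
 proof (rule discrete_gronwall[where Y=Y and C=C4 and a=a and b=1])
  show "Y t - Y r <= (t - r) * (C4 * (hb^2 * kR) + C4 * Y t)" if rt: "a <= r" "r <= t" "t <= 1" for r t
  proof -
  have "(LINT u:{r..t}|lborel. y u) <= (LINT u:{r..t}|lborel. C4 * (hb^2 * kR) + C4 * Y t)"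
  proof (rule set_integral_mono_AE)
  show "AE u\<in>{r..t} in lborel. y u <= C4 * (hb^2 * kR) + C4 * Y t"
  using G_AE AE_lborel_singleton[of a]
  proof eventually_elim
  case (elim u)
  show ?case
  proof
  assume u: "u : {r..t}"
  then have uG: "u : G" "a < u" using elim rt a0 by auto
  have "Y t - Y u \<ge> 0"
  proof -
  have "0 <= (LINT v:{u..t}|lborel. y v)" unfolding set_lebesgue_integral_def by (intro integral_nonneg_AE) (auto simp: y_nn)
  then show ?thesis using Y_diff[of u t] u rt by auto
  qed
  then have "C4 * (Y u + hb^2 * kR) <= C4 * (Y t + hb^2 * kR)" using C4 by (intro mult_left_mono) auto
  with main[OF uG] show "y u <= C4 * (hb^2 * kR) + C4 * Y t" by (simp add: algebra_simps)
  qed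
  qed
  qed (use rt yI in "auto simp: set_integrable_def emeasure_lborel_Icc_eq")
  then show ?thesis using Y_diff[of r t] rt by (simp add: set_lebesgue_integral_def)
  qed
 qed (use a a0 C4 kR Y_nn NN in "auto simp: C4_def")
 moreover have "Y a = 0"
  unfolding Y_def set_lebesgue_integral_def
  using AE_lborel_singleton[of a] by (intro integral_eq_zero_AE) (auto elim: eventually_mono)
 ultimately have Y1: "Y 1 <= 2 ^ NN * (2 * (C4 * (hb^2 * kR)))" by simp
 have "(INT+ t:{1/2..1}. (INT+ x. en ((max 0 (c * A - U t x))^2 * rho s x)))
  <= (INT+ t. 2 * (en (y t) * ind {a..1} t) + en (2 * hb^2 * kR) * ind {a..1} t)"
 proof (intro nn_integral_mono, goal_cases)
  case (1 t)
  show ?case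
  proof (cases "t : {1/2..1}")
  case True
  then have ta: "a <= t" using a by auto
  have "(INT+ x. en ((max 0 (c * A - U t x))^2 * rho s x)) <= (INT+ x. en ((V t x)^2 * rho s x))"
  using kh[of t] True by (intro nn_integral_mono ennreal_leI mult_right_mono power_mono) (auto simp: V_def)
  also have "... <= en (?Y t)" by (rule rhoV[OF ta])
  also have "... = 2 * en (y t) + en (2 * hb^2 * kR)" using y_nn[of t] kR by (simp add: ennreal_plus ennreal_mult)
  finally show ?thesis using True ta by simp
  qed simp
 qed
 also have "... = 2 * en (Y 1) + en (2 * hb^2 * kR) * en (1 - a)"
  using a Yennreal[of a 1] by (simp add: nn_integral_add nn_integral_cmult nn_integral_cmult_indicator Y_def)
 also have "... <= 2 * en (Y 1) + en (2 * hb^2 * kR) * en 1"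
  using a0 by (intro add_left_mono mult_left_mono ennreal_leI) auto
 also have "... = en (2 * Y 1 + 2 * hb^2 * kR)" using Y_nn[of 1] kR by (simp add: ennreal_plus ennreal_mult)
 also have "... <= en (8 * (2 ^ NN * (8 * Lam * C3) + 1) * kR * (c * A)^2)"
 proof (rule ennreal_leI)
  have "2 * Y 1 + 2 * hb^2 * kR <= 2 * (2 ^ NN * (2 * (C4 * (hb^2 * kR)))) + 2 * hb^2 * kR" using Y1 by linarith
  also have "... = 8 * (2 ^ NN * (8 * Lam * C3) + 1) * kR * (c * A)^2"
  by (simp add: C4_def hb_def power2_eq_square algebra_simps)
  finally show "2 * Y 1 + 2 * hb^2 * kR <= ..." .
 qed
 finally show ?thesis .
qed

end

section \<open>Rescaled local boundedness and coverings\<close>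

lemma nn_integral_lincomb:
 assumes [measurable]: "f : borel_measurable M" "g : borel_measurable M"
 shows "(\<integral>\<^sup>+x. a * f x + b * g x \<partial>M) = a * (\<integral>\<^sup>+x. f x \<partial>M) + b * (\<integral>\<^sup>+x. g x \<partial>M)"
 by (simp add: nn_integral_add nn_integral_cmult)

lemma nn_integral_scale:
 fixes f :: "real => 'a::euclidean_space => ennreal"
 assumes f[measurable]: "(%(t, x). f t x) : borel_measurable borel2" and r: "0 < r" and h: "0 < h"
 shows "(INT+ u:{t0 - h<..t0}. (INT+ y. f u y))
  = en (h * r ^ DIM('a)) * (INT+ t:{0<..1}. (INT+ x. f (t0 - h + h * t) (x0 + r *R x)))"
proof -
 have ind: "ind {t0 - h<..t0} (t0 - h + h * t) = (ind {0<..1} t :: ennreal)" for t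
 proof -
  have "t0 - h + h * t <= t0 \<longleftrightarrow> h * t <= h * 1" by auto
  also have "... \<longleftrightarrow> t <= 1" using h by (subst mult_le_cancel_left_pos) auto
  finally show ?thesis using h by (auto simp: indicator_def zero_less_mult_iff)
 qed
 have "(INT+ u:{t0 - h<..t0}. (INT+ y. f u y))
  = en h * (INT+ t:{0<..1}. (INT+ y. f (t0 - h + h * t) y))"
  using nn_integral_real_affine[of "%u. (INT+ y. f u y) * ind {t0 - h<..t0} u" h "t0 - h"] h
  by (simp add: ind)
 also have "(INT+ t:{0<..1}. (INT+ y. f (t0 - h + h * t) y))
  = (INT+ t. en (r ^ DIM('a)) * ((INT+ x. f (t0 - h + h * t) (x0 + r *R x)) * ind {0<..1} t))"
  by (subst nn_integral_affine[OF _ r, of _ x0]) (simp_all add: mult.assoc)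
 also have "... = en (r ^ DIM('a)) * (INT+ t:{0<..1}. (INT+ x. f (t0 - h + h * t) (x0 + r *R x)))"
  by (rule nn_integral_cmult) measurable
 finally show ?thesis using h r by (simp add: ennreal_mult mult.assoc)
qed

lemma AE_affine:
 fixes x0 :: "'a::euclidean_space"
 assumes [measurable]: "Measurable.pred borel P" and r: "0 < r" and P: "AEL x. P (x0 + r *R x)"
 shows "AEL y. P y"
proof -
 have "AE y in density (distr lborel borel (%x. x0 + r *R x)) (%_. en (<|r|> ^ DIM('a))). P y"
  using P by (subst AE_density) (auto simp: AE_distr_iff)
 then show ?thesis using r by (subst lborel_affine[of r x0]) auto
qed

text \<open>Each ball has its own exceptional null set. By the Lindelof property countably many
  balls suffice, so these sets combine into one null set.\<close>

lemma AE_ball_cover: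
 fixes S :: "'a::euclidean_space set"
 assumes r: "0 < r" and P: "!!x0. x0 : S ==> AEL x. x : ball x0 r --> P x"
 shows "AEL x. x : S --> P x"
proof -
 have op: "open S'" if "S' : (%x0. ball x0 r) ` S" for S' using that by auto
 obtain F where F: "F \<subseteq> (%x0. ball x0 r) ` S" "countable F" "\<Union>F = \<Union>((%x0. ball x0 r) ` S)"
  using Lindelof[of "(%x0. ball x0 r) ` S"] op by metis
 have "AEL x. \<forall>B\<in>F. x : B --> P x"
  using F(1,2) P by (subst AE_ball_countable) auto
 then show ?thesis
 proof eventually_elim
  case (elim x)
  show ?case
  proof
  assume "x : S"
  then have "x : \<Union>((%x0. ball x0 r) ` S)" using r by (auto intro!: bexI[of _ x])
  then show "P x" using elim F(3) by auto
  qed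
 qed
qed

lemma AE_meets_interval:
 fixes a b :: real
 assumes "AEL t. t : {a<..<b} --> t : G" "a < b"
 shows "\<exists>t\<in>G. a < t \<and> t < b"
proof (rule ccontr)
 assume *: "\<not> ?thesis"
 have "AEL t. t \<notin> {a<..<b}" using assms(1) by eventually_elim (use * in auto)
 then have "{a<..<b} : null_sets lborel" by (subst AE_iff_null_sets) auto
 then have "emeasure lborel {a<..<b} = 0" by (rule null_setsD1)
 then show False using assms(2) by simp
qed

lemma ennreal_le_cmult_cancel:
 assumes "en c * x <= en (c * y)" "0 < c" "0 <= y"
 shows "x <= en y"
proof (cases x)
 case (real z)
 then show ?thesis using assms by (simp add: ennreal_mult[symmetric] ennreal_le_iff ennreal_leI)
next
 case top
 then show ?thesis using assms by (simp add: ennreal_mult_top top_unique)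
qed

text \<open>Both hypotheses carry the factor \<open>r powr (2 * s) * r ^ d\<close>, the size of the
  cylinder, so that \<open>n\<close> and \<open>n'\<close> remain averages and \<open>C\<close> does
  not depend on the scale.\<close>

theorem local_boundedness_scaled:
 assumes s: "0 < s" "s < 1" and lam: "0 < lam" "lam <= Lam"
 obtains C where "0 < C" "!!(U :: real => 'a::euclidean_space => real) kap G r t0 x0 n n'. nlsol s lam Lam U kap G ==>
  0 < r ==> t0 : G ==> r powr (2 * s) <= t0 ==> 0 < n ==> 0 <= n' ==>
  (INT+ t:{t0 - r powr (2 * s)<..t0}. (INT+ x:ball x0 (5 * r). en ((max 0 (U t x))^2)))
  <= en (r powr (2 * s) * r ^ DIM('a) * n^2) ==>
  (INT+ t:{t0 - r powr (2 * s)<..t0}. (INT+ x. en (max 0 (U t x) * rho s ((1 / r) *R (x - x0)))))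
  <= en (r powr (2 * s) * r ^ DIM('a) * n') ==>
  AEL x. x : ball x0 r --> U t0 x <= C * (n + n')"
proof (rule local_boundedness[OF assms, where ?'a='a], goal_cases)
 case (1 C)
 show ?case
 proof (rule 1(1)[OF 1(2)])
  fix U :: "real => 'a => real" and kap G r t0 x0 n n'
  define h where "h = r powr (2 * s)"
  assume sol: "nlsol s lam Lam U kap G" and r: "0 < r" and t0: "t0 : G" "r powr (2 * s) <= t0" and n: "0 < n" "0 <= n'"
  and L2: "(INT+ t:{t0 - r powr (2 * s)<..t0}. (INT+ x:ball x0 (5 * r). en ((max 0 (U t x))^2)))
  <= en (r powr (2 * s) * r ^ DIM('a) * n^2)"
  and L1: "(INT+ t:{t0 - r powr (2 * s)<..t0}. (INT+ x. en (max 0 (U t x) * rho s ((1 / r) *R (x - x0)))))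
  <= en (r powr (2 * s) * r ^ DIM('a) * n')"
  interpret nlsol s lam Lam U kap G by fact
  have h: "0 < h" using r by (simp add: h_def)
  have hr: "0 < h * r ^ DIM('a)" using h r by simp
  have ind: "ind (ball x0 (5 * r)) (x0 + r *R x) = (ind (ball 0 5) x :: ennreal)" for x
  using r by (auto simp: indicator_def dist_norm)
  note sc = nn_integral_scale[OF _ r h, of _ t0 x0]
  have "AEL x. x : ball 0 1 --> U (t0 - h + h * 1) (x0 + r *R x) <= C * (n + n')"
  proof (rule 1(3)[OF nlsol_scale[OF sol r t0, folded h_def] n])
  show "(INT+ t:{0<..1}. (INT+ x:ball 0 5. en ((max 0 (U (t0 - h + h * t) (x0 + r *R x)))^2))) <= en (n^2)"
  proof (rule ennreal_le_cmult_cancel[OF _ hr])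
  have m: "(%(t, x). en ((max 0 (U t x))^2) * ind (ball x0 (5 * r)) x) : borel_measurable borel2" by measurable
  show "en (h * r ^ DIM('a)) * (INT+ t:{0<..1}. (INT+ x:ball 0 5. en ((max 0 (U (t0 - h + h * t) (x0 + r *R x)))^2)))
  <= en (h * r ^ DIM('a) * n^2)"
  using L2[folded h_def, unfolded sc[OF m]] by (simp only: ind)
  qed simp
  show "(INT+ t:{0<..1}. (INT+ x. en (max 0 (U (t0 - h + h * t) (x0 + r *R x)) * rho s x))) <= en n'"
  proof (rule ennreal_le_cmult_cancel[OF _ hr n(2)])
  have m: "(%(t, x). en (max 0 (U t x) * rho s ((1 / r) *R (x - x0)))) : borel_measurable borel2" by measurable
  show "en (h * r ^ DIM('a)) * (INT+ t:{0<..1}. (INT+ x. en (max 0 (U (t0 - h + h * t) (x0 + r *R x)) * rho s x)))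
  <= en (h * r ^ DIM('a) * n')"
  using L1[folded h_def, unfolded sc[OF m]] r by simp
  qed
  qed
  then have "AEL x. x0 + r *R x : ball x0 r --> U t0 (x0 + r *R x) <= C * (n + n')"
  using r by (auto elim!: eventually_mono simp: dist_norm)
  then show "AEL x. x : ball x0 r --> U t0 x <= C * (n + n')"
  by (rule AE_affine[OF _ r, rotated]) measurable
 qed
qed

lemma rho_tail:
 assumes s: "0 < s" "s < 1" and "0 < ep"
 obtains R where "1 <= R" "(INT+ x. en (min (rho s (x::'a::euclidean_space)) (1 / (1 + R) powr (real DIM('a) + 2 * s)))) <= en ep"
proof -
 define q where "q n = 1 / (1 + real (Suc n)) powr (real DIM('a) + 2 * s)" for n
 have p: "- (real DIM('a) + 2 * s) < 0" using s by (simp add: add_nonneg_pos)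
 have "filterlim (%n. 1 + real (Suc n)) at_top sequentially"
  by (intro filterlim_tendsto_add_at_top[OF tendsto_const] filterlim_compose[OF filterlim_real_sequentially filterlim_Suc])
 from tendsto_neg_powr[OF p this] have q: "q ~~> 0"
  unfolding q_def by (simp only: powr_minus_divide)
 have "(%n. INT+ x. en (min (rho s (x::'a)) (q n))) ~~> (INT+ (x::'a). 0)"
 proof (rule nn_integral_dominated_convergence[where w="%x. en (rho s x)"])
  show "(INT+ x. en (rho s (x::'a))) < inft" by (rule rho_finite_integral[OF s])
  have "(%n. min (rho s (x::'a)) (q n)) ~~> min (rho s x) 0" for x by (intro tendsto_min tendsto_const q)
  then show "AEL x. (%n. en (min (rho s (x::'a)) (q n))) ~~> 0"
  by (intro always_eventually allI) (metis ennreal_0 min_absorb2 rho_nonneg tendsto_ennrealI)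
 qed (auto intro!: always_eventually ennreal_leI)
 then have "eventually (%n. (INT+ x. en (min (rho s (x::'a)) (q n))) < en ep) sequentially"
  using assms(3) by (intro order_tendstoD(2)) auto
 then obtain n where "(INT+ x. en (min (rho s (x::'a)) (q n))) < en ep"
  using eventually_happens by fastforce
 then show thesis by (intro that[of "real (Suc n)"]) (auto simp: q_def)
qed

text \<open>\<open>low_level_energy\<close> makes the deficit below \<open>k\<close>, a fixed
  multiple of the past mass, small in the mean on the second half of the interval. Local boundedness
  of \<open>k - U\<close> turns small mean into small supremum: the deficit is at most
  \<open>k / 2\<close>, so \<open>U\<close> is at least \<open>k / 2\<close>.\<close>

theorem lower_bound:
 assumes s: "0 < s" "s < 1" and lam: "0 < lam" "lam <= Lam"
 obtains c where "0 < c" "!!(U :: real => 'a::euclidean_space => real) kap G. nlpos s lam Lam U kap G ==>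
  AEL x. x : ball 0 1 --> en c * (INT+ t:{0<..1/2}. nlsol.N s U t) <= en (U 1 x)"
proof (rule local_boundedness_scaled[OF assms, where ?'a='a], goal_cases)
 case (1 C)
 let ?p = "real DIM('a) + 2 * s"
 have Lam: "0 < Lam" using lam by simp
 obtain C3 where C3: "0 < C3" "!!x::'a. (INT+ y. en ((sqrt (rho s x) - sqrt (rho s y))^2 * kern s x y)) <= en (C3 * rho s x)"
  by (fact sqrt_rho_moment[OF s, where ?'a='a])
 obtain C0 where C0: "0 <= C0" "(INT+ y. en (rho s (y::'a))) = en C0"
  using rho_finite_integral[OF s, where ?'a='a] by (rule ennreal_finiteE)
 define NN where "NN = Suc (nat \<lceil>8 * Lam * C3\<rceil>)"
 have NN: "8 * Lam * C3 <= real NN" "0 < NN" by (auto simp: NN_def) linarith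
 define B where "B = 8 * (2 ^ NN * (8 * Lam * C3) + 1)"
 have B: "0 < B" using Lam C3(1) by (simp add: B_def add_nonneg_pos)
 \<comment> \<open>The cylinders of this radius have time length 1/2, so they fit exactly into the
   second half of the interval, where the deficit is controlled.\<close>
 define r :: real where "r = (1/2) powr (1 / (2 * s))"
 have r: "0 < r" "r <= 1" "r powr (2 * s) = 1/2"
  using s by (auto simp: r_def powr_powr intro!: powr_le1)
 define v where "v = 1/2 * r ^ DIM('a)"
 have v: "0 < v" using r by (simp add: v_def)
 define M where "M = 2 powr ?p / v * (C0 + 1)"
 have M: "0 <= M" using v C0 by (simp add: M_def)
 \<comment> \<open>Relative size of the deficit for which local boundedness, with mean
   \<open>k * de\<close> and far field \<open>k * de * M\<close>, yields exactly
   \<open>k / 2\<close>.\<close>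
 define de where "de = 1 / (2 * C * (1 + M))"
 have de: "0 < de" "C * (de * (1 + M)) = 1/2" using 1(2) M by (auto simp: de_def)
 \<comment> \<open>Tail of the weight that may be neglected. It fixes the radius \<open>R\<close>
   below, and \<open>R\<close> in turn fixes the constant \<open>c\<close>; the order matters
   because a larger support sees the mass through a weaker kernel.\<close>
 define kR where "kR = de^2 / (B * (1 + 7 powr ?p / v))"
 have w: "0 < 1 + 7 powr ?p / v" using v by (simp add: add_pos_nonneg)
 have kR: "0 < kR" using de B w by (simp add: kR_def)
 have BkR: "B * kR * (1 + 7 powr ?p / v) = de^2" using B w by (simp add: kR_def)
 have k1: "B * kR <= de^2" "7 powr ?p * (B * kR) <= v * de^2"
 proof -
  have e: "B * kR + B * kR * (7 powr ?p / v) = de^2" using BkR by (simp add: distrib_left)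
  have nn: "0 <= B * kR" "0 <= B * kR * (7 powr ?p / v)" using B kR v by auto
  from e nn show "B * kR <= de^2" by linarith
  have "B * kR * (7 powr ?p / v) <= de^2" using e nn by linarith
  then show "7 powr ?p * (B * kR) <= v * de^2" using v by (simp add: field_simps)
 qed
 obtain R where R: "1 <= R" "(INT+ x. en (min (rho s (x::'a)) (1 / (1 + R) powr ?p))) <= en kR"
  by (rule rho_tail[OF s kR])
 \<comment> \<open>The first entry lets the kernel pay for the rise of the level from anywhere in
   the support, the second keeps the correction for mass below the level small.\<close>
 define c where "c = min (lam / R powr ?p) (1 / (4 * (C0 + 1)))"
 have c: "0 < c" "c * R powr ?p <= lam" "c * C0 <= 1/4"
 proof -
  have "0 < R powr ?p" using R by simp
  then show "0 < c" using lam C0 by (simp add: c_def)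
  have "c <= lam / R powr ?p" by (simp add: c_def)
  then show "c * R powr ?p <= lam" using \<open>0 < R powr ?p\<close> by (simp add: pos_le_divide_eq)
  have "c * C0 <= 1 / (4 * (C0 + 1)) * C0" using C0 by (intro mult_right_mono) (simp_all add: c_def)
  also have "... <= 1/4" using C0 by (simp add: field_simps)
  finally show "c * C0 <= 1/4" .
 qed
 show ?case
 proof (rule 1(1))
  show "0 < c / 2" using c by simp
  fix U :: "real => 'a => real" and kap G
  assume "nlpos s lam Lam U kap G"
  then interpret nlpos s lam Lam U kap G .
  let ?J = "%k t. INT+ x. en ((max 0 (k - U t x))^2 * rho s x)"
  have low: "AEL x. x : ball 0 1 --> en (c / 2) * (INT+ t:{a..1/2}. N t) <= en (U 1 x)" if a: "a : G" "a < 1/2" for a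
  proof -
  have "0 < a" using a G_sub by auto
  from N_half_fin[OF this] obtain A where A: "0 <= A" "(INT+ t:{a..1/2}. N t) = en A" by (rule ennreal_finiteE)
  define k where "k = c * A"
  have "AEL x. x : ball 0 1 --> k / 2 <= U 1 x"
  proof (cases "A = 0")
  case False
  then have k: "0 < k" using c A by (simp add: k_def)
  have J: "(INT+ t:{1/2..1}. ?J k t) <= en (B * kR * k^2)"
  unfolding k_def B_def
  by (rule low_level_energy[OF a R(1) c C0 A less_imp_le[OF C3(1)] C3(2) less_imp_le[OF kR] _ NN]) (use R in "simp add: kapR_def")
  have "AEL x. x : ball x0 r --> k / 2 <= U 1 x" if x0: "x0 : ball 0 1" for x0
  proof -
  have "AEL x. x : ball x0 r --> k - U 1 x <= C * (k * de + k * de * M)"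
  proof (rule 1(3)[OF nlsol_const_minus[OF nlsol_axioms] r(1) G_1])
  show "(INT+ t:{1 - r powr (2 * s)<..1}. (INT+ x:ball x0 (5 * r). en ((max 0 (k - U t x))^2)))
  <= en (r powr (2 * s) * r ^ DIM('a) * (k * de)^2)" (is "?l <= _")
  proof -
  have "?l <= (INT+ t. en (7 powr ?p) * (?J k t * ind {1/2..1} t))"
  proof (intro nn_integral_mono, goal_cases)
  case gc: (1 t)
  have "(INT+ x:ball x0 (5 * r). en ((max 0 (k - U t x))^2))
  <= (INT+ x. en (7 powr ?p) * en ((max 0 (k - U t x))^2 * rho s x))"
  proof (intro nn_integral_mono, goal_cases)
  case gc: (1 x)
  show ?case
  proof (cases "x : ball x0 (5 * r)")
  case True
  have "norm x <= norm x0 + norm (x - x0)" using norm_triangle_ineq[of x0 "x - x0"] by simp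
  then have "norm x <= 6" using True x0 r by (auto simp: dist_norm norm_minus_commute)
  then have "rho s (0::'a) <= 7 powr ?p * rho s x" using s by (intro rho_le_rho) auto
  then have "(max 0 (k - U t x))^2 * 1 <= (max 0 (k - U t x))^2 * (7 powr ?p * rho s x)" by (intro mult_left_mono) (auto simp: rho_def)
  then show ?thesis using True by (subst ennreal_mult[symmetric]) (auto intro!: ennreal_leI simp: mult_ac)
  qed simp
  qed
  also have "... = en (7 powr ?p) * ?J k t" by (rule nn_integral_cmult) measurable
  finally show ?case
  using r by (auto simp: indicator_def)
  qed
  also have "... = en (7 powr ?p) * (INT+ t:{1/2..1}. ?J k t)"
  by (rule nn_integral_cmult) measurable
  also have "... <= en (7 powr ?p) * en (B * kR * k^2)" by (rule mult_left_mono[OF J]) simp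
  also have "... <= en (r powr (2 * s) * r ^ DIM('a) * (k * de)^2)"
  proof -
  have "7 powr ?p * (B * kR) * k^2 <= v * de^2 * k^2" by (intro mult_right_mono k1) simp
  also have "... = r powr (2 * s) * r ^ DIM('a) * (k * de)^2" unfolding r(3) v_def power_mult_distrib by (simp add: mult_ac)
  finally show ?thesis using B kR by (subst ennreal_mult[symmetric]) (auto intro!: ennreal_leI simp: mult_ac)
  qed
  finally show ?thesis .
  qed
  show "(INT+ t:{1 - r powr (2 * s)<..1}. (INT+ x. en (max 0 (k - U t x) * rho s ((1 / r) *R (x - x0)))))
  <= en (r powr (2 * s) * r ^ DIM('a) * (k * de * M))" (is "?l <= _")
  proof -
  let ?P = "2 powr ?p"
  have "?l <= (INT+ t. en (?P * (de * k) * C0) * ind {1/2..1} t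
  + en (?P * (1 / (de * k))) * (?J k t * ind {1/2..1} t))"
  proof (intro nn_integral_mono, goal_cases)
  case gc: (1 t)
  have "(INT+ x. en (max 0 (k - U t x) * rho s ((1 / r) *R (x - x0))))
  <= (INT+ x. en (?P * (de * k)) * en (rho s x) + en (?P * (1 / (de * k))) * en ((max 0 (k - U t x))^2 * rho s x))"
  proof (intro nn_integral_mono, goal_cases)
  case gc: (1 x)
  let ?w = "max 0 (k - U t x)"
  have "norm x <= norm x0 + norm (x - x0)" using norm_triangle_ineq[of x0 "x - x0"] by simp
  moreover have "r * norm (x - x0) <= 1 * norm (x - x0)" using r by (intro mult_right_mono) auto
  then have "norm (x - x0) <= norm ((1 / r) *R (x - x0))" using r by (simp add: pos_le_divide_eq mult.commute)
  ultimately have "1 + norm x <= 2 * (1 + norm ((1 / r) *R (x - x0)))" using x0 norm_ge_zero[of "(1 / r) *R (x - x0)"]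
  unfolding mem_ball dist_0_norm by (smt (verit, best))
  then have rr: "rho s ((1 / r) *R (x - x0)) <= ?P * rho s x" using s by (intro rho_le_rho) auto
  have "0 < de * k" using de k by simp
  have ww: "?w <= de * k + (1 / (de * k)) * ?w^2"
  using mult_le_weighted_squares[OF \<open>0 < de * k\<close>, of 1 ?w] by simp
  have "?w * rho s ((1 / r) *R (x - x0)) <= (de * k + (1 / (de * k)) * ?w^2) * (?P * rho s x)"
  by (rule mult_mono[OF ww rr]) (use de k in auto)
  also have "... = ?P * (de * k) * rho s x + ?P * (1 / (de * k)) * (?w^2 * rho s x)" by (simp add: distrib_right distrib_left mult_ac)
  finally have "en (?w * rho s ((1 / r) *R (x - x0))) <= en (?P * (de * k) * rho s x + ?P * (1 / (de * k)) * (?w^2 * rho s x))" by (rule ennreal_leI)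
  also have "... = en (?P * (de * k)) * en (rho s x) + en (?P * (1 / (de * k))) * en (?w^2 * rho s x)"
  using \<open>0 < de * k\<close> by (subst ennreal_plus) (auto simp: ennreal_mult simp del: times_divide_eq_right)
  finally show ?case .
  qed
  also have "... = en (?P * (de * k)) * en C0 + en (?P * (1 / (de * k))) * ?J k t"
  unfolding C0(2)[symmetric] by (rule nn_integral_lincomb) measurable
  also have "en (?P * (de * k)) * en C0 = en (?P * (de * k) * C0)"
  using de k C0 by (subst ennreal_mult[symmetric]) auto
  finally show ?case
  using r by (auto simp: indicator_def)
  qed
  also have "... = en (?P * (de * k) * C0) * en (1/2)
  + en (?P * (1 / (de * k))) * (INT+ t:{1/2..1}. ?J k t)"
  by (subst nn_integral_lincomb) simp_all
  also have "... <= en (?P * (de * k) * C0) * en 1 + en (?P * (1 / (de * k))) * en (B * kR * k^2)"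
  by (intro add_mono mult_left_mono J ennreal_leI) auto
  also have "... = en (?P * (de * k) * C0 + ?P * (1 / (de * k)) * (B * kR * k^2))"
  using de k B kR C0 by (subst ennreal_plus) (auto simp: ennreal_mult simp del: times_divide_eq_right)
  also have "... <= en (r powr (2 * s) * r ^ DIM('a) * (k * de * M))"
  proof (rule ennreal_leI)
  have "?P * (1 / (de * k)) * (B * kR * k^2) <= ?P * (1 / (de * k)) * (de^2 * k^2)"
  using k1(1) de k by (intro mult_left_mono mult_right_mono) auto
  also have "... = ?P * (de * k)" using de k by (simp add: power2_eq_square)
  finally have "?P * (de * k) * C0 + ?P * (1 / (de * k)) * (B * kR * k^2) <= ?P * (de * k) * (C0 + 1)" by (simp add: distrib_left)
  also have "... = v * (k * de * M)" using v by (simp add: M_def)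
  also have "v = r powr (2 * s) * r ^ DIM('a)" by (simp add: v_def r)
  finally show "?P * (de * k) * C0 + ?P * (1 / (de * k)) * (B * kR * k^2) <= r powr (2 * s) * r ^ DIM('a) * (k * de * M)" .
  qed
  finally show ?thesis .
  qed
  qed (use r k de M in auto)
  moreover have "C * (k * de + k * de * M) = k / 2"
  proof -
  have "C * (k * de + k * de * M) = k * (C * (de * (1 + M)))" by (simp add: algebra_simps)
  then show ?thesis using de by simp
  qed
  ultimately show ?thesis by (auto elim!: eventually_mono)
  qed
  then show ?thesis by (rule AE_ball_cover[OF r(1)])
  qed (simp add: k_def U_nn)
  then show ?thesis
  proof eventually_elim
  case (elim x)
  have "en (c / 2) * (INT+ t:{a..1/2}. N t) = en (k / 2)"
  unfolding A(2) using c A(1) by (subst ennreal_mult[symmetric]) (auto simp: k_def)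
  then show ?case using elim by (auto intro: ennreal_leI)
  qed
  qed
  \<comment> \<open>The estimate starts at a time of \<open>G\<close>, where the slice is
    controlled, and 0 is not one. Starting times tend to 0 and monotone convergence recovers the
    whole interval.\<close>
  have "\<exists>a\<in>G. 0 < a \<and> a < 1 / real (n + 2)" for n
  proof (rule AE_meets_interval)
  show "AEL t. t : {0<..<1 / real (n + 2)} --> t : G"
  using G_AE
  proof eventually_elim
  case (elim t)
  have "1 / real (n + 2) <= 1" by simp
  with elim show ?case by (meson greaterThanAtMost_iff greaterThanLessThan_iff less_imp_le less_le_trans)
  qed
  qed simp
  then obtain a where a: "!!n. a n : G" "!!n. a n < 1 / real (n + 2)" by metis
  have a2: "a n < 1/2" for n
  proof -
  have "1 / real (n + 2) <= 1/2" by (simp add: field_simps)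
  then show ?thesis using a(2)[of n] by linarith
  qed
  have "AEL x. \<forall>n. x : ball 0 1 --> en (c / 2) * (INT+ t:{a n..1/2}. N t) <= en (U 1 x)"
  unfolding AE_all_countable using low[OF a(1) a2] by blast
  then show "AEL x. x : ball 0 1 --> en (c / 2) * (INT+ t:{0<..1/2}. N t) <= en (U 1 x)"
  proof eventually_elim
  case (elim x)
  show ?case
  proof
  assume x: "x : ball 0 1"
  have "(INT+ t:{0<..1/2}. N t) = (INT+ t. (SUP n. N t * ind {1 / real (n + 2)..1/2} t))"
  proof (intro nn_integral_cong)
  fix t :: real
  have "(SUP n. N t * ind {1 / real (n + 2)..1/2} t) = N t * (SUP n. ind {1 / real (n + 2)..1/2} t)"
  by (simp add: SUP_mult_left_ennreal)
  also have "(SUP n. ind {1 / real (n + 2)..1/2} t) = (ind {0<..1/2} t :: ennreal)"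
  proof (cases "t : {0<..1/2}")
  case True
  then obtain n where "1 / real (Suc n) < t" using reals_Archimedean[of t] by (auto simp: inverse_eq_divide)
  moreover have "1 / real (n + 2) <= 1 / real (Suc n)" by (simp add: field_simps)
  ultimately have "t : {1 / real (n + 2)..1/2}" using True by simp
  then have "(1::ennreal) <= (SUP n. ind {1 / real (n + 2)..1/2} t)" by (intro SUP_upper2[of n]) auto
  moreover have "(SUP n. ind {1 / real (n + 2)..1/2} t) <= (1::ennreal)" by (intro SUP_least) (auto simp: indicator_def)
  ultimately show ?thesis using True by (simp add: antisym)
  next
  case False
  have "t \<notin> {1 / real (n + 2)..1/2}" for n
  proof
  assume t: "t : {1 / real (n + 2)..1/2}"
  moreover have "0 < 1 / real (n + 2)" by simp
  ultimately have "0 < t" unfolding atLeastAtMost_iff by (meson less_le_trans)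
  then show False using t False by auto
  qed
  then show ?thesis using False by simp
  qed
  finally show "N t * ind {0<..1/2} t = (SUP n. N t * ind {1 / real (n + 2)..1/2} t)" by simp
  qed
  also have "... = (SUP n. INT+ t:{1 / real (n + 2)..1/2}. N t)"
  proof (rule nn_integral_monotone_convergence_SUP)
  show "incseq (%n t. N t * ind {1 / real (n + 2)..1/2} t)"
  proof (intro incseq_SucI le_funI mult_left_mono)
  fix n and t :: real
  have "1 / real (Suc n + 2) <= 1 / real (n + 2)" by (simp add: field_simps)
  then show "ind {1 / real (n + 2)..1/2} t <= (ind {1 / real (Suc n + 2)..1/2} t :: ennreal)" by (auto simp: indicator_def)
  qed simp
  qed simp
  finally have "en (c / 2) * (INT+ t:{0<..1/2}. N t) = (SUP n. en (c / 2) * (INT+ t:{1 / real (n + 2)..1/2}. N t))"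
  by (simp add: SUP_mult_left_ennreal)
  also have "... <= en (U 1 x)"
  proof (rule SUP_least)
  fix n
  have "en (c / 2) * (INT+ t:{1 / real (n + 2)..1/2}. N t) <= en (c / 2) * (INT+ t:{a n..1/2}. N t)"
  using a(2)[of n] by (intro mult_left_mono nn_integral_mono) (auto simp: indicator_def)
  also have "... <= en (U 1 x)" using elim x by blast
  finally show "en (c / 2) * (INT+ t:{1 / real (n + 2)..1/2}. N t) <= en (U 1 x)" .
  qed
  finally show "en (c / 2) * (INT+ t:{0<..1/2}. N t) <= en (U 1 x)" .
  qed
  qed
 qed
qed

section \<open>Upper bound by the past mass\<close>

text \<open>Local boundedness on small cylinders bounds the supremum by the \<open>L\<^sup>2\<close> norm, hence by the square root of the supremum on a larger cylinder times the mass. The cylinders grow geometrically and the constant \<open>1/2\<close> gained in each step beats the loss \<open>b\<close> of the radii.\<close>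

theorem upper_bound:
 assumes s: "0 < s" "s < 1" and lam: "0 < lam" "lam <= Lam"
 obtains C where "0 < C" "!!(U :: real => 'a::euclidean_space => real) kap G. nlpos s lam Lam U kap G ==>
  AEL x. x : ball 0 1 --> en (U 1 x) <= en C * (INT+ t:{0<..1}. nlsol.N s U t)"
proof (rule local_boundedness_scaled[OF assms, where ?'a='a], goal_cases)
 case (1 C)
 let ?p = "real DIM('a) + 2 * s"
 have p: "0 < ?p" using s by (simp add: add_nonneg_pos)
 \<comment> \<open>The exponent makes both the radius \<open>rr i = z i powr e\<close> and its time
   length \<open>rr i powr (2 * s)\<close> at most \<open>z i\<close>, whichever of the two would
   otherwise be larger.\<close>
 define e where "e = max 1 (1 / (2 * s))"
 have e: "1 <= e" "1 <= 2 * s * e"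
 proof -
  have "2 * s * (1 / (2 * s)) <= 2 * s * e" using s by (intro mult_left_mono) (auto simp: e_def)
  then show "1 <= 2 * s * e" using s by simp
 qed (simp add: e_def)
 \<comment> \<open>The factor by which the size of the cylinders of radius \<open>rr i\<close>
   shrinks from one index to the next, hence the loss per step.\<close>
 define b where "b = 2 powr (e * ?p)"
 have b: "1 <= b" using e p by (simp add: b_def one_le_powr)
 define v0 where "v0 = (1/16) powr (e * ?p)"
 have v0: "0 < v0" by (simp add: v0_def)
 define z where "z i = (1/16 * (1/2) ^ i :: real)" for i :: nat
 define rr where "rr i = z i powr e" for i
 have z: "0 < z i" "z i <= 1/16" for i using power_le_one[of "1/2::real" i] by (auto simp: z_def)
 have rr: "0 < rr i" "rr i <= z i" "rr i powr (2 * s) <= z i" "rr i powr (2 * s) * rr i ^ DIM('a) = v0 / b ^ i" for i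
 proof -
  have z1: "z i <= 1" using z[of i] by simp
  show "0 < rr i" using z[of i] by (simp add: rr_def)
  have "z i powr e <= z i powr 1" using z[of i] z1 e by (intro powr_mono') auto
  then show "rr i <= z i" using z[of i] by (simp add: rr_def)
  have "z i powr (e * (2 * s)) <= z i powr 1" using z[of i] z1 e by (intro powr_mono') (auto simp: mult_ac)
  then show "rr i powr (2 * s) <= z i" using z[of i] by (simp add: rr_def powr_powr)
  have "rr i powr (2 * s) * rr i ^ DIM('a) = rr i powr ?p" using \<open>0 < rr i\<close> by (simp add: powr_add powr_realpow)
  also have "... = z i powr (e * ?p)" by (simp add: rr_def powr_powr)
  also have "... = v0 * ((1/2) ^ i) powr (e * ?p)" unfolding z_def by (subst powr_mult) (simp_all add: v0_def)
  also have "((1/2) ^ i) powr (e * ?p) = 1 / b ^ i"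
  by (simp add: b_def powr_power power_one_over powr_divide powr_realpow[symmetric] powr_powr mult.commute)
  finally show "rr i powr (2 * s) * rr i ^ DIM('a) = v0 / b ^ i" by simp
 qed
 \<comment> \<open>Young parameter for which the loss \<open>b\<close> of one step is turned into a
   gain of 1/2.\<close>
 define de where "de = 1 / (2 * C * b)"
 have de: "0 < de" "C * de * b = 1/2" using 1(2) b by (auto simp: de_def)
 define K where "K = C * (1 / de + 1) * (3 powr ?p / v0)"
 have K: "0 < K" using 1(2) de v0 by (simp add: K_def add_pos_pos)
 show ?case
 proof (rule 1(1))
  show "0 < 2 * K" using K by simp
  fix U :: "real => 'a => real" and kap G
  assume "nlpos s lam Lam U kap G"
  then interpret nlpos s lam Lam U kap G .
  obtain A where A: "0 <= A" "(INT+ t:{0<..1}. N t) = en A"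
  using L1_fin unfolding N_def[symmetric] by (rule ennreal_finiteE)
  have max0: "max 0 (U t x) = U t x" for t x using U_nn[of t x] by simp
  have absU: "<|U t x|> = U t x" for t x using U_nn[of t x] by simp
  have sub01: "{t - r powr (2 * s)<..t} \<subseteq> {0<..1}" if "t : G" "r powr (2 * s) <= t" for t r
  using that G_sub by auto
  have core: "AEL x. x : S --> U t x <= C * (n + n')"
  if t: "t : G" and r: "0 < r" "r <= 1" "r powr (2 * s) <= t" and S: "S \<subseteq> ball 0 2" and n: "0 < n"
  and L2: "!!x0. x0 : S ==> (INT+ t:{t - r powr (2 * s)<..t}. (INT+ x:ball x0 (5 * r). en ((U t x)^2)))
  <= en (r powr (2 * s) * r ^ DIM('a) * n^2)"
  and n': "3 powr ?p * A <= r powr (2 * s) * r ^ DIM('a) * n'" "0 <= n'" for t r S n n'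
  proof (rule AE_ball_cover[OF r(1)])
  fix x0 assume x0: "x0 : S"
  show "AEL x. x : ball x0 r --> U t x <= C * (n + n')"
  proof (rule 1(3)[OF nlsol_axioms r(1) t r(3) n n'(2)])
  show "(INT+ t:{t - r powr (2 * s)<..t}. (INT+ x:ball x0 (5 * r). en ((max 0 (U t x))^2)))
  <= en (r powr (2 * s) * r ^ DIM('a) * n^2)" using L2[OF x0] by (simp only: max0)
  have "(INT+ t:{t - r powr (2 * s)<..t}. (INT+ x. en (max 0 (U t x) * rho s ((1 / r) *R (x - x0)))))
  <= (INT+ t. en (3 powr ?p) * (N t * ind {0<..1} t))"
  proof (intro nn_integral_mono, goal_cases)
  case gc: (1 u)
  have "(INT+ x. en (max 0 (U u x) * rho s ((1 / r) *R (x - x0))))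
  <= (INT+ x. en (3 powr ?p) * en (<|U u x|> * rho s x))"
  proof (intro nn_integral_mono, goal_cases)
  case gc: (1 x)
  define y where "y = (1 / r) *R (x - x0)"
  have "norm x <= norm x0 + norm (x - x0)" using norm_triangle_ineq[of x0 "x - x0"] by simp
  moreover have "r * norm (x - x0) <= 1 * norm (x - x0)" using r by (intro mult_right_mono) auto
  then have "norm (x - x0) <= norm y" using r by (simp add: y_def pos_le_divide_eq mult.commute)
  moreover have "norm x0 < 2" using x0 S by auto
  ultimately have "1 + norm x <= 3 * (1 + norm y)" using norm_ge_zero[of y] by (smt (verit, best))
  then have "rho s y <= 3 powr ?p * rho s x" by (rule rho_le_rho[OF s(1)])
  then have "U u x * rho s y <= U u x * (3 powr ?p * rho s x)" by (intro mult_left_mono U_nn)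
  then show ?case
  unfolding max0 absU y_def by (subst ennreal_mult[symmetric]) (auto intro!: ennreal_leI simp: mult_ac U_nn)
  qed
  also have "... = en (3 powr ?p) * N u" unfolding N_def by (rule nn_integral_cmult) measurable
  finally show ?case
  using sub01[OF t r(3)] by (cases "u : {t - r powr (2 * s)<..t}") (auto simp: subset_eq)
  qed
  also have "... = en (3 powr ?p * A)" using A by (simp add: nn_integral_cmult ennreal_mult)
  also have "... <= en (r powr (2 * s) * r ^ DIM('a) * n')" by (rule ennreal_leI[OF n'(1)])
  finally show "(INT+ t:{t - r powr (2 * s)<..t}. (INT+ x. en (max 0 (U t x) * rho s ((1 / r) *R (x - x0)))))
  <= en (r powr (2 * s) * r ^ DIM('a) * n')" .
  qed
  qed
  \<comment> \<open>The cylinders grow from the unit ball and times after 3/4 towards radius 2 and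
    times after 1/2. Consecutive ones differ by \<open>1/2 * (1/2) ^ i\<close> in radius and
    \<open>1/8 * (1/2) ^ i\<close> in time, which leaves room for the balls of radius
    \<open>5 * rr i\<close> and their time length.\<close>
  define R where "R i = 2 - (1/2::real) ^ i" for i :: nat
  define a where "a i = 1/2 + 1/4 * (1/2::real) ^ i" for i :: nat
  have R2: "R i <= 2" for i by (simp add: R_def)
  have ball_sub: "ball x0 (5 * rr i) \<subseteq> ball 0 (R (Suc i))" if "x0 : ball 0 (R i)" for x0 :: 'a and i
  proof
  fix x assume x: "x : ball x0 (5 * rr i)"
  have "norm x <= norm x0 + norm (x - x0)" using norm_triangle_ineq[of x0 "x - x0"] by simp
  moreover have "norm (x - x0) < 5 * rr i" "norm x0 < R i" using x that by (auto simp: dist_norm norm_minus_commute)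
  moreover have "rr i <= 1/16 * (1/2) ^ i" using rr(2)[of i] by (simp add: z_def)
  moreover have "R (Suc i) = R i + 1/2 * (1/2) ^ i" by (simp add: R_def)
  moreover have "0 < (1/2::real) ^ i" by simp
  ultimately have "norm x < R (Suc i)" by linarith
  then show "x : ball 0 (R (Suc i))" by simp
  qed
  define P where "P i m \<longleftrightarrow> (\<forall>t\<in>G. a i < t --> (AEL x. x : ball 0 (R i) --> U t x <= m))" for i m
  \<comment> \<open>A family of bounds \<open>F * b ^ i\<close>, valid for all cylinders at once,
    improves to one with \<open>F / 2 + K * A\<close>. Only the next larger cylinder is consulted,
    where the bound is \<open>m\<close>; there the squared L^2 norm is at most \<open>m\<close>
    times the mass.\<close>
  have step: "P i ((F / 2 + K * A) * b ^ i)" if F: "0 < F" and PF: "!!i. P i (F * b ^ i)" for F i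
  unfolding P_def
  proof (intro ballI impI)
  fix t assume t: "t : G" "a i < t"
  define m where "m = F * b ^ Suc i"
  have m: "0 < m" using F b by (simp add: m_def)
  define X where "X = 3 powr ?p * A * b ^ i / v0"
  have X: "0 <= X" using A b v0 by (simp add: X_def)
  have rX: "rr i powr (2 * s) * rr i ^ DIM('a) * X = 3 powr ?p * A" unfolding rr(4) X_def using v0 b by simp
  have "AEL x. x : ball 0 (R i) --> U t x <= C * ((de * m + X / de) + X)"
  proof (rule core[OF t(1) rr(1)])
  show "rr i <= 1" using rr(2)[of i] z[of i] by linarith
  have "0 < (1/2::real) ^ i" by simp
  then show rt: "rr i powr (2 * s) <= t" using rr(3)[of i] z(2)[of i] t(2) unfolding a_def by linarith
  show "ball 0 (R i) \<subseteq> ball (0::'a) 2" using R2[of i] by (auto simp: subset_eq)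
  show "0 < de * m + X / de" using m X de by (simp add: add_pos_nonneg)
  show "3 powr ?p * A <= rr i powr (2 * s) * rr i ^ DIM('a) * X" by (simp add: rX)
  show "0 <= X" by (rule X)
  fix x0 :: 'a assume x0: "x0 : ball 0 (R i)"
  have "(INT+ t:{t - rr i powr (2 * s)<..t}. (INT+ x:ball x0 (5 * rr i). en ((U t x)^2)))
  <= (INT+ t. en (m * 3 powr ?p) * (N t * ind {0<..1} t))"
  proof (rule nn_integral_mono_AE, use G_AE in eventually_elim)
  case (elim u)
  show ?case
  proof (cases "u : {t - rr i powr (2 * s)<..t}")
  case True
  then have u01: "u : {0<..1}" using sub01[OF t(1) rt] by blast
  then have "u : G" using elim by blast
  moreover have "a (Suc i) < u" using True t rr(3)[of i] by (auto simp: a_def z_def)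
  ultimately have "AEL x. x : ball 0 (R (Suc i)) --> U u x <= m" using PF[of "Suc i"] unfolding P_def m_def by blast
  then have "(INT+ x:ball x0 (5 * rr i). en ((U u x)^2)) <= (INT+ x. en (m * 3 powr ?p) * en (<|U u x|> * rho s x))"
  proof (intro nn_integral_mono_AE, eventually_elim)
  case (elim x)
  show ?case
  proof (cases "x : ball x0 (5 * rr i)")
  case True
  then have xR: "x : ball 0 (R (Suc i))" using ball_sub[OF x0] by blast
  then have "norm x <= 2" using R2[of "Suc i"] by simp
  then have "rho s (0::'a) <= 3 powr ?p * rho s x" using s by (intro rho_le_rho) auto
  then have "1 <= 3 powr ?p * rho s x" by (simp add: rho_def)
  then have "(U u x)^2 * 1 <= (m * U u x) * (3 powr ?p * rho s x)"
  using xR elim U_nn[of u x] m by (intro mult_mono) (auto simp: power2_eq_square intro!: mult_right_mono)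
  then show ?thesis using m True unfolding absU
  by (subst ennreal_mult[symmetric]) (auto intro!: ennreal_leI simp: mult_ac U_nn)
  qed simp
  qed
  also have "... = en (m * 3 powr ?p) * N u" unfolding N_def by (rule nn_integral_cmult) measurable
  finally show ?thesis using True u01 by simp
  qed simp
  qed
  also have "... = en (m * 3 powr ?p * A)" using A m by (simp add: nn_integral_cmult ennreal_mult)
  also have "... <= en (rr i powr (2 * s) * rr i ^ DIM('a) * (de * m + X / de)^2)"
  proof (rule ennreal_leI)
  \<comment> \<open>Young's inequality in the form needed: the product of supremum and mass becomes
    the square of an admissible \<open>n\<close>.\<close>
  have "m * X <= (de * m + X / de)^2"
  proof -
  have "0 <= (de * m)^2 + m * X + (X / de)^2" using m X by simp
  also have "... = (de * m + X / de)^2 - m * X" using de by (simp add: power2_sum)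
  finally show ?thesis by simp
  qed
  then have "rr i powr (2 * s) * rr i ^ DIM('a) * (m * X) <= rr i powr (2 * s) * rr i ^ DIM('a) * (de * m + X / de)^2"
  using rr(1)[of i] by (intro mult_left_mono) auto
  moreover have "rr i powr (2 * s) * rr i ^ DIM('a) * (m * X) = m * (rr i powr (2 * s) * rr i ^ DIM('a) * X)" by simp
  ultimately show "m * 3 powr ?p * A <= rr i powr (2 * s) * rr i ^ DIM('a) * (de * m + X / de)^2" unfolding rX by simp
  qed
  finally show "(INT+ t:{t - rr i powr (2 * s)<..t}. (INT+ x:ball x0 (5 * rr i). en ((U t x)^2)))
  <= en (rr i powr (2 * s) * rr i ^ DIM('a) * (de * m + X / de)^2)" .
  qed
  moreover have "C * ((de * m + X / de) + X) = (F / 2 + K * A) * b ^ i"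
  proof -
  have "C * ((de * m + X / de) + X) = (C * de * b) * F * b ^ i + (C * (1 / de + 1)) * X" by (simp add: m_def algebra_simps)
  also have "(C * (1 / de + 1)) * X = K * A * b ^ i" by (simp add: K_def X_def)
  finally show ?thesis unfolding de(2) by (simp add: algebra_simps)
  qed
  ultimately show "AEL x. x : ball 0 (R i) --> U t x <= (F / 2 + K * A) * b ^ i" by simp
  qed
  \<comment> \<open>A merely qualitative bound \<open>M\<close> starts the absorption. It depends on
    the solution through \<open>C7\<close>, but it is halved at every stage and leaves no trace in
    the limit, which is the fixed point \<open>2 * K * A\<close>.\<close>
  obtain C7 where C7: "!!t. t : G ==> (sqb 3 (U t)) <= en C7" using L2_bound[of 3] by blast
  define n where "n = 1 + max C7 0 / v0"
  define n' where "n' = 3 powr ?p * A / v0"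
  have n: "1 <= n" "0 <= n'" using v0 A by (auto simp: n_def n'_def)
  define M where "M = C * (n + n')"
  have M: "0 < M" using n 1(2) by (simp add: M_def add_pos_nonneg)
  have r0: "rr 0 powr (2 * s) * rr 0 ^ DIM('a) = v0" "rr 0 <= 1/16" "rr 0 powr (2 * s) <= 1/16"
  using rr(2,3,4)[of 0] by (auto simp: z_def)
  have qual: "AEL x. x : ball 0 2 --> U t x <= M" if t: "t : G" "1/2 < t" for t
  unfolding M_def
  proof (rule core[OF t(1) rr(1)])
  show rt: "rr 0 powr (2 * s) <= t" using r0 t by simp
  fix x0 :: 'a assume x0: "x0 : ball 0 2"
  have sub: "ball x0 (5 * rr 0) \<subseteq> ball 0 3"
  proof
  fix x assume x: "x : ball x0 (5 * rr 0)"
  have "norm x <= norm x0 + norm (x - x0)" using norm_triangle_ineq[of x0 "x - x0"] by simp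
  then show "x : ball 0 3" using x x0 r0(2) by (auto simp: dist_norm norm_minus_commute)
  qed
  have "(INT+ t:{t - rr 0 powr (2 * s)<..t}. (INT+ x:ball x0 (5 * rr 0). en ((U t x)^2)))
  <= (INT+ t. en (max C7 0) * ind {0<..1::real} t)"
  proof (rule nn_integral_mono_AE, use G_AE in eventually_elim)
  case (elim u)
  show ?case
  proof (cases "u : {t - rr 0 powr (2 * s)<..t}")
  case True
  then have u01: "u : {0<..1}" using sub01[OF t(1) rt] by blast
  have "(INT+ x:ball x0 (5 * rr 0). en ((U u x)^2)) <= (sqb 3 (U u))"
  using sub by (intro nn_integral_mono) (auto simp: indicator_def)
  also have "... <= en C7" using elim u01 C7 by blast
  also have "... <= en (max C7 0)" by (intro ennreal_leI) simp
  finally show ?thesis using True u01 by simp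
  qed simp
  qed
  also have "... = en (max C7 0)" by (simp add: nn_integral_cmult_indicator)
  also have "... <= en (rr 0 powr (2 * s) * rr 0 ^ DIM('a) * n^2)"
  proof (rule ennreal_leI)
  have "max C7 0 = v0 * (max C7 0 / v0)" using v0 by simp
  also have "... <= v0 * n" using v0 by (intro mult_left_mono) (auto simp: n_def)
  also have "... <= v0 * n^2" using v0 n by (intro mult_left_mono) (auto simp: power2_eq_square)
  finally show "max C7 0 <= rr 0 powr (2 * s) * rr 0 ^ DIM('a) * n^2" by (simp only: r0(1))
  qed
  finally show "(INT+ t:{t - rr 0 powr (2 * s)<..t}. (INT+ x:ball x0 (5 * rr 0). en ((U t x)^2)))
  <= en (rr 0 powr (2 * s) * rr 0 ^ DIM('a) * n^2)" .
  next
  show "3 powr ?p * A <= rr 0 powr (2 * s) * rr 0 ^ DIM('a) * n'" unfolding r0(1) n'_def using v0 by simp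
  qed (use r0 n in auto)
  have "\<forall>i. P i ((M / 2 ^ j + 2 * K * A) * b ^ i)" for j
  proof (induction j)
  case 0
  show ?case
  proof (unfold P_def, intro allI ballI impI)
  fix i t assume t: "t : G" "a i < t"
  have "0 < (1/2::real) ^ i" by simp
  then have "1/2 < t" using t(2) unfolding a_def by linarith
  from qual[OF t(1) this] show "AEL x. x : ball 0 (R i) --> U t x <= (M / 2 ^ 0 + 2 * K * A) * b ^ i"
  proof eventually_elim
  case (elim x)
  show ?case
  proof
  assume "x : ball 0 (R i)"
  then have "U t x <= M" using elim R2[of i] by auto
  also have "... <= (M / 2 ^ 0 + 2 * K * A) * 1" using K A by simp
  also have "... <= (M / 2 ^ 0 + 2 * K * A) * b ^ i" using b M K A by (intro mult_left_mono one_le_power) auto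
  finally show "U t x <= (M / 2 ^ 0 + 2 * K * A) * b ^ i" .
  qed
  qed
  qed
  next
  case (Suc j)
  have "0 < M / 2 ^ j + 2 * K * A" using M K A by (simp add: add_pos_nonneg)
  then have "P i (((M / 2 ^ j + 2 * K * A) / 2 + K * A) * b ^ i)" for i using Suc by (intro step) auto
  moreover have "(M / 2 ^ j + 2 * K * A) / 2 + K * A = M / 2 ^ Suc j + 2 * K * A" by (simp add: add_divide_distrib)
  ultimately show ?case by simp
  qed
  then have "P 0 (M / 2 ^ j + 2 * K * A)" for j by (metis mult.right_neutral power_0)
  then have "AEL x. x : ball 0 1 --> U 1 x <= M / 2 ^ j + 2 * K * A" for j
  using G_1 by (auto simp: P_def a_def R_def)
  then have "AEL x. \<forall>j. x : ball 0 1 --> U 1 x <= M / 2 ^ j + 2 * K * A"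
  unfolding AE_all_countable by blast
  then show "AEL x. x : ball 0 1 --> en (U 1 x) <= en (2 * K) * (INT+ t:{0<..1}. N t)"
  proof eventually_elim
  case (elim x)
  show ?case
  proof
  assume x: "x : ball 0 1"
  have "(%j. M / 2 ^ j + 2 * K * A) ~~> 0 + 2 * K * A"
  by (intro tendsto_intros LIMSEQ_divide_realpow_zero) simp
  then have "U 1 x <= 0 + 2 * K * A" using elim x by (intro LIMSEQ_le_const) auto
  then show "en (U 1 x) <= en (2 * K) * (INT+ t:{0<..1}. N t)"
  unfolding A(2) using K A(1) by (subst ennreal_mult[symmetric]) (auto intro: ennreal_leI)
  qed
  qed
 qed
qed

section \<open>Transporting the mass in time\<close>

text \<open>Moving the centre by at most one radius changes the rescaled weight by a bounded factor.
  The mass seen from the centre of a ball can thus be replaced by the mass seen from each of its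
  points.\<close>

lemma rho_scaled_le:
 fixes x x0 y :: "'a::euclidean_space"
 assumes "0 < s" "0 < r" "x : ball x0 r"
 shows "rho s ((1 / r) *R (y - x)) <= 2 powr (real DIM('a) + 2 * s) * rho s ((1 / r) *R (y - x0))"
  "rho s ((1 / r) *R (y - x0)) <= 2 powr (real DIM('a) + 2 * s) * rho s ((1 / r) *R (y - x))"
proof -
 have "(1 / r) *R (y - x0) = (1 / r) *R (y - x) + (1 / r) *R (x - x0)" by (simp flip: scaleR_add_right)
 moreover have "norm ((1 / r) *R (x - x0)) <= 1" using assms by (simp add: dist_norm norm_minus_commute)
 ultimately have "<|norm ((1 / r) *R (y - x0)) - norm ((1 / r) *R (y - x))|> <= 1"
  by (metis add_diff_cancel_left' norm_triangle_ineq3 order_trans)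
 then have "1 + norm ((1 / r) *R (y - x0)) <= 2 * (1 + norm ((1 / r) *R (y - x)))"
  "1 + norm ((1 / r) *R (y - x)) <= 2 * (1 + norm ((1 / r) *R (y - x0)))"
  using norm_ge_zero[of "(1 / r) *R (y - x)"] norm_ge_zero[of "(1 / r) *R (y - x0)"] unfolding abs_le_iff by argo+
 then show "rho s ((1 / r) *R (y - x)) <= 2 powr (real DIM('a) + 2 * s) * rho s ((1 / r) *R (y - x0))"
  "rho s ((1 / r) *R (y - x0)) <= 2 powr (real DIM('a) + 2 * s) * rho s ((1 / r) *R (y - x))"
  using assms(1) by (auto intro: rho_le_rho)
qed

context nlpos
begin

text \<open>The past mass as seen from \<open>x\<close> at the scale \<open>r\<close>. Making it a
  function of the point allows the scaled bounds to be integrated over the whole space.\<close>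

definition Q :: "real set => real => 'a => ennreal" where
 "Q S r x = (INT+ t:S. (INT+ y. en (U t y * rho s ((1 / r) *R (y - x)))))"

lemma N_nn: "N t = (INT+ x. en (U t x * rho s x))"
 using U_nn by (simp add: N_def)

lemma Q_measurable [measurable]:
 assumes [measurable]: "S : sets borel"
 shows "Q S r : borelm"
 unfolding Q_def by measurable

lemma Q_le:
 assumes S[measurable]: "S : sets borel" and le: "!!y. rho s ((1 / r) *R (y - x)) <= c * rho s ((1 / r) *R (y - x'))" and c: "0 <= c"
 shows "Q S r x <= en c * Q S r x'"
proof -
 have "Q S r x <= (INT+ t:S. (INT+ y. en c * en (U t y * rho s ((1 / r) *R (y - x')))))"
  unfolding Q_def
 proof (intro nn_integral_mono mult_right_mono)
  fix t y
  have "U t y * rho s ((1 / r) *R (y - x)) <= U t y * (c * rho s ((1 / r) *R (y - x')))" by (intro mult_left_mono le U_nn)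
  then show "en (U t y * rho s ((1 / r) *R (y - x))) <= en c * en (U t y * rho s ((1 / r) *R (y - x')))"
  using c U_nn[of t y] by (subst ennreal_mult[symmetric]) (auto intro!: ennreal_leI simp: mult_ac)
 qed simp
 also have "... = (INT+ t. en c * ((INT+ y. en (U t y * rho s ((1 / r) *R (y - x')))) * ind S t))"
  by (subst nn_integral_cmult) (simp_all add: mult.assoc)
 also have "... = en c * Q S r x'" unfolding Q_def by (rule nn_integral_cmult) measurable
 finally show ?thesis .
qed

lemma Q_integral:
 assumes S[measurable]: "S : sets borel"
 shows "(INT+ x. Q S r x * en (rho s x))
  = (INT+ t:S. (INT+ y. en (U t y) * (INT+ x. en (rho s ((1 / r) *R (y - x)) * rho s x))))"
proof -
 let ?w = "%t y x. U t y * rho s ((1 / r) *R (y - x))" and ?W = "%t. INT+ y. en (U t y) * (INT+ x. en (rho s ((1 / r) *R (y - x)) * rho s x))"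
 have "(INT+ x. Q S r x * en (rho s x))
  = (INT+ x. INT+ t. (INT+ y. en (?w t y x)) * ind S t * en (rho s x))"
  unfolding Q_def by (intro nn_integral_cong nn_integral_multc[symmetric]) measurable
 also have "... = (INT+ t. INT+ x. (INT+ y. en (?w t y x)) * ind S t * en (rho s x))"
  by (rule lborel_pair.Fubini') measurable
 also have "... = (INT+ t:S. ?W t)"
 proof (intro nn_integral_cong, goal_cases)
  case (1 t)
  have "(INT+ x. (INT+ y. en (?w t y x)) * en (rho s x))
  = (INT+ x. INT+ y. en (?w t y x) * en (rho s x))"
  by (intro nn_integral_cong nn_integral_multc[symmetric]) measurable
  also have "... = (INT+ y. INT+ x. en (?w t y x) * en (rho s x))"
  by (rule lborel_pair.Fubini') measurable
  also have "... = ?W t"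
  proof (intro nn_integral_cong, goal_cases)
  case (1 y)
  have "(INT+ x. en (?w t y x) * en (rho s x))
  = (INT+ x. en (U t y) * en (rho s ((1 / r) *R (y - x)) * rho s x))"
  by (intro nn_integral_cong) (simp add: ennreal_mult U_nn mult.assoc)
  also have "... = en (U t y) * (INT+ x. en (rho s ((1 / r) *R (y - x)) * rho s x))" by (rule nn_integral_cmult) measurable
  finally show ?case .
  qed
  finally show ?case
  by (cases "t : S") simp_all
 qed
 finally show ?thesis .
qed

lemma weighted_N:
 assumes [measurable]: "S : sets borel" and c: "0 <= c"
 shows "(INT+ t:S. (INT+ y. en (U t y) * en (c * rho s y))) = en c * (INT+ t:S. N t)"
proof -
 have "(INT+ y. en (U t y) * en (c * rho s y)) = en c * N t" for t
 proof -
  have "(INT+ y. en (U t y) * en (c * rho s y)) = (INT+ y. en c * en (U t y * rho s y))"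
  using c U_nn by (intro nn_integral_cong) (simp add: ennreal_mult mult_ac)
  also have "... = en c * N t" unfolding N_nn by (rule nn_integral_cmult) measurable
  finally show ?thesis .
 qed
 then show ?thesis by (simp add: mult.assoc nn_integral_cmult)
qed

text \<open>After exchanging integrals it remains to bound from below the convolution of the
  rescaled weight with \<open>rho\<close>. Restricting it to a ball of radius \<open>r <= 1\<close>,
  where both factors are comparable to their values at the centre, costs 2 to the power
  \<open>d + 2 s\<close> twice.\<close>

lemma Q_integral_lower:
 assumes S[measurable]: "S : sets borel" and r: "0 < r" "r <= 1"
 shows "en (unit_ball_vol (real DIM('a)) / 4 powr (real DIM('a) + 2 * s) * r ^ DIM('a)) * (INT+ t:S. N t)
  <= (INT+ x. Q S r x * en (rho s x))"
proof -
 let ?p = "real DIM('a) + 2 * s" and ?c = "unit_ball_vol (real DIM('a)) / 4 powr (real DIM('a) + 2 * s) * r ^ DIM('a)"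
 have "en (?c * rho s y) <= (INT+ x. en (rho s ((1 / r) *R (y - x)) * rho s x))" for y :: 'a
 proof -
  have "?c * rho s y = rho s y / 4 powr ?p * (unit_ball_vol (real DIM('a)) * r ^ DIM('a))" by simp
  then have "en (?c * rho s y) = en (rho s y / 4 powr ?p) * en (unit_ball_vol (real DIM('a)) * r ^ DIM('a))"
  using r by (subst ennreal_mult[symmetric]) auto
  also have "... = en (rho s y / 4 powr ?p) * emeasure lborel (ball y r)" using r by (simp add: emeasure_ball)
  also have "... = (INT+ x:ball y r. en (rho s y / 4 powr ?p))" by (simp add: nn_integral_cmult_indicator)
  also have "... <= (INT+ x. en (rho s ((1 / r) *R (y - x)) * rho s x))"
  proof (intro nn_integral_mono, goal_cases)
  case gc: (1 x)
  show ?case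
  proof (cases "x : ball y r")
  case True
  have "rho s ((1 / r) *R (y - y)) <= 2 powr ?p * rho s ((1 / r) *R (y - x))" by (rule rho_scaled_le(2)[OF s(1) r(1) True])
  then have 1: "1 <= 2 powr ?p * rho s ((1 / r) *R (y - x))" by (simp add: rho_def)
  have "norm x <= norm y + norm (x - y)" using norm_triangle_ineq[of y "x - y"] by simp
  moreover have "norm (x - y) <= 1" using True r by (simp add: dist_norm norm_minus_commute)
  ultimately have "1 + norm x <= 2 * (1 + norm y)" using norm_ge_zero[of y] by argo
  then have 2: "rho s y <= 2 powr ?p * rho s x" by (rule rho_le_rho[OF s(1)])
  have "1 * rho s y <= (2 powr ?p * rho s ((1 / r) *R (y - x))) * (2 powr ?p * rho s x)" by (rule mult_mono[OF 1 2]) auto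
  also have "... = 4 powr ?p * (rho s ((1 / r) *R (y - x)) * rho s x)"
  using powr_mult[of 2 2 ?p] by (simp add: mult_ac)
  finally have "rho s y / 4 powr ?p <= rho s ((1 / r) *R (y - x)) * rho s x" by (simp add: pos_divide_le_eq mult.commute)
  then show ?thesis using True by (simp add: ennreal_leI)
  qed simp
  qed
  finally show ?thesis .
 qed
 then have "(INT+ t:S. (INT+ y. en (U t y) * en (?c * rho s y))) <= (INT+ x. Q S r x * en (rho s x))"
  unfolding Q_integral[OF S] by (intro nn_integral_mono mult_right_mono mult_left_mono) auto
 then show ?thesis using weighted_N[OF S, of ?c] r by simp
qed

text \<open>For \<open>r <= 1\<close> the rescaled weight is at most the unscaled one, so the
  convolution bound applies. No factor \<open>r ^ d\<close> is gained; this is harmless because the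
  lemma is used at one fixed scale.\<close>

lemma Q_integral_upper:
 assumes S[measurable]: "S : sets borel" and r: "0 < r" "r <= 1" and C: "0 <= C"
  and conv: "!!y::'a. (INT+ x. en (rho s (y - x) * rho s x)) <= en (C * rho s y)"
 shows "(INT+ x. Q S r x * en (rho s x)) <= en C * (INT+ t:S. N t)"
proof -
 have "(INT+ x. en (rho s ((1 / r) *R (y - x)) * rho s x)) <= en (C * rho s y)" for y :: 'a
 proof (rule order_trans[OF nn_integral_mono conv])
  fix x
  have "r * norm (y - x) <= 1 * norm (y - x)" using r by (intro mult_right_mono) auto
  then have "norm (y - x) <= norm ((1 / r) *R (y - x))" using r by (simp add: pos_le_divide_eq mult.commute)
  then have "1 + norm (y - x) <= 1 * (1 + norm ((1 / r) *R (y - x)))" by (simp only: mult_1 add_left_mono)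
  from rho_le_rho[OF s(1) this] show "en (rho s ((1 / r) *R (y - x)) * rho s x) <= en (rho s (y - x) * rho s x)"
  by (intro ennreal_leI mult_right_mono) auto
 qed
 then have "(INT+ x. Q S r x * en (rho s x)) <= (INT+ t:S. (INT+ y. en (U t y) * en (C * rho s y)))"
  unfolding Q_integral[OF S] by (intro nn_integral_mono mult_right_mono mult_left_mono) auto
 then show ?thesis using weighted_N[OF S C] by simp
qed

lemma nlpos_scale:
 assumes r: "0 < r" and t0: "t0 : G" "r powr (2 * s) <= t0"
 shows "nlpos s lam Lam (%t x. U (t0 - r powr (2 * s) + r powr (2 * s) * t) (x0 + r *R x))
  (%t x y. r powr (2 * s) * r ^ DIM('a) * kap (t0 - r powr (2 * s) + r powr (2 * s) * t) (x0 + r *R x) (x0 + r *R y)) {t\<in>{0<..1}. t0 - r powr (2 * s) + r powr (2 * s) * t : G}"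
 by (intro nlpos.intro nlpos_axioms.intro nlsol_scale[OF nlsol_axioms r t0] U_nn)

lemma scaled_N:
 assumes r: "0 < r" and t0: "t0 : G" "r powr (2 * s) <= t0" and vt: "0 < vt" "vt <= 1"
 shows "en (r powr (2 * s) * r ^ DIM('a)) * (INT+ t:{0<..vt}. nlsol.N s (%t x. U (t0 - r powr (2 * s) + r powr (2 * s) * t) (x0 + r *R x)) t)
  = Q {t0 - r powr (2 * s)<..t0 - r powr (2 * s) + r powr (2 * s) * vt} r x0"
proof -
 define h where "h = r powr (2 * s)"
 have h: "0 < h" using r by (simp add: h_def)
 let ?f = "%u y. en (U u y * rho s ((1 / r) *R (y - x0))) * ind {..t0 - h + h * vt} u"
 have *: "(INT+ x. ?f (t0 - h + h * t) (x0 + r *R x)) * ind {0<..1} t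
  = nlsol.N s (%t x. U (t0 - h + h * t) (x0 + r *R x)) t * ind {0<..vt} t" for t
  unfolding h_def nlsol.N_def[OF nlsol_scale[OF nlsol_axioms r t0]]
  using r vt U_nn by (cases "t <= vt") (auto simp: indicator_def)
 have "Q {t0 - h<..t0 - h + h * vt} r x0 = (INT+ u:{t0 - h<..t0}. (INT+ y. ?f u y))"
  unfolding Q_def
 proof (intro nn_integral_cong, goal_cases)
  case (1 u)
  have "h * vt <= h * 1" using h vt by (intro mult_left_mono) auto
  then show ?case
  by (cases "u <= t0 - h + h * vt") (auto simp: indicator_def)
 qed
 also have "... = en (h * r ^ DIM('a)) * (INT+ t:{0<..1}. (INT+ x. ?f (t0 - h + h * t) (x0 + r *R x)))"
  by (rule nn_integral_scale[OF _ r h]) measurable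
 finally show ?thesis unfolding * by (simp add: h_def)
qed

text \<open>Once the mass is taken as seen from \<open>x\<close> instead of the centre, the
  statement no longer mentions the ball, and a covering extends it to almost every point of the
  space.\<close>

lemma scaled_lower:
 assumes LB: "!!(U :: real => 'a => real) kap G. nlpos s lam Lam U kap G ==>
  AEL x. x : ball 0 1 --> en c * (INT+ t:{0<..1/2}. nlsol.N s U t) <= en (U 1 x)"
  and r: "0 < r" and t0: "t0 : G" "r powr (2 * s) <= t0"
 shows "AEL x. en c * Q {t0 - r powr (2 * s)<..t0 - r powr (2 * s) + r powr (2 * s) * (1/2)} r x
  <= en (2 powr (real DIM('a) + 2 * s) * (r powr (2 * s) * r ^ DIM('a))) * en (U t0 x)"
proof -
 define h where "h = r powr (2 * s)"
 let ?P = "2 powr (real DIM('a) + 2 * s)" and ?S = "{t0 - h<..t0 - h + h * (1/2)}"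
 have h: "0 < h" using r by (simp add: h_def)
 have "AEL x. x : ball x0 r --> en c * Q ?S r x <= en (?P * (h * r ^ DIM('a))) * en (U t0 x)" for x0
 proof -
  let ?I = "INT+ t:{0<..1/2}. nlsol.N s (%t x. U (t0 - h + h * t) (x0 + r *R x)) t"
  have Q0: "en (h * r ^ DIM('a)) * ?I = Q ?S r x0" unfolding h_def by (rule scaled_N[OF r t0]) auto
  have "AEL x. x : ball 0 1 --> en c * ?I <= en (U t0 (x0 + r *R x))"
  using LB[OF nlpos_scale[OF r t0], of x0] by (simp add: h_def)
  then have "AEL x. x0 + r *R x : ball x0 r --> en c * ?I <= en (U t0 (x0 + r *R x))"
  using r by (auto elim!: eventually_mono simp: dist_norm)
  then have "AEL x. x : ball x0 r --> en c * ?I <= en (U t0 x)"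
  by (rule AE_affine[OF _ r, rotated]) measurable
  then show ?thesis
  proof eventually_elim
  case (elim x)
  show ?case
  proof
  assume x: "x : ball x0 r"
  have "en c * Q ?S r x <= en c * (en ?P * Q ?S r x0)"
  by (intro mult_left_mono Q_le rho_scaled_le(1)[OF s(1) r x]) auto
  also have "... = en (?P * (h * r ^ DIM('a))) * (en c * ?I)"
  unfolding Q0[symmetric] using h r by (simp add: ennreal_mult mult_ac)
  also have "... <= en (?P * (h * r ^ DIM('a))) * en (U t0 x)" using elim x by (intro mult_left_mono) auto
  finally show "en c * Q ?S r x <= en (?P * (h * r ^ DIM('a))) * en (U t0 x)" .
  qed
  qed
 qed
 from AE_ball_cover[OF r this, of UNIV] show ?thesis by (simp add: h_def)
qed

lemma scaled_upper:
 assumes UB: "!!(U :: real => 'a => real) kap G. nlpos s lam Lam U kap G ==>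
  AEL x. x : ball 0 1 --> en (U 1 x) <= en C * (INT+ t:{0<..1}. nlsol.N s U t)"
  and C: "0 <= C" and r: "0 < r" and t0: "t0 : G" "r powr (2 * s) <= t0"
 shows "AEL x. en (r powr (2 * s) * r ^ DIM('a)) * en (U t0 x)
  <= en (C * 2 powr (real DIM('a) + 2 * s)) * Q {t0 - r powr (2 * s)<..t0} r x"
proof -
 define h where "h = r powr (2 * s)"
 let ?P = "2 powr (real DIM('a) + 2 * s)" and ?S = "{t0 - h<..t0}"
 have h: "0 < h" using r by (simp add: h_def)
 have "AEL x. x : ball x0 r --> en (h * r ^ DIM('a)) * en (U t0 x) <= en (C * ?P) * Q ?S r x" for x0
 proof -
  let ?I = "INT+ t:{0<..1}. nlsol.N s (%t x. U (t0 - h + h * t) (x0 + r *R x)) t"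
  have Q0: "en (h * r ^ DIM('a)) * ?I = Q ?S r x0" using scaled_N[OF r t0, of 1 x0] by (simp add: h_def)
  have "AEL x. x : ball 0 1 --> en (U t0 (x0 + r *R x)) <= en C * ?I"
  using UB[OF nlpos_scale[OF r t0], of x0] by (simp add: h_def)
  then have "AEL x. x0 + r *R x : ball x0 r --> en (U t0 (x0 + r *R x)) <= en C * ?I"
  using r by (auto elim!: eventually_mono simp: dist_norm)
  then have "AEL x. x : ball x0 r --> en (U t0 x) <= en C * ?I"
  by (rule AE_affine[OF _ r, rotated]) measurable
  then show ?thesis
  proof eventually_elim
  case (elim x)
  show ?case
  proof
  assume x: "x : ball x0 r"
  have "en (h * r ^ DIM('a)) * en (U t0 x) <= en (h * r ^ DIM('a)) * (en C * ?I)" using elim x by (intro mult_left_mono) auto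
  also have "... = en C * Q ?S r x0" unfolding Q0[symmetric] by (simp add: mult_ac)
  also have "... <= en C * (en ?P * Q ?S r x)"
  by (intro mult_left_mono Q_le rho_scaled_le(2)[OF s(1) r x]) auto
  also have "... = en (C * ?P) * Q ?S r x" using C by (simp add: ennreal_mult mult.assoc)
  finally show "en (h * r ^ DIM('a)) * en (U t0 x) <= en (C * ?P) * Q ?S r x" .
  qed
  qed
 qed
 from AE_ball_cover[OF r this, of UNIV] show ?thesis by (simp add: h_def)
qed

end

lemma ennreal_cancel:
 assumes "en a * X <= en b * Y" "0 < a" "0 <= b"
 shows "X <= en (b / a) * Y"
proof -
 have "X = en (1 / a) * (en a * X)" using assms by (simp add: mult.assoc[symmetric] flip: ennreal_mult)
 also have "... <= en (1 / a) * (en b * Y)" by (intro mult_left_mono assms) simp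
 also have "... = en (b / a) * Y" using assms by (simp add: mult.assoc[symmetric] flip: ennreal_mult)
 finally show ?thesis .
qed

context nlpos
begin

text \<open>The lower bound at scale \<open>2 ^ - j\<close>, integrated over all centres against the weight, controls the mass in the dyadic time interval \<open>S j\<close>.\<close>

lemma integral_N_le_final:
 assumes LB: "!!(U :: real => 'a => real) kap G. nlpos s lam Lam U kap G ==>
  AEL x. x : ball 0 1 --> en c * (INT+ t:{0<..1/2}. nlsol.N s U t) <= en (U 1 x)"
  and c: "0 < c"
 defines "D \<equiv> 2 powr (real DIM('a) + 2 * s) / (c * (unit_ball_vol (real DIM('a)) / 4 powr (real DIM('a) + 2 * s)))"
 shows "(INT+ t:{0<..1}. N t) <= en (2 * D) * N 1"
proof -
 let ?P = "2 powr (real DIM('a) + 2 * s)" and ?ka = "unit_ball_vol (real DIM('a)) / 4 powr (real DIM('a) + 2 * s)"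
 have ka: "0 < ?ka" by simp
 have D: "0 <= D" using c by (simp add: D_def)
 \<comment> \<open>The first half of the last piece of length \<open>(1/2) ^ j\<close>: this is the
   window seen by the lower bound at that scale. The windows tile the open unit interval.\<close>
 define S where "S j = {1 - (1/2::real) ^ j<..1 - (1/2) ^ j + (1/2) ^ j * (1/2)}" for j :: nat
 have S[measurable]: "S j : sets borel" for j by (simp add: S_def)
 have le: "(INT+ t:S j. N t) <= en (D * (1/2) ^ j) * N 1" for j
 proof -
  define r :: real where "r = ((1/2) ^ j) powr (1 / (2 * s))"
  have r: "0 < r" "r <= 1" "r powr (2 * s) = (1/2) ^ j"
  using s by (auto simp: r_def powr_powr power_le_one intro!: powr_le1)
  have r1: "r powr (2 * s) <= 1" unfolding r(3) by (simp add: power_le_one)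
  have "AEL x. en c * Q (S j) r x <= en (?P * ((1/2) ^ j * r ^ DIM('a))) * en (U 1 x)"
  using scaled_lower[OF LB r(1) G_1 r1] unfolding r(3) S_def .
  then have "(INT+ x. en c * (Q (S j) r x * en (rho s x)))
  <= (INT+ x. en (?P * ((1/2) ^ j * r ^ DIM('a))) * en (U 1 x * rho s x))"
  proof (intro nn_integral_mono_AE, eventually_elim)
  case (elim x)
  from mult_right_mono[OF elim(2), of "en (rho s x)"] show ?case by (simp add: ennreal_mult U_nn mult.assoc)
  qed
  then have 1: "en c * (INT+ x. Q (S j) r x * en (rho s x)) <= en (?P * ((1/2) ^ j * r ^ DIM('a))) * N 1"
  unfolding N_nn by (simp add: nn_integral_cmult)
  have "en (c * (?ka * r ^ DIM('a))) * (INT+ t:S j. N t) = en c * (en (?ka * r ^ DIM('a)) * (INT+ t:S j. N t))"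
  using c r by (subst ennreal_mult) (auto simp: mult.assoc)
  also have "... <= en c * (INT+ x. Q (S j) r x * en (rho s x))"
  by (intro mult_left_mono Q_integral_lower S r) simp
  also note 1
  finally have "(INT+ t:S j. N t) <= en ((?P * ((1/2) ^ j * r ^ DIM('a))) / (c * (?ka * r ^ DIM('a)))) * N 1"
  by (rule ennreal_cancel) (use c r ka in auto)
  \<comment> \<open>The powers of \<open>r\<close> from the lower bound and from
    \<open>Q_integral_lower\<close> cancel. The length of the time window remains and makes the
    bounds summable, with sum \<open>2 * D\<close>.\<close>
  also have "(?P * ((1/2) ^ j * r ^ DIM('a))) / (c * (?ka * r ^ DIM('a))) = D * (1/2) ^ j" using r by (simp add: D_def)
  finally show ?thesis .
 qed
 have "(INT+ t:{0<..1}. N t) <= (INT+ t. (\<Sum>j. N t * ind (S j) t))"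
 proof (rule nn_integral_mono_AE, use AE_lborel_singleton[of "1::real"] in eventually_elim)
  case (elim t)
  show ?case
  proof (cases "t : {0<..1}")
  case True
  then have t: "0 < t" "t < 1" using elim by auto
  define j where "j = (LEAST j. (1/2) ^ Suc j <= 1 - t)"
  have "\<exists>n. (1/2) ^ n < 1 - t" using t by (intro real_arch_pow_inv) auto
  then obtain n where "(1/2) ^ n < 1 - t" ..
  moreover have "(1/2::real) ^ Suc n <= (1/2) ^ n" by simp
  ultimately have "(1/2) ^ Suc n <= 1 - t" by linarith
  then have j: "(1/2) ^ Suc j <= 1 - t" unfolding j_def by (rule LeastI)
  have "1 - t < (1/2) ^ j"
  proof (cases j)
  case (Suc i)
  then have "\<not> (1/2) ^ Suc i <= 1 - t" unfolding j_def by (intro not_less_Least) simp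
  then show ?thesis unfolding Suc by simp
  qed (use t in simp)
  with j have "t : S j" by (simp add: S_def)
  then have "N t * ind {0<..1} t = (\<Sum>j\<in>{j}. N t * ind (S j) t)" using True by simp
  also have "... <= (\<Sum>j. N t * ind (S j) t)" by (rule sum_le_suminf) auto
  finally show ?thesis .
  qed simp
 qed
 also have "... = (\<Sum>j. INT+ t:S j. N t)" by (rule nn_integral_suminf) measurable
 also have "... <= (\<Sum>j. en (D * (1/2) ^ j) * N 1)" by (intro suminf_le le) auto
 also have "... = (\<Sum>j. en (D * (1/2) ^ j)) * N 1" by simp
 also have "(\<Sum>j. en (D * (1/2) ^ j)) = en (\<Sum>j. D * (1/2) ^ j)"
  using D by (intro suminf_ennreal2 summable_mult summable_geometric) auto
 also have "(\<Sum>j. D * (1/2) ^ j) = 2 * D"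
  using suminf_mult[of "%j. (1/2::real) ^ j" D] by (simp add: summable_geometric suminf_geometric)
 finally show ?thesis .
qed

text \<open>The upper bound at the fixed scale with time length 1/2, integrated against the weight.
  The assumption \<open>1/2 <= t\<close> makes the window fit into the past.\<close>

lemma N_le_past:
 assumes UB: "!!(U :: real => 'a => real) kap G. nlpos s lam Lam U kap G ==>
  AEL x. x : ball 0 1 --> en (U 1 x) <= en C * (INT+ t:{0<..1}. nlsol.N s U t)"
  and C: "0 <= C" and Cc: "0 <= Cc" "!!y::'a. (INT+ x. en (rho s (y - x) * rho s x)) <= en (Cc * rho s y)"
  and t: "t : G" "1/2 <= t"
 defines "D \<equiv> C * 2 powr (real DIM('a) + 2 * s) * Cc / (1/2 * ((1/2) powr (1 / (2 * s))) ^ DIM('a))"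
 shows "N t <= en D * (INT+ u:{0<..t}. N u)"
proof -
 let ?P = "2 powr (real DIM('a) + 2 * s)"
 define r :: real where "r = (1/2) powr (1 / (2 * s))"
 have r: "0 < r" "r <= 1" "r powr (2 * s) = 1/2" using s by (auto simp: r_def powr_powr intro!: powr_le1)
 let ?S = "{t - 1/2<..t}"
 have rt: "r powr (2 * s) <= t" using r t by simp
 have S: "?S : sets borel" by simp
 have "AEL x. en (1/2 * r ^ DIM('a)) * en (U t x) <= en (C * ?P) * Q ?S r x"
  using scaled_upper[OF UB C r(1) t(1) rt] unfolding r(3) .
 then have "(INT+ x. en (1/2 * r ^ DIM('a)) * en (U t x * rho s x))
  <= (INT+ x. en (C * ?P) * (Q ?S r x * en (rho s x)))"
 proof (intro nn_integral_mono_AE, eventually_elim)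
  case (elim x)
  from mult_right_mono[OF elim(2), of "en (rho s x)"] show ?case by (simp add: ennreal_mult U_nn mult.assoc)
 qed
 then have "en (1/2 * r ^ DIM('a)) * N t <= en (C * ?P) * (INT+ x. Q ?S r x * en (rho s x))"
  unfolding N_nn by (simp add: nn_integral_cmult)
 also have "... <= en (C * ?P) * (en Cc * (INT+ u:?S. N u))"
  by (intro mult_left_mono Q_integral_upper[OF S r(1,2) Cc]) simp
 also have "... <= en (C * ?P) * (en Cc * (INT+ u:{0<..t}. N u))"
  using t by (intro mult_left_mono nn_integral_mono) (auto simp: indicator_def)
 also have "... = en (C * ?P * Cc) * (INT+ u:{0<..t}. N u)" using C Cc by (simp add: ennreal_mult mult.assoc)
 finally have "N t <= en (C * ?P * Cc / (1/2 * r ^ DIM('a))) * (INT+ u:{0<..t}. N u)"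
  by (rule ennreal_cancel) (use r C Cc in auto)
 then show ?thesis by (simp add: D_def r_def)
qed

text \<open>The integral \<open>A t\<close> of \<open>N\<close> up to \<open>t\<close> grows between
  1/2 and 1 at a rate of at most \<open>D * A t\<close>, so it is at most multiplied by a constant
  there.\<close>

lemma integral_N_le_half:
 assumes D: "0 <= D" "!!t. t : G ==> 1/2 <= t ==> N t <= en D * (INT+ u:{0<..t}. N u)" and NN: "2 * D <= real NN" "0 < NN"
 shows "(INT+ t:{0<..1}. N t) <= en (2 ^ NN) * (INT+ t:{0<..1/2}. N t)"
proof -
 define A where "A t = enn2real (INT+ u:{0<..t}. N u)" for t
 have A: "(INT+ u:{0<..t}. N u) = en (A t)" if "t <= 1" for t
 proof -
  have "(INT+ u:{0<..t}. N u) <= (INT+ u:{0<..1}. N u)"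
  using that by (intro nn_integral_mono) (auto simp: indicator_def)
  also have "... < inft" using L1_fin by (simp add: N_def)
  finally show ?thesis by (simp add: A_def)
 qed
 have A_nn: "0 <= A t" for t by (simp add: A_def)
 have "A 1 <= 2 ^ NN * (A (1/2) + 2 * 0)"
 proof (rule discrete_gronwall[where Y=A and C=D])
  fix r t :: real assume rt: "1/2 <= r" "r <= t" "t <= 1"
  have "en (A t) <= en (A r) + (INT+ u:{r<..t}. N u)"
  proof -
  have "en (A t) = (INT+ u. N u * ind {0<..r} u + N u * ind {r<..t} u)"
  unfolding A[OF rt(3), symmetric] using rt by (intro nn_integral_cong) (auto simp: indicator_def)
  also have "... = (INT+ u:{0<..r}. N u) + (INT+ u:{r<..t}. N u)"
  by (rule nn_integral_add) measurable
  finally show ?thesis using A[of r] rt by simp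
  qed
  also have "... <= en (A r) + (INT+ u. en (D * A t) * ind {r<..t} u)"
  proof (rule add_left_mono, rule nn_integral_mono_AE, use G_AE in eventually_elim)
  case (elim u)
  show ?case
  proof (cases "u : {r<..t}")
  case True
  then have u: "u : G" "1/2 <= u" "u <= 1" using elim rt by auto
  have "N u <= en D * (INT+ u:{0<..t}. N u)"
  using True by (intro order_trans[OF D(2)[OF u(1,2)]] mult_left_mono nn_integral_mono) (auto simp: indicator_def)
  then show ?thesis using True A[OF rt(3)] D(1) A_nn by (simp add: ennreal_mult)
  qed simp
  qed
  also have "(INT+ u. en (D * A t) * ind {r<..t} u) = en (D * A t) * en (t - r)"
  using rt by (simp add: nn_integral_cmult_indicator)
  also have "en (A r) + en (D * A t) * en (t - r) = en (A r + D * A t * (t - r))"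
  using rt D A_nn by (simp add: ennreal_plus ennreal_mult)
  finally have "A t <= A r + D * A t * (t - r)" using rt D A_nn by (subst (asm) ennreal_le_iff) auto
  then show "A t - A r <= (t - r) * (0 + D * A t)" by (simp add: mult_ac)
 qed (use D NN A_nn in auto)
 then have "en (A 1) <= en (2 ^ NN * A (1/2))" by (intro ennreal_leI) simp
 then show ?thesis using A[of 1] A[of "1/2"] A_nn by (simp add: ennreal_mult)
qed

end

theorem harnack_normalized:
 assumes s: "0 < s" "s < 1" and lam: "0 < lam" "lam <= Lam"
 obtains C where "1 < C" "!!(U :: real => 'a::euclidean_space => real) kap G. nlpos s lam Lam U kap G ==>
  AEL x. x : ball 0 1 --> en (U 1 x) <= en C * (INT+ y. en (U 1 y * rho s y))
  \<and> (INT+ y. en (U 1 y * rho s y)) <= en C * en (U 1 x)"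
proof -
 obtain c where c: "0 < c" and LB: "!!(U :: real => 'a => real) kap G. nlpos s lam Lam U kap G ==>
  AEL x. x : ball 0 1 --> en c * (INT+ t:{0<..1/2}. nlsol.N s U t) <= en (U 1 x)"
  by (fact lower_bound[OF assms, where ?'a='a])
 obtain C1 where C1: "0 < C1" and UB: "!!(U :: real => 'a => real) kap G. nlpos s lam Lam U kap G ==>
  AEL x. x : ball 0 1 --> en (U 1 x) <= en C1 * (INT+ t:{0<..1}. nlsol.N s U t)"
  by (fact upper_bound[OF assms, where ?'a='a])
 obtain Cc where Cc: "0 < Cc" "!!y::'a. (INT+ x. en (rho s (y - x) * rho s x)) <= en (Cc * rho s y)"
  by (fact rho_convolution[OF s, where ?'a='a])
 define D1 where "D1 = 2 * (2 powr (real DIM('a) + 2 * s) / (c * (unit_ball_vol (real DIM('a)) / 4 powr (real DIM('a) + 2 * s))))"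
 define D2 where "D2 = C1 * 2 powr (real DIM('a) + 2 * s) * Cc / (1/2 * ((1/2) powr (1 / (2 * s))) ^ DIM('a))"
 define NN where "NN = Suc (nat \<lceil>2 * D2\<rceil>)"
 have D: "0 <= D1" "0 <= D2" using c C1 Cc by (auto simp: D1_def D2_def)
 have NN: "2 * D2 <= real NN" "0 < NN" by (auto simp: NN_def) linarith
 \<comment> \<open>The first product belongs to the estimate from above, which passes through the
   integral over the whole interval; the quotient belongs to the estimate from below, which has to
   come back to the first half.\<close>
 define C where "C = 2 + C1 * D1 + D2 * 2 ^ NN / c"
 have C: "1 < C" "C1 * D1 <= C" "D2 * 2 ^ NN / c <= C" using c C1 D by (auto simp: C_def add_nonneg_nonneg add_pos_nonneg intro: add_increasing add_increasing2)
 show thesis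
 proof (rule that[OF C(1)])
  fix U :: "real => 'a => real" and kap G
  assume pos: "nlpos s lam Lam U kap G"
  then interpret nlpos s lam Lam U kap G .
  have 1: "(INT+ t:{0<..1}. N t) <= en D1 * N 1" unfolding D1_def by (rule integral_N_le_final[OF LB c])
  have past: "N t <= en D2 * (INT+ u:{0<..t}. N u)" if "t : G" "1/2 <= t" for t
  unfolding D2_def by (rule N_le_past[OF UB less_imp_le[OF C1] less_imp_le[OF Cc(1)] Cc(2) that])
  have 2: "N 1 <= en (D2 * 2 ^ NN) * (INT+ u:{0<..1/2}. N u)"
  proof -
  have "N 1 <= en D2 * (INT+ u:{0<..1}. N u)" using past[of 1] G_1 by simp
  also have "... <= en D2 * (en (2 ^ NN) * (INT+ u:{0<..1/2}. N u))"
  by (intro mult_left_mono integral_N_le_half[OF D(2) past NN]) auto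
  finally show ?thesis using D by (simp add: ennreal_mult mult.assoc)
  qed
  show "AEL x. x : ball 0 1 --> en (U 1 x) <= en C * (INT+ y. en (U 1 y * rho s y))
  \<and> (INT+ y. en (U 1 y * rho s y)) <= en C * en (U 1 x)"
  unfolding N_nn[symmetric] using LB[OF pos] UB[OF pos]
  proof eventually_elim
  case (elim x)
  show ?case
  proof (intro impI conjI)
  assume x: "x : ball 0 1"
  have "en (U 1 x) <= en C1 * (en D1 * N 1)" using elim x 1 by (meson mult_left_mono order_trans zero_le)
  also have "... = en (C1 * D1) * N 1" using C1 D by (simp add: ennreal_mult mult.assoc)
  also have "... <= en C * N 1" by (intro mult_right_mono ennreal_leI C) simp
  finally show "en (U 1 x) <= en C * N 1" .
  have "(INT+ u:{0<..1/2}. N u) <= en (1 / c) * en (U 1 x)"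
  by (rule ennreal_cancel) (use elim x c in auto)
  then have "N 1 <= en (D2 * 2 ^ NN) * (en (1 / c) * en (U 1 x))"
  by (intro order_trans[OF 2] mult_left_mono) auto
  also have "... = en (D2 * 2 ^ NN / c) * en (U 1 x)"
  using c D by (simp add: mult.assoc[symmetric] flip: ennreal_mult)
  also have "... <= en C * en (U 1 x)" by (intro mult_right_mono ennreal_leI C) simp
  finally show "N 1 <= en C * en (U 1 x)" .
  qed
  qed
 qed
qed

section \<open>Trapezoidal test functions\<close>

text \<open>The ramp at \<open>a\<close> minus the ramp at \<open>b - 2 * h\<close> is a trapezoid
  that is already zero from \<open>b - h\<close> on. It therefore has compact support in the open
  time interval even if \<open>b\<close> is the final time.\<close>

definition ramp :: "real => real => real => real" where "ramp c h t = max 0 (min 1 ((t - c) / h))"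
definition bump :: "real => real => real => real" where "bump c h t = ind {c..c + h} t / h"

lemma ramp_measurable [measurable]: "ramp c h : borelm" unfolding ramp_def by measurable
lemma bump_measurable [measurable]: "bump c h : borelm" unfolding bump_def by measurable

lemma ramp_0: "0 < h ==> t <= c ==> ramp c h t = 0"
 by (simp add: ramp_def max_def min_def field_simps)

lemma ramp_1: "0 < h ==> c + h <= t ==> ramp c h t = 1"
 by (simp add: ramp_def max_def min_def field_simps)

lemma ramp_bounds: "0 <= ramp c h t" "ramp c h t <= 1" by (auto simp: ramp_def)

lemma ramp_antimono: "0 < h ==> c <= c' ==> ramp c' h t <= ramp c h t"
 unfolding ramp_def by (intro max.mono min.mono divide_right_mono) auto

lemma ramp_ibp:
 assumes h: "0 < h" and c: "0 <= c" "c + h <= T" and et: "smooth_compact_support {0<..<T} et"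
 shows "(LINT t:{0<..T}|lborel. ramp c h t * deriv et t) = - (LINT t:{0<..T}|lborel. bump c h t * et t)"
proof -
 have d: "(deriv ^^ k) et differentiable_on UNIV" for k using et by (auto simp: smooth_compact_support_def)
 have "et differentiable (at t)" for t using d[of 0] by (simp add: differentiable_on_def)
 then have D: "(et has_real_derivative deriv et t) (at t)" for t by (rule DERIV_deriv_iff_real_differentiable[THEN iffD2])
 have "continuous_on UNIV (deriv et)" using d[of 1] by (intro differentiable_imp_continuous_on) simp
 then have cont: "isCont (deriv et) t" for t by (simp add: continuous_on_eq_continuous_at)
 have cet: "isCont et t" for t by (rule DERIV_isCont[OF D])
 have etT: "et T = 0"
 proof (rule ccontr)
  assume "et T \<noteq> 0"
  then have "T : closure {t. et t \<noteq> 0}" by (intro subsetD[OF closure_subset]) simp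
  moreover have "closure {t. et t \<noteq> 0} \<subseteq> {0<..<T}"
  using et unfolding smooth_compact_support_def compactly_contained_def by (elim conjE)
  ultimately show False by (metis greaterThanLessThan_iff less_irrefl subsetD)
 qed
 have 1: "(INT1 t. ((t - c) / h * deriv et t) * ind {c..c + h} t)
  = (c + h - c) / h * et (c + h) - (c - c) / h * et c - (INT1 t. (1 / h * et t) * ind {c..c + h} t)"
  by (rule integral_by_parts) (use h D cont in "auto intro!: derivative_eq_intros")
 have 2: "(INT1 t. deriv et t * ind {c + h..T} t) = et T - et (c + h)"
  by (rule integral_FTC_Icc_real) (use c D cont in "auto intro: has_field_derivative_at_within")
 have i: "set_integrable lborel {p..q} f" if "!!t. isCont f t" for p q and f :: "real => real"
  unfolding set_integrable_def using that by (intro borel_integrable_compact) (auto intro: continuous_at_imp_continuous_on)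
 have "(LINT t:{0<..T}|lborel. ramp c h t * deriv et t)
  = (INT1 t. ((t - c) / h * deriv et t) * ind {c..c + h} t + deriv et t * ind {c + h..T} t)"
  unfolding set_lebesgue_integral_def
 proof (rule integral_cong_AE)
  show "AEL t. ind {0<..T} t *R (ramp c h t * deriv et t)
  = ((t - c) / h * deriv et t) * ind {c..c + h} t + deriv et t * ind {c + h..T} t"
  using AE_lborel_singleton[of "0::real"] AE_lborel_singleton[of "c + h"]
  proof eventually_elim
  case (elim t)
  consider "t <= c" | "c < t" "t < c + h" | "c + h <= t" by linarith
  then show ?case
  proof cases
  case 1 then show ?thesis using h c elim by (auto simp: ramp_0 indicator_def)
  next
  case 2
  then have "ramp c h t = (t - c) / h" using h by (simp add: ramp_def max_def min_def field_simps)
  then show ?thesis using 2 h c by (auto simp: indicator_def)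
  next
  case 3 then show ?thesis using h c elim by (auto simp: ramp_1 indicator_def)
  qed
  qed
  have [measurable]: "deriv et : borelm" using cont by (intro borel_measurable_continuous_onI continuous_at_imp_continuous_on) auto
  show "(%t. ind {0<..T} t *R (ramp c h t * deriv et t)) : borel_measurable lborel" by measurable
  show "(%t. ((t - c) / h * deriv et t) * ind {c..c + h} t + deriv et t * ind {c + h..T} t) : borel_measurable lborel" by measurable
 qed
 also have "... = (INT1 t. ((t - c) / h * deriv et t) * ind {c..c + h} t) + (INT1 t. deriv et t * ind {c + h..T} t)"
  using i[of "%t. (t - c) / h * deriv et t" c "c + h"] i[of "deriv et" "c + h" T] cont h
  by (intro Bochner_Integration.integral_add) (auto simp: set_integrable_def mult.commute)
 also have "... = - (INT1 t. (1 / h * et t) * ind {c..c + h} t)" unfolding 1 2 using h by (simp add: etT)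
 also have "(INT1 t. (1 / h * et t) * ind {c..c + h} t) = (LINT t:{0<..T}|lborel. bump c h t * et t)"
  unfolding set_lebesgue_integral_def
 proof (rule integral_cong_AE)
  have [measurable]: "et : borelm" using cet by (intro borel_measurable_continuous_onI continuous_at_imp_continuous_on) auto
  show "(%t. (1 / h * et t) * ind {c..c + h} t) : borel_measurable lborel"
  "(%t. ind {0<..T} t *R (bump c h t * et t)) : borel_measurable lborel" by measurable
  show "AEL t. (1 / h * et t) * ind {c..c + h} t = ind {0<..T} t *R (bump c h t * et t)"
  using AE_lborel_singleton[of "0::real"] by eventually_elim (use c in "auto simp: bump_def indicator_def")
 qed
 finally show ?thesis .
qed

text \<open>Means over shrinking intervals near \<open>p\<close>. Convergence of \<open>f\<close> is
  assumed along sequences of times in \<open>G\<close> only; after rescaling to the unit interval,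
  almost every parameter keeps the whole sequence in \<open>G\<close>.\<close>

lemma bump_average_tendsto:
 fixes f :: "real => real"
 assumes f[measurable]: "f : borelm" and GAE: "AEL t. t : {a..b} --> t : G"
  and bd: "!!t. t : G ==> a <= t ==> t <= b ==> <|f t|> <= B"
  and cont: "!!sg. (!!n. sg n : G) ==> sg ~~> p ==> (%n. f (sg n)) ~~> f p"
  and h: "!!n. 0 < h n" "h ~~> 0" and c: "!!n. a <= c n" "!!n. c n + h n <= b" "c ~~> p"
 shows "(%n. INT1 t. bump (c n) (h n) t * f t) ~~> f p" "integrable lborel (%t. bump (c n) (h n) t * f t)"
proof -
 have eq: "(INT1 t. bump (c n) (h n) t * f t) = (INT1 u. ind {0..1} u * f (c n + h n * u))" for n
 proof -
  have "(INT1 t. bump (c n) (h n) t * f t) = <|h n|> *R (INT1 u. bump (c n) (h n) (c n + h n * u) * f (c n + h n * u))"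
  using h(1)[of n] by (intro lborel_integral_real_affine) simp
  also have "... = (INT1 u. h n * (bump (c n) (h n) (c n + h n * u) * f (c n + h n * u)))"
  using h(1)[of n] by simp
  also have "... = (INT1 u. ind {0..1} u * f (c n + h n * u))"
  proof (intro Bochner_Integration.integral_cong refl)
  fix u
  have "h n * u <= h n \<longleftrightarrow> u <= 1" using h(1)[of n] mult_le_cancel_left_pos[of "h n" u 1] by simp
  then show "h n * (bump (c n) (h n) (c n + h n * u) * f (c n + h n * u)) = ind {0..1} u * f (c n + h n * u)"
  using h(1)[of n] by (auto simp: bump_def indicator_def zero_le_mult_iff)
  qed
  finally show ?thesis .
 qed
 have "AEL u. \<forall>n. c n + h n * u : {a..b} --> c n + h n * u : G"
  unfolding AE_all_countable
 proof
  fix n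
  obtain N where N: "N : null_sets lborel" "!!t. t \<notin> N ==> t : {a..b} --> t : G" using GAE by (rule AE_E3) auto
  have "AEL t. t \<notin> N" using N(1) by (rule AE_not_in)
  then have "AEL u. c n + h n * u \<notin> N" using N(1) h(1)[of n] by (intro AE_borel_affine) auto
  then show "AEL u. c n + h n * u : {a..b} --> c n + h n * u : G" by eventually_elim (use N(2) in auto)
 qed
 then have AEu: "AEL u. \<forall>n. u : {0..1} --> c n + h n * u : G \<and> a <= c n + h n * u \<and> c n + h n * u <= b"
 proof eventually_elim
  case (elim u)
  show ?case
  proof (intro allI impI)
  fix n assume u: "u : {0..1}"
  have "0 <= h n * u" "h n * u <= h n * 1" using u h(1)[of n] by (auto intro!: mult_left_mono)
  then have "c n + h n * u : {a..b}" using c(1,2)[of n] by auto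
  then show "c n + h n * u : G \<and> a <= c n + h n * u \<and> c n + h n * u <= b" using elim by auto
  qed
 qed
 have "(%n. INT1 u. ind {0..1} u * f (c n + h n * u)) ~~> (INT1 u. ind {0..1::real} u * f p)"
 proof (rule integral_dominated_convergence[where w="%u::real. ind {0..1} u * <|B|>"])
  show "integrable lborel (%u. ind {0..1::real} u * <|B|>)" by (intro integrable_mult_left) simp
  show "AEL u. (%n. ind {0..1} u * f (c n + h n * u)) ~~> ind {0..1} u * f p"
  using AEu
  proof eventually_elim
  case (elim u)
  show ?case
  proof (cases "u : {0..1}")
  case True
  have "(%n. c n + h n * u) ~~> p + 0 * u" by (intro tendsto_intros h c)
  then have "(%n. f (c n + h n * u)) ~~> f p" using True elim by (intro cont) auto
  then show ?thesis using True by simp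
  qed simp
  qed
  show "AEL u. norm (ind {0..1} u * f (c n + h n * u)) <= ind {0..1} u * <|B|>" for n
  using AEu
  proof eventually_elim
  case (elim u)
  show ?case
  proof (cases "u : {0..1}")
  case True
  then have "<|f (c n + h n * u)|> <= B" using elim by (intro bd) auto
  then show ?thesis using True by simp
  qed simp
  qed
 qed auto
 also have "(INT1 u. ind {0..1::real} u * f p) = f p" by simp
 finally show "(%n. INT1 t. bump (c n) (h n) t * f t) ~~> f p" unfolding eq .
 show "integrable lborel (%t. bump (c n) (h n) t * f t)"
 proof (rule Bochner_Integration.integrable_bound)
  show "integrable lborel (%t. ind {a..b} t * (1 / h n * <|B|>))" by (intro integrable_mult_left) (simp add: emeasure_lborel_Icc_eq)
  show "AEL t. norm (bump (c n) (h n) t * f t) <= norm (ind {a..b} t * (1 / h n * <|B|>))"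
  using GAE
  proof eventually_elim
  case (elim t)
  show ?case
  proof (cases "t : {c n..c n + h n}")
  case True
  then have t: "t : {a..b}" using c(1,2)[of n] by auto
  then have "<|f t|> <= B" using elim by (intro bd) auto
  then have "<|f t|> <= <|B|>" by simp
  then have "1 / h n * <|f t|> <= 1 / h n * <|B|>" using h(1)[of n] by (intro mult_left_mono) auto
  then show ?thesis using True t h(1)[of n] by (simp add: bump_def abs_mult)
  qed (simp add: bump_def)
  qed
 qed measurable
qed

text \<open>As the flanks become steep, the derivative of the trapezoid tends to the difference of
  point evaluations at the two ends, and the trapezoid itself to the indicator of the
  interval.\<close>

lemma trapezoid_limit:
 fixes f E :: "real => real"
 assumes ab: "a < b" and f[measurable]: "f : borelm" and GAE: "AEL t. t : {a..b} --> t : G"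
  and bd: "!!t. t : G ==> a <= t ==> t <= b ==> <|f t|> <= B"
  and cont: "!!p sg. p = a \<or> p = b ==> (!!n. sg n : G) ==> sg ~~> p ==> (%n. f (sg n)) ~~> f p"
  and E[measurable]: "E : borelm" "set_integrable lborel {a..b} E"
  and id: "!!h. 0 < h ==> 3 * h < b - a ==> (INT1 t. (bump a h t - bump (b - 2 * h) h t) * f t) = (INT1 t. (ramp a h t - ramp (b - 2 * h) h t) * E t)"
 shows "f b - f a = - (LINT t:{a..b}|lborel. E t)"
proof -
 define h where "h n = (b - a) / 4 * inverse (real (Suc n))" for n
 have h0: "0 < h n" for n using ab by (simp add: h_def)
 have h1: "4 * h n <= b - a" for n
 proof -
  have "(b - a) * inverse (real (Suc n)) <= (b - a) * 1" using ab by (intro mult_left_mono) (auto simp: inverse_eq_divide)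
  then show ?thesis by (simp add: h_def)
 qed
 have h3: "3 * h n < b - a" for n using h1[of n] h0[of n] by linarith
 have hl: "h ~~> 0" unfolding h_def using tendsto_mult_right_zero[OF LIMSEQ_inverse_real_of_nat, of "(b - a) / 4"] by simp
 have hb: "a + h n <= b" "a <= b - 2 * h n" "b - 2 * h n + h n <= b" for n using h0[of n] h1[of n] by linarith+
 have bl: "(%n. b - 2 * h n) ~~> b" using tendsto_diff[OF tendsto_const tendsto_mult_right_zero[OF hl], of b 2] by simp
 have avg: "(%n. INT1 t. bump (c n) (h n) t * f t) ~~> f p" "integrable lborel (%t. bump (c n) (h n) t * f t)"
  if p: "p = a \<or> p = b" and c: "!!n. a <= c n" "!!n. c n + h n <= b" "c ~~> p" for p c n
 proof -
  have cp: "(%n. f (sg n)) ~~> f p" if "!!n. sg n : G" "sg ~~> p" for sg by (rule cont[OF p that])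
  show "(%n. INT1 t. bump (c n) (h n) t * f t) ~~> f p"
  by (rule bump_average_tendsto(1)[where G=G and B=B and a=a and b=b]) (fact f GAE bd cp h0 hl c)+
  show "integrable lborel (%t. bump (c n) (h n) t * f t)"
  by (rule bump_average_tendsto(2)[where G=G and B=B and a=a and b=b and p=p]) (fact f GAE bd cp h0 hl c)+
 qed
 note A = avg[OF disjI1[OF refl], of "%_. a", OF order_refl hb(1) tendsto_const]
 note B = avg[OF disjI2[OF refl], of "%n. b - 2 * h n", OF hb(2,3) bl]
 have L: "(%n. INT1 t. (bump a (h n) t - bump (b - 2 * h n) (h n) t) * f t) ~~> f a - f b"
  unfolding left_diff_distrib using tendsto_diff[OF A(1) B(1)] by (simp add: Bochner_Integration.integral_diff[OF A(2) B(2)])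
 define vt where "vt n t = ramp a (h n) t - ramp (b - 2 * h n) (h n) t" for n t
 have vt0: "vt n t = 0" if "t \<notin> {a..b}" for n t
  using that h0[of n] h1[of n] by (cases "t <= a") (auto simp: vt_def ramp_0 ramp_1)
 have vt1: "<|vt n t|> <= 1" for n t using ramp_bounds[of a "h n" t] ramp_bounds[of "b - 2 * h n" "h n" t] unfolding vt_def by linarith
 have "(%n. INT1 t. vt n t * E t) ~~> (INT1 t. ind {a..b} t *R E t)"
 proof (rule integral_dominated_convergence[where w="%t. <|ind {a..b} t *R E t|>"])
  show "integrable lborel (%t. <|ind {a..b} t *R E t|>)" using E(2) unfolding set_integrable_def by (rule integrable_abs)
  show "AEL t. norm (vt n t * E t) <= <|ind {a..b} t *R E t|>" for n
  proof (intro always_eventually allI)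
  fix t
  have "<|vt n t|> * <|E t|> <= 1 * <|E t|>" by (intro mult_right_mono vt1) simp
  then show "norm (vt n t * E t) <= <|ind {a..b} t *R E t|>"
  using vt0[of t n] by (cases "t : {a..b}") (auto simp: abs_mult)
  qed
  show "AEL t. (%n. vt n t * E t) ~~> ind {a..b} t *R E t"
  using AE_lborel_singleton[of a] AE_lborel_singleton[of b]
  proof eventually_elim
  case (elim t)
  show ?case
  proof (cases "t : {a..b}")
  case True
  then have t: "0 < min (t - a) ((b - t) / 2)" using elim by auto
  have "\<forall>\<^sub>F n in sequentially. h n < min (t - a) ((b - t) / 2)" by (rule order_tendstoD(2)[OF hl t])
  then have "\<forall>\<^sub>F n in sequentially. vt n t * E t = E t"
  proof eventually_elim
  case (elim n)
  then have "a + h n <= t" "t <= b - 2 * h n" by auto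
  then show ?case using h0[of n] by (simp add: vt_def ramp_0 ramp_1)
  qed
  then show ?thesis using True by (simp add: tendsto_eventually)
  qed (simp add: vt0)
  qed
 qed (auto simp: vt_def)
 moreover have "(INT1 t. vt n t * E t) = (INT1 t. (bump a (h n) t - bump (b - 2 * h n) (h n) t) * f t)" for n
  unfolding vt_def using id[OF h0 h3] by simp
 ultimately have "(%n. INT1 t. (bump a (h n) t - bump (b - 2 * h n) (h n) t) * f t) ~~> (INT1 t. ind {a..b} t *R E t)"
  by simp
 then have "f a - f b = (INT1 t. ind {a..b} t *R E t)" by (rule LIMSEQ_unique[OF L])
 then show ?thesis by (simp add: set_lebesgue_integral_def)
qed

text \<open>Solutions are only Lebesgue measurable. By completeness of the measure an integral over
  them may be read as one over a Borel function equal almost everywhere, and no measurability of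
  \<open>f\<close> has to be known beforehand.\<close>

lemma borel_measurable_AE_cong:
 fixes f g :: "'a::euclidean_space => real"
 assumes g[measurable]: "g : borelm" and eq: "AEL x. f x = g x"
 shows "f : borel_measurable lebesgue" "(LINT x|lebesgue. f x) = (INT1 x. g x)"
proof -
 have gl: "g : borel_measurable lborel" by simp
 have g': "g : borel_measurable lebesgue" by (rule measurable_completion[OF gl])
 have eq': "AE x in lebesgue. f x = g x" by (rule AE_completion[OF eq])
 show f: "f : borel_measurable lebesgue"
 proof (rule measurableI)
  fix A :: "real set" assume "A : sets borel"
  then have A: "g -` A \<inter> space lebesgue : sets lebesgue" by (rule measurable_sets[OF g'])
  show "f -` A \<inter> space lebesgue : sets lebesgue"
  by (rule completion.in_sets_AE[OF _ A]) (use eq' in "auto elim!: eventually_mono")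
 qed simp
 show "(LINT x|lebesgue. f x) = (INT1 x. g x)"
  using integral_cong_AE[OF f g' eq'] integral_completion[OF gl] by simp
qed

lemma nn_integral_lebesgue_AE_cong:
 assumes "AEL x. f x = g x"
 shows "(\<integral>\<^sup>+x. f x \<partial>lebesgue) = (INT+ x. g x)"
 unfolding nn_integral_completion by (rule nn_integral_cong_AE[OF assms])

lemma pairing_tendsto:
 fixes v :: "'a::euclidean_space => real"
 assumes vn[measurable]: "!!n. vn n : borelm" "v : borelm" and psi[measurable]: "ps : borelm"
  and supp: "!!x. R <= norm x ==> ps x = 0" and psi2: "(INT+ x. en ((ps x)^2)) < inft"
  and fin: "!!n. (sqb R (vn n)) < inft" "(sqb R v) < inft"
  and lim: "(%n. INT+ x:ball 0 R. en ((vn n x - v x)^2)) ~~> 0"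
 shows "(%n. INT1 x. vn n x * ps x) ~~> (INT1 x. v x * ps x)"
proof -
 have ptw: "(INT+ x. en <|g x * ps x|>) <= en de * (INT+ x. en ((ps x)^2)) + en (1 / de) * (sqb R g)"
  if de: "0 < de" and [measurable]: "g : borelm" for de g
 proof -
  have "(INT+ x. en <|g x * ps x|>) <= (INT+ x. en de * en ((ps x)^2) + en (1 / de) * (en ((g x)^2) * ind (ball 0 R) x))"
  proof (intro nn_integral_mono, goal_cases)
  case (1 x)
  show ?case
  proof (cases "x : ball 0 R")
  case True
  have "<|g x * ps x|> <= de * (ps x)^2 + (1 / de) * (g x)^2"
  using mult_le_weighted_squares[OF de, of "<|ps x|>" "<|g x|>"] by (simp add: abs_mult mult.commute)
  from ennreal_leI[OF this] show ?thesis using True de by (simp add: ennreal_plus ennreal_mult del: times_divide_eq_left)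
  qed (simp add: supp)
  qed
  also have "... = en de * (INT+ x. en ((ps x)^2)) + en (1 / de) * (sqb R g)"
  by (rule nn_integral_lincomb) measurable
  finally show ?thesis .
 qed
 have int: "integrable lborel (%x. g x * ps x)" if "g : borelm" "(sqb R g) < inft" for g
  using le_less_trans[OF ptw[OF zero_less_one that(1)]] that psi2 by (intro integrableI_bounded) (auto simp: ennreal_mult_less_top)
 have W: "(%n. INT+ x. en <|(vn n x - v x) * ps x|>) ~~> 0"
  by (rule weighted_tendsto_zero[OF ptw psi2 lim]) auto
 have "(%n. en <|(INT1 x. vn n x * ps x) - (INT1 x. v x * ps x)|>) ~~> 0"
 proof (rule tendsto_sandwich[OF _ _ tendsto_const W])
  show "\<forall>\<^sub>F n in sequentially. en <|(INT1 x. vn n x * ps x) - (INT1 x. v x * ps x)|> <= (INT+ x. en <|(vn n x - v x) * ps x|>)"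
  proof (intro always_eventually allI)
  fix n
  have "(INT1 x. vn n x * ps x) - (INT1 x. v x * ps x) = (INT1 x. (vn n x - v x) * ps x)"
  using int[OF vn(1) fin(1), of n] int[OF vn(2) fin(2)] by (simp add: left_diff_distrib)
  then have "<|(INT1 x. vn n x * ps x) - (INT1 x. v x * ps x)|> <= (INT1 x. <|(vn n x - v x) * ps x|>)"
  using integral_abs_bound[of lborel "%x. (vn n x - v x) * ps x"] by simp
  then show "en <|(INT1 x. vn n x * ps x) - (INT1 x. v x * ps x)|> <= (INT+ x. en <|(vn n x - v x) * ps x|>)"
  by (intro order_trans[OF ennreal_leI ennreal_integral_le_nn_integral])
  qed
 qed simp
 then have "(%n. <|(INT1 x. vn n x * ps x) - (INT1 x. v x * ps x)|>) ~~> 0"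
  by (subst (asm) ennreal_0[symmetric], subst (asm) tendsto_ennreal_iff) auto
 then show ?thesis by (simp add: LIM_zero_iff tendsto_rabs_zero_iff)
qed

lemma pairing_bound:
 fixes g :: "'a::euclidean_space => real"
 assumes [measurable]: "g : borelm" "ps : borelm"
  and supp: "!!x. R <= norm x ==> ps x = 0" and psi2: "(INT+ x. en ((ps x)^2)) <= en P"
  and g2: "(sqb R g) <= en C" and nn: "0 <= P" "0 <= C"
 shows "<|INT1 x. g x * ps x|> <= P + C"
proof -
 have "(INT+ x. en <|g x * ps x|>) <= (INT+ x. en ((ps x)^2) + en ((g x)^2) * ind (ball 0 R) x)"
 proof (intro nn_integral_mono, goal_cases)
  case (1 x)
  show ?case
  proof (cases "x : ball 0 R")
  case True
  have "<|g x * ps x|> <= (ps x)^2 + (g x)^2"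
  using mult_le_weighted_squares[of 1 "<|ps x|>" "<|g x|>"] by (simp add: abs_mult mult.commute)
  from ennreal_leI[OF this] show ?thesis using True by simp
  qed (simp add: supp)
 qed
 also have "... <= en P + en C" using psi2 g2 by (simp add: nn_integral_add add_mono)
 finally have le: "(INT+ x. en <|g x * ps x|>) <= en (P + C)" using nn by simp
 have "en <|INT1 x. g x * ps x|> <= en (INT1 x. <|g x * ps x|>)"
  by (intro ennreal_leI integral_abs_bound)
 also note ennreal_integral_le_nn_integral
 also note le
 finally show ?thesis using nn by (subst (asm) ennreal_le_iff) auto
qed

text \<open>Integrability in time of the form against a fixed test function, as required by
  \<open>trapezoid_limit\<close>; it must be available before an abstract solution has been
  constructed.\<close>

lemma form_set_integrable:
 fixes U :: "real => 'a::euclidean_space => real"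
 assumes s: "0 < s" "s < 1" and R: "1 <= R"
  and U: "(%(t, x). U t x) : borel_measurable borel2"
  and kap: "(%(t, x, y). kap t x y) : borel_measurable (borel \<Otimes>\<^sub>M borel \<Otimes>\<^sub>M borel)"
  and kap_le: "!!t x y. 0 <= kap t x y" "!!t x y. kap t x y <= Lam * kern s x y"
  and psi[measurable]: "ps : borelm" and supp: "!!x. R <= norm x ==> ps x = 0"
  and psi2: "(INT+ x. en ((ps x)^2)) < inft" and gpsi: "gag s UNIV ps < inft"
  and fin: "(INT+ t:S. gag s (ball 0 (2 * R)) (U t)) < inft" "(INT+ t:S. (sqb R (U t))) < inft"
  "(INT+ t:S. (INT+ x. en (<|U t x|> * rho s x))) < inft"
  and S[measurable]: "S : sets borel" "emeasure lborel S < inft"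
 defines "E t \<equiv> INT1 x. INT1 y. (U t x - U t y) * (ps x - ps y) * kap t x y"
 shows "E : borelm" "set_integrable lborel S E"
proof -
 have Um[measurable (raw)]: "(%z. U (f z) (g z)) : borel_measurable M" if "f : borel_measurable M" "g : borel_measurable M" for f g and M :: "'c measure"
  using measurable_compose[OF measurable_Pair[OF that] U] by simp
 have km[measurable (raw)]: "(%z. kap (f z) (g z) (k z)) : borel_measurable M" if "f : borel_measurable M" "g : borel_measurable M" "k : borel_measurable M" for f g k and M :: "'c measure"
  using measurable_compose[OF measurable_Pair[OF that(1) measurable_Pair[OF that(2,3)]] kap] by simp
 show Em[measurable]: "E : borelm" unfolding E_def by measurable
 have gm[measurable]: "(%t. gag s (ball 0 (2 * R)) (U t)) : borelm" unfolding gag_def by measurable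
 obtain C where C: "0 < C" "!!(v :: 'a => real) ps de. v : borelm ==> ps : borelm ==>
  (!!x. R <= norm x ==> ps x = 0) ==> 0 < de ==>
  (INT+ x. INT+ y. en (<|v x - v y|> * <|ps x - ps y|> * kern s x y))
  <= en de * (gag s (ball 0 (2 * R)) v + en C * (sqb R v)
  + en C * (INT+ x. en (<|v x|> * rho s x)))
  + en (1 / de) * (gag s (ball 0 (2 * R)) ps + en C * (1 + (INT+ x. en (<|v x|> * rho s x))) * (INT+ x. en ((ps x)^2)))"
  by (fact form_bound[OF s R, where ?'a='a])
 define N where "N t = (INT+ x. en (<|U t x|> * rho s x))" for t
 define M where "M t = (sqb R (U t))" for t
 have [measurable]: "N : borelm" "M : borelm" unfolding N_def M_def by measurable
 define q where "q = (INT+ x. en ((ps x)^2))"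
 define g0 where "g0 = gag s (ball 0 (2 * R)) ps"
 have g0: "g0 < inft"
  unfolding g0_def gag_def by (rule le_less_trans[OF _ gpsi[unfolded gag_def]]) (intro nn_integral_mono mult_mono, auto simp: indicator_def)
 have Ele: "en <|E t|> <= en Lam * (gag s (ball 0 (2 * R)) (U t) + (en C * M t + (en C * N t + (g0 + (en C * q + (en C * q) * N t)))))" for t
 proof -
  have "en <|E t|> <= en (INT1 x. <|INT1 y. (U t x - U t y) * (ps x - ps y) * kap t x y|>)"
  unfolding E_def by (intro ennreal_leI integral_abs_bound)
  also have "... <= (INT+ x. en <|INT1 y. (U t x - U t y) * (ps x - ps y) * kap t x y|>)" by (rule ennreal_integral_le_nn_integral)
  also have "... <= (INT+ x. INT+ y. en Lam * en (<|U t x - U t y|> * <|ps x - ps y|> * kern s x y))"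
  proof (rule nn_integral_mono, goal_cases)
  case (1 x)
  have "en <|INT1 y. (U t x - U t y) * (ps x - ps y) * kap t x y|> <= en (INT1 y. <|(U t x - U t y) * (ps x - ps y) * kap t x y|>)"
  by (intro ennreal_leI integral_abs_bound)
  also have "... <= (INT+ y. en <|(U t x - U t y) * (ps x - ps y) * kap t x y|>)" by (rule ennreal_integral_le_nn_integral)
  also have "... <= (INT+ y. en Lam * en (<|U t x - U t y|> * <|ps x - ps y|> * kern s x y))"
  proof (rule nn_integral_mono, goal_cases)
  case (1 y)
  have "<|U t x - U t y|> * <|ps x - ps y|> * kap t x y <= <|U t x - U t y|> * <|ps x - ps y|> * (Lam * kern s x y)" by (intro mult_left_mono kap_le) simp
  then have "<|(U t x - U t y) * (ps x - ps y) * kap t x y|> <= Lam * (<|U t x - U t y|> * <|ps x - ps y|> * kern s x y)" using kap_le(1)[of t x y] by (simp add: abs_mult mult_ac)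
  from ennreal_leI[OF this] show ?case
  by (subst ennreal_mult''[symmetric]) auto
  qed
  finally show ?case .
  qed
  also have "... = en Lam * (INT+ x. INT+ y. en (<|U t x - U t y|> * <|ps x - ps y|> * kern s x y))"
  by (simp add: nn_integral_cmult)
  also have "... <= en Lam * (en 1 * (gag s (ball 0 (2 * R)) (U t) + en C * M t + en C * N t) + en (1 / 1) * (g0 + en C * (1 + N t) * q))"
  unfolding N_def M_def q_def g0_def by (intro mult_left_mono C(2) supp) auto
  also have "... = en Lam * (gag s (ball 0 (2 * R)) (U t) + (en C * M t + (en C * N t + (g0 + (en C * q + (en C * q) * N t)))))"
  by (simp add: distrib_left distrib_right add.assoc mult_ac)
  finally show ?thesis .
 qed
 have "(INT+ t:S. en <|E t|>) <= (INT+ t. en Lam * (gag s (ball 0 (2 * R)) (U t) * ind S t + (en C * (M t * ind S t) + (en C * (N t * ind S t)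
  + (g0 * ind S t + ((en C * q) * ind S t + (en C * q) * (N t * ind S t)))))))"
 proof (intro nn_integral_mono, goal_cases)
  case (1 t)
  show ?case
  using Ele[of t] by (cases "t : S") simp_all
 qed
 also have "... = en Lam * ((INT+ t:S. gag s (ball 0 (2 * R)) (U t)) + (en C * (INT+ t:S. M t) + (en C * (INT+ t:S. N t)
  + (g0 * emeasure lborel S + ((en C * q) * emeasure lborel S + (en C * q) * (INT+ t:S. N t))))))"
  by (simp add: nn_integral_cmult nn_integral_add nn_integral_cmult_indicator)
 also have "... < inft" using fin psi2 g0 S(2) by (simp add: N_def[symmetric] M_def[symmetric] q_def[symmetric] ennreal_mult_less_top)
 finally show "set_integrable lborel S E" by (intro set_integrableI_nn) auto
qed

lemma gagliardo_sq_eq: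
 fixes v v' :: "real ^ 'n => real"
 assumes "AEL x. v' x = v x"
 shows "gagliardo_sq s A v' = gag s A v"
 unfolding gagliardo_sq_def gag_def
proof (rule nn_integral_lebesgue_AE_cong, use assms in eventually_elim)
 case (elim x)
 have "(\<integral>\<^sup>+y\<in>A. en ((v' x - v' y)^2 / norm (x - y) powr (real CARD('n) + 2 * s)) \<partial>lebesgue)
  = (INT+ y:A. en ((v x - v y)^2 * kern s x y))"
  by (rule nn_integral_lebesgue_AE_cong, use assms in eventually_elim) (simp add: elim kern_def)
 then show ?case by simp
qed

lemma L2_sq_eq:
 assumes "AEL x. v' x = v x"
 shows "L2_sq A v' = (INT+ x:A. en ((v x)^2))"
 unfolding L2_sq_def by (rule nn_integral_lebesgue_AE_cong, use assms in eventually_elim) simp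

lemma borel_measurable_cylinder:
 assumes "(%(t, x). ph t x) : borel_measurable borel2" "I : sets borel" "\<Omega> : sets borel"
 shows "measurable_on_cylinder I \<Omega> ph"
proof -
 have [measurable]: "I \<times> \<Omega> : sets borel" using assms(2,3) by (simp flip: borel_prod)
 have [measurable]: "(%(t, x). ph t x) : borelm" using assms(1) by (simp add: borel_prod)
 have "(%p. ind (I \<times> \<Omega>) p *R (case p of (t, x) => ph t x)) : borel_measurable lborel" by measurable
 then show ?thesis unfolding measurable_on_cylinder_def set_borel_measurable_def by (rule measurable_completion)
qed

text \<open>The enlarged radius \<open>R + 1\<close> puts the closed ball carrying the spatial
  support into the open domain, and the early end of the trapezoid does the same in time.\<close>

lemma trapezoid_test:
 fixes ps :: "real ^ 'n => real"
 assumes psi[measurable]: "ps : borelm" and nn: "!!x. 0 <= ps x" and R: "0 <= R" and supp: "!!x. R <= norm x ==> ps x = 0"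
  and psi2: "(INT+ x. en ((ps x)^2)) < inft" and gpsi: "gag s UNIV ps < inft"
  and ab: "0 < a" "b <= T" and h: "0 < h" "3 * h < b - a"
 defines "ph \<equiv> %t x. (ramp a h t - ramp (b - 2 * h) h t) * ps x" and "om \<equiv> %t x. (bump a h t - bump (b - 2 * h) h t) * ps x"
 shows "H1_time_derivative {0<..T} (ball 0 (R + 1)) ph om" "test_function s {0<..T} (ball 0 (R + 1)) ph"
proof -
 let ?I = "{0<..T}" and ?\<Omega> = "ball (0 :: real ^ 'n) (R + 1)"
 let ?th = "%t. ramp a h t - ramp (b - 2 * h) h t" and ?be = "%t. bump a h t - bump (b - 2 * h) h t"
 have th: "0 <= ?th t" "?th t <= 1" for t
  using ramp_antimono[of h a "b - 2 * h" t] ramp_bounds[of a h t] ramp_bounds[of "b - 2 * h" h t] h by auto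
 have be: "<|?be t|> <= 1 / h" for t using h by (auto simp: bump_def indicator_def)
 have th0: "?th t = 0" if "t \<notin> {a..b - h}" for t
  using that h by (cases "t <= a") (auto simp: ramp_0 ramp_1)
 have T: "0 < T" using ab h by linarith
 have T_em: "emeasure lborel ?I = en T" using T by simp
 have m: "measurable_on_cylinder ?I A (%t x. f t * ps x)" if [measurable]: "A : sets borel" "f : borelm" for A f
  by (rule borel_measurable_cylinder[OF _ greaterThanAtMost_borel that(1)]) measurable
 have L2: "L2_sq A (%x. c * ps x) <= en (c^2) * (INT+ x. en ((ps x)^2))" for A c
 proof -
  have "L2_sq A (%x. c * ps x) = (INT+ x:A. en ((c * ps x)^2))" by (rule L2_sq_eq) simp
  also have "... <= (INT+ x. en (c^2) * en ((ps x)^2))"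
  by (intro nn_integral_mono) (auto simp: power_mult_distrib ennreal_mult indicator_def)
  also have "... = en (c^2) * (INT+ x. en ((ps x)^2))" by (rule nn_integral_cmult) measurable
  finally show ?thesis .
 qed
 have bound: "(\<integral>\<^sup>+t\<in>?I. F t \<partial>lebesgue) < inft" if "!!t. F t <= M" "M < inft" for F M
 proof -
  have "(\<integral>\<^sup>+t\<in>?I. F t \<partial>lebesgue) = (INT+ t:?I. F t)" by (simp add: nn_integral_completion)
  also have "... <= (INT+ t. M * ind ?I t)" by (intro nn_integral_mono mult_right_mono that) simp
  also have "... = M * en T" by (simp add: nn_integral_cmult_indicator T_em del: emeasure_lborel_Ioc)
  also have "... < inft" using that by (simp add: ennreal_mult_less_top)
  finally show ?thesis .
 qed
 have ibp: "AE x in lebesgue. x : ?\<Omega> --> (LINT t:?I|lebesgue. ph t x * deriv et t) = - (LINT t:?I|lebesgue. om t x * et t)"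
  if et: "smooth_compact_support (interior ?I) et" for et
 proof (intro always_eventually allI impI)
  fix x
  have et': "smooth_compact_support {0<..<T} et" using et by simp
  have d: "(deriv ^^ k) et differentiable_on UNIV" for k using et by (auto simp: smooth_compact_support_def)
  have c: "continuous_on UNIV et" "continuous_on UNIV (deriv et)"
  using differentiable_imp_continuous_on[OF d[of 0]] differentiable_imp_continuous_on[OF d[of 1]] by simp_all
  note [measurable] = borel_measurable_continuous_onI[OF c(1)] borel_measurable_continuous_onI[OF c(2)]
  have bnd: "set_integrable lborel ?I (%t. f t * g t)" if f[measurable]: "f : borelm" and fb: "!!t. <|f t|> <= B" and g: "continuous_on UNIV g" for f g :: "real => real" and B
  proof -
  note [measurable] = borel_measurable_continuous_onI[OF g]
  have "compact (g ` {0..T})" by (intro compact_continuous_image continuous_on_subset[OF g]) auto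
  then obtain D where D: "!!t. t : {0..T} ==> <|g t|> <= D" using compact_imp_bounded[THEN bounded_iff[THEN iffD1]] by fastforce
  have "0 <= B" using fb[of 0] by linarith
  show ?thesis unfolding set_integrable_def
  proof (rule integrableI_bounded_set[where A="?I" and B="B * D"])
  show "AEL t. t : ?I --> norm (ind ?I t *R (f t * g t)) <= B * D"
  using fb D \<open>0 <= B\<close> by (intro always_eventually allI impI) (auto simp: abs_mult intro!: mult_mono)
  qed (auto simp: T_em less_top[symmetric] simp del: emeasure_lborel_Ioc)
  qed
  have rb: "<|ramp c h t|> <= 1" "<|bump c h t|> <= 1 / h" for c t using ramp_bounds[of c h t] h by (auto simp: bump_def indicator_def)
  have conv: "(LINT t:?I|lebesgue. f t) = (LINT t:?I|lborel. f t)" if [measurable]: "f : borelm" for f :: "real => real"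
  unfolding set_lebesgue_integral_def by (rule integral_completion) measurable
  have "(LINT t:?I|lebesgue. ph t x * deriv et t) = (LINT t:?I|lborel. ps x * (ramp a h t * deriv et t) - ps x * (ramp (b - 2 * h) h t * deriv et t))"
  unfolding ph_def by (subst conv) (measurable, simp add: algebra_simps)
  also have "... = ps x * (LINT t:?I|lborel. ramp a h t * deriv et t) - ps x * (LINT t:?I|lborel. ramp (b - 2 * h) h t * deriv et t)"
  using bnd[OF ramp_measurable rb(1) c(2)] by (subst set_integral_diff) auto
  also have "... = - (ps x * (LINT t:?I|lborel. bump a h t * et t) - ps x * (LINT t:?I|lborel. bump (b - 2 * h) h t * et t))"
  using h ab by (subst ramp_ibp[OF h(1) _ _ et'], simp, simp)+ simp
  also have "ps x * (LINT t:?I|lborel. bump a h t * et t) - ps x * (LINT t:?I|lborel. bump (b - 2 * h) h t * et t)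
  = (LINT t:?I|lborel. ps x * (bump a h t * et t) - ps x * (bump (b - 2 * h) h t * et t))"
  using bnd[OF bump_measurable rb(2) c(1)] by (subst set_integral_diff) auto
  also have "... = (LINT t:?I|lebesgue. om t x * et t)"
  unfolding om_def by (subst conv) (measurable, simp add: algebra_simps)
  finally show "(LINT t:?I|lebesgue. ph t x * deriv et t) = - (LINT t:?I|lebesgue. om t x * et t)" .
 qed
 show H1: "H1_time_derivative ?I ?\<Omega> ph om"
  unfolding H1_time_derivative_def
 proof (intro conjI allI impI)
  show "measurable_on_cylinder ?I ?\<Omega> ph" unfolding ph_def by (rule m) measurable
  show "measurable_on_cylinder ?I ?\<Omega> om" unfolding om_def by (rule m) measurable
  have "L2_sq ?\<Omega> (ph t) <= en 1 * (INT+ x. en ((ps x)^2))" for t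
  unfolding ph_def using th[of t] by (intro order_trans[OF L2] mult_right_mono ennreal_leI power_le_one) auto
  then show "(\<integral>\<^sup>+t\<in>?I. L2_sq ?\<Omega> (ph t) \<partial>lebesgue) < inft" by (rule bound) (use psi2 in simp)
  have "L2_sq ?\<Omega> (om t) <= en ((1 / h)^2) * (INT+ x. en ((ps x)^2))" for t
  unfolding om_def
  proof (intro order_trans[OF L2] mult_right_mono ennreal_leI)
  show "(?be t)^2 <= (1 / h)^2" using power_mono[OF be[of t], of 2] by simp
  qed simp
  then show "(\<integral>\<^sup>+t\<in>?I. L2_sq ?\<Omega> (om t) \<partial>lebesgue) < inft" by (rule bound) (use psi2 in "simp add: ennreal_mult_less_top")
  show "om t x = 0" if "x \<notin> ?\<Omega>" for t x using that supp[of x] by (simp add: om_def)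
 qed (rule ibp)
 show "test_function s ?I ?\<Omega> ph"
  unfolding test_function_def
 proof (intro conjI allI exI)
  show "H1_time_derivative ?I ?\<Omega> ph om" by (rule H1)
  show "measurable_on_cylinder ?I UNIV ph" unfolding ph_def by (rule m) measurable
  show "0 <= ph t x" for t x unfolding ph_def by (intro mult_nonneg_nonneg th nn)
  have "Hs_sq s UNIV (ph t) <= (INT+ x. en ((ps x)^2)) + gag s UNIV ps" for t
  unfolding Hs_sq_def
  proof (rule add_mono)
  have "L2_sq UNIV (ph t) <= en 1 * (INT+ x. en ((ps x)^2))"
  unfolding ph_def using th[of t] by (intro order_trans[OF L2] mult_right_mono ennreal_leI power_le_one) auto
  then show "L2_sq UNIV (ph t) <= (INT+ x. en ((ps x)^2))" by simp
  have "gagliardo_sq s UNIV (ph t) = gag s UNIV (ph t)" by (rule gagliardo_sq_eq) simp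
  also have "... <= gag s UNIV ps"
  unfolding gag_def
  proof (intro nn_integral_mono mult_right_mono ennreal_leI)
  fix x y
  have "(ph t x - ph t y)^2 = (?th t)^2 * (ps x - ps y)^2" by (simp add: ph_def power_mult_distrib flip: right_diff_distrib)
  also have "... <= 1 * (ps x - ps y)^2" using th[of t] by (intro mult_right_mono power_le_one) auto
  finally show "(ph t x - ph t y)^2 <= (ps x - ps y)^2" by simp
  qed auto
  finally show "gagliardo_sq s UNIV (ph t) <= gag s UNIV ps" .
  qed
  then show "(\<integral>\<^sup>+t\<in>?I. Hs_sq s UNIV (ph t) \<partial>lebesgue) < inft" by (rule bound) (use psi2 gpsi in simp)
  have sub: "{(t, x). ph t x \<noteq> 0} \<subseteq> {a..b - h} \<times> cball 0 R"
  proof clarify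
  fix t x assume ne: "ph t x \<noteq> 0"
  have "t : {a..b - h}" using ne th0[of t] by (cases "t : {a..b - h}") (auto simp: ph_def)
  moreover have "norm x <= R" using ne supp[of x] by (cases "R <= norm x") (auto simp: ph_def)
  ultimately show "t : {a..b - h} \<and> x : cball 0 R" by simp
  qed
  have comp: "compact ({a..b - h} \<times> cball (0 :: real ^ 'n) R)" by (intro compact_Times) auto
  have cl: "closure {(t, x). ph t x \<noteq> 0} \<subseteq> {a..b - h} \<times> cball 0 R"
  by (rule closure_minimal[OF sub compact_imp_closed[OF comp]])
  show "compactly_contained {(t, x). ph t x \<noteq> 0} (interior ?I \<times> ?\<Omega>)"
  unfolding compactly_contained_def
  proof
  show "compact (closure {(t, x). ph t x \<noteq> 0})" using compact_Int_closed[OF comp closed_closure] cl by (metis inf.absorb2)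
  show "closure {(t, x). ph t x \<noteq> 0} \<subseteq> interior ?I \<times> ?\<Omega>" using cl ab h by fastforce
  qed
 qed
qed

section \<open>From weak solutions to abstract solutions\<close>

lemma AE_lborel_pair:
 assumes "AEL p. Q (p :: 'a::euclidean_space \<times> 'b::euclidean_space)"
 shows "AEL x. AEL y. Q (x, y)"
proof (rule lborel_pair.AE_pair)
 show "AE p in lborel \<Otimes>\<^sub>M lborel. Q p" using assms unfolding lborel_prod .
qed

lemma borel_version:
 fixes f :: "'a::euclidean_space => real"
 assumes "f : borel_measurable lebesgue"
 obtains g where "g : borelm" "AEL x. f x = g x"
 using completion_ex_borel_measurable_real[OF assms] by auto

text \<open>A Borel version agrees with the kernel only almost everywhere and may violate symmetry
  and bounds on a null set. Symmetrizing and clamping restores both at every point without changing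
  it where it was right.\<close>

lemma borel_kernel_version:
 fixes K :: "real => real ^ 'n => real ^ 'n => ennreal"
 assumes s: "0 < s" and lam: "0 < lam" "lam <= Lam" and Km: "(%(t, x, y). K t x y) : borel_measurable lebesgue"
  and K: "!!t x y. en lam / en (norm (x - y) powr (real CARD('n) + 2 * s)) <= K t x y"
  "!!t x y. K t x y = K t y x" "!!t x y. K t x y <= en Lam / en (norm (x - y) powr (real CARD('n) + 2 * s))"
 obtains kap where "(%(t, x, y). kap t x y) : borel_measurable (borel \<Otimes>\<^sub>M borel \<Otimes>\<^sub>M borel)" "!!t x y. kap t x y = kap t y x"
  "!!t x y. lam * kern s x y <= kap t x y" "!!t x y. kap t x y <= Lam * kern s x y"
  "AEL t. AEL x. AEL y. enn2real (K t x y) = kap t x y"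
proof -
 have "(%p. enn2real (case p of (t, x, y) => K t x y)) : borel_measurable lebesgue" using Km by (rule borel_measurable_enn2real)
 then obtain k0 where k0m: "k0 : borelm" and k0: "AEL p. enn2real (case p of (t, x, y) => K t x y) = k0 p"
  by (rule borel_version)
 have k0m'[measurable]: "k0 : borel_measurable (borel \<Otimes>\<^sub>M borel \<Otimes>\<^sub>M borel)" using k0m by (simp add: borel_prod)
 define kap where "kap t x y = max (lam * kern s x y) (min (Lam * kern s x y) ((k0 (t, x, y) + k0 (t, y, x)) / 2))" for t and x y :: "real ^ 'n"
 have le: "lam * kern s x y <= Lam * kern s x y" for x y :: "real ^ 'n" using lam by (intro mult_right_mono) auto
 have bounds: "lam * kern s x y <= enn2real (K t x y) \<and> enn2real (K t x y) <= Lam * kern s x y" if "x \<noteq> y" for t x y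
 proof -
  have n: "0 < norm (x - y) powr (real CARD('n) + 2 * s)" using that by simp
  have up: "K t x y <= en (Lam * kern s x y)" using K(3)[of t x y] n lam by (simp add: divide_ennreal kern_def)
  then have "K t x y < top" by (rule le_less_trans) simp
  then obtain k where k: "0 <= k" "K t x y = en k" using ennreal_finiteE[of "K t x y"] by auto
  have "en (lam * kern s x y) <= K t x y" using K(1)[of x y t] n lam by (simp add: divide_ennreal kern_def)
  with up k lam show ?thesis by (simp add: ennreal_le_iff)
 qed
 obtain N where N: "N : null_sets lborel" "!!p. p \<notin> N ==> enn2real (case p of (t, x, y) => K t x y) = k0 p"
  using k0 by (rule AE_E3) auto
 have Nm: "N : sets borel" using null_setsD2[OF N(1)] by simp
 then have Nm'[measurable]: "N : sets (borel \<Otimes>\<^sub>M borel \<Otimes>\<^sub>M borel)" unfolding borel_prod .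
 have "AEL p. p \<notin> N" using N(1) by (rule AE_not_in)
 then have "AEL t. AEL q. (t, q) \<notin> N" by (rule AE_lborel_pair)
 then have AEK: "AEL t. AEL x. AEL y. enn2real (K t x y) = kap t x y"
 proof eventually_elim
  case (elim t)
  have 1: "AEL x. AEL y. (t, x, y) \<notin> N" using AE_lborel_pair[OF elim] .
  moreover have "{q : space lborel2. (t, fst q, snd q) \<notin> N} : sets lborel2" by measurable
  \<comment> \<open>Symmetrization also evaluates the version at the swapped pair, so the null set
    must be avoided there as well.\<close>
  ultimately have 2: "AEL y. AEL x. (t, x, y) \<notin> N" by (subst (asm) lborel_pair.AE_commute)
  from 1 2 show ?case
  proof eventually_elim
  case (elim x)
  from elim(1) elim(2) AE_lborel_singleton[of x] show ?case
  proof eventually_elim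
  case (elim y)
  then have "enn2real (K t x y) = k0 (t, x, y)" "enn2real (K t y x) = k0 (t, y, x)" using N(2)[of "(t, x, y)"] N(2)[of "(t, y, x)"] by simp_all
  then have "(k0 (t, x, y) + k0 (t, y, x)) / 2 = enn2real (K t x y)" using K(2)[of t x y] by simp
  then show ?case using bounds[of x y t] elim(3) by (simp add: kap_def)
  qed
  qed
 qed
 show thesis
 proof (rule that[of kap])
  show "(%(t, x, y). kap t x y) : borel_measurable (borel \<Otimes>\<^sub>M borel \<Otimes>\<^sub>M borel)" unfolding kap_def by measurable
  show "kap t x y = kap t y x" for t x y by (simp add: kap_def kern_commute[of s x y] add.commute)
  show "lam * kern s x y <= kap t x y" "kap t x y <= Lam * kern s x y" for t x y using le[of x y] by (auto simp: kap_def)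
 qed (rule AEK)
qed

lemma energy_form_eq:
 fixes v V :: "real ^ 'n => real"
 assumes "AEL x. v x = V x" and "AEL x. AEL y. enn2real (k x y) = kap x y"
  and [measurable]: "V : borelm" "ps : borelm" "(%(x, y). kap x y) : borel_measurable borel2"
 shows "energy_form k v (%x. c * ps x) = c * (INT1 x. INT1 y. (V x - V y) * (ps x - ps y) * kap x y)"
proof -
 have "energy_form k v (%x. c * ps x) = (INT1 x. c * (INT1 y. (V x - V y) * (ps x - ps y) * kap x y))"
  unfolding energy_form_def
 proof (rule borel_measurable_AE_cong(2))
  show "AEL x. (LINT y|lebesgue. (v x - v y) * (c * ps x - c * ps y) * enn2real (k x y)) = c * (INT1 y. (V x - V y) * (ps x - ps y) * kap x y)"
  using assms(1,2)
  proof eventually_elim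
  case (elim x)
  have "(LINT y|lebesgue. (v x - v y) * (c * ps x - c * ps y) * enn2real (k x y)) = (INT1 y. c * ((V x - V y) * (ps x - ps y) * kap x y))"
  proof (rule borel_measurable_AE_cong(2))
  show "AEL y. (v x - v y) * (c * ps x - c * ps y) * enn2real (k x y) = c * ((V x - V y) * (ps x - ps y) * kap x y)"
  using assms(1) elim(2) by eventually_elim (simp add: elim(1) algebra_simps)
  qed measurable
  then show ?case by simp
  qed
 qed measurable
 then show ?thesis by simp
qed

text \<open>Final time and solution are adapted to the given time \<open>tu\<close>: the result
  lives on the interval up to \<open>tu\<close>, and its last slice is the slice of the continuous
  representative.\<close>

lemma extraction:
 fixes K :: "real => real ^ 'n => real ^ 'n => ennreal"
 assumes s: "0 < s" "s < 1" and lam: "0 < lam" "lam <= Lam" and Km: "(%(t, x, y). K t x y) : borel_measurable lebesgue"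
  and K: "!!t x y. en lam / en (norm (x - y) powr (real CARD('n) + 2 * s)) <= K t x y"
  "!!t x y. K t x y = K t y x" "!!t x y. K t x y <= en Lam / en (norm (x - y) powr (real CARD('n) + 2 * s))"
  and sol: "global_weak_solution s K {0<..T} u" and u_nn: "AE (t, x) in lebesgue. t : {0<..T} --> 0 <= u t x"
  and rep: "continuous_representative {0<..T} u w" and tu: "tu : {0<..T}"
 obtains U kap G where "nlsol_on s lam Lam tu U kap G" "!!t x. 0 <= U t x" "AEL x. w tu x = U tu x"
proof -
 let ?I = "{0<..T}"
 obtain kap where kap: "(%(t, x, y). kap t x y) : borel_measurable (borel \<Otimes>\<^sub>M borel \<Otimes>\<^sub>M borel)" "!!t x y. kap t x y = kap t y x"
  "!!t x y. lam * kern s x y <= kap t x y" "!!t x y. kap t x y <= Lam * kern s x y"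
  "AEL t. AEL x. AEL y. enn2real (K t x y) = kap t x y"
  using borel_kernel_version[OF s(1) lam Km K] by blast
 have space: "solution_space s ?I UNIV u" and weak: "!!R. 0 < R ==> weak_solution s K ?I (ball 0 R) u"
  using sol by (auto simp: global_weak_solution_def)
 have "(%p. ind (?I \<times> UNIV) p *R (case p of (t, x) => u t x)) : borel_measurable lebesgue"
  using space by (simp add: solution_space_def measurable_on_cylinder_def set_borel_measurable_def)
 then obtain u0 where u0m: "u0 : borelm" and u0: "AEL p. ind (?I \<times> UNIV) p *R (case p of (t, x) => u t x) = u0 p"
  by (rule borel_version)
 have u0m'[measurable]: "u0 : borel_measurable borel2" using u0m by (simp add: borel_prod)
 have "w tu : borel_measurable lebesgue" using rep tu by (auto simp: continuous_representative_def)
 then obtain w0 where w0m[measurable]: "w0 : borelm" and w0: "AEL x. w tu x = w0 x" by (rule borel_version)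
 \<comment> \<open>The single slice of \<open>u\<close> at \<open>tu\<close> is meaningless, so it
   is taken from \<open>w\<close>. The positive part makes \<open>U\<close> nonnegative everywhere
   and, being a contraction, preserves L^2 continuity.\<close>
 define U where "U t x = (if t = tu then max 0 (w0 x) else max 0 (u0 (t, x)))" for t x
 have Um: "(%(t, x). U t x) : borel_measurable borel2" unfolding U_def by measurable
 have Um1[measurable (raw)]: "(%z. U (f z) (g z)) : borel_measurable M" if "f : borel_measurable M" "g : borel_measurable M" for f g and M :: "'c measure"
  using measurable_compose[OF measurable_Pair[OF that] Um] by simp
 have km1[measurable (raw)]: "(%z. kap (f z) (g z) (k z)) : borel_measurable M" if "f : borel_measurable M" "g : borel_measurable M" "k : borel_measurable M" for f g k and M :: "'c measure"
  using measurable_compose[OF measurable_Pair[OF that(1) measurable_Pair[OF that(2,3)]] kap(1)] by simp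
 have "AEL p. case p of (t, x) => t : ?I --> w t x = u t x" "AEL p. case p of (t, x) => t : ?I --> 0 <= u t x"
  using rep u_nn by (auto simp: continuous_representative_def AE_completion_iff)
 with u0 have "AEL p. case p of (t, x) => t : ?I --> u t x = u0 (t, x) \<and> w t x = u t x \<and> 0 <= u t x"
  by eventually_elim (auto simp: indicator_def)
 from AE_lborel_pair[OF this] have AEu: "AEL t. AEL x. t : ?I --> u t x = u0 (t, x) \<and> w t x = u t x \<and> 0 <= u t x" by simp
 have cc: "compactly_contained (ball 0 r) (UNIV :: (real ^ 'n) set)" for r
  unfolding compactly_contained_def using bounded_ball[of "0 :: real ^ 'n" r] by (simp add: compact_closure)
 have "\<exists>C::real. AE t in lebesgue. t : ?I --> L2_sq (ball 0 (real n)) (u t) <= en C" for n :: nat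
  using space cc[of "real n"] unfolding solution_space_def by blast
 then obtain C where C: "!!n::nat. AE t in lebesgue. t : ?I --> L2_sq (ball 0 (real n)) (u t) <= en (C n)" by metis
 have C': "AEL t. \<forall>n::nat. t : ?I --> L2_sq (ball 0 (real n)) (u t) <= en (C n)"
  unfolding AE_all_countable using C by (simp add: AE_completion_iff)
 define good where "good t \<longleftrightarrow> (AEL x. u t x = U t x \<and> w t x = U t x) \<and> (\<forall>n::nat. L2_sq (ball 0 (real n)) (u t) <= en (C n))
  \<and> (AEL x. AEL y. enn2real (K t x y) = kap t x y)" for t
 have "AEL t. t : {0<..<tu} --> good t"
  using AEu C' kap(5)
 proof eventually_elim
  case (elim t)
  show ?case
  proof
  assume t: "t : {0<..<tu}"
  then have tI: "t : ?I" using tu by auto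
  have "AEL x. u t x = U t x \<and> w t x = U t x" using elim(1) by eventually_elim (use t tI in "auto simp: U_def")
  then show "good t" unfolding good_def using elim tI by blast
  qed
 qed
 then obtain N where N: "N : null_sets lborel" "!!t. t \<notin> N ==> t : {0<..<tu} --> good t" by (rule AE_E3) auto
 \<comment> \<open>The final time is added by hand: it may lie in the exceptional set, yet its slice
   is controlled because it comes from the continuous representative.\<close>
 define G where "G = ({0<..<tu} - N) \<union> {tu}"
 have Gm[measurable]: "G : sets borel" using null_setsD2[OF N(1)] by (auto simp: G_def)
 have Ggood: "good t" if "t : G" "t \<noteq> tu" for t using that N(2) by (auto simp: G_def)
 have GI: "G \<subseteq> {0<..tu}" "{0<..tu} \<subseteq> ?I" using tu by (auto simp: G_def)
 have G_AE: "AEL t. t : {0<..tu} --> t : G" using AE_not_in[OF N(1)] by eventually_elim (auto simp: G_def)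
 have G_gAE: "AEL t. t : {0<..tu} --> good t"
  using G_AE AE_lborel_singleton[of tu] by eventually_elim (use Ggood in auto)
 have wU: "AEL x. U t x = max 0 (w t x)" if "t : G" for t
 proof (cases "t = tu")
  case True
  then show ?thesis using w0 by (auto simp: U_def elim!: eventually_mono)
 next
  case False
  then have "AEL x. u t x = U t x \<and> w t x = U t x" using Ggood[OF that] by (simp add: good_def)
  then show ?thesis by eventually_elim (use False in "auto simp: U_def")
 qed
 have w_cont: "((%r. L2_sq (ball 0 R) (%x. w r x - w t x)) \<longlongrightarrow> 0) (at t within ?I)" "L2_sq (ball 0 R) (w t) < inft" if "t : ?I" for t R
  using rep that unfolding continuous_representative_def by (meson bounded_ball open_ball)+
 have ball_mono: "(INT+ x:ball 0 R. F x) <= (INT+ x:ball 0 R'. F x)" if "R <= R'" for R R' and F :: "real ^ 'n => ennreal"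
  using that by (intro nn_integral_mono) (auto simp: indicator_def)
 have seq: "(%n. L2_sq (ball 0 R) (%x. w (sg n) x - w t x)) ~~> 0" if "t : G" "!!n. sg n : G" "sg ~~> t" for t sg R
 proof -
  have tI: "t : ?I" "!!n. sg n : ?I" using that GI by blast+
  have z: "L2_sq (ball 0 R) (%x. w t x - w t x) = 0" by (simp add: L2_sq_def)
  have "continuous (at t within ?I) (%r. L2_sq (ball 0 R) (%x. w r x - w t x))"
  unfolding continuous_within z by (rule w_cont(1)[OF tI(1)])
  from continuous_within_tendsto_compose'[OF this tI(2) that(3)] show ?thesis unfolding z .
 qed
 have pair: "(INT+ x:ball 0 R. en ((U r x - U t x)^2)) <= L2_sq (ball 0 R) (%x. w r x - w t x)" if "r : G" "t : G" for r t R
  unfolding L2_sq_def nn_integral_completion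
 proof (rule nn_integral_mono_AE, use wU[OF that(1)] wU[OF that(2)] in eventually_elim)
  case (elim x)
  have "<|U r x - U t x|> <= <|w r x - w t x|>" unfolding elim by linarith
  then have "(U r x - U t x)^2 <= (w r x - w t x)^2" by (simp add: abs_le_square_iff)
  then show ?case by (intro mult_right_mono ennreal_leI) auto
 qed
 have L2_bound: "\<exists>C. \<forall>t\<in>G. (sqb R (U t)) <= en C" for R
 proof -
  obtain n :: nat where n: "R <= real n" using real_arch_simple by blast
  have "tu : ?I" by (rule tu)
  from w_cont(2)[OF this, of R] obtain c where c: "0 <= c" "L2_sq (ball 0 R) (w tu) = en c" by (rule ennreal_finiteE)
  have "(sqb R (U t)) <= en (max c (C n))" if t: "t : G" for t
  proof (cases "t = tu")
  case True
  have "(sqb R (U t)) <= L2_sq (ball 0 R) (w t)"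
  unfolding L2_sq_def nn_integral_completion
  proof (rule nn_integral_mono_AE, use wU[OF t] in eventually_elim)
  case (elim x)
  have "(U t x)^2 <= (w t x)^2" unfolding elim by (simp add: max_def)
  then show ?case by (intro mult_right_mono ennreal_leI) auto
  qed
  also have "... = en c" using c True by simp
  also have "... <= en (max c (C n))" by (intro ennreal_leI) simp
  finally show ?thesis .
  next
  case False
  then have g: "good t" by (rule Ggood[OF t])
  have "(sqb R (U t)) <= (sqb (real n) (U t))" by (rule ball_mono[OF n])
  also have "... = L2_sq (ball 0 (real n)) (u t)" by (rule L2_sq_eq[symmetric]) (use g in "auto simp: good_def elim: eventually_mono")
  also have "... <= en (C n)" using g by (simp add: good_def)
  also have "... <= en (max c (C n))" by (intro ennreal_leI) simp
  finally show ?thesis .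
  qed
  then show ?thesis by blast
 qed
 have L2_cont: "(%n. INT+ x:ball 0 R. en ((U (sg n) x - U t x)^2)) ~~> 0" if "t : G" "!!n. sg n : G" "sg ~~> t" for t sg R
  by (rule tendsto_sandwich[OF _ _ tendsto_const seq[OF that, of R]]) (use pair that in auto)
 have Hs_fin: "(INT+ t:{0<..tu}. gag s (ball 0 R) (U t)) < inft" for R
 proof -
  have "(\<integral>\<^sup>+t\<in>?I. Hs_sq s (ball 0 R) (u t) \<partial>lebesgue) < inft" using space cc[of R] unfolding solution_space_def by blast
  moreover have "(INT+ t:{0<..tu}. gag s (ball 0 R) (U t)) <= (\<integral>\<^sup>+t\<in>?I. Hs_sq s (ball 0 R) (u t) \<partial>lebesgue)"
  unfolding nn_integral_completion
  proof (rule nn_integral_mono_AE, use G_gAE in eventually_elim)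
  case (elim t)
  show ?case
  proof (cases "t : {0<..tu}")
  case True
  then have "good t" using elim by blast
  then have "gag s (ball 0 R) (U t) = gagliardo_sq s (ball 0 R) (u t)"
  by (intro gagliardo_sq_eq[symmetric]) (auto simp: good_def elim: eventually_mono)
  then show ?thesis using True GI by (auto simp: Hs_sq_def indicator_def)
  qed simp
  qed
  ultimately show ?thesis by (rule le_less_trans[rotated])
 qed
 have L1_fin: "(INT+ t:{0<..tu}. (INT+ x. en (<|U t x|> * rho s x))) < inft"
 proof -
  have "(\<integral>\<^sup>+t\<in>?I. L1_mu s (u t) \<partial>lebesgue) < inft" using space unfolding solution_space_def by blast
  moreover have "(INT+ t:{0<..tu}. (INT+ x. en (<|U t x|> * rho s x))) <= (\<integral>\<^sup>+t\<in>?I. L1_mu s (u t) \<partial>lebesgue)"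
  unfolding nn_integral_completion
  proof (rule nn_integral_mono_AE, use G_gAE in eventually_elim)
  case (elim t)
  show ?case
  proof (cases "t : {0<..tu}")
  case True
  then have "AEL x. u t x = U t x \<and> w t x = U t x" using elim by (simp add: good_def)
  then have "L1_mu s (u t) = (INT+ x. en (<|U t x|> * rho s x))"
  unfolding L1_mu_def by (intro nn_integral_lebesgue_AE_cong) (auto simp: rho_def elim!: eventually_mono)
  then show ?thesis using True GI by (auto simp: indicator_def)
  qed simp
  qed
  ultimately show ?thesis by (rule le_less_trans[rotated])
 qed
 have slice: "(INT1 x. U b x * ps x) - (INT1 x. U a x * ps x)
  = - (LINT t:{a..b}|lborel. INT1 x. INT1 y. (U t x - U t y) * (ps x - ps y) * kap t x y)"
  if ab: "a : G" "b : G" "a < b" and psi[measurable]: "ps : borelm" and nn: "!!x. 0 <= ps x"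
  and supp0: "!!x. R0 <= norm x ==> ps x = 0" and psi2: "(INT+ x. en ((ps x)^2)) < inft" and gpsi: "gag s UNIV ps < inft"
  for a b R0 :: real and ps :: "real ^ 'n => real"
 proof -
  define R where "R = max 1 R0"
  have R: "1 <= R" "0 <= R" by (auto simp: R_def)
  have supp: "ps x = 0" if "R <= norm x" for x using that by (intro supp0) (simp add: R_def)
  have ab0: "0 < a" "b <= tu" using ab GI by auto
  have sub: "{a..b} \<subseteq> {0<..tu}" using ab0 by auto
  have abI: "{a..b} \<subseteq> ?I" by (rule subset_trans[OF sub GI(2)])
  define f where "f t = (INT1 x. U t x * ps x)" for t
  define E where "E t = (INT1 x. INT1 y. (U t x - U t y) * (ps x - ps y) * kap t x y)" for t
  have fm: "f : borelm" unfolding f_def by measurable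
  obtain P where P: "0 <= P" "(INT+ x. en ((ps x)^2)) = en P" using psi2 by (rule ennreal_finiteE)
  obtain D where D: "!!t. t : G ==> (sqb R (U t)) <= en D" using L2_bound[of R] by blast
  then have D': "(sqb R (U t)) <= en (max D 0)" if "t : G" for t
  using that by (intro order_trans[OF D] ennreal_leI) auto
  have restr: "(INT+ t:{a..b}. F t) <= (INT+ t:{0<..tu}. F t)" for F :: "real => ennreal"
  using sub by (intro nn_integral_mono) (auto simp: indicator_def)
  have kap0: "0 <= kap t x y" for t x y using kap(3)[of x y t] lam by (meson kern_nonneg less_imp_le mult_nonneg_nonneg order_trans)
  have fin1: "(INT+ t:{a..b}. gag s (ball 0 (2 * R)) (U t)) < inft" by (rule le_less_trans[OF restr Hs_fin])
  have fin3: "(INT+ t:{a..b}. (INT+ x. en (<|U t x|> * rho s x))) < inft" by (rule le_less_trans[OF restr L1_fin])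
  have "(INT+ t:{a..b}. (sqb R (U t))) <= (INT+ t. en (max D 0) * ind {a..b} t)"
  by (rule nn_integral_mono_AE, use G_AE in eventually_elim) (use D' sub in "auto simp: indicator_def")
  also have "... < inft" using ab by (simp add: nn_integral_cmult_indicator ennreal_mult_less_top)
  finally have fin2: "(INT+ t:{a..b}. (sqb R (U t))) < inft" .
  have "emeasure lborel {a..b} < inft" using ab by simp
  note E = form_set_integrable[OF s R(1) Um kap(1) kap0 kap(4) psi supp psi2 gpsi fin1 fin2 fin3 _ this, folded E_def, simplified]
  have "f b - f a = - (LINT t:{a..b}|lborel. E t)"
  proof (rule trapezoid_limit[OF ab(3) fm _ _ _ E])
  show "AEL t. t : {a..b} --> t : G" using G_AE by eventually_elim (use sub in auto)
  show "<|f t|> <= P + max D 0" if "t : G" for t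
  unfolding f_def by (rule pairing_bound[OF _ psi supp _ D'[OF that]]) (use P in auto)
  show "(%n. f (sg n)) ~~> f p" if p: "p = a \<or> p = b" and sg: "!!n. sg n : G" "sg ~~> p" for p sg
  proof -
  have pG: "p : G" using p ab by auto
  have fin: "(sqb R (U t)) < inft" if "t : G" for t by (rule le_less_trans[OF D'[OF that]]) simp
  show ?thesis unfolding f_def
  by (rule pairing_tendsto[OF _ _ psi supp psi2 fin[OF sg(1)] fin[OF pG] L2_cont[OF pG sg]]) measurable
  qed
  fix h assume h: "0 < h" "3 * h < b - a"
  let ?th = "%t. ramp a h t - ramp (b - 2 * h) h t" and ?be = "%t. bump a h t - bump (b - 2 * h) h t"
  define ph where "ph t x = ?th t * ps x" for t x
  define om where "om t x = ?be t * ps x" for t x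
  have bT: "b <= T" using ab0 tu by auto
  note test = trapezoid_test[OF psi nn R(2) supp psi2 gpsi ab0(1) bT h, folded ph_def om_def]
  have "weak_solution s K ?I (ball 0 (R + 1)) u" using R by (intro weak) simp
  then have sup: "- (LINT t:?I|lebesgue. (LINT x|lebesgue. u t x * om t x)) + (LINT t:?I|lebesgue. energy_form (K t) (u t) (ph t)) \<ge> 0"
  and sub': "- (LINT t:?I|lebesgue. (LINT x|lebesgue. - u t x * om t x)) + (LINT t:?I|lebesgue. energy_form (K t) (%x. - u t x) (ph t)) \<ge> 0"
  using test unfolding weak_solution_def weak_subsolution_def weak_supersolution_def by blast+
  have neg: "energy_form (K t) (%x. - u t x) (ph t) = - energy_form (K t) (u t) (ph t)" for t
  proof -
  have *: "(- u t x - - u t y) * z = - ((u t x - u t y) * z)" for x y z by (simp add: algebra_simps)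
  show ?thesis unfolding energy_form_def mult.assoc unfolding * Bochner_Integration.integral_minus ..
  qed
  \<comment> \<open>The super- and subsolution inequalities for the same nonnegative test function
    combine to an equality.\<close>
  have eq: "(LINT t:?I|lebesgue. (LINT x|lebesgue. u t x * om t x)) = (LINT t:?I|lebesgue. energy_form (K t) (u t) (ph t))"
  using sup sub' unfolding neg set_lebesgue_integral_def mult_minus_left scaleR_minus_right Bochner_Integration.integral_minus by linarith
  have th0: "?th t = 0" "?be t = 0" if "t \<notin> {a..b}" for t
  using that h by (cases "t <= a"; auto simp: ramp_0 ramp_1 bump_def)+
  have L: "(LINT t:?I|lebesgue. (LINT x|lebesgue. u t x * om t x)) = (INT1 t. ?be t * f t)"
  unfolding set_lebesgue_integral_def
  proof (rule borel_measurable_AE_cong(2))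
  show "AEL t. ind ?I t *R (LINT x|lebesgue. u t x * om t x) = ?be t * f t"
  using G_gAE
  proof eventually_elim
  case (elim t)
  show ?case
  proof (cases "t : {a..b}")
  case True
  then have t: "good t" "t : ?I" using elim sub abI by blast+
  have "(LINT x|lebesgue. u t x * om t x) = (INT1 x. ?be t * (U t x * ps x))"
  proof (rule borel_measurable_AE_cong(2))
  have "AEL x. u t x = U t x \<and> w t x = U t x" using t(1) by (simp add: good_def)
  then show "AEL x. u t x * om t x = ?be t * (U t x * ps x)" by eventually_elim (simp add: om_def)
  qed measurable
  then show ?thesis using t(2) by (simp add: f_def)
  qed (simp add: th0 om_def)
  qed
  show "(%t. ?be t * f t) : borelm" using fm by measurable
  qed
  have Rr: "(LINT t:?I|lebesgue. energy_form (K t) (u t) (ph t)) = (INT1 t. ?th t * E t)"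
  unfolding set_lebesgue_integral_def
  proof (rule borel_measurable_AE_cong(2))
  show "AEL t. ind ?I t *R energy_form (K t) (u t) (ph t) = ?th t * E t"
  using G_gAE
  proof eventually_elim
  case (elim t)
  show ?case
  proof (cases "t : {a..b}")
  case True
  then have t: "good t" "t : ?I" using elim sub abI by blast+
  have "energy_form (K t) (u t) (ph t) = ?th t * E t"
  unfolding E_def ph_def
  proof (rule energy_form_eq)
  have "AEL x. u t x = U t x \<and> w t x = U t x" using t(1) by (simp add: good_def)
  then show "AEL x. u t x = U t x" by eventually_elim simp
  show "AEL x. AEL y. enn2real (K t x y) = kap t x y" using t(1) by (simp add: good_def)
  qed measurable
  then show ?thesis using t(2) by simp
  qed (simp add: th0 ph_def energy_form_def)
  qed
  show "(%t. ?th t * E t) : borelm" using E(1) by measurable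
  qed
  show "(INT1 t. ?be t * f t) = (INT1 t. ?th t * E t)" using eq unfolding L Rr .
  qed
  then show ?thesis by (simp add: f_def E_def)
 qed
 have "nlsol_on s lam Lam tu U kap G"
  by (intro nlsol_on.intro s lam Um kap(1-4) Gm GI(1) G_AE L2_bound L2_cont Hs_fin L1_fin slice) (auto simp: G_def)
 \<comment> \<open>Nonnegativity of \<open>u\<close> is given almost everywhere in space-time and
   says nothing about one slice. It passes to the slice at \<open>tu\<close> as an L^2 limit of
   nonnegative slices at earlier times of \<open>G\<close>.\<close>
 moreover have "AEL x. 0 <= w tu x"
 proof -
  have "\<exists>t\<in>G. max 0 (tu - 1 / real (Suc n)) < t \<and> t < tu" for n
  proof (rule AE_meets_interval)
  show "AEL t. t : {max 0 (tu - 1 / real (Suc n))<..<tu} --> t : G" using G_AE by eventually_elim auto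
  show "max 0 (tu - 1 / real (Suc n)) < tu" using tu by simp
  qed
  then obtain sg where sg: "!!n. sg n : G \<and> max 0 (tu - 1 / real (Suc n)) < sg n \<and> sg n < tu" by metis
  have "sg ~~> tu"
  proof (rule tendsto_sandwich[OF _ _ _ tendsto_const])
  show "(%n. tu - 1 / real (Suc n)) ~~> tu"
  using tendsto_diff[OF tendsto_const[of tu] LIMSEQ_inverse_real_of_nat] by (simp add: inverse_eq_divide)
  show "\<forall>\<^sub>F n in sequentially. tu - 1 / real (Suc n) <= sg n" "\<forall>\<^sub>F n in sequentially. sg n <= tu"
  using sg by (simp_all add: less_imp_le)
  qed
  have tuG: "tu : G" by (simp add: G_def)
  have zero: "(INT+ x:ball 0 (real k). en ((max 0 (- w0 x))^2)) = 0" for k :: nat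
  proof -
  have le: "(INT+ x:ball 0 (real k). en ((max 0 (- w0 x))^2)) <= L2_sq (ball 0 (real k)) (%x. w (sg n) x - w tu x)" for n
  unfolding L2_sq_def nn_integral_completion
  proof (rule nn_integral_mono_AE)
  have "good (sg n)" using sg[of n] Ggood[of "sg n"] by auto
  then have "AEL x. u (sg n) x = U (sg n) x \<and> w (sg n) x = U (sg n) x" by (simp add: good_def)
  then show "AEL x. en ((max 0 (- w0 x))^2) * ind (ball 0 (real k)) x <= en ((w (sg n) x - w tu x)^2) * ind (ball 0 (real k)) x"
  using w0
  proof eventually_elim
  case (elim x)
  have "0 <= U (sg n) x" by (simp add: U_def)
  then have "<|max 0 (- w0 x)|> <= <|w (sg n) x - w tu x|>" using elim by (simp add: max_def)
  then have "(max 0 (- w0 x))^2 <= (w (sg n) x - w tu x)^2" by (simp only: abs_le_square_iff)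
  then show ?case by (intro mult_right_mono ennreal_leI) auto
  qed
  qed
  have "(INT+ x:ball 0 (real k). en ((max 0 (- w0 x))^2)) <= 0"
  using sg by (intro LIMSEQ_le_const[OF seq[OF tuG _ \<open>sg ~~> tu\<close>, of "real k"]]) (auto intro: le)
  then show ?thesis by simp
  qed
  have "AEL x. \<forall>k::nat. en ((max 0 (- w0 x))^2) * ind (ball 0 (real k)) x = 0"
  unfolding AE_all_countable using zero by (subst nn_integral_0_iff_AE[symmetric]) auto
  then show ?thesis using w0
  proof eventually_elim
  case (elim x)
  obtain k :: nat where "norm x < real k" using reals_Archimedean2 by blast
  then have "(max 0 (- w0 x))^2 <= 0" using elim(1)[rule_format, of k] by (simp add: ennreal_eq_0_iff)
  then have "max 0 (- w0 x) = 0" by simp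
  then show ?case using elim(2) by (simp add: max_def split: if_splits)
  qed
 qed
 then have "AEL x. w tu x = U tu x" using w0 by eventually_elim (simp add: U_def)
 ultimately show thesis by (intro that[of U kap G]) (auto simp: U_def)
qed

section \<open>The estimates\<close>

text \<open>The radius is chosen with \<open>r powr (2 * s) = tu\<close>, so that rescaling maps the
  whole interval up to \<open>tu\<close> onto the unit interval. Then \<open>r\<close> to the power
  \<open>d + 2 s\<close> equals \<open>r ^ d * tu\<close>, which is the origin of the factor
  \<open>tu\<close> in front of the weighted integral.\<close>

lemma harnack_scaled:
 fixes U :: "real => 'a::euclidean_space => real" and x0 :: 'a
 assumes H: "!!(U :: real => 'a => real) kap G. nlpos s lam Lam U kap G ==>
  AEL x. x : ball 0 1 --> en (U 1 x) <= en C * (INT+ y. en (U 1 y * rho s y))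
  \<and> (INT+ y. en (U 1 y * rho s y)) <= en C * en (U 1 x)"
  and C: "0 <= C" and sol: "nlsol_on s lam Lam tu U kap G" and U_nn: "!!t x. 0 <= U t x" and s: "0 < s" and tu: "0 < tu"
 defines "r \<equiv> tu powr (1 / (2 * s))"
 defines "W \<equiv> (INT+ x. en (U tu x / (r + norm (x - x0)) powr (real DIM('a) + 2 * s)))"
 shows "AEL x. x : ball x0 r --> en (U tu x) <= en (C * tu) * W \<and> en tu * W <= en C * en (U tu x)"
proof -
 interpret nlsol_on s lam Lam tu U kap G by fact
 let ?p = "real DIM('a) + 2 * s"
 have r: "0 < r" "r powr (2 * s) = tu" using tu s by (auto simp: r_def powr_powr)
 have rp: "r powr ?p = r ^ DIM('a) * tu" using r by (simp add: powr_add powr_realpow)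
 have pos: "nlpos s lam Lam (%t x. U (tu - r powr (2 * s) + r powr (2 * s) * t) (x0 + r *R x))
  (%t x y. r powr (2 * s) * r ^ DIM('a) * kap (tu - r powr (2 * s) + r powr (2 * s) * t) (x0 + r *R x) (x0 + r *R y))
  {t\<in>{0<..1}. tu - r powr (2 * s) + r powr (2 * s) * t : G}"
  by (intro nlpos.intro nlpos_axioms.intro nlsol_on_scale[OF sol r(1) G_1] U_nn eq_refl r(2))
 have "W = en (r ^ DIM('a)) * (INT+ x. en (U tu (x0 + r *R x) / (r + norm (x0 + r *R x - x0)) powr ?p))"
  unfolding W_def by (rule nn_integral_affine[OF _ r(1)]) measurable
 also have "(INT+ x. en (U tu (x0 + r *R x) / (r + norm (x0 + r *R x - x0)) powr ?p))
  = (INT+ x. en (1 / r powr ?p) * en (U tu (x0 + r *R x) * rho s x))"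
 proof (intro nn_integral_cong, goal_cases)
  case (1 x)
  have "(r + norm (x0 + r *R x - x0)) powr ?p = (r * (1 + norm x)) powr ?p" using r by (simp add: distrib_left)
  also have "... = r powr ?p * (1 + norm x) powr ?p" using r by (simp add: powr_mult)
  finally have "U tu (x0 + r *R x) / (r + norm (x0 + r *R x - x0)) powr ?p = 1 / r powr ?p * (U tu (x0 + r *R x) * rho s x)" by (simp add: rho_def)
  then show ?case
  by (simp only: ennreal_mult'[symmetric] divide_nonneg_nonneg zero_le_one powr_ge_zero)
 qed
 also have "... = en (1 / r powr ?p) * (INT+ x. en (U tu (x0 + r *R x) * rho s x))" by (rule nn_integral_cmult) measurable
 finally have "en tu * W = (en tu * en (r ^ DIM('a)) * en (1 / r powr ?p)) * (INT+ x. en (U tu (x0 + r *R x) * rho s x))"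
  by (simp add: mult.assoc)
 also have "en tu * en (r ^ DIM('a)) * en (1 / r powr ?p) = 1"
  unfolding rp using r tu by (simp flip: ennreal_mult)
 finally have W: "en tu * W = (INT+ x. en (U tu (x0 + r *R x) * rho s x))" by simp
 have "AEL x. x : ball 0 1 --> en (U tu (x0 + r *R x)) <= en C * (en tu * W) \<and> en tu * W <= en C * en (U tu (x0 + r *R x))"
  using H[OF pos] by (simp add: W)
 then have "AEL x. x0 + r *R x : ball x0 r --> en (U tu (x0 + r *R x)) <= en C * (en tu * W) \<and> en tu * W <= en C * en (U tu (x0 + r *R x))"
  using r by (auto elim!: eventually_mono simp: dist_norm)
 then have "AEL x. x : ball x0 r --> en (U tu x) <= en C * (en tu * W) \<and> en tu * W <= en C * en (U tu x)"
  by (rule AE_affine[OF _ r(1), rotated]) measurable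
 then show ?thesis using C tu by (simp add: ennreal_mult mult.assoc)
qed

lemma ess_bounds:
 fixes v :: "real ^ 'n => real"
 assumes v: "v : borel_measurable lebesgue" and r: "0 < r" and c: "0 < c" and tu: "0 < tu" and v_nn: "AEL x. 0 <= v x"
  and le: "AEL x. x : ball x0 r --> en (v x) <= en (c * tu) * W \<and> en tu * W <= en c * en (v x)"
 shows "ess_sup_on (ball x0 r) v <= ereal (c * tu) * enn2ereal W" "ereal c * ess_inf_on (ball x0 r) v \<ge> ereal tu * enn2ereal W"
  "ess_sup_on (ball x0 r) v <= ereal (c * c) * ess_inf_on (ball x0 r) v"
proof -
 \<comment> \<open>The ball has positive measure, so the bound holds at some point, where the
   right-hand side is a real number. Hence the weighted integral is finite.\<close>
 have "\<exists>x. en tu * W <= en c * en (v x)"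
 proof (rule ccontr)
  assume *: "\<not> ?thesis"
  have "AEL x. x \<notin> ball x0 r" using le by eventually_elim (use * in auto)
  then have "ball x0 r : null_sets lborel" by (subst AE_iff_null_sets) auto
  then have "emeasure lborel (ball x0 r) = 0" by (rule null_setsD1)
  then show False using r unit_ball_vol_pos[of "real CARD('n)"] by (simp add: emeasure_ball)
 qed
 then obtain x1 where "en tu * W <= en c * en (v x1)" ..
 then have "en tu * W < inft" by (rule le_less_trans) (simp add: ennreal_mult_less_top)
 then have "W < inft" using tu by (rule ennreal_cmult_finiteD)
 then obtain z where z: "0 <= z" "W = en z" by (rule ennreal_finiteE)
 have le': "AE x in lebesgue. x : ball x0 r --> v x <= c * tu * z \<and> tu * z / c <= v x"
  using AE_completion[OF le] AE_completion[OF v_nn]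
 proof eventually_elim
  case (elim x)
  show ?case
  proof
  assume "x : ball x0 r"
  with elim have "en (v x) <= en (c * tu * z)" "en (tu * z) <= en (c * v x)"
  using z tu c by (auto simp: ennreal_mult)
  then have "v x <= c * tu * z" "tu * z <= c * v x" using z tu c elim(2) by (auto simp: ennreal_le_iff)
  then show "v x <= c * tu * z \<and> tu * z / c <= v x" using c by (simp add: pos_divide_le_eq mult.commute)
  qed
 qed
 have m: "(%x. ereal (v x)) : borel_measurable (lebesgue_on (ball x0 r))" "(%x. - ereal (v x)) : borel_measurable (lebesgue_on (ball x0 r))"
  using measurable_restrict_space1[OF v] by measurable
 have rs: "(AE x in lebesgue_on (ball x0 r). P x) \<longleftrightarrow> (AE x in lebesgue. x : ball x0 r --> P x)" for P
  by (rule AE_restrict_space_iff) simp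
 have sup: "ess_sup_on (ball x0 r) v <= ereal (c * tu * z)"
  unfolding ess_sup_on_def by (rule esssup_I[OF m(1)], unfold rs) (use le' in "auto elim!: eventually_mono")
 have "esssup (lebesgue_on (ball x0 r)) (%x. - ereal (v x)) <= ereal (- (tu * z / c))"
  by (rule esssup_I[OF m(2)], unfold rs) (use le' in "auto elim!: eventually_mono")
 then have inf: "ereal (tu * z / c) <= ess_inf_on (ball x0 r) v"
  unfolding ess_inf_on_def by (metis ereal_minus_le_minus ereal_uminus_uminus uminus_ereal.simps(1))
 have W: "enn2ereal W = ereal z" using z by (simp add: enn2ereal_ennreal)
 show "ess_sup_on (ball x0 r) v <= ereal (c * tu) * enn2ereal W" using sup by (simp add: W)
 have "ereal c * ereal (tu * z / c) <= ereal c * ess_inf_on (ball x0 r) v" using c by (intro ereal_mult_left_mono inf) simp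
 then show "ereal c * ess_inf_on (ball x0 r) v \<ge> ereal tu * enn2ereal W" using c by (simp add: W)
 have "ereal (c * c) * ereal (tu * z / c) <= ereal (c * c) * ess_inf_on (ball x0 r) v" using c by (intro ereal_mult_left_mono inf) simp
 moreover have "ereal (c * c) * ereal (tu * z / c) = ereal (c * tu * z)" using c by simp
 ultimately show "ess_sup_on (ball x0 r) v <= ereal (c * c) * ess_inf_on (ball x0 r) v" using sup by (metis order_trans)
qed

theorem theorem1p2:
  fixes s lam Lam :: real
  assumes "0 < s" "s < 1" "0 < lam" "lam \<le> Lam"
  shows "\<exists>c>1. \<exists>c'.
    \<forall>(T::real) (K :: real \<Rightarrow> real ^ 'n \<Rightarrow> real ^ 'n \<Rightarrow> ennreal) (u :: real \<Rightarrow> real ^ 'n \<Rightarrow> real) w.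
      0 < T
      \<and> (\<lambda>(t, x, y). K t x y) \<in> borel_measurable lebesgue
      \<and> (\<forall>t x y.
           ennreal lam / ennreal (norm (x - y) powr (real CARD('n) + 2 * s)) \<le> K t x y
           \<and> K t x y = K t y x
           \<and> K t x y \<le> ennreal Lam / ennreal (norm (x - y) powr (real CARD('n) + 2 * s)))
      \<and> global_weak_solution s K {0<..T} u
      \<and> (AE (t, x) in lebesgue. t \<in> {0<..T} \<longrightarrow> 0 \<le> u t x)
      \<and> continuous_representative {0<..T} u w
      \<longrightarrow> (\<forall>\<tau>\<in>{0<..T}. \<forall>x\<^sub>o :: real ^ 'n.
            ess_sup_on (ball x\<^sub>o (\<tau> powr (1 / (2 * s)))) (w \<tau>)
              \<le> ereal (c * \<tau>) * weighted_integral s (\<tau> powr (1 / (2 * s))) x\<^sub>o (w \<tau>)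
            \<and> ereal c * ess_inf_on (ball x\<^sub>o (\<tau> powr (1 / (2 * s)))) (w \<tau>)
              \<ge> ereal \<tau> * weighted_integral s (\<tau> powr (1 / (2 * s))) x\<^sub>o (w \<tau>)
            \<and> ess_sup_on (ball x\<^sub>o (\<tau> powr (1 / (2 * s)))) (w \<tau>)
              \<le> ereal c' * ess_inf_on (ball x\<^sub>o (\<tau> powr (1 / (2 * s)))) (w \<tau>))"
proof (rule harnack_normalized[OF assms, where ?'a="real ^ 'n"], goal_cases)
 case (1 C)
 note C1 = 1(1) and H = 1(2)
 have C: "0 <= C" "0 < C" using C1 by auto
 show ?case
 \<comment> \<open>The comparison of supremum and infimum chains the two estimates through the
   weighted integral, which gives the square of the constant.\<close>
 proof (rule exI[of _ C], rule conjI[OF C1], rule exI[of _ "C * C"], intro allI impI ballI, goal_cases)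
  case (1 T K u w tu x0)
  then have Km: "(%(t, x, y). K t x y) : borel_measurable lebesgue"
  and K: "!!t x y. en lam / en (norm (x - y) powr (real CARD('n) + 2 * s)) <= K t x y"
  "!!t x y. K t x y = K t y x" "!!t x y. K t x y <= en Lam / en (norm (x - y) powr (real CARD('n) + 2 * s))"
  and sol: "global_weak_solution s K {0<..T} u" and u_nn: "AE (t, x) in lebesgue. t : {0<..T} --> 0 <= u t x"
  and rep: "continuous_representative {0<..T} u w" and tu: "tu : {0<..T}" by blast+
  obtain U kap G where U: "nlsol_on s lam Lam tu U kap G" "!!t x. 0 <= U t x" "AEL x. w tu x = U tu x"
  by (fact extraction[OF assms Km K sol u_nn rep tu])
  let ?r = "tu powr (1 / (2 * s))"
  let ?W = "INT+ x. en (U tu x / (?r + norm (x - x0)) powr (real DIM(real ^ 'n) + 2 * s))"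
  have tu0: "0 < tu" using tu by simp
  have W: "weighted_integral s ?r x0 (w tu) = enn2ereal ?W"
  unfolding weighted_integral_def using U(3)
  by (intro arg_cong[where f=enn2ereal] nn_integral_lebesgue_AE_cong) (auto elim!: eventually_mono)
  have w: "w tu : borel_measurable lebesgue" using rep tu by (auto simp: continuous_representative_def)
  have w_nn: "AEL x. 0 <= w tu x" using U(3) by eventually_elim (simp add: U(2))
  have "AEL x. x : ball x0 ?r --> en (U tu x) <= en (C * tu) * ?W \<and> en tu * ?W <= en C * en (U tu x)"
  by (rule harnack_scaled[OF _ C(1) U(1,2) assms(1) tu0]) (rule H)
  with U(3) have "AEL x. x : ball x0 ?r --> en (w tu x) <= en (C * tu) * ?W \<and> en tu * ?W <= en C * en (w tu x)"
  by eventually_elim simp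
  from ess_bounds[OF w _ C(2) tu0 w_nn this] tu0 show ?case unfolding W by simp
 qed
qed

end
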